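(* Let $\mathscr{F}=\mathcal{C}\boxtimes\mathcal{F}$ be a reduced convex pre-foliation on $\mathbb{P}^2_{\mathbb{C}}$ whose associated curve $\mathcal{C}$ consists of $\mathcal{F}$-invariant lines (i.e. $\mathcal{C}$ is a union of finitely many distinct $\mathcal{F}$-invariant lines). Then the dual web $\mathrm{Leg}\,\mathscr{F}$ is flat, i.e. its curvature $K(\mathrm{Leg}\,\mathscr{F})$ vanishes identically.
   Context: **Pre-foliations.** Let $0\le k\le d$ be integers. A (holomorphic) pre-foliation $\mathscr{F}=\mathcal{C}\boxtimes\mathcal{F}$ on $\mathbb{P}^2_{\mathbb{C}}$ of co-degree $k$ and degree $d$ (of type $(k,d)$) is the data of a reduced complex projective curve $\mathcal{C}\subset\mathbb{P}^2_{\mathbb{C}}$ of degree $k$ (the associated curve) and a holomorphic foliation $\mathcal{F}$ (with isolated singularities) on $\mathbb{P}^2_{\mathbb{C}}$ of degree $d-k$ (the associated foliation). **Convexity.** A holomorphic foliation on $\mathbb{P}^2_{\mathbb{C}}$ is convex if its leaves which are not straight lines have no inflection points. A foliation of degree $m\ge1$ has at most $3m$ distinct invariant lines; if it has exactly $3m$, it is automatically convex and is called reduced convex. A pre-foliation $\mathcal{C}\boxtimes\mathcal{F}$ is convex (resp. reduced convex) if $\mathcal{F}$ is convex (resp. reduced convex) and $\mathcal{C}$ is invariant by $\mathcal{F}$. **Webs.** A regular $d$-web of $(\mathbb{C}^2,0)$ is a family $\{\mathcal{F}_1,\dots,\mathcal{F}_d\}$ of germs of regular holomorphic foliations pairwise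 transverse at the origin, written $\mathcal{F}_1\boxtimes\cdots\boxtimes\mathcal{F}_d$. A $d$-web on a complex surface $M$ is given in local coordinates $(x,y)$ by an implicit differential equation $F(x,y,y')=0$, where $F(x,y,p)=\sum_{i=0}^d a_i(x,y)p^{d-i}$ is a reduced polynomial in $p$ of degree $d$ with analytic coefficients, $a_0\not\equiv0$; near every point where $a_0\Delta\ne0$ ($\Delta$ the $p$-discriminant of $F$) its integral curves form a regular $d$-web. The product $\boxtimes$ denotes superposition of webs without common component. **Dual web (Legendre transform).** Let $\mathscr{F}=\mathcal{C}\boxtimes\mathcal{F}$ be a pre-foliation of degree $d\ge1$ and co-degree $k<d$, given in an affine chart $(x,y)$ by $\omega=f(x,y)(A(x,y)\,dx+B(x,y)\,dy)$, with $f,A,B\in\mathbb{C}[x,y]$, $\gcd(A,B)=1$, where $f=0$ defines $\mathcal{C}$ and $A\,dx+B\,dy$ defines $\mathcal{F}$. In the affine chart $(p,q)$ of the dual plane $\check{\mathbb{P}}^2_{\mathbb{C}}$ corresponding to the line $\{y=px-q\}\subset\mathbb{P}^2_{\mathbb{C}}$, $\mathrm{Leg}\,\mathscr{F}$ is the $d$-web given by $f(x,px-q)\,(A(x,px-q)+pB(x,px-q))=0$ with $x=\frac{dq}{dp}$. Thus $\mathrm{Leg}\,\mathscr{F}=\mathrm{Leg}\,\mathcal{C}\boxtimes\mathrm{Leg}\,\mathcal{F}$ for $k\ge1$. For a line $\ell$, $\mathrm{Leg}\,\ell$ is the radial foliation of $\check{\mathbb{P}}^2_{\mathbb{C}}$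 whose leaves are the lines through the point dual to $\ell$ (for the line at infinity of the chart it is given by $dp=0$). **Curvature and flatness.** For a completely decomposable 3-web $\mathcal{W}=\mathcal{F}_1\boxtimes\mathcal{F}_2\boxtimes\mathcal{F}_3$ choose 1-forms $\omega_i$ defining $\mathcal{F}_i$ with $\omega_1+\omega_2+\omega_3=0$; there is a meromorphic 1-form $\eta(\mathcal{W})$, well defined up to addition of $dg/g$ with $g$ a holomorphic unit, with $d\omega_i=\eta(\mathcal{W})\wedge\omega_i$ for $i=1,2,3$; set $K(\mathcal{W})=d\eta(\mathcal{W})$. For a completely decomposable $d$-web with $d>3$, $K(\mathcal{W})$ is the sum of the curvatures of its 3-subwebs. For a general $d$-web on a surface $M$, $K(\mathcal{W})$ is the global meromorphic 2-form on $M$ (poles along the discriminant) obtained by passing to a ramified Galois covering where the web decomposes completely and descending; near generic points it is given by the preceding local definition. For $d\le 2$ the curvature is $0$ (empty sum). A web is flat if its curvature is identically zero. *)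

theory Defs
  imports
    "HOL-Analysis.Analysis"
    "HOL-Computational_Algebra.Computational_Algebra"
begin

section \<open>Curves and foliations on the complex projective plane\<close>

text \<open>
  Ternary polynomials in the homogeneous coordinates (x : y : z) are nested univariate
  polynomials: the outermost variable is z, the middle one y, the innermost one x.  With this
  order \<open>poly P 1\<close> is the dehomogenisation P(x,y,1), an element of C[x][y].
\<close>

type_synonym ternary = "complex poly poly poly"

abbreviation varX :: ternary where "varX \<equiv> [:[:[:0, 1:]:]:]"
abbreviation varY :: ternary where "varY \<equiv> [:[:0, 1:]:]"
abbreviation varZ :: ternary where "varZ \<equiv> [:0, 1:]"

definition eval3 :: "ternary \<Rightarrow> complex \<times> complex \<times> complex \<Rightarrow> complex" where
  "eval3 P = (\<lambda>(x, y, z). poly (poly (poly P [:[:z:]:]) [:y:]) x)"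

definition homogeneous :: "nat \<Rightarrow> ternary \<Rightarrow> bool" where
  "homogeneous n P \<longleftrightarrow>
     (\<forall>i j k. coeff (coeff (coeff P k) j) i \<noteq> 0 \<longrightarrow> i + j + k = n)"

definition dX :: "ternary \<Rightarrow> ternary" where "dX = map_poly (map_poly pderiv)"
definition dY :: "ternary \<Rightarrow> ternary" where "dY = map_poly pderiv"
definition dZ :: "ternary \<Rightarrow> ternary" where "dZ = pderiv"

text \<open>
  A foliation of degree m is given by a homogeneous 1-form P dx + Q dy + R dz with coefficients
  of degree m + 1, annihilated by the radial vector field.  Its singularities are isolated
  exactly when the coefficients have no common factor.
\<close>

definition foliation :: "nat \<Rightarrow> ternary \<Rightarrow> ternary \<Rightarrow> ternary \<Rightarrow> bool" where
  "foliation m P Q R \<longleftrightarrow>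
     homogeneous (m + 1) P \<and> homogeneous (m + 1) Q \<and> homogeneous (m + 1) R \<and>
     varX * P + varY * Q + varZ * R = 0 \<and>
     (\<forall>h. h dvd P \<and> h dvd Q \<and> h dvd R \<longrightarrow> is_unit h)"

text \<open>The curve G = 0 is invariant iff G divides the 2-form (P dx + Q dy + R dz) \<open>\<and>\<close> dG.\<close>

definition invariant_curve :: "ternary \<Rightarrow> ternary \<Rightarrow> ternary \<Rightarrow> ternary \<Rightarrow> bool" where
  "invariant_curve P Q R G \<longleftrightarrow>
     G dvd (P * dY G - Q * dX G) \<and>
     G dvd (P * dZ G - R * dX G) \<and>
     G dvd (Q * dZ G - R * dY G)"

definition invariant_line :: "ternary \<Rightarrow> ternary \<Rightarrow> ternary \<Rightarrow> ternary \<Rightarrow> bool" where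
  "invariant_line P Q R L \<longleftrightarrow> L \<noteq> 0 \<and> homogeneous 1 L \<and> invariant_curve P Q R L"

text \<open>
  Proportional linear forms define the same line, so distinct lines are counted as subsets
  (cones in \<open>\<complex>\<^sup>3\<close>) rather than as linear forms.
\<close>

definition invariant_line_loci ::
    "ternary \<Rightarrow> ternary \<Rightarrow> ternary \<Rightarrow> (complex \<times> complex \<times> complex) set set" where
  "invariant_line_loci P Q R = (\<lambda>L. {v. eval3 L v = 0}) ` {L. invariant_line P Q R L}"

definition reduced_convex :: "nat \<Rightarrow> ternary \<Rightarrow> ternary \<Rightarrow> ternary \<Rightarrow> bool" where
  "reduced_convex m P Q R \<longleftrightarrow>
     foliation m P Q R \<and> 1 \<le> m \<and> card (invariant_line_loci P Q R) = 3 * m"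

definition prefoliation ::
    "nat \<Rightarrow> nat \<Rightarrow> ternary \<Rightarrow> ternary \<Rightarrow> ternary \<Rightarrow> ternary \<Rightarrow> bool" where
  "prefoliation k d G P Q R \<longleftrightarrow>
     k \<le> d \<and> homogeneous k G \<and> squarefree G \<and> foliation (d - k) P Q R"

definition reduced_convex_prefoliation ::
    "nat \<Rightarrow> nat \<Rightarrow> ternary \<Rightarrow> ternary \<Rightarrow> ternary \<Rightarrow> ternary \<Rightarrow> bool" where
  "reduced_convex_prefoliation k d G P Q R \<longleftrightarrow>
     prefoliation k d G P Q R \<and> reduced_convex (d - k) P Q R \<and> invariant_curve P Q R G"

text \<open>
  The empty union (k = 0) is allowed.  For squarefree G the lines below are pairwise distinct.
\<close>

definition union_of_invariant_lines :: "ternary \<Rightarrow> ternary \<Rightarrow> ternary \<Rightarrow> ternary \<Rightarrow> bool" where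
  "union_of_invariant_lines P Q R G \<longleftrightarrow>
     (\<exists>S r. finite S \<and> (\<forall>L\<in>S. invariant_line P Q R L) \<and> r \<noteq> 0 \<and> G = [:[:[:r:]:]:] * \<Prod>S)"

section \<open>Webs on open subsets of the complex affine plane\<close>

text \<open>
  A 1-form \<open>\<alpha> dp + \<beta> dq\<close> is represented by the map sending a point (p,q) to \<open>(\<alpha>, \<beta>)\<close>, and a
  2-form \<open>\<kappa> dp \<and> dq\<close> by its coefficient \<open>\<kappa>\<close>.
\<close>

type_synonym form1 = "complex \<times> complex \<Rightarrow> complex \<times> complex"
type_synonym form2 = "complex \<times> complex \<Rightarrow> complex"

definition holomorphic2_on ::
    "(complex \<times> complex \<Rightarrow> complex) \<Rightarrow> (complex \<times> complex) set \<Rightarrow> bool" where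
  "holomorphic2_on f U \<longleftrightarrow>
     (\<forall>z\<in>U. \<exists>a b. (f has_derivative (\<lambda>h. a * fst h + b * snd h)) (at z))"

definition holomorphic_form_on :: "form1 \<Rightarrow> (complex \<times> complex) set \<Rightarrow> bool" where
  "holomorphic_form_on w U \<longleftrightarrow>
     holomorphic2_on (\<lambda>z. fst (w z)) U \<and> holomorphic2_on (\<lambda>z. snd (w z)) U"

definition form_apply :: "complex \<times> complex \<Rightarrow> complex \<times> complex \<Rightarrow> complex" where
  "form_apply a v = fst a * fst v + snd a * snd v"

definition wedge :: "complex \<times> complex \<Rightarrow> complex \<times> complex \<Rightarrow> complex" where
  "wedge a b = fst a * snd b - snd a * fst b"

definition form_scale :: "(complex \<times> complex \<Rightarrow> complex) \<Rightarrow> form1 \<Rightarrow> form1" where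
  "form_scale u w = (\<lambda>z. (u z * fst (w z), u z * snd (w z)))"

definition ext_deriv :: "form1 \<Rightarrow> form2" where
  "ext_deriv w = (\<lambda>(p, q). deriv (\<lambda>s. snd (w (s, q))) p - deriv (\<lambda>t. fst (w (p, t))) q)"

text \<open>
  \<open>implicit_form d F\<close> is the binary differential form of degree d (in dp, dq) attached to the
  implicit differential equation F(p,q,x) = 0, x = dq/dp, of degree d in x.  If the
  coefficient of \<open>x^d\<close> vanishes identically, dp is a factor of this form, i.e. dp = 0 belongs to
  the web.
\<close>

definition implicit_form ::
    "nat \<Rightarrow> (complex \<times> complex \<Rightarrow> complex poly) \<Rightarrow>
     complex \<times> complex \<Rightarrow> complex \<times> complex \<Rightarrow> complex" where
  "implicit_form d F z v = (\<Sum>i\<le>d. coeff (F z) i * snd v ^ i * fst v ^ (d - i))"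

text \<open>On U the web decomposes as the regular d-web defined by the 1-forms \<open>w 0, \<dots>, w (d - 1)\<close>.\<close>

definition regular_decomposition ::
    "nat \<Rightarrow> (complex \<times> complex \<Rightarrow> complex poly) \<Rightarrow>
     (complex \<times> complex) set \<Rightarrow> (nat \<Rightarrow> form1) \<Rightarrow> bool" where
  "regular_decomposition d F U w \<longleftrightarrow>
     open U \<and>
     (\<forall>i<d. holomorphic_form_on (w i) U \<and> (\<forall>z\<in>U. w i z \<noteq> 0)) \<and>
     (\<forall>i<d. \<forall>j<d. i \<noteq> j \<longrightarrow> (\<forall>z\<in>U. wedge (w i z) (w j z) \<noteq> 0)) \<and>
     (\<forall>z\<in>U. \<forall>v. implicit_form d F z v = (\<Prod>i<d. form_apply (w i z) v))"

text \<open>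
  Curvature \<open>d\<eta>\<close> on U of the regular 3-web defined by the forms \<open>w i\<close>, \<open>i \<in> J\<close>, card J = 3.
  The normalising units \<open>u i\<close> are determined up to a common unit g, which changes \<open>\<eta>\<close> by dg/g;
  so \<open>\<kappa>\<close> is determined on U.  Since the web is regular on U, \<open>\<eta>\<close> has no poles there.
\<close>

definition has_curvature3 ::
    "(complex \<times> complex) set \<Rightarrow> nat set \<Rightarrow> (nat \<Rightarrow> form1) \<Rightarrow> form2 \<Rightarrow> bool" where
  "has_curvature3 U J w \<kappa> \<longleftrightarrow>
     (\<exists>u \<eta>.
        (\<forall>i\<in>J. holomorphic2_on (u i) U \<and> (\<forall>z\<in>U. u i z \<noteq> 0)) \<and>
        (\<forall>z\<in>U. (\<Sum>i\<in>J. form_scale (u i) (w i) z) = 0) \<and>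
        holomorphic_form_on \<eta> U \<and>
        (\<forall>i\<in>J. \<forall>z\<in>U. ext_deriv (form_scale (u i) (w i)) z
                         = wedge (\<eta> z) (form_scale (u i) (w i) z)) \<and>
        (\<forall>z\<in>U. \<kappa> z = ext_deriv \<eta> z))"

definition has_curvature ::
    "(complex \<times> complex) set \<Rightarrow> nat \<Rightarrow> (nat \<Rightarrow> form1) \<Rightarrow> form2 \<Rightarrow> bool" where
  "has_curvature U d w \<kappa> \<longleftrightarrow>
     (\<exists>K. (\<forall>J. J \<subseteq> {..<d} \<and> card J = 3 \<longrightarrow> has_curvature3 U J w (K J)) \<and>
          (\<forall>z\<in>U. \<kappa> z = (\<Sum>J | J \<subseteq> {..<d} \<and> card J = 3. K J z)))"

text \<open>
  The curvature is a meromorphic 2-form with poles along the discriminant, so it vanishes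
  identically iff it vanishes wherever the web is regular.
\<close>

definition flat_web :: "nat \<Rightarrow> (complex \<times> complex \<Rightarrow> complex poly) \<Rightarrow> bool" where
  "flat_web d F \<longleftrightarrow>
     (\<forall>U w. regular_decomposition d F U w \<longrightarrow> has_curvature U d w (\<lambda>_. 0))"

section \<open>Legendre transform\<close>

text \<open>
  Left-hand side, as a polynomial in x, of f(x,px-q) (A(x,px-q) + p B(x,px-q)) = 0 with
  f = G(x,y,1), A = P(x,y,1), B = Q(x,y,1); the point (p,q) is dual to the line y = px - q.
  If z divides G, then f has degree k - 1, and \<open>implicit_form\<close> restores the component dp = 0
  dual to the line at infinity.
\<close>

definition Leg :: "ternary \<Rightarrow> ternary \<Rightarrow> ternary \<Rightarrow> complex \<times> complex \<Rightarrow> complex poly" where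
  "Leg G P Q = (\<lambda>(p, q).
     poly (poly G 1) [:- q, p:] *
       (poly (poly P 1) [:- q, p:] + [:p:] * poly (poly Q 1) [:- q, p:]))"

end

theory Submission
  imports Defs "HOL-Complex_Analysis.Complex_Analysis"
begin

text \<open>
  Take an invariant line as line at infinity.  Near a generic point of the dual plane the web is
  then given by the forms \<open>dq - x\<^sub>i dp\<close>, where \<open>x\<^sub>i\<close> runs through the abscissas of the points of
  tangency of the line \<open>y = p x - q\<close> with the foliation and of the intersections of this line with the
  components of the curve; if the line at infinity is a component, \<open>dp\<close> is a further form of the
  web.  Written out, the sum of the connection forms of all 3-subwebs is a combination of \<open>dp\<close> and of
  the forms \<open>dq - x\<^sub>i dp\<close> at the points of tangency.  Reduced convexity enters through the extactic
  polynomial: on the line \<open>y = p x - q\<close> it has degree at most \<open>3 m - 1\<close> and vanishes at the intersections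
  with the \<open>3 m - 1\<close> remaining invariant lines, so it splits into linear factors.  Comparing its
  logarithmic derivatives with its definition at a point of tangency rewrites the coefficients
  in terms of these lines, after which Lagrange interpolation at the points of tangency shows that the
  connection form is closed.  Generic points are dense, and the curvature is continuous where the
  web is regular.
\<close>

section \<open>Holomorphic functions of two variables\<close>

text \<open>The slopes \<open>x i\<close> at the tangencies are only algebraic in \<open>p\<close>
  and \<open>q\<close>, so no single 3-subweb is computed: only sums over all tangencies are
  evaluated. Summing over 3-subwebs leaves at each tangency the second elementary symmetric function
  of the numbers \<open>1 / (x i - x j)\<close>. Among the tangencies this is
  \<open>T''' / (6 T')\<close>, where \<open>T = p a - b\<close> and \<open>a dy - b dx\<close>
  defines the foliation. Slopes coming from the curve have straight leaves, so for them
  \<open>g i = 0\<close>. Computing two derivatives of the extactic polynomial in two ways trades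
  \<open>T''\<close> and \<open>T'''\<close> for the divergence, the Jacobian and the cofactors
  \<open>C j\<close> of the invariant lines for the vector field \<open>(a, b)\<close>. Each
  resulting term has as its sum over the tangencies a logarithmic differential (of
  \<open>x i - lam j\<close>, \<open>lam k - lam j\<close>, \<open>a\<close> or \<open>T'\<close>)
  plus a function of \<open>p\<close> times \<open>dp\<close>, or only the latter. Invariance of the
  line at infinity makes the leading coefficients functions of \<open>p\<close> alone, and residue
  sums produce nothing but these coefficients.\<close>

definition has_diff :: "(complex \<times> complex \<Rightarrow> complex) \<Rightarrow> complex \<times> complex \<Rightarrow> complex \<times> complex \<Rightarrow> bool" where
  "has_diff f w z \<longleftrightarrow> (f has_derivative form_apply w) (at z)"

text \<open>Built from partial \<open>deriv\<close>s, just like \<open>ext_deriv\<close>, so that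
  \<open>ext_deriv_eq\<close> holds without any differentiability assumption.\<close>

definition dif :: "(complex \<times> complex \<Rightarrow> complex) \<Rightarrow> form1" where
  "dif f z = (deriv (\<lambda>s. f (s, snd z)) (fst z), deriv (\<lambda>t. f (fst z, t)) (snd z))"

lemma form_apply_eta: "form_apply (a, b) = (\<lambda>h. a * fst h + b * snd h)"
  by (simp add: form_apply_def fun_eq_iff)

lemma has_diff_iff:
  "has_diff f w z \<longleftrightarrow> (f has_derivative (\<lambda>h. fst w * fst h + snd w * snd h)) (at z)"
  by (cases w) (simp add: has_diff_def form_apply_eta)

lemma holomorphic2_on_iff: "holomorphic2_on f U \<longleftrightarrow> (\<forall>z\<in>U. \<exists>w. has_diff f w z)"
  by (auto simp: holomorphic2_on_def has_diff_def form_apply_eta)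

lemma has_diff_partials:
  assumes "has_diff f w z"
  shows "((\<lambda>s. f (s, snd z)) has_field_derivative fst w) (at (fst z))"
    and "((\<lambda>t. f (fst z, t)) has_field_derivative snd w) (at (snd z))"
proof -
  have f: "(f has_derivative form_apply w) (at (fst z, snd z))"
    using assms by (simp add: has_diff_def)
  have "((f \<circ> (\<lambda>s. (s, snd z))) has_derivative (form_apply w \<circ> (\<lambda>h. (h, 0)))) (at (fst z))"
    by (rule diff_chain_at[where f = "\<lambda>s. (s, snd z)"]) (use f in \<open>auto intro!: derivative_eq_intros\<close>)
  then show "((\<lambda>s. f (s, snd z)) has_field_derivative fst w) (at (fst z))"
    by (simp add: has_field_derivative_def o_def form_apply_def)
  have "((f \<circ> (\<lambda>s. (fst z, s))) has_derivative (form_apply w \<circ> (\<lambda>h. (0, h)))) (at (snd z))"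
    by (rule diff_chain_at[where f = "\<lambda>s. (fst z, s)"]) (use f in \<open>auto intro!: derivative_eq_intros\<close>)
  then show "((\<lambda>t. f (fst z, t)) has_field_derivative snd w) (at (snd z))"
    by (simp add: has_field_derivative_def o_def form_apply_def)
qed

lemma has_diff_imp_dif: "has_diff f w z \<Longrightarrow> dif f z = w"
  by (simp add: dif_def has_diff_partials[THEN DERIV_imp_deriv])

lemma holomorphic2_on_has_diff:
  "holomorphic2_on f U \<Longrightarrow> z \<in> U \<Longrightarrow> has_diff f (dif f z) z"
  using has_diff_imp_dif holomorphic2_on_iff by metis

lemma holomorphic2_onI: "(\<And>z. z \<in> U \<Longrightarrow> has_diff f (w z) z) \<Longrightarrow> holomorphic2_on f U"
  unfolding holomorphic2_on_iff by blast

lemma holomorphic2_on_subset: "holomorphic2_on f U \<Longrightarrow> V \<subseteq> U \<Longrightarrow> holomorphic2_on f V"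
  unfolding holomorphic2_on_def by blast

lemma has_diff_continuous: "has_diff f w z \<Longrightarrow> isCont f z"
  unfolding has_diff_def using has_derivative_continuous by blast

lemma holomorphic2_on_continuous: "holomorphic2_on f U \<Longrightarrow> continuous_on U f"
  by (meson continuous_at_imp_continuous_on has_diff_continuous holomorphic2_on_iff)

lemma has_diff_transform:
  assumes "has_diff f w z" "open U" "z \<in> U" "\<And>y. y \<in> U \<Longrightarrow> f y = g y"
  shows "has_diff g w z"
  using assms unfolding has_diff_def by (metis has_derivative_transform_within_open)

lemma dif_cong:
  assumes "open U" "z \<in> U" "\<And>y. y \<in> U \<Longrightarrow> f y = g y"
  shows "dif f z = dif g z"
proof -
  have 1: "\<forall>\<^sub>F s in nhds (fst z). (s, snd z) \<in> U"
    using assms(1,2)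
    by (intro eventually_nhds_in_open[THEN eventually_compose_filterlim])
       (auto intro!: tendsto_eq_intros filterlim_ident simp: nhds_prod[symmetric])
  have 2: "\<forall>\<^sub>F s in nhds (snd z). (fst z, s) \<in> U"
    using assms(1,2)
    by (intro eventually_nhds_in_open[THEN eventually_compose_filterlim])
       (auto intro!: tendsto_eq_intros filterlim_ident simp: nhds_prod[symmetric])
  show ?thesis
    unfolding dif_def using 1 2 assms(3)
    by (auto intro!: deriv_cong_ev elim: eventually_mono)
qed

definition smul :: "complex \<Rightarrow> complex \<times> complex \<Rightarrow> complex \<times> complex" where
  "smul c w = (c * fst w, c * snd w)"

lemma smul_simps [simp]: "fst (smul c w) = c * fst w" "snd (smul c w) = c * snd w"
  by (simp_all add: smul_def)

lemma smul_zero [simp]: "smul 0 w = 0" "smul c 0 = 0"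
  by (simp_all add: smul_def prod_eq_iff)

lemma smul_sum_right: "smul c (\<Sum>i\<in>A. f i) = (\<Sum>i\<in>A. smul c (f i))"
  by (simp add: prod_eq_iff fst_sum snd_sum sum_distrib_left)

lemma smul_sum_left: "smul (\<Sum>i\<in>A. c i) w = (\<Sum>i\<in>A. smul (c i) w)"
  by (simp add: prod_eq_iff fst_sum snd_sum sum_distrib_right)

lemma form_scale_eq: "form_scale u w z = smul (u z) (w z)"
  by (simp add: form_scale_def smul_def)

lemma has_diff_const: "has_diff (\<lambda>_. c) 0 z"
  by (simp add: has_diff_iff)

lemma has_diff_fst: "has_diff fst (1, 0) z"
  unfolding has_diff_iff by (auto intro!: derivative_eq_intros)

lemma has_diff_snd: "has_diff snd (0, 1) z"
  unfolding has_diff_iff by (auto intro!: derivative_eq_intros)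

lemma has_diff_add: "has_diff f v z \<Longrightarrow> has_diff g w z \<Longrightarrow> has_diff (\<lambda>x. f x + g x) (v + w) z"
  unfolding has_diff_iff
  by (drule (1) has_derivative_add) (simp add: algebra_simps)

lemma has_diff_diff: "has_diff f v z \<Longrightarrow> has_diff g w z \<Longrightarrow> has_diff (\<lambda>x. f x - g x) (v - w) z"
  unfolding has_diff_iff
  by (drule (1) has_derivative_diff) (simp add: algebra_simps)

lemma has_diff_mult:
  "has_diff f v z \<Longrightarrow> has_diff g w z \<Longrightarrow> has_diff (\<lambda>x. f x * g x) (smul (f z) w + smul (g z) v) z"
  unfolding has_diff_iff
  by (drule (1) has_derivative_mult) (simp add: algebra_simps)

lemma has_diff_chain:
  assumes "has_diff f w z" "(\<phi> has_field_derivative c) (at (f z))"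
  shows "has_diff (\<lambda>x. \<phi> (f x)) (smul c w) z"
proof -
  have "((\<phi> \<circ> f) has_derivative ((*) c \<circ> (\<lambda>h. fst w * fst h + snd w * snd h))) (at z)"
    using assms unfolding has_diff_iff has_field_derivative_def by (rule diff_chain_at)
  then show ?thesis
    unfolding has_diff_iff by (simp add: o_def algebra_simps)
qed

lemma has_diff_minus: "has_diff f v z \<Longrightarrow> has_diff (\<lambda>x. - f x) (- v) z"
  using has_diff_diff[OF has_diff_const[of 0]] by simp

lemma has_diff_inverse:
  "has_diff f v z \<Longrightarrow> f z \<noteq> 0 \<Longrightarrow> has_diff (\<lambda>x. inverse (f x)) (smul (- (inverse (f z) ^ 2)) v) z"
  by (erule has_diff_chain) (auto intro!: derivative_eq_intros simp: power2_eq_square)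

lemma has_diff_divide:
  assumes "has_diff f v z" "has_diff g w z" "g z \<noteq> 0"
  shows "has_diff (\<lambda>x. f x / g x) (smul (1 / g z) (v - smul (f z / g z) w)) z"
proof -
  have "has_diff (\<lambda>x. f x * inverse (g x))
      (smul (f z) (smul (- (inverse (g z) ^ 2)) w) + smul (inverse (g z)) v) z"
    by (intro has_diff_mult has_diff_inverse assms)
  moreover have "smul (f z) (smul (- (inverse (g z) ^ 2)) w) + smul (inverse (g z)) v
      = smul (1 / g z) (v - smul (f z / g z) w)"
    using assms(3) by (simp add: prod_eq_iff divide_simps power2_eq_square)
  ultimately show ?thesis by (simp add: divide_inverse)
qed

lemma holomorphic2_const: "holomorphic2_on (\<lambda>_. c) U"
  and holomorphic2_fst: "holomorphic2_on fst U"
  and holomorphic2_snd: "holomorphic2_on snd U"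
  unfolding holomorphic2_on_iff by (blast intro: has_diff_const has_diff_fst has_diff_snd)+

lemma holomorphic2_add: "holomorphic2_on f U \<Longrightarrow> holomorphic2_on g U \<Longrightarrow> holomorphic2_on (\<lambda>z. f z + g z) U"
  by (rule holomorphic2_onI) (erule (1) has_diff_add[OF holomorphic2_on_has_diff holomorphic2_on_has_diff], assumption)

lemma holomorphic2_diff: "holomorphic2_on f U \<Longrightarrow> holomorphic2_on g U \<Longrightarrow> holomorphic2_on (\<lambda>z. f z - g z) U"
  by (rule holomorphic2_onI) (erule (1) has_diff_diff[OF holomorphic2_on_has_diff holomorphic2_on_has_diff], assumption)

lemma holomorphic2_mult: "holomorphic2_on f U \<Longrightarrow> holomorphic2_on g U \<Longrightarrow> holomorphic2_on (\<lambda>z. f z * g z) U"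
  by (rule holomorphic2_onI) (erule (1) has_diff_mult[OF holomorphic2_on_has_diff holomorphic2_on_has_diff], assumption)

lemma holomorphic2_minus: "holomorphic2_on f U \<Longrightarrow> holomorphic2_on (\<lambda>z. - f z) U"
  by (rule holomorphic2_onI) (erule (1) has_diff_minus[OF holomorphic2_on_has_diff])

lemma holomorphic2_divide:
  "holomorphic2_on f U \<Longrightarrow> holomorphic2_on g U \<Longrightarrow> (\<And>z. z \<in> U \<Longrightarrow> g z \<noteq> 0) \<Longrightarrow> holomorphic2_on (\<lambda>z. f z / g z) U"
  by (rule holomorphic2_onI) (erule (1) has_diff_divide[OF holomorphic2_on_has_diff holomorphic2_on_has_diff], assumption, blast)

lemma holomorphic2_sum: "(\<And>i. i \<in> A \<Longrightarrow> holomorphic2_on (h i) U) \<Longrightarrow> holomorphic2_on (\<lambda>z. \<Sum>i\<in>A. h i z) U"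
  by (induction A rule: infinite_finite_induct) (auto intro: holomorphic2_const holomorphic2_add)

lemma holomorphic2_prod: "(\<And>i. i \<in> A \<Longrightarrow> holomorphic2_on (h i) U) \<Longrightarrow> holomorphic2_on (\<lambda>z. \<Prod>i\<in>A. h i z) U"
  by (induction A rule: infinite_finite_induct) (auto intro: holomorphic2_const holomorphic2_mult)

lemma holomorphic2_cong:
  "open U \<Longrightarrow> (\<And>z. z \<in> U \<Longrightarrow> f z = g z) \<Longrightarrow> holomorphic2_on f U \<Longrightarrow> holomorphic2_on g U"
  unfolding holomorphic2_on_iff by (meson has_diff_transform)

section \<open>Cauchy integrals: smoothness and symmetry of second derivatives\<close>

lemma cauchy_deriv_integral:
  assumes "f holomorphic_on S" "open S" "cball z r \<subseteq> S" "w \<in> ball z r"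
  shows "(f has_field_derivative integral (cbox 0 1) (\<lambda>t::real.
     f (circlepath z r t) * (of_real r * exp (2 * of_real pi * \<i> * of_real t) / (circlepath z r t - w)\<^sup>2))) (at w)"
proof -
  have "contour_integral (circlepath z r) (\<lambda>u. f u / (u - w)\<^sup>2) = integral (cbox 0 1) (\<lambda>t::real.
     (2 * of_real pi * \<i>) * (f (circlepath z r t) * (of_real r * exp (2 * of_real pi * \<i> * of_real t) / (circlepath z r t - w)\<^sup>2)))"
    unfolding contour_integral_integral vector_derivative_circlepath
    by (simp add: mult_ac divide_simps)
  also have "\<dots> = (2 * of_real pi * \<i>) * integral (cbox 0 1) (\<lambda>t::real.
     f (circlepath z r t) * (of_real r * exp (2 * of_real pi * \<i> * of_real t) / (circlepath z r t - w)\<^sup>2))"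
    by (rule integral_mult_right)
  finally have eq: "1 / (2 * of_real pi * \<i>) * contour_integral (circlepath z r) (\<lambda>u. f u / (u - w)\<^sup>2) =
     integral (cbox 0 1) (\<lambda>t::real.
     f (circlepath z r t) * (of_real r * exp (2 * of_real pi * \<i> * of_real t) / (circlepath z r t - w)\<^sup>2))"
    by simp
  show ?thesis
    unfolding eq[symmetric]
    by (rule Cauchy_derivative_integral_circlepath)
       (use assms in \<open>auto intro: holomorphic_on_imp_continuous_on holomorphic_on_subset
          dest: order_trans[OF ball_subset_cball]\<close>)
qed

text \<open>The weight of Cauchy's formula for the derivative, pulled back to the parameter interval
  of the circle, with the factor \<open>2 pi i\<close> cancelled. Integrals over a real interval are
  what the continuity and Leibniz rules for parameters apply to.\<close>

definition cauchy_kernel :: "complex \<Rightarrow> real \<Rightarrow> real \<Rightarrow> complex \<Rightarrow> complex" where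
  "cauchy_kernel z r t w = of_real r * exp (2 * of_real pi * \<i> * of_real t) / (circlepath z r t - w)\<^sup>2"

lemma circlepath_ne_interior: "w \<in> ball z r \<Longrightarrow> circlepath z r t \<noteq> w"
proof
  assume w: "w \<in> ball z r" and "circlepath z r t = w"
  then have "dist z w = \<bar>r\<bar>"
    by (auto simp: circlepath dist_norm norm_mult)
  with w show False by auto
qed

lemma circlepath_mem_cball: "0 \<le> r \<Longrightarrow> circlepath z r t \<in> cball z r"
  by (simp add: circlepath dist_norm norm_mult)

lemma continuous_cauchy_kernel [continuous_intros]:
  assumes "continuous_on S f" "continuous_on S g" "\<And>x. x \<in> S \<Longrightarrow> g x \<in> ball z r"
  shows "continuous_on S (\<lambda>x. cauchy_kernel z r (f x) (g x))"
  unfolding cauchy_kernel_def circlepath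
  by (intro continuous_intros assms)
     (use circlepath_ne_interior[OF assms(3)] in \<open>auto simp: circlepath\<close>)

lemma continuous_circlepath [continuous_intros]:
  "continuous_on S f \<Longrightarrow> continuous_on S (\<lambda>x. circlepath z r (f x))"
  unfolding circlepath by (intro continuous_intros)

lemma deriv_eq_cauchy_kernel:
  assumes "f holomorphic_on S" "open S" "cball z r \<subseteq> S" "w \<in> ball z r"
  shows "deriv f w = integral (cbox 0 1) (\<lambda>t. f (circlepath z r t) * cauchy_kernel z r t w)"
  using cauchy_deriv_integral[OF assms] by (simp add: DERIV_imp_deriv cauchy_kernel_def)

lemma open_contains_bidisc:
  assumes "open U" "z \<in> U"
  obtains r where "0 < r" "cball (fst z) r \<times> cball (snd z) r \<subseteq> U"
proof -
  obtain A B where AB: "open A" "open B" "fst z \<in> A" "snd z \<in> B" "A \<times> B \<subseteq> U"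
    using assms by (metis mem_Times_iff open_prod_elim)
  then obtain r s where "r > 0" "cball (fst z) r \<subseteq> A" "s > 0" "cball (snd z) s \<subseteq> B"
    by (meson open_contains_cball)
  then have "0 < min r s" "cball (fst z) (min r s) \<times> cball (snd z) (min r s) \<subseteq> A \<times> B"
    by auto
  with AB that show ?thesis by blast
qed

lemma holomorphic_slice_snd:
  assumes "holomorphic2_on f U" "open U"
  shows "(\<lambda>t. f (p, t)) holomorphic_on {t. (p, t) \<in> U}" and "open {t. (p, t) \<in> U}"
proof -
  show op: "open {t. (p, t) \<in> U}"
    using open_vimage[OF assms(2), of "\<lambda>t. (p, t)"] by (simp add: vimage_def continuous_on_Pair)
  show "(\<lambda>t. f (p, t)) holomorphic_on {t. (p, t) \<in> U}"
    unfolding holomorphic_on_open[OF op]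
    using holomorphic2_on_has_diff[OF assms(1)] has_diff_partials(2) by fastforce
qed

lemma has_diff_swap:
  assumes "has_diff f w z"
  shows "has_diff (\<lambda>z. f (prod.swap z)) (prod.swap w) (prod.swap z)"
proof -
  have "((f \<circ> prod.swap) has_derivative (form_apply w \<circ> prod.swap)) (at (prod.swap z))"
  proof (rule diff_chain_at)
    have "bounded_linear (\<lambda>z::complex \<times> complex. (snd z, fst z))"
      by (rule bounded_linear_Pair[OF bounded_linear_snd bounded_linear_fst])
    then show "(prod.swap has_derivative prod.swap) (at (prod.swap z))"
      unfolding prod.swap_def by (rule bounded_linear_imp_has_derivative)
    show "(f has_derivative form_apply w) (at (prod.swap (prod.swap z)))"
      using assms by (simp add: has_diff_def)
  qed
  then show ?thesis
    unfolding has_diff_iff by (simp add: o_def form_apply_def algebra_simps)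
qed

lemma holomorphic2_on_swap:
  assumes "holomorphic2_on f U"
  shows "holomorphic2_on (\<lambda>z. f (prod.swap z)) (prod.swap ` U)"
    and "z \<in> U \<Longrightarrow> dif (\<lambda>z. f (prod.swap z)) (prod.swap z) = prod.swap (dif f z)"
  using has_diff_swap holomorphic2_on_has_diff[OF assms] has_diff_imp_dif
  unfolding holomorphic2_on_iff by blast+

lemma open_swap: "open U \<Longrightarrow> open (prod.swap ` U)"
  for U :: "('a::topological_space \<times> 'b::topological_space) set"
proof -
  assume "open U"
  then have "open (prod.swap -` U)"
    by (intro open_vimage) (auto simp: prod.swap_def intro!: continuous_intros)
  moreover have "prod.swap -` U = prod.swap ` U" by force
  ultimately show ?thesis by simp
qed

lemma snd_dif_eq_integral:
  assumes "holomorphic2_on f U" "open U" "cball p0 r \<times> cball q0 r \<subseteq> U" "p \<in> cball p0 r" "q \<in> ball q0 r"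
  shows "snd (dif f (p, q)) = integral (cbox 0 1) (\<lambda>t. f (p, circlepath q0 r t) * cauchy_kernel q0 r t q)"
proof -
  have "cball q0 r \<subseteq> {t. (p, t) \<in> U}"
    using assms(3,4) by blast
  then show ?thesis
    using deriv_eq_cauchy_kernel[OF holomorphic_slice_snd[OF assms(1,2)] _ assms(5)]
    by (simp add: dif_def)
qed

text \<open>\<open>holomorphic2_on\<close> assumes differentiability only. Cauchy's formula in the
  second variable expresses this partial derivative by values of \<open>f\<close> on a circle, and
  these depend continuously on both variables.\<close>

lemma continuous_on_snd_dif:
  assumes f: "holomorphic2_on f U" and U: "open U"
  shows "continuous_on U (\<lambda>z. snd (dif f z))"
proof (rule continuous_at_imp_continuous_on, safe)
  fix p0 q0 assume "(p0, q0) \<in> U"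
  with U obtain r where r: "0 < r" "cball p0 r \<times> cball q0 r \<subseteq> U"
    using open_contains_bidisc[of U "(p0, q0)"] by auto
  let ?B = "ball p0 r \<times> ball q0 r"
  have sub: "(p, circlepath q0 r t) \<in> U" if "p \<in> ball p0 r" for p t
    using r that circlepath_mem_cball[of r q0 t] by auto
  have "continuous_on ?B (\<lambda>z. integral (cbox 0 1) (\<lambda>t. f (fst z, circlepath q0 r t) * cauchy_kernel q0 r t (snd z)))"
    by (rule integral_continuous_on_param)
       (auto simp: split_beta intro!: continuous_intros sub continuous_on_compose2[OF holomorphic2_on_continuous[OF f]])
  then have "continuous_on ?B (\<lambda>z. snd (dif f z))"
    by (rule continuous_on_eq) (use snd_dif_eq_integral[OF f U r(2)] in \<open>auto simp: dest: less_imp_le\<close>)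
  then show "isCont (\<lambda>z. snd (dif f z)) (p0, q0)"
    using r(1) by (auto simp: continuous_on_eq_continuous_at open_Times)
qed

text \<open>Cauchy's formula in the first variable turns the first partial derivative into an
  integral of \<open>f\<close>, which is then differentiated in the second variable under the
  integral sign. The value of that derivative is recorded because it identifies the mixed
  partials.\<close>

lemma has_diff_fst_dif_integral:
  assumes f: "holomorphic2_on f U" and U: "open U" and z: "(p0, q0) \<in> U"
  obtains r c where "0 < r" "cball p0 r \<times> cball q0 r \<subseteq> U"
    "has_diff (\<lambda>z. fst (dif f z))
       (c, integral (cbox 0 1) (\<lambda>t. snd (dif f (circlepath p0 r t, q0)) * cauchy_kernel p0 r t p0)) (p0, q0)"
proof -
  from U z obtain r where r: "0 < r" "cball p0 r \<times> cball q0 r \<subseteq> U"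
    using open_contains_bidisc[of U "(p0, q0)"] by auto
  have sub: "(circlepath p0 r t, q) \<in> U" if "q \<in> ball q0 r" for q t
    using r that circlepath_mem_cball[of r p0 t] by auto
  have fst_eq: "fst (dif f (p, q)) = integral (cbox 0 1) (\<lambda>t. f (circlepath p0 r t, q) * cauchy_kernel p0 r t p)"
    if "p \<in> ball p0 r" "q \<in> ball q0 r" for p q
  proof -
    have "(p, q) \<in> cball p0 r \<times> cball q0 r" using that by auto
    then have pq: "(p, q) \<in> U" using r(2) by blast
    have sub': "cball q0 r \<times> cball p0 r \<subseteq> prod.swap ` U"
      using image_mono[OF r(2), of prod.swap] by (simp add: product_swap)
    have "fst (dif f (p, q)) = snd (dif (\<lambda>z. f (prod.swap z)) (q, p))"
      using holomorphic2_on_swap(2)[OF f pq] by simp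
    also have "\<dots> = integral (cbox 0 1) (\<lambda>t. f (circlepath p0 r t, q) * cauchy_kernel p0 r t p)"
      using snd_dif_eq_integral[OF holomorphic2_on_swap(1)[OF f] open_swap[OF U] sub', of q p] that
      by simp
    finally show ?thesis .
  qed
  define H where "H p q = integral (cbox 0 1) (\<lambda>t. snd (dif f (circlepath p0 r t, q)) * cauchy_kernel p0 r t p)" for p q
  have contH: "continuous_on (ball p0 r \<times> ball q0 r) (\<lambda>z. H (fst z) (snd z))"
    unfolding H_def
  proof (rule integral_continuous_on_param)
    have 1: "continuous_on ((ball p0 r \<times> ball q0 r) \<times> cbox 0 1)
       (\<lambda>x. snd (dif f (circlepath p0 r (snd x), snd (fst x))))"
      by (rule continuous_on_compose2[OF continuous_on_snd_dif[OF f U]])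
         (use sub in \<open>auto intro!: continuous_intros\<close>)
    have 2: "continuous_on ((ball p0 r \<times> ball q0 r) \<times> cbox 0 1) (\<lambda>x. cauchy_kernel p0 r (snd x) (fst (fst x)))"
      by (intro continuous_intros) auto
    show "continuous_on ((ball p0 r \<times> ball q0 r) \<times> cbox 0 1)
       (\<lambda>(x, t). snd (dif f (circlepath p0 r t, snd x)) * cauchy_kernel p0 r t (fst x))"
      unfolding split_beta by (rule continuous_on_mult[OF 1 2])
  qed
  have dq: "((\<lambda>q. fst (dif f (p, q))) has_field_derivative H p q) (at q)"
    if pq: "p \<in> ball p0 r" "q \<in> ball q0 r" for p q
  proof -
    have "((\<lambda>q. integral (cbox 0 1) (\<lambda>t. f (circlepath p0 r t, q) * cauchy_kernel p0 r t p)) has_field_derivative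
      H p q) (at q within ball q0 r)"
      unfolding H_def
    proof (rule leibniz_rule_field_derivative[where
        fx = "\<lambda>q t. snd (dif f (circlepath p0 r t, q)) * cauchy_kernel p0 r t p"])
      fix x t assume "x \<in> ball q0 r" "t \<in> cbox (0::real) 1"
      then show "((\<lambda>x. f (circlepath p0 r t, x) * cauchy_kernel p0 r t p) has_field_derivative
         snd (dif f (circlepath p0 r t, x)) * cauchy_kernel p0 r t p) (at x within ball q0 r)"
        using has_diff_partials(2)[OF holomorphic2_on_has_diff[OF f sub], of x t]
        by (auto intro: DERIV_cmult_right dest: has_field_derivative_at_within)
    next
      show "continuous_on (ball q0 r \<times> cbox 0 1) (\<lambda>(x, t). snd (dif f (circlepath p0 r t, x)) * cauchy_kernel p0 r t p)"
      proof -
        have 1: "continuous_on (ball q0 r \<times> cbox 0 1) (\<lambda>x. snd (dif f (circlepath p0 r (snd x), fst x)))"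
          by (rule continuous_on_compose2[OF continuous_on_snd_dif[OF f U]])
             (use sub in \<open>auto intro!: continuous_intros\<close>)
        have 2: "continuous_on (ball q0 r \<times> cbox 0 1) (\<lambda>x. cauchy_kernel p0 r (snd x) p)"
          by (intro continuous_intros) (use pq in auto)
        show ?thesis
          unfolding split_beta by (rule continuous_on_mult[OF 1 2])
      qed
    next
      fix x assume "x \<in> ball q0 r"
      then show "(\<lambda>t. f (circlepath p0 r t, x) * cauchy_kernel p0 r t p) integrable_on cbox 0 1"
        by (intro integrable_continuous continuous_intros continuous_on_compose2[OF holomorphic2_on_continuous[OF f]])
           (use pq sub in auto)
    qed (use pq in auto)
    then have "((\<lambda>q. integral (cbox 0 1) (\<lambda>t. f (circlepath p0 r t, q) * cauchy_kernel p0 r t p)) has_field_derivative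
      H p q) (at q)"
      unfolding at_within_open[OF pq(2) open_ball] .
    then show ?thesis
      by (rule has_field_derivative_transform_within_open[OF _ open_ball pq(2)])
         (rule fst_eq[OF pq(1), symmetric])
  qed
  \<comment> \<open>In the direction of \<open>p\<close> the slice is a holomorphic function of one
    variable, so its derivative is again differentiable.\<close>
  have dp: "\<exists>c. ((\<lambda>p. fst (dif f (p, q0))) has_field_derivative c) (at p0)"
  proof -
    have 1: "(\<lambda>p. f (p, q0)) holomorphic_on ball p0 r"
      unfolding holomorphic_on_open[OF open_ball]
    proof
      fix x assume "x \<in> ball p0 r"
      then have "(x, q0) \<in> cball p0 r \<times> cball q0 r" using r(1) by simp
      then show "\<exists>f'. ((\<lambda>p. f (p, q0)) has_field_derivative f') (at x)"
        using has_diff_partials(1)[OF holomorphic2_on_has_diff[OF f, of "(x, q0)"]] subsetD[OF r(2)]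
        by (auto simp del: mem_cball)
    qed
    have "deriv (\<lambda>p. f (p, q0)) holomorphic_on ball p0 r"
      by (rule holomorphic_deriv[OF 1 open_ball])
    then show ?thesis
      using r(1) unfolding holomorphic_on_open[OF open_ball] by (auto simp: dif_def)
  qed
  then obtain c where c: "((\<lambda>p. fst (dif f (p, q0))) has_field_derivative c) (at p0)" ..
  \<comment> \<open>Total differentiability follows from one partial derivative at the point and
    continuity of the other one nearby, namely \<open>H\<close>.\<close>
  have "((\<lambda>(x, y). fst (dif f (x, y))) has_derivative
      (\<lambda>(tx, ty). c * tx + blinfun_apply (blinfun_mult_right (H p0 q0)) ty)) (at (p0, q0) within ball p0 r \<times> ball q0 r)"
  proof (rule has_derivative_partialsI)
    show "((\<lambda>x. fst (dif f (x, q0))) has_derivative (\<lambda>tx. c * tx)) (at p0 within ball p0 r)"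
      using c by (simp add: has_field_derivative_def has_derivative_at_withinI)
    show "((\<lambda>y. fst (dif f (x, y))) has_derivative blinfun_apply (blinfun_mult_right (H x y))) (at y within ball q0 r)"
      if "x \<in> ball p0 r" "y \<in> ball q0 r" for x y
      using dq[OF that] by (simp add: has_field_derivative_def has_derivative_at_withinI)
    have "continuous (at (p0, q0) within ball p0 r \<times> ball q0 r) (\<lambda>z. H (fst z) (snd z))"
      using contH r(1) by (simp add: continuous_on_eq_continuous_within)
    then show "continuous (at (p0, q0) within ball p0 r \<times> ball q0 r) (\<lambda>(x, y). blinfun_mult_right (H x y))"
      unfolding split_beta
      by (rule bounded_linear.continuous[OF bounded_linear_blinfun_mult_right])
  qed (use r in auto)
  then have hd: "has_diff (\<lambda>z. fst (dif f z)) (c, H p0 q0) (p0, q0)"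
    using r(1) at_within_open[of "(p0, q0)" "ball p0 r \<times> ball q0 r"]
    unfolding has_diff_iff by (simp add: case_prod_unfold open_Times)
  show thesis
    by (rule that[OF r]) (use hd in \<open>simp add: H_def\<close>)
qed

lemma holomorphic2_fst_dif:
  assumes f: "holomorphic2_on f U" and U: "open U"
  shows "holomorphic2_on (\<lambda>z. fst (dif f z)) U"
  unfolding holomorphic2_on_iff
proof safe
  fix p q assume "(p, q) \<in> U"
  from has_diff_fst_dif_integral[OF f U this] show "\<exists>w. has_diff (\<lambda>z. fst (dif f z)) w (p, q)"
    by blast
qed

lemma holomorphic2_snd_dif:
  assumes f: "holomorphic2_on f U" and U: "open U"
  shows "holomorphic2_on (\<lambda>z. snd (dif f z)) U"
proof -
  let ?g = "\<lambda>z. f (prod.swap z)"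
  have "holomorphic2_on (\<lambda>z. fst (dif ?g (prod.swap z))) (prod.swap ` prod.swap ` U)"
    by (rule holomorphic2_on_swap(1)[OF holomorphic2_fst_dif[OF holomorphic2_on_swap(1)[OF f] open_swap[OF U]]])
  then have "holomorphic2_on (\<lambda>z. fst (dif ?g (prod.swap z))) U"
    by (simp add: image_image)
  then show ?thesis
    by (rule holomorphic2_cong[OF U, rotated]) (simp add: holomorphic2_on_swap(2)[OF f])
qed

text \<open>Both sides are the same Cauchy integral: the left one by differentiation under the
  integral sign, the right one by Cauchy's formula for the second partial derivative as a function
  of \<open>p\<close>.\<close>

lemma mixed_partials_eq:
  assumes f: "holomorphic2_on f U" and U: "open U" and z: "z \<in> U"
  shows "snd (dif (\<lambda>z. fst (dif f z)) z) = fst (dif (\<lambda>z. snd (dif f z)) z)"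
proof -
  obtain p0 q0 where z0: "z = (p0, q0)" by (cases z)
  obtain r c where r: "0 < r" "cball p0 r \<times> cball q0 r \<subseteq> U" and
    d: "has_diff (\<lambda>z. fst (dif f z))
       (c, integral (cbox 0 1) (\<lambda>t. snd (dif f (circlepath p0 r t, q0)) * cauchy_kernel p0 r t p0)) (p0, q0)"
    by (rule has_diff_fst_dif_integral[OF f U z[unfolded z0]])
  let ?S = "(\<lambda>p. (p, q0)) -` U"
  have op: "open ?S"
    by (rule open_vimage[OF U]) (intro continuous_intros)
  have "(\<lambda>p. snd (dif f (p, q0))) holomorphic_on ?S"
    unfolding holomorphic_on_open[OF op]
  proof
    fix x assume "x \<in> ?S"
    then show "\<exists>f'. ((\<lambda>p. snd (dif f (p, q0))) has_field_derivative f') (at x)"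
      using has_diff_partials(1)[OF holomorphic2_on_has_diff[OF holomorphic2_snd_dif[OF f U], of "(x, q0)"]]
      by auto
  qed
  moreover have "cball p0 r \<subseteq> ?S"
  proof
    fix x assume "x \<in> cball p0 r"
    then have "(x, q0) \<in> cball p0 r \<times> cball q0 r" using r(1) by simp
    then show "x \<in> ?S" using r(2) by blast
  qed
  ultimately have "deriv (\<lambda>p. snd (dif f (p, q0))) p0 =
      integral (cbox 0 1) (\<lambda>t. snd (dif f (circlepath p0 r t, q0)) * cauchy_kernel p0 r t p0)"
    using op r(1) by (intro deriv_eq_cauchy_kernel) auto
  then show ?thesis
    using has_diff_imp_dif[OF d] by (simp add: z0 dif_def[of "\<lambda>z. snd (dif f z)"])
qed

section \<open>Differential forms and curvature of 3-webs\<close>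

lemma ext_deriv_eq: "ext_deriv w z = fst (dif (\<lambda>z. snd (w z)) z) - snd (dif (\<lambda>z. fst (w z)) z)"
  by (cases z) (simp add: ext_deriv_def dif_def)

lemma ext_deriv_cong:
  assumes "open N" "z \<in> N" "\<And>y. y \<in> N \<Longrightarrow> v y = w y"
  shows "ext_deriv v z = ext_deriv w z"
  unfolding ext_deriv_eq
  using dif_cong[OF assms(1,2), of "\<lambda>z. snd (v z)" "\<lambda>z. snd (w z)"]
    dif_cong[OF assms(1,2), of "\<lambda>z. fst (v z)" "\<lambda>z. fst (w z)"] assms(3) by simp

lemma dif_add:
  "holomorphic2_on f N \<Longrightarrow> holomorphic2_on g N \<Longrightarrow> z \<in> N \<Longrightarrow> dif (\<lambda>z. f z + g z) z = dif f z + dif g z"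
  by (rule has_diff_imp_dif[OF has_diff_add[OF holomorphic2_on_has_diff holomorphic2_on_has_diff]])

lemma dif_mult:
  "holomorphic2_on f N \<Longrightarrow> holomorphic2_on g N \<Longrightarrow> z \<in> N \<Longrightarrow>
    dif (\<lambda>z. f z * g z) z = smul (f z) (dif g z) + smul (g z) (dif f z)"
  by (rule has_diff_imp_dif[OF has_diff_mult[OF holomorphic2_on_has_diff holomorphic2_on_has_diff]])

lemma holomorphic_form_dif: "holomorphic2_on f N \<Longrightarrow> open N \<Longrightarrow> holomorphic_form_on (dif f) N"
  by (simp add: holomorphic_form_on_def holomorphic2_fst_dif holomorphic2_snd_dif)

lemma holomorphic_form_add:
  "holomorphic_form_on v N \<Longrightarrow> holomorphic_form_on w N \<Longrightarrow> holomorphic_form_on (\<lambda>z. v z + w z) N"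
  by (simp add: holomorphic_form_on_def holomorphic2_add)

lemma holomorphic_form_diff:
  "holomorphic_form_on v N \<Longrightarrow> holomorphic_form_on w N \<Longrightarrow> holomorphic_form_on (\<lambda>z. v z - w z) N"
  by (simp add: holomorphic_form_on_def holomorphic2_diff)

lemma holomorphic_form_smul:
  "holomorphic2_on f N \<Longrightarrow> holomorphic_form_on w N \<Longrightarrow> holomorphic_form_on (\<lambda>z. smul (f z) (w z)) N"
  by (simp add: holomorphic_form_on_def holomorphic2_mult)

lemma holomorphic_form_sum:
  "(\<And>i. i \<in> A \<Longrightarrow> holomorphic_form_on (w i) N) \<Longrightarrow> holomorphic_form_on (\<lambda>z. \<Sum>i\<in>A. w i z) N"
  by (simp add: holomorphic_form_on_def fst_sum snd_sum holomorphic2_sum)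

lemma holomorphic_form_cong:
  "open N \<Longrightarrow> (\<And>z. z \<in> N \<Longrightarrow> v z = w z) \<Longrightarrow> holomorphic_form_on v N \<Longrightarrow> holomorphic_form_on w N"
  unfolding holomorphic_form_on_def
  using holomorphic2_cong[of N "\<lambda>z. fst (v z)" "\<lambda>z. fst (w z)"]
    holomorphic2_cong[of N "\<lambda>z. snd (v z)" "\<lambda>z. snd (w z)"] by simp

lemma holomorphic_form_subset: "holomorphic_form_on v N \<Longrightarrow> M \<subseteq> N \<Longrightarrow> holomorphic_form_on v M"
  unfolding holomorphic_form_on_def using holomorphic2_on_subset by blast

lemma ext_deriv_dif:
  "holomorphic2_on f N \<Longrightarrow> open N \<Longrightarrow> z \<in> N \<Longrightarrow> ext_deriv (dif f) z = 0"
  by (simp add: ext_deriv_eq mixed_partials_eq)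

lemma ext_deriv_add:
  assumes "holomorphic_form_on v N" "holomorphic_form_on w N" "z \<in> N"
  shows "ext_deriv (\<lambda>z. v z + w z) z = ext_deriv v z + ext_deriv w z"
  using assms unfolding ext_deriv_eq holomorphic_form_on_def
  by (simp add: dif_add[OF _ _ assms(3)])

lemma ext_deriv_sum:
  assumes "\<And>i. i \<in> A \<Longrightarrow> holomorphic_form_on (w i) N" "z \<in> N"
  shows "ext_deriv (\<lambda>z. \<Sum>i\<in>A. w i z) z = (\<Sum>i\<in>A. ext_deriv (w i) z)"
  using assms(1)
proof (induction A rule: infinite_finite_induct)
  case (insert i A)
  then show ?case
    using ext_deriv_add[OF _ holomorphic_form_sum[of A w N] assms(2), of "w i"] by simp
qed (simp_all add: ext_deriv_def split: prod.split)

lemma ext_deriv_smul: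
  assumes "holomorphic2_on f N" "holomorphic_form_on w N" "z \<in> N"
  shows "ext_deriv (\<lambda>z. smul (f z) (w z)) z = wedge (dif f z) (w z) + f z * ext_deriv w z"
  using assms unfolding ext_deriv_eq holomorphic_form_on_def
  by (simp add: dif_mult[OF _ _ assms(3)] wedge_def algebra_simps)

lemma holomorphic2_ext_deriv:
  "holomorphic_form_on w N \<Longrightarrow> open N \<Longrightarrow> holomorphic2_on (ext_deriv w) N"
  unfolding ext_deriv_eq[abs_def] holomorphic_form_on_def
  by (intro holomorphic2_diff holomorphic2_fst_dif holomorphic2_snd_dif) auto

lemma holomorphic2_wedge:
  "holomorphic_form_on v N \<Longrightarrow> holomorphic_form_on w N \<Longrightarrow> holomorphic2_on (\<lambda>z. wedge (v z) (w z)) N"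
  unfolding wedge_def holomorphic_form_on_def
  by (intro holomorphic2_diff holomorphic2_mult) auto

section \<open>Closed 1-forms\<close>

definition closed_on :: "form1 \<Rightarrow> (complex \<times> complex) set \<Rightarrow> bool" where
  "closed_on w N \<longleftrightarrow> holomorphic_form_on w N \<and> (\<forall>z\<in>N. ext_deriv w z = 0)"

lemma closed_on_cong:
  "open N \<Longrightarrow> (\<And>z. z \<in> N \<Longrightarrow> v z = w z) \<Longrightarrow> closed_on v N \<Longrightarrow> closed_on w N"
  unfolding closed_on_def using ext_deriv_cong holomorphic_form_cong by metis

lemma closed_on_add: "closed_on v N \<Longrightarrow> closed_on w N \<Longrightarrow> closed_on (\<lambda>z. v z + w z) N"
  unfolding closed_on_def by (simp add: holomorphic_form_add ext_deriv_add[of v N w])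

lemma closed_on_sum: "(\<And>i. i \<in> A \<Longrightarrow> closed_on (w i) N) \<Longrightarrow> closed_on (\<lambda>z. \<Sum>i\<in>A. w i z) N"
  unfolding closed_on_def by (simp add: holomorphic_form_sum ext_deriv_sum[of A w N])

lemma closed_on_smul:
  "closed_on w N \<Longrightarrow> holomorphic2_on f N \<Longrightarrow> (\<And>z. z \<in> N \<Longrightarrow> wedge (dif f z) (w z) = 0) \<Longrightarrow>
    closed_on (\<lambda>z. smul (f z) (w z)) N"
  unfolding closed_on_def by (simp add: holomorphic_form_smul ext_deriv_smul[of f N w])

lemma closed_on_cmult: "closed_on w N \<Longrightarrow> closed_on (\<lambda>z. smul c (w z)) N"
  by (rule closed_on_smul) (simp_all add: holomorphic2_const has_diff_imp_dif[OF has_diff_const] wedge_def)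

lemma closed_on_diff: "closed_on v N \<Longrightarrow> closed_on w N \<Longrightarrow> closed_on (\<lambda>z. v z - w z) N"
  using closed_on_add[OF _ closed_on_cmult[of w N "-1"], of v]
  by (simp add: smul_def minus_prod_def plus_prod_def)

lemma closed_on_dif: "holomorphic2_on f N \<Longrightarrow> open N \<Longrightarrow> closed_on (dif f) N"
  by (simp add: closed_on_def holomorphic_form_dif ext_deriv_dif[of f N])

lemma closed_on_fun_dif:
  assumes "holomorphic2_on f N" "open N" "\<And>z. z \<in> N \<Longrightarrow> (\<phi> has_field_derivative \<phi>' (f z)) (at (f z))"
  shows "closed_on (\<lambda>z. smul (\<phi> (f z)) (dif f z)) N"
proof (rule closed_on_smul[OF closed_on_dif[OF assms(1,2)]])
  have *: "has_diff (\<lambda>z. \<phi> (f z)) (smul (\<phi>' (f z)) (dif f z)) z" if "z \<in> N" for z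
    by (rule has_diff_chain[OF holomorphic2_on_has_diff[OF assms(1) that] assms(3)[OF that]])
  then show "holomorphic2_on (\<lambda>z. \<phi> (f z)) N"
    by (rule holomorphic2_onI)
  show "wedge (dif (\<lambda>z. \<phi> (f z)) z) (dif f z) = 0" if "z \<in> N" for z
    unfolding has_diff_imp_dif[OF *[OF that]] by (simp add: wedge_def)
qed

lemma closed_on_dlog:
  assumes "holomorphic2_on f N" "open N" "\<And>z. z \<in> N \<Longrightarrow> f z \<noteq> 0"
  shows "closed_on (\<lambda>z. smul (1 / f z) (dif f z)) N"
  using assms(3)
  by (intro closed_on_fun_dif[OF assms(1,2), where \<phi>' = "\<lambda>x. - (1 / x\<^sup>2)"])
     (auto intro!: derivative_eq_intros simp: power2_eq_square)

lemma wedge_simps: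
  "wedge (smul a v) w = a * wedge v w" "wedge v (smul a w) = a * wedge v w"
  "wedge (v + v') w = wedge v w + wedge v' w" "wedge v (w + w') = wedge v w + wedge v w'"
  "wedge (v - v') w = wedge v w - wedge v' w" "wedge v (w - w') = wedge v w - wedge v w'"
  "wedge v v = 0" "wedge 0 w = 0" "wedge v 0 = 0"
  by (simp_all add: wedge_def algebra_simps)

lemma wedge_anti: "wedge v w = - wedge w v"
  by (simp add: wedge_def)

lemma wedge_sum_left: "wedge (\<Sum>i\<in>A. v i) w = (\<Sum>i\<in>A. wedge (v i) w)"
  by (simp add: wedge_def fst_sum snd_sum sum_distrib_left sum_distrib_right sum_subtractf)

lemma eq_if_wedge_eq:
  assumes "wedge v w \<noteq> 0" "wedge a v = wedge b v" "wedge a w = wedge b w"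
  shows "a = b"
proof -
  have "fst c * wedge v w = fst v * wedge c w - fst w * wedge c v"
    "snd c * wedge v w = snd v * wedge c w - snd w * wedge c v" for c
    by (simp_all add: wedge_def algebra_simps)
  then have "fst a * wedge v w = fst b * wedge v w" "snd a * wedge v w = snd b * wedge v w"
    using assms(2,3) by simp_all
  with assms(1) show ?thesis by (simp add: prod_eq_iff)
qed

text \<open>Three covectors of a plane satisfy Cramer's relation, which supplies the units; two of
  the structure equations determine the connection form, and the third follows because the
  normalised forms add up to zero. Continuity is recorded for the later density argument.\<close>

lemma has_curvature3_ex:
  assumes U: "open U" and J: "card J = 3"
    and w: "\<And>i. i \<in> J \<Longrightarrow> holomorphic_form_on (w i) U"
    and tr: "\<And>i j z. i \<in> J \<Longrightarrow> j \<in> J \<Longrightarrow> i \<noteq> j \<Longrightarrow> z \<in> U \<Longrightarrow> wedge (w i z) (w j z) \<noteq> 0"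
  shows "\<exists>\<kappa>. has_curvature3 U J w \<kappa> \<and> continuous_on U \<kappa>"
proof -
  obtain i j k where J': "J = {i, j, k}" and d: "i \<noteq> j" "i \<noteq> k" "j \<noteq> k"
    using J by (auto simp: card_3_iff)
  have hi: "holomorphic_form_on (w i) U" "holomorphic_form_on (w j) U" "holomorphic_form_on (w k) U"
    using w J' by auto
  \<comment> \<open>Cyclic wedge products, the coefficients of Cramer's relation; they are units
    because the web is regular.\<close>
  define u where "u l z = (if l = i then wedge (w j z) (w k z) else if l = j then wedge (w k z) (w i z)
      else wedge (w i z) (w j z))" for l z
  define o1 where "o1 = form_scale (u i) (w i)"
  define o2 where "o2 = form_scale (u j) (w j)"
  have ho: "holomorphic2_on (u l) U" if "l \<in> J" for l
    using that d hi unfolding u_def J' by (auto intro!: holomorphic2_wedge)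
  have un: "u l z \<noteq> 0" if "l \<in> J" "z \<in> U" for l z
    using that d tr[of j k z] tr[of k i z] tr[of i j z] unfolding u_def J' by auto
  have sum0: "(\<Sum>l\<in>J. form_scale (u l) (w l) z) = 0" for z
    using d by (simp add: J' u_def form_scale_def wedge_def algebra_simps zero_prod_def)
  have hol_o: "holomorphic_form_on (form_scale (u l) (w l)) U" if "l \<in> J" for l
    unfolding form_scale_eq[abs_def] by (rule holomorphic_form_smul[OF ho[OF that] w[OF that]])
  have oh: "holomorphic_form_on o1 U" "holomorphic_form_on o2 U"
    using hol_o J' by (auto simp: o1_def o2_def)
  have W: "wedge (o2 z) (o1 z) \<noteq> 0" if "z \<in> U" for z
    using un[of i z] un[of j z] tr[of j i z] that J' d
    by (simp add: o1_def o2_def form_scale_eq wedge_simps)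
  \<comment> \<open>The covector with prescribed wedge products against the basis \<open>o1\<close>,
    \<open>o2\<close>.\<close>
  define \<eta> where "\<eta> z = smul (1 / wedge (o2 z) (o1 z))
      (smul (ext_deriv o1 z) (o2 z) - smul (ext_deriv o2 z) (o1 z))" for z
  have h\<eta>: "holomorphic_form_on \<eta> U"
    unfolding \<eta>_def
    by (intro holomorphic_form_smul holomorphic_form_diff holomorphic2_divide holomorphic2_const
        holomorphic2_wedge holomorphic2_ext_deriv oh U W)
  have e1: "ext_deriv o1 z = wedge (\<eta> z) (o1 z)" "ext_deriv o2 z = wedge (\<eta> z) (o2 z)" if "z \<in> U" for z
    using W[OF that] unfolding \<eta>_def by (simp_all add: wedge_simps wedge_anti[of "o1 z" "o2 z"])
  have e3: "ext_deriv (form_scale (u k) (w k)) z = wedge (\<eta> z) (form_scale (u k) (w k) z)" if z: "z \<in> U" for z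
  proof -
    have o3: "form_scale (u k) (w k) y = - (o1 y + o2 y)" for y
    proof -
      have "o1 y + (o2 y + form_scale (u k) (w k) y) = 0"
        using sum0[of y] d by (simp add: J' o1_def o2_def)
      then have "(o1 y + o2 y) + form_scale (u k) (w k) y = 0" by (simp only: add.assoc)
      then show ?thesis by (metis minus_unique)
    qed
    have "ext_deriv (form_scale (u k) (w k)) z + ext_deriv (\<lambda>z. o1 z + o2 z) z = 0"
    proof -
      have "ext_deriv (\<lambda>y. form_scale (u k) (w k) y + (o1 y + o2 y)) z = 0"
        by (simp add: o3 ext_deriv_def split: prod.split)
      then show ?thesis
        using ext_deriv_add[OF hol_o[of k] holomorphic_form_add[OF oh] z] J' by simp
    qed
    then have "ext_deriv (form_scale (u k) (w k)) z = - (ext_deriv o1 z + ext_deriv o2 z)"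
      using ext_deriv_add[OF oh z] by algebra
    then show ?thesis
      by (simp add: e1[OF z] o3) (simp add: wedge_def algebra_simps)
  qed
  have "has_curvature3 U J w (ext_deriv \<eta>)"
    unfolding has_curvature3_def
  proof (intro exI conjI ballI)
    fix l z assume l: "l \<in> J" and z: "z \<in> U"
    show "ext_deriv (form_scale (u l) (w l)) z = wedge (\<eta> z) (form_scale (u l) (w l) z)"
      using l e1[OF z] e3[OF z] J' by (auto simp: o1_def o2_def)
  qed (use ho un sum0 h\<eta> in auto)
  moreover have "continuous_on U (ext_deriv \<eta>)"
    by (rule holomorphic2_on_continuous[OF holomorphic2_ext_deriv[OF h\<eta> U]])
  ultimately show ?thesis by blast
qed

text \<open>Two normalisations differ by a common unit \<open>g\<close>, so the connection forms
  differ by \<open>dg / g\<close>, which is closed.\<close>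

lemma has_curvature3_unique:
  assumes N: "open N" "N \<subseteq> U" and J: "card J = 3"
    and w: "\<And>i. i \<in> J \<Longrightarrow> holomorphic_form_on (w i) U"
    and tr: "\<And>i j z. i \<in> J \<Longrightarrow> j \<in> J \<Longrightarrow> i \<noteq> j \<Longrightarrow> z \<in> U \<Longrightarrow> wedge (w i z) (w j z) \<noteq> 0"
    and c: "has_curvature3 U J w \<kappa>" "has_curvature3 N J w \<kappa>'"
    and z: "z \<in> N"
  shows "\<kappa> z = \<kappa>' z"
proof -
  obtain i j k where J': "J = {i, j, k}" and d: "i \<noteq> j" "i \<noteq> k" "j \<noteq> k"
    using J by (auto simp: card_3_iff)
  obtain u \<eta> where u: "\<And>l. l \<in> J \<Longrightarrow> holomorphic2_on (u l) U" "\<And>l z. l \<in> J \<Longrightarrow> z \<in> U \<Longrightarrow> u l z \<noteq> 0"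
    "\<And>z. z \<in> U \<Longrightarrow> (\<Sum>l\<in>J. form_scale (u l) (w l) z) = 0" "holomorphic_form_on \<eta> U"
    "\<And>l z. l \<in> J \<Longrightarrow> z \<in> U \<Longrightarrow> ext_deriv (form_scale (u l) (w l)) z = wedge (\<eta> z) (form_scale (u l) (w l) z)"
    "\<And>z. z \<in> U \<Longrightarrow> \<kappa> z = ext_deriv \<eta> z"
    using c(1) unfolding has_curvature3_def by blast
  obtain v \<theta> where v: "\<And>l. l \<in> J \<Longrightarrow> holomorphic2_on (v l) N" "\<And>l z. l \<in> J \<Longrightarrow> z \<in> N \<Longrightarrow> v l z \<noteq> 0"
    "\<And>z. z \<in> N \<Longrightarrow> (\<Sum>l\<in>J. form_scale (v l) (w l) z) = 0" "holomorphic_form_on \<theta> N"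
    "\<And>l z. l \<in> J \<Longrightarrow> z \<in> N \<Longrightarrow> ext_deriv (form_scale (v l) (w l)) z = wedge (\<theta> z) (form_scale (v l) (w l) z)"
    "\<And>z. z \<in> N \<Longrightarrow> \<kappa>' z = ext_deriv \<theta> z"
    using c(2) unfolding has_curvature3_def by blast
  define g where "g z = v i z / u i z" for z
  have iJ: "i \<in> J" "j \<in> J" "k \<in> J" using J' by auto
  have NU: "y \<in> U" if "y \<in> N" for y using N that by blast
  have hg: "holomorphic2_on g N"
    unfolding g_def using v(1)[OF iJ(1)] holomorphic2_on_subset[OF u(1)[OF iJ(1)] N(2)] u(2)[OF iJ(1)] NU
    by (intro holomorphic2_divide) auto
  have gn: "g y \<noteq> 0" if "y \<in> N" for y
    using u(2)[OF iJ(1)] v(2)[OF iJ(1)] NU that by (simp add: g_def)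
  have vg: "v i y = g y * u i y" "v j y = g y * u j y" if y: "y \<in> N" for y
  proof -
    show "v i y = g y * u i y" using u(2)[OF iJ(1) NU[OF y]] by (simp add: g_def)
    \<comment> \<open>Wedging with \<open>w k\<close> eliminates the third form and leaves the ratio
      of the first two units.\<close>
    have ku: "u i y * wedge (w i y) (w k y) + u j y * wedge (w j y) (w k y) = 0"
      using arg_cong[OF u(3)[OF NU[OF y]], of "\<lambda>a. wedge a (w k y)"] d
      by (simp add: J' form_scale_eq wedge_simps)
    have kv: "v i y * wedge (w i y) (w k y) + v j y * wedge (w j y) (w k y) = 0"
      using arg_cong[OF v(3)[OF y], of "\<lambda>a. wedge a (w k y)"] d
      by (simp add: J' form_scale_eq wedge_simps)
    have "(v j y * u i y - v i y * u j y) * wedge (w j y) (w k y) = 0"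
    proof -
      have "(v j y * u i y - v i y * u j y) * wedge (w j y) (w k y) =
          u i y * (v i y * wedge (w i y) (w k y) + v j y * wedge (w j y) (w k y)) -
          v i y * (u i y * wedge (w i y) (w k y) + u j y * wedge (w j y) (w k y))"
        by (simp add: algebra_simps)
      then show ?thesis by (simp add: ku kv)
    qed
    then have "v j y * u i y = v i y * u j y"
      using tr[OF iJ(2,3) d(3) NU[OF y]] by simp
    then show "v j y = g y * u j y"
      using u(2)[OF iJ(1) NU[OF y]] by (simp add: g_def field_simps)
  qed
  have hol: "holomorphic_form_on (form_scale (u l) (w l)) N" if "l \<in> J" for l
    unfolding form_scale_eq[abs_def]
    using holomorphic_form_smul[OF u(1)[OF that] w[OF that]] N(2) holomorphic_form_subset by blast
  have key: "wedge (\<theta> y) (form_scale (u l) (w l) y) = wedge (\<eta> y + smul (1 / g y) (dif g y)) (form_scale (u l) (w l) y)"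
    if y: "y \<in> N" and l: "l \<in> J" and vl: "\<And>y. y \<in> N \<Longrightarrow> v l y = g y * u l y" for y l
  proof -
    have *: "form_scale (v l) (w l) x = smul (g x) (form_scale (u l) (w l) x)" if "x \<in> N" for x
      using vl[OF that] by (simp add: form_scale_eq smul_def)
    have "ext_deriv (form_scale (v l) (w l)) y = ext_deriv (\<lambda>x. smul (g x) (form_scale (u l) (w l) x)) y"
      by (rule ext_deriv_cong[OF N(1) y *])
    also have "\<dots> = wedge (dif g y) (form_scale (u l) (w l) y) + g y * wedge (\<eta> y) (form_scale (u l) (w l) y)"
      using ext_deriv_smul[OF hg hol[OF l] y] u(5)[OF l NU[OF y]] by simp
    finally have "wedge (\<theta> y) (smul (g y) (form_scale (u l) (w l) y)) = \<dots>"
      using v(5)[OF l y] *[OF y] by simp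
    then have "g y * wedge (\<theta> y) (form_scale (u l) (w l) y) =
        wedge (dif g y) (form_scale (u l) (w l) y) + g y * wedge (\<eta> y) (form_scale (u l) (w l) y)"
      by (simp add: wedge_simps)
    then show ?thesis
      using gn[OF y] by (simp add: wedge_simps field_simps)
  qed
  have eq: "\<theta> y = \<eta> y + smul (1 / g y) (dif g y)" if y: "y \<in> N" for y
  proof (rule eq_if_wedge_eq)
    show "wedge (form_scale (u i) (w i) y) (form_scale (u j) (w j) y) \<noteq> 0"
      using u(2)[OF iJ(1) NU[OF y]] u(2)[OF iJ(2) NU[OF y]] tr[OF iJ(1,2) d(1) NU[OF y]]
      by (simp add: form_scale_eq wedge_simps)
    show "wedge (\<theta> y) (form_scale (u i) (w i) y) = wedge (\<eta> y + smul (1 / g y) (dif g y)) (form_scale (u i) (w i) y)"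
      by (rule key[OF y iJ(1) vg(1)])
    show "wedge (\<theta> y) (form_scale (u j) (w j) y) = wedge (\<eta> y + smul (1 / g y) (dif g y)) (form_scale (u j) (w j) y)"
      by (rule key[OF y iJ(2) vg(2)])
  qed
  have cl: "closed_on (\<lambda>y. smul (1 / g y) (dif g y)) N"
    by (rule closed_on_dlog[OF hg N(1) gn])
  have "\<kappa>' z = ext_deriv (\<lambda>y. \<eta> y + smul (1 / g y) (dif g y)) z"
    using v(6)[OF z] ext_deriv_cong[OF N(1) z eq] by simp
  also have "\<dots> = ext_deriv \<eta> z"
    using ext_deriv_add[OF holomorphic_form_subset[OF u(4) N(2)] _ z] cl z by (simp add: closed_on_def)
  finally show ?thesis using u(6)[OF NU[OF z]] by simp
qed

section \<open>Webs in terms of their slopes\<close>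

text \<open>Double counting of the pairs of a set \<open>K\<close> and an element \<open>i\<close>
  of it: such a pair is the same as \<open>i\<close> together with
  \<open>L = K - {i}\<close>.\<close>

lemma sum_subsets_Suc:
  fixes f :: "'a \<Rightarrow> 'a set \<Rightarrow> 'b::comm_monoid_add"
  assumes "finite I"
  shows "(\<Sum>K | K \<subseteq> I \<and> card K = Suc n. \<Sum>i\<in>K. f i (K - {i})) =
         (\<Sum>i\<in>I. \<Sum>L | L \<subseteq> I - {i} \<and> card L = n. f i L)"
proof -
  have fin: "finite K" if "K \<subseteq> I" for K using that assms finite_subset by blast
  have fin': "finite L" if "L \<subseteq> I - {i}" for L i using fin[of L] that by blast
  have "(\<Sum>K | K \<subseteq> I \<and> card K = Suc n. \<Sum>i\<in>K. f i (K - {i})) =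
      (\<Sum>(K, i)\<in>(SIGMA K:{K. K \<subseteq> I \<and> card K = Suc n}. K). f i (K - {i}))"
    by (rule sum.Sigma) (use assms fin in auto)
  also have "\<dots> = (\<Sum>(i, L)\<in>(SIGMA i:I. {L. L \<subseteq> I - {i} \<and> card L = n}). f i L)"
    by (rule sum.reindex_bij_witness[where i = "\<lambda>(i, L). (insert i L, i)" and j = "\<lambda>(K, i). (i, K - {i})"])
       (auto simp: insert_absorb fin card_Diff_singleton dest: fin' intro!: card_insert_disjoint)
  also have "\<dots> = (\<Sum>i\<in>I. \<Sum>L | L \<subseteq> I - {i} \<and> card L = n. f i L)"
    by (rule sum.Sigma[symmetric]) (use assms in auto)
  finally show ?thesis .
qed

lemma sum_subsets_1:
  assumes "finite A"
  shows "(\<Sum>L | L \<subseteq> A \<and> card L = 1. h L) = (\<Sum>a\<in>A. h {a})"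
proof -
  have "{L. L \<subseteq> A \<and> card L = 1} = (\<lambda>a. {a}) ` A"
    by (auto simp: card_1_singleton_iff)
  then show ?thesis by (simp add: sum.reindex)
qed

lemma sum_subsets_2_sum:
  fixes \<phi> :: "'a \<Rightarrow> complex"
  assumes "finite A"
  shows "(\<Sum>L | L \<subseteq> A \<and> card L = 2. \<Sum>j\<in>L. \<phi> j) = of_nat (card A - 1) * (\<Sum>j\<in>A. \<phi> j)"
proof -
  have "(\<Sum>L | L \<subseteq> A \<and> card L = Suc 1. \<Sum>j\<in>L. \<phi> j) = (\<Sum>i\<in>A. \<Sum>L | L \<subseteq> A - {i} \<and> card L = 1. \<phi> i)"
    by (rule sum_subsets_Suc[OF assms, where f = "\<lambda>i L. \<phi> i"])
  also have "\<dots> = (\<Sum>i\<in>A. of_nat (card A - 1) * \<phi> i)"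
    using assms by (intro sum.cong refl) (simp add: n_subsets)
  finally show ?thesis by (simp add: numeral_2_eq_2 sum_distrib_left)
qed

text \<open>The second elementary symmetric function in terms of power sums.\<close>

lemma sum_subsets_2_prod:
  fixes \<phi> :: "'a \<Rightarrow> complex"
  assumes "finite A"
  shows "(\<Sum>L | L \<subseteq> A \<and> card L = 2. \<Prod>j\<in>L. \<phi> j) = ((\<Sum>j\<in>A. \<phi> j)\<^sup>2 - (\<Sum>j\<in>A. (\<phi> j)\<^sup>2)) / 2"
proof -
  have "2 * (\<Sum>L | L \<subseteq> A \<and> card L = 2. \<Prod>j\<in>L. \<phi> j) = (\<Sum>L | L \<subseteq> A \<and> card L = Suc 1. \<Sum>i\<in>L. \<phi> i * (\<Prod>j\<in>L - {i}. \<phi> j))"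
    unfolding sum_distrib_left
  proof (rule sum.cong)
    fix L assume L: "L \<in> {L. L \<subseteq> A \<and> card L = Suc 1}"
    then have fin: "finite L" using assms finite_subset by blast
    have "(\<Sum>i\<in>L. \<phi> i * (\<Prod>j\<in>L - {i}. \<phi> j)) = (\<Sum>i\<in>L. \<Prod>j\<in>L. \<phi> j)"
      by (rule sum.cong) (simp_all add: prod.remove[OF fin])
    then show "2 * (\<Prod>j\<in>L. \<phi> j) = (\<Sum>i\<in>L. \<phi> i * (\<Prod>j\<in>L - {i}. \<phi> j))"
      using L by simp
  qed (simp add: numeral_2_eq_2)
  also have "\<dots> = (\<Sum>i\<in>A. \<Sum>L | L \<subseteq> A - {i} \<and> card L = 1. \<phi> i * (\<Prod>j\<in>L. \<phi> j))"
    by (rule sum_subsets_Suc[OF assms, where f = "\<lambda>i L. \<phi> i * (\<Prod>j\<in>L. \<phi> j)"])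
  also have "\<dots> = (\<Sum>i\<in>A. \<phi> i * (\<Sum>j\<in>A - {i}. \<phi> j))"
    using assms by (intro sum.cong refl) (simp add: sum_subsets_1 sum_distrib_left del: One_nat_def)
  also have "\<dots> = (\<Sum>i\<in>A. \<phi> i * (\<Sum>j\<in>A. \<phi> j) - (\<phi> i)\<^sup>2)"
    using assms by (intro sum.cong refl) (simp add: sum.remove[of A] power2_eq_square algebra_simps)
  finally have "2 * (\<Sum>L | L \<subseteq> A \<and> card L = 2. \<Prod>j\<in>L. \<phi> j) = (\<Sum>j\<in>A. \<phi> j)\<^sup>2 - (\<Sum>j\<in>A. (\<phi> j)\<^sup>2)"
    by (simp add: sum_subtractf sum_distrib_right[symmetric] power2_eq_square[of "sum \<phi> A"])
  then show ?thesis by (metis nonzero_mult_div_cancel_left zero_neq_numeral)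
qed

locale web_chart =
  fixes N :: "(complex \<times> complex) set" and p q :: "complex \<times> complex \<Rightarrow> complex"
    and I :: "nat set" and x :: "nat \<Rightarrow> complex \<times> complex \<Rightarrow> complex"
  assumes open_N: "open N" and hol_p: "holomorphic2_on p N" and hol_q: "holomorphic2_on q N"
    and frame: "z \<in> N \<Longrightarrow> wedge (dif p z) (dif q z) \<noteq> 0"
    and fin_I: "finite I" and hol_x: "i \<in> I \<Longrightarrow> holomorphic2_on (x i) N"
    and x_ne: "i \<in> I \<Longrightarrow> j \<in> I \<Longrightarrow> i \<noteq> j \<Longrightarrow> z \<in> N \<Longrightarrow> x i z \<noteq> x j z"
begin

definition W :: "nat \<Rightarrow> form1" where "W i z = dif q z - smul (x i z) (dif p z)"

text \<open>\<open>r i\<close> and \<open>g i\<close> are the coordinates of \<open>d(x i)\<close>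
  in the coframe \<open>dp\<close>, \<open>W i\<close>. Thus \<open>r i\<close> is the derivative of
  the slope with respect to \<open>q\<close>, and \<open>g i\<close> is its derivative with respect
  to \<open>p\<close> along the leaves, which vanishes for straight leaves.\<close>

definition r :: "nat \<Rightarrow> complex \<times> complex \<Rightarrow> complex" where
  "r i z = wedge (dif p z) (dif (x i) z) / wedge (dif p z) (dif q z)"

definition g :: "nat \<Rightarrow> complex \<times> complex \<Rightarrow> complex" where
  "g i z = wedge (dif (x i) z) (W i z) / wedge (dif p z) (dif q z)"

definition S :: "nat set \<Rightarrow> nat \<Rightarrow> complex \<times> complex \<Rightarrow> complex" where
  "S L i z = (\<Sum>j\<in>L. 1 / (x i z - x j z))"

text \<open>The Lagrange weights: multiplied by them, the forms \<open>W i\<close> of a 3-subweb add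
  up to zero.\<close>

definition Q :: "nat set \<Rightarrow> nat \<Rightarrow> complex \<times> complex \<Rightarrow> complex" where
  "Q L i z = (\<Prod>j\<in>L. 1 / (x i z - x j z))"

lemma wedge_dp_W: "wedge (dif p z) (W i z) = wedge (dif p z) (dif q z)"
  by (simp add: W_def wedge_simps)

lemma dif_x:
  assumes "z \<in> N"
  shows "dif (x i) z = smul (g i z) (dif p z) + smul (r i z) (W i z)"
proof (rule eq_if_wedge_eq)
  show "wedge (dif p z) (W i z) \<noteq> 0" using frame[OF assms] by (simp add: wedge_dp_W)
qed (use frame[OF assms] in \<open>simp_all add: wedge_simps r_def g_def wedge_dp_W
       wedge_anti[of "W i z" "dif p z"] wedge_anti[of "dif (x i) z" "dif p z"]\<close>)

lemma g_r_eqI: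
  assumes "z \<in> N" "dif (x i) z = smul a (dif p z) + smul b (W i z)"
  shows "g i z = a" "r i z = b"
  using frame[OF assms(1)] by (simp_all add: g_def r_def assms(2) wedge_simps wedge_dp_W)

lemma W_rel: "W j z = W i z + smul (x i z - x j z) (dif p z)"
  by (simp add: W_def prod_eq_iff algebra_simps)

lemma hol_W: "i \<in> I \<Longrightarrow> holomorphic_form_on (W i) N"
  unfolding W_def
  by (intro holomorphic_form_diff holomorphic_form_smul holomorphic_form_dif hol_p hol_q hol_x open_N)

lemma hol_r: "i \<in> I \<Longrightarrow> holomorphic2_on (r i) N"
  unfolding r_def using frame
  by (intro holomorphic2_divide holomorphic2_wedge holomorphic_form_dif hol_p hol_q hol_x open_N)

lemma hol_g: "i \<in> I \<Longrightarrow> holomorphic2_on (g i) N"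
  unfolding g_def using frame
  by (intro holomorphic2_divide holomorphic2_wedge holomorphic_form_dif hol_W hol_p hol_q hol_x open_N)

lemma hol_inv:
  assumes "L \<subseteq> I - {i}" "i \<in> I" "j \<in> L"
  shows "holomorphic2_on (\<lambda>z. 1 / (x i z - x j z)) N"
proof -
  have "j \<in> I" "i \<noteq> j" using assms by auto
  then show ?thesis using x_ne[OF \<open>i \<in> I\<close>]
    by (intro holomorphic2_divide holomorphic2_diff holomorphic2_const hol_x assms(2)) auto
qed

lemma hol_S: "L \<subseteq> I - {i} \<Longrightarrow> i \<in> I \<Longrightarrow> holomorphic2_on (S L i) N"
  unfolding S_def by (intro holomorphic2_sum hol_inv)

lemma hol_Q: "L \<subseteq> I - {i} \<Longrightarrow> i \<in> I \<Longrightarrow> holomorphic2_on (Q L i) N"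
  unfolding Q_def by (intro holomorphic2_prod hol_inv)

lemma ext_deriv_W:
  assumes "i \<in> I" "z \<in> N"
  shows "ext_deriv (W i) z = r i z * wedge (dif p z) (dif q z)"
proof -
  have "ext_deriv (\<lambda>y. W i y + smul (x i y) (dif p y)) z = 0"
    using ext_deriv_dif[OF hol_q open_N assms(2)] by (simp add: W_def)
  moreover have "ext_deriv (\<lambda>y. W i y + smul (x i y) (dif p y)) z = ext_deriv (W i) z + ext_deriv (\<lambda>y. smul (x i y) (dif p y)) z"
    by (rule ext_deriv_add[OF hol_W holomorphic_form_smul[OF hol_x holomorphic_form_dif[OF hol_p open_N]] assms(2)])
       (use assms in auto)
  moreover have "ext_deriv (\<lambda>y. smul (x i y) (dif p y)) z = wedge (dif (x i) z) (dif p z)"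
    using ext_deriv_smul[OF hol_x[OF assms(1)] holomorphic_form_dif[OF hol_p open_N] assms(2)]
      ext_deriv_dif[OF hol_p open_N assms(2)] by simp
  ultimately show ?thesis
    using dif_x[OF assms(2), of i] wedge_dp_W[of z i]
    by (simp add: wedge_simps wedge_anti[of "W i z" "dif p z"] eq_neg_iff_add_eq_0)
qed

lemma dif_Q:
  assumes "K \<subseteq> I" "i \<in> K" "z \<in> N"
  shows "dif (Q (K - {i}) i) z =
      smul (- Q (K - {i}) i z) (\<Sum>j\<in>K - {i}. smul (1 / (x i z - x j z)) (dif (x i) z - dif (x j) z))"
proof -
  have "dif (Q L i) z = smul (- Q L i z) (\<Sum>j\<in>L. smul (1 / (x i z - x j z)) (dif (x i) z - dif (x j) z))"
    if "L \<subseteq> I - {i}" for L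
    using finite_subset[OF that finite_Diff[OF fin_I]] that
  proof (induction L rule: finite_induct)
    case empty
    then show ?case using has_diff_imp_dif[OF has_diff_const[of 1 z]] by (simp add: Q_def[abs_def])
  next
    case (insert j L)
    have j: "j \<in> I" "j \<noteq> i" "i \<in> I" using insert assms by auto
    have ne: "x i z - x j z \<noteq> 0" using x_ne[of i j z] j assms(3) by simp
    have hd: "has_diff (\<lambda>y. 1 / (x i y - x j y))
        (smul (1 / (x i z - x j z)) (0 - smul (1 / (x i z - x j z)) (dif (x i) z - dif (x j) z))) z"
      using j assms(3) ne
      by (intro has_diff_divide has_diff_const has_diff_diff holomorphic2_on_has_diff[OF hol_x]) auto
    have "dif (Q (insert j L) i) z = dif (\<lambda>y. 1 / (x i y - x j y) * Q L i y) z"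
      using insert by (simp add: Q_def[abs_def])
    also have "\<dots> = smul (1 / (x i z - x j z)) (dif (Q L i) z) + smul (Q L i z)
        (smul (1 / (x i z - x j z)) (0 - smul (1 / (x i z - x j z)) (dif (x i) z - dif (x j) z)))"
      using insert j assms(3)
      by (intro has_diff_imp_dif has_diff_mult hd holomorphic2_on_has_diff[OF hol_Q]) auto
    also have "dif (Q L i) z = smul (- Q L i z) (\<Sum>j\<in>L. smul (1 / (x i z - x j z)) (dif (x i) z - dif (x j) z))"
      using insert by auto
    finally show ?case
      using insert ne by (simp add: Q_def prod_eq_iff algebra_simps)
  qed
  from this[of "K - {i}"] show ?thesis using assms(1) by blast
qed

text \<open>For a set \<open>K\<close> of two indices this is the connection form of the 3-web made
  of the two \<open>W i\<close> and \<open>dp\<close>. Being a multiple of \<open>dp\<close>, it is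
  compatible with \<open>dp\<close> being closed.\<close>

definition eta_sum :: "nat set \<Rightarrow> form1" where
  "eta_sum K z = (\<Sum>i\<in>K. smul (r i z - g i z * S (K - {i}) i z) (dif p z))"

definition eta :: "nat set \<Rightarrow> form1" where
  "eta K z = eta_sum K z - (\<Sum>i\<in>K. smul (g i z * Q (K - {i}) i z) (W i z))"

lemma hol_eta_sum: "K \<subseteq> I \<Longrightarrow> holomorphic_form_on (eta_sum K) N"
  unfolding eta_sum_def
  by (intro holomorphic_form_sum holomorphic_form_smul holomorphic2_diff holomorphic2_mult
      hol_r hol_g hol_S holomorphic_form_dif hol_p open_N) auto

lemma hol_eta: "K \<subseteq> I \<Longrightarrow> holomorphic_form_on (eta K) N"
  unfolding eta_def
  by (intro holomorphic_form_diff hol_eta_sum holomorphic_form_sum holomorphic_form_smul holomorphic2_mult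
      hol_g hol_Q hol_W) auto

lemma wedge_dif_x:
  assumes "z \<in> N"
  shows "wedge (dif (x j) z) (W i z) = (g j z + r j z * (x i z - x j z)) * wedge (dif p z) (dif q z)"
  unfolding dif_x[OF assms] W_rel[of j z i]
  by (simp add: wedge_simps wedge_dp_W algebra_simps)

text \<open>Only the part of \<open>dQ\<close> transverse to \<open>W i\<close> matters, so the
  differentials of the slopes enter through \<open>wedge_dif_x\<close>, that is through
  \<open>g\<close> and \<open>r\<close> alone.\<close>

lemma ext_deriv_Q_W:
  assumes "K \<subseteq> I" "i \<in> K" "z \<in> N"
  shows "ext_deriv (\<lambda>y. smul (Q (K - {i}) i y) (W i y)) z =
     Q (K - {i}) i z * ((\<Sum>j\<in>K. r j z) - (\<Sum>j\<in>K - {i}. (g i z - g j z) / (x i z - x j z))) * wedge (dif p z) (dif q z)"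
proof -
  have iI: "i \<in> I" and sub: "K - {i} \<subseteq> I - {i}" and fin: "finite K"
    using assms fin_I finite_subset by auto
  have "ext_deriv (\<lambda>y. smul (Q (K - {i}) i y) (W i y)) z =
      wedge (dif (Q (K - {i}) i) z) (W i z) + Q (K - {i}) i z * (r i z * wedge (dif p z) (dif q z))"
    using ext_deriv_smul[OF hol_Q[OF sub iI] hol_W[OF iI] assms(3)] ext_deriv_W[OF iI assms(3)] by simp
  moreover have "wedge (dif (Q (K - {i}) i) z) (W i z) =
      Q (K - {i}) i z * ((\<Sum>j\<in>K - {i}. r j z - (g i z - g j z) / (x i z - x j z)) * wedge (dif p z) (dif q z))"
  proof -
    have "1 / (x i z - x j z) * (wedge (dif (x i) z) (W i z) - wedge (dif (x j) z) (W i z)) =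
        - ((r j z - (g i z - g j z) / (x i z - x j z)) * wedge (dif p z) (dif q z))" if "j \<in> K - {i}" for j
    proof -
      have "x i z - x j z \<noteq> 0" using x_ne[of i j z] that assms iI by auto
      then show ?thesis by (simp add: wedge_dif_x[OF assms(3)] field_simps)
    qed
    then have "(\<Sum>j\<in>K - {i}. 1 / (x i z - x j z) * (wedge (dif (x i) z) (W i z) - wedge (dif (x j) z) (W i z))) =
       - ((\<Sum>j\<in>K - {i}. r j z - (g i z - g j z) / (x i z - x j z)) * wedge (dif p z) (dif q z))"
      unfolding sum_distrib_right sum_negf[symmetric] by (intro sum.cong refl)
    then show ?thesis
      unfolding dif_Q[OF assms] wedge_simps wedge_sum_left by simp
  qed
  ultimately show ?thesis
    using assms(2) fin by (simp add: sum.remove[OF fin assms(2)] sum_subtractf algebra_simps)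
qed

lemma wedge_W_W: "wedge (W j z) (W i z) = (x i z - x j z) * wedge (dif p z) (dif q z)"
  unfolding W_rel[of j z i] by (simp add: wedge_simps wedge_dp_W)

lemma pair_identity:
  assumes "card K = 2" "K \<subseteq> I" "i \<in> K" "z \<in> N"
  shows "(\<Sum>j\<in>K - {i}. (g i z - g j z) / (x i z - x j z)) = (\<Sum>j\<in>K. g j z * S (K - {j}) j z)"
proof -
  have "card (K - {i}) = 1" using assms by (simp add: card_Diff_singleton)
  then obtain j where j: "K - {i} = {j}" by (auto simp: card_1_singleton_iff)
  have d: "j \<noteq> i" "K = {i, j}" "K - {j} = {i}" using j assms(3) by auto
  have "x i z \<noteq> x j z" using x_ne[of i j z] assms d by auto
  then have "(g i z - g j z) / (x i z - x j z) = g i z * (1 / (x i z - x j z)) + g j z * (1 / (x j z - x i z))"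
    by (simp add: divide_simps) (simp add: algebra_simps)
  then show ?thesis using d(1) unfolding j d(3) S_def by (subst d(2)) (simp add: j d(3))
qed

text \<open>This partial fraction identity dictates the form of \<open>eta\<close>: the left side is
  what \<open>ext_deriv_Q_W\<close> produces and varies with \<open>i\<close>. Its symmetric part
  becomes the coefficient of \<open>dp\<close>; the remainder is the wedge product of the
  \<open>W j\<close> terms with \<open>W i\<close>, where \<open>x i - x j\<close> cancels one
  factor of \<open>Q\<close>.\<close>

lemma triple_identity:
  assumes "card K = 3" "K \<subseteq> I" "i \<in> K" "z \<in> N"
  shows "(\<Sum>j\<in>K - {i}. (g i z - g j z) / (x i z - x j z)) =
    (\<Sum>j\<in>K. g j z * S (K - {j}) j z) + (\<Sum>j\<in>K. g j z * Q (K - {j}) j z * (x i z - x j z))"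
proof -
  have "card (K - {i}) = 2" using assms by (simp add: card_Diff_singleton)
  then obtain j k where jk: "K - {i} = {j, k}" "j \<noteq> k" by (auto simp: card_2_iff)
  have d: "j \<noteq> i" "k \<noteq> i" "K = {i, j, k}" "K - {j} = {i, k}" "K - {k} = {i, j}"
    using jk assms(3) by auto
  have ne: "x i z \<noteq> x j z" "x i z \<noteq> x k z" "x j z \<noteq> x k z"
    using x_ne[of _ _ z] assms d(1,2,3) jk(2) by auto
  have scalar: "(a - b) / (xi - xj) + (a - c) / (xi - xk) =
     a * (1 / (xi - xj) + 1 / (xi - xk)) + b * (1 / (xj - xi) + 1 / (xj - xk)) + c * (1 / (xk - xi) + 1 / (xk - xj)) +
     b * (1 / (xj - xi) * (1 / (xj - xk))) * (xi - xj) + c * (1 / (xk - xi) * (1 / (xk - xj))) * (xi - xk)"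
    if "xi \<noteq> xj" "xi \<noteq> xk" "xj \<noteq> xk" for a b c xi xj xk :: complex
  proof -
    have m: "1 / (u - v) * (v - u) = -1" if "u \<noteq> v" for u v :: complex using that by (simp add: field_simps)
    have b: "b * (1 / (xj - xi) * (1 / (xj - xk))) * (xi - xj) = - (b * (1 / (xj - xk)))"
      using m[of xj xi] that by (metis (no_types, opaque_lifting) mult.assoc mult.commute mult_minus1_right)
    have c: "c * (1 / (xk - xi) * (1 / (xk - xj))) * (xi - xk) = - (c * (1 / (xk - xj)))"
      using m[of xk xi] that by (metis (no_types, opaque_lifting) mult.assoc mult.commute mult_minus1_right)
    have d: "1 / (xj - xi) = - (1 / (xi - xj))" "1 / (xk - xi) = - (1 / (xi - xk))"
      by (metis minus_diff_eq minus_divide_right)+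
    show ?thesis unfolding b c unfolding d by (simp add: diff_divide_distrib algebra_simps)
  qed
  have S3: "(\<Sum>l\<in>K. f l) = f i + f j + f k" for f :: "nat \<Rightarrow> complex"
    unfolding d(3) using d(1,2) jk(2) by simp
  show ?thesis
    unfolding jk(1) S3 S_def Q_def d(4,5) using d(1,2) jk(2) scalar[OF ne] by (simp add: add.assoc)
qed

lemma gauge3:
  assumes "card K = 3" "K \<subseteq> I" "i \<in> K" "z \<in> N"
  shows "ext_deriv (\<lambda>y. smul (Q (K - {i}) i y) (W i y)) z = wedge (eta K z) (smul (Q (K - {i}) i z) (W i z))"
proof -
  have "wedge (eta K z) (W i z) = ((\<Sum>j\<in>K. r j z) - ((\<Sum>j\<in>K. g j z * S (K - {j}) j z) +
     (\<Sum>j\<in>K. g j z * Q (K - {j}) j z * (x i z - x j z)))) * wedge (dif p z) (dif q z)"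
    by (simp add: eta_def eta_sum_def wedge_simps wedge_sum_left wedge_W_W wedge_dp_W
        sum_subtractf sum.distrib sum_distrib_left sum_distrib_right algebra_simps)
  then show ?thesis
    unfolding ext_deriv_Q_W[OF assms(2-4)] triple_identity[OF assms] by (simp add: wedge_simps)
qed

lemma gauge2:
  assumes "card K = 2" "K \<subseteq> I" "i \<in> K" "z \<in> N"
  shows "ext_deriv (\<lambda>y. smul (Q (K - {i}) i y) (W i y)) z = wedge (eta_sum K z) (smul (Q (K - {i}) i z) (W i z))"
proof -
  have "wedge (eta_sum K z) (W i z) =
      ((\<Sum>j\<in>K. r j z) - (\<Sum>j\<in>K. g j z * S (K - {j}) j z)) * wedge (dif p z) (dif q z)"
    by (simp add: eta_sum_def wedge_simps wedge_sum_left wedge_dp_W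
        sum_subtractf sum.distrib sum_distrib_left sum_distrib_right algebra_simps)
  then show ?thesis
    unfolding ext_deriv_Q_W[OF assms(2-4)] pair_identity[OF assms] by (simp add: wedge_simps)
qed

text \<open>The sums of \<open>Q\<close> and of \<open>Q\<close> times \<open>x i\<close> are the
  quadratic coefficients of the interpolation at three nodes of the polynomials 1 and X, hence
  zero.\<close>

lemma sum_Q_W_3:
  assumes "card K = 3" "K \<subseteq> I" "z \<in> N"
  shows "(\<Sum>i\<in>K. smul (Q (K - {i}) i z) (W i z)) = 0"
proof -
  obtain i j k where K: "K = {i, j, k}" "i \<noteq> j" "i \<noteq> k" "j \<noteq> k"
    using assms(1) by (auto simp: card_3_iff)
  then have sub: "K - {i} = {j, k}" "K - {j} = {i, k}" "K - {k} = {i, j}" by auto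
  have ne: "x i z - x j z \<noteq> 0" "x i z - x k z \<noteq> 0" "x j z - x k z \<noteq> 0" "x j z - x i z \<noteq> 0" "x k z - x i z \<noteq> 0" "x k z - x j z \<noteq> 0"
    using x_ne[of _ _ z] assms K by auto
  have S3: "(\<Sum>i\<in>K. f i) = f i + f j + f k" for f :: "nat \<Rightarrow> complex"
    using K by simp
  have d: "1 / (x j z - x i z) = - (1 / (x i z - x j z))" "1 / (x k z - x i z) = - (1 / (x i z - x k z))"
    "1 / (x k z - x j z) = - (1 / (x j z - x k z))"
    by (metis minus_diff_eq minus_divide_right)+
  have 0: "1 / (x i z - x j z) * (1 / (x i z - x k z)) - 1 / (x i z - x j z) * (1 / (x j z - x k z)) +
      1 / (x i z - x k z) * (1 / (x j z - x k z)) = 0"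
  proof -
    have "1 / u * (1 / (u + v)) - 1 / u * (1 / v) + 1 / (u + v) * (1 / v) = 0"
      if "u \<noteq> 0" "v \<noteq> 0" "u + v \<noteq> 0" for u v :: complex
      using that by (simp add: divide_simps)
    from this[of "x i z - x j z" "x j z - x k z"] show ?thesis using ne by simp
  qed
  have 1: "(\<Sum>i\<in>K. Q (K - {i}) i z) = 0"
    unfolding S3 Q_def sub using 0 K(2-4) by (simp add: d)
  have 2: "(\<Sum>i\<in>K. Q (K - {i}) i z * x i z) = 0"
  proof -
    have "a * b * xi - a * c * xj + b * c * xk = a * b * (xi - xj) - b * c * (xj - xk) + (a * b - a * c + b * c) * xj"
      for a b c xi xj xk :: complex
      by (simp add: algebra_simps)
    from this[of "1 / (x i z - x j z)" "1 / (x i z - x k z)" "x i z" "1 / (x j z - x k z)" "x j z" "x k z"]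
    show ?thesis unfolding S3 Q_def sub 0 using K(2-4) ne by (simp add: d)
  qed
  have "(\<Sum>i\<in>K. smul (Q (K - {i}) i z) (W i z)) =
      smul (\<Sum>i\<in>K. Q (K - {i}) i z) (dif q z) - smul (\<Sum>i\<in>K. Q (K - {i}) i z * x i z) (dif p z)"
    by (simp add: W_def prod_eq_iff fst_sum snd_sum sum_distrib_left sum_subtractf algebra_simps)
  then show ?thesis by (simp add: 1 2)
qed

text \<open>With two nodes the linear coefficient of the interpolated X is 1, so \<open>dp\<close>
  itself completes the relation, with unit 1.\<close>

lemma sum_Q_W_2:
  assumes "card K = 2" "K \<subseteq> I" "z \<in> N"
  shows "(\<Sum>i\<in>K. smul (Q (K - {i}) i z) (W i z)) = - dif p z"
proof -
  obtain i j where K: "K = {i, j}" "i \<noteq> j"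
    using assms(1) by (auto simp: card_2_iff)
  then have sub: "K - {i} = {j}" "K - {j} = {i}" by auto
  have ne: "x i z \<noteq> x j z" "x j z \<noteq> x i z"
    using x_ne[of _ _ z] assms K by auto
  have S2: "(\<Sum>i\<in>K. f i) = f i + f j" for f :: "nat \<Rightarrow> complex"
    using K by simp
  have 1: "(\<Sum>i\<in>K. Q (K - {i}) i z) = 0"
    using ne by (simp add: S2 Q_def sub divide_simps)
  have 2: "(\<Sum>i\<in>K. Q (K - {i}) i z * x i z) = 1"
    using ne by (simp add: S2 Q_def sub divide_simps) (simp add: algebra_simps)
  have "(\<Sum>i\<in>K. smul (Q (K - {i}) i z) (W i z)) =
      smul (\<Sum>i\<in>K. Q (K - {i}) i z) (dif q z) - smul (\<Sum>i\<in>K. Q (K - {i}) i z * x i z) (dif p z)"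
    by (simp add: W_def prod_eq_iff fst_sum snd_sum sum_distrib_left sum_subtractf algebra_simps)
  then show ?thesis by (simp add: 1 2 prod_eq_iff)
qed

lemma curvature3_finite:
  assumes "card K = 3" "K \<subseteq> I"
    and \<rho>: "\<And>i. i \<in> K \<Longrightarrow> holomorphic2_on (\<rho> i) N" "\<And>i z. i \<in> K \<Longrightarrow> z \<in> N \<Longrightarrow> \<rho> i z \<noteq> 0"
    and w: "\<And>i z. i \<in> K \<Longrightarrow> z \<in> N \<Longrightarrow> w i z = smul (\<rho> i z) (W i z)"
  shows "has_curvature3 N K w (ext_deriv (eta K))"
  unfolding has_curvature3_def
proof (intro exI conjI ballI)
  let ?u = "\<lambda>i z. Q (K - {i}) i z / \<rho> i z"
  have eq: "form_scale (?u i) (w i) z = smul (Q (K - {i}) i z) (W i z)" if "i \<in> K" "z \<in> N" for i z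
    using \<rho>(2)[OF that] by (simp add: form_scale_eq w[OF that] smul_def)
  have nz: "Q (K - {i}) i z \<noteq> 0" if "i \<in> K" "z \<in> N" for i z
    using that x_ne[of i _ z] assms(2) finite_subset[OF assms(2) fin_I] by (auto simp: Q_def)
  fix i assume i: "i \<in> K"
  show "holomorphic2_on (?u i) N"
    by (rule holomorphic2_divide[OF hol_Q \<rho>(1) \<rho>(2)]) (use i assms(2) in auto)
  fix z assume z: "z \<in> N"
  show "?u i z \<noteq> 0" using nz[OF i z] \<rho>(2)[OF i z] by simp
  show "ext_deriv (form_scale (?u i) (w i)) z = wedge (eta K z) (form_scale (?u i) (w i) z)"
    unfolding eq[OF i z] gauge3[OF assms(1,2) i z, symmetric]
    by (rule ext_deriv_cong[OF open_N z eq[OF i]])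
next
  fix z assume z: "z \<in> N"
  show "(\<Sum>i\<in>K. form_scale (\<lambda>z. Q (K - {i}) i z / \<rho> i z) (w i) z) = 0"
    using sum_Q_W_3[OF assms(1,2) z] \<rho>(2)[OF _ z] w[OF _ z] by (simp add: form_scale_eq smul_def cong: sum.cong)
qed (use hol_eta[OF assms(2)] in auto)

lemma curvature3_infinite:
  assumes "card K = 2" "K \<subseteq> I" "o' \<notin> I"
    and \<rho>: "\<And>i. i \<in> insert o' K \<Longrightarrow> holomorphic2_on (\<rho> i) N" "\<And>i z. i \<in> insert o' K \<Longrightarrow> z \<in> N \<Longrightarrow> \<rho> i z \<noteq> 0"
    and w: "\<And>i z. i \<in> K \<Longrightarrow> z \<in> N \<Longrightarrow> w i z = smul (\<rho> i z) (W i z)"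
      "\<And>z. z \<in> N \<Longrightarrow> w o' z = smul (\<rho> o' z) (dif p z)"
  shows "has_curvature3 N (insert o' K) w (ext_deriv (eta_sum K))"
  unfolding has_curvature3_def
proof (intro exI conjI ballI)
  \<comment> \<open>The index \<open>o'\<close> carries \<open>dp\<close>, whose unit before
    division by \<open>\<rho>\<close> is 1 by \<open>sum_Q_W_2\<close>.\<close>
  let ?u = "\<lambda>i z. (if i = o' then 1 else Q (K - {i}) i z) / \<rho> i z"
  have oK: "o' \<notin> K" using assms by auto
  have eq: "form_scale (?u i) (w i) z = smul (Q (K - {i}) i z) (W i z)" if "i \<in> K" "z \<in> N" for i z
    using \<rho>(2)[OF _ that(2), of i] that oK by (auto simp: form_scale_eq w(1)[OF that] smul_def)
  have eqo: "form_scale (?u o') (w o') z = dif p z" if "z \<in> N" for z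
    using \<rho>(2)[OF _ that, of o'] by (simp add: form_scale_eq w(2)[OF that] smul_def)
  have nz: "Q (K - {i}) i z \<noteq> 0" if "i \<in> K" "z \<in> N" for i z
    using that x_ne[of i _ z] assms(2) finite_subset[OF assms(2) fin_I] by (auto simp: Q_def)
  fix i assume i: "i \<in> insert o' K"
  have *: "holomorphic2_on (\<lambda>z. if i = o' then 1 else Q (K - {i}) i z) N"
    using hol_Q[of "K - {i}" i] i assms(2) by (cases "i = o'") (auto simp: holomorphic2_const)
  show "holomorphic2_on (?u i) N"
    by (rule holomorphic2_divide[OF * \<rho>]) (use i in auto)
  fix z assume z: "z \<in> N"
  show "?u i z \<noteq> 0" using nz[OF _ z, of i] \<rho>(2)[OF i z] i by auto
  show "ext_deriv (form_scale (?u i) (w i)) z = wedge (eta_sum K z) (form_scale (?u i) (w i) z)"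
  proof (cases "i = o'")
    case True
    have "wedge (eta_sum K z) (dif p z) = 0"
      by (simp add: eta_sum_def wedge_sum_left wedge_simps)
    moreover have "ext_deriv (form_scale (?u o') (w o')) z = ext_deriv (dif p) z"
      by (rule ext_deriv_cong[OF open_N z eqo])
    ultimately show ?thesis
      unfolding True eqo[OF z] by (simp only: ext_deriv_dif[OF hol_p open_N z])
  next
    case False
    then have iK: "i \<in> K" using i by auto
    show ?thesis
      unfolding eq[OF iK z] gauge2[OF assms(1,2) iK z, symmetric]
      by (rule ext_deriv_cong[OF open_N z eq[OF iK]])
  qed
next
  fix z assume z: "z \<in> N"
  have oK: "o' \<notin> K" "finite K" using assms fin_I finite_subset by auto
  have "(\<Sum>i\<in>K. form_scale (\<lambda>z. (if i = o' then 1 else Q (K - {i}) i z) / \<rho> i z) (w i) z)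
      = (\<Sum>i\<in>K. smul (Q (K - {i}) i z) (W i z))"
    using oK \<rho>(2)[OF _ z] w(1)[OF _ z] by (intro sum.cong) (auto simp: form_scale_eq smul_def)
  then show "(\<Sum>i\<in>insert o' K. form_scale (\<lambda>z. (if i = o' then 1 else Q (K - {i}) i z) / \<rho> i z) (w i) z) = 0"
    using sum_Q_W_2[OF assms(1,2) z] \<rho>(2)[OF _ z, of o'] w(2)[OF z] oK
    by (simp add: form_scale_eq smul_def zero_prod_def)
qed (use hol_eta_sum[OF assms(2)] in auto)

lemma sum_eta_sum:
  "(\<Sum>K | K \<subseteq> I \<and> card K = 2. eta_sum K z) =
     smul (of_nat (card I - 1) * (\<Sum>i\<in>I. r i z) - (\<Sum>i\<in>I. g i z * S (I - {i}) i z)) (dif p z)"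
proof -
  have "(\<Sum>K | K \<subseteq> I \<and> card K = Suc 1. eta_sum K z) =
     (\<Sum>i\<in>I. \<Sum>L | L \<subseteq> I - {i} \<and> card L = 1. smul (r i z - g i z * S L i z) (dif p z))"
    unfolding eta_sum_def by (rule sum_subsets_Suc[OF fin_I, where f = "\<lambda>i L. smul (r i z - g i z * S L i z) (dif p z)"])
  also have "\<dots> = (\<Sum>i\<in>I. smul (of_nat (card I - 1) * r i z - g i z * S (I - {i}) i z) (dif p z))"
  proof (intro sum.cong refl)
    fix i assume i: "i \<in> I"
    have fin: "finite (I - {i})" using fin_I by simp
    show "(\<Sum>L | L \<subseteq> I - {i} \<and> card L = 1. smul (r i z - g i z * S L i z) (dif p z)) =
        smul (of_nat (card I - 1) * r i z - g i z * S (I - {i}) i z) (dif p z)"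
      unfolding sum_subsets_1[OF fin] using i
      by (simp add: S_def smul_sum_left[symmetric] sum_subtractf sum_distrib_left)
  qed
  finally show ?thesis
    by (simp add: numeral_2_eq_2 smul_sum_left[symmetric] sum_subtractf sum_distrib_left)
qed

text \<open>An index \<open>i\<close> collects \<open>Q\<close> over all pairs of other indices,
  which is the second elementary symmetric function of the numbers
  \<open>1 / (x i - x j)\<close>.\<close>

lemma sum_eta:
  "(\<Sum>K | K \<subseteq> I \<and> card K = 3. eta K z) =
     smul (of_nat (card I - 1 choose 2) * (\<Sum>i\<in>I. r i z) - of_nat (card I - 2) * (\<Sum>i\<in>I. g i z * S (I - {i}) i z)) (dif p z)
     - (\<Sum>i\<in>I. smul (g i z * (((S (I - {i}) i z)\<^sup>2 - (\<Sum>j\<in>I - {i}. (1 / (x i z - x j z))\<^sup>2)) / 2)) (W i z))"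
proof -
  have "(\<Sum>K | K \<subseteq> I \<and> card K = Suc 2. eta K z) =
     (\<Sum>K | K \<subseteq> I \<and> card K = Suc 2. \<Sum>i\<in>K. smul (r i z - g i z * S (K - {i}) i z) (dif p z) - smul (g i z * Q (K - {i}) i z) (W i z))"
    by (simp add: eta_def eta_sum_def sum_subtractf)
  also have "\<dots> = (\<Sum>i\<in>I. \<Sum>L | L \<subseteq> I - {i} \<and> card L = 2. smul (r i z - g i z * S L i z) (dif p z) - smul (g i z * Q L i z) (W i z))"
    by (rule sum_subsets_Suc[OF fin_I, where f = "\<lambda>i L. smul (r i z - g i z * S L i z) (dif p z) - smul (g i z * Q L i z) (W i z)"])
  also have "\<dots> = (\<Sum>i\<in>I. smul (of_nat (card I - 1 choose 2) * r i z - of_nat (card I - 2) * (g i z * S (I - {i}) i z)) (dif p z)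
     - smul (g i z * (((S (I - {i}) i z)\<^sup>2 - (\<Sum>j\<in>I - {i}. (1 / (x i z - x j z))\<^sup>2)) / 2)) (W i z))"
  proof (intro sum.cong refl)
    fix i assume i: "i \<in> I"
    let ?A = "{L. L \<subseteq> I - {i} \<and> card L = 2}"
    have fin: "finite (I - {i})" using fin_I by simp
    have c: "card (I - {i}) = card I - 1" using i by simp
    have S: "(\<Sum>L\<in>?A. S L i z) = of_nat (card I - 2) * S (I - {i}) i z"
      unfolding S_def sum_subsets_2_sum[OF fin] c by (simp add: numeral_2_eq_2)
    have Q: "(\<Sum>L\<in>?A. Q L i z) = ((S (I - {i}) i z)\<^sup>2 - (\<Sum>j\<in>I - {i}. (1 / (x i z - x j z))\<^sup>2)) / 2"
      unfolding Q_def S_def by (rule sum_subsets_2_prod[OF fin])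
    have n: "of_nat (card ?A) = (of_nat (card I - 1 choose 2) :: complex)"
      by (simp add: n_subsets[OF fin] c)
    have "(\<Sum>L\<in>?A. smul (r i z - g i z * S L i z) (dif p z) - smul (g i z * Q L i z) (W i z)) =
        smul (of_nat (card ?A) * r i z - g i z * (\<Sum>L\<in>?A. S L i z)) (dif p z) - smul (g i z * (\<Sum>L\<in>?A. Q L i z)) (W i z)"
      by (simp add: sum_subtractf smul_sum_left[symmetric] sum_distrib_left)
    then show "(\<Sum>L\<in>?A. smul (r i z - g i z * S L i z) (dif p z) - smul (g i z * Q L i z) (W i z)) =
       smul (of_nat (card I - 1 choose 2) * r i z - of_nat (card I - 2) * (g i z * S (I - {i}) i z)) (dif p z)
       - smul (g i z * (((S (I - {i}) i z)\<^sup>2 - (\<Sum>j\<in>I - {i}. (1 / (x i z - x j z))\<^sup>2)) / 2)) (W i z)"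
      unfolding S Q n by (simp add: mult_ac)
  qed
  finally show ?thesis
    by (simp add: numeral_3_eq_3 numeral_2_eq_2 smul_sum_left[symmetric] sum_subtractf sum_distrib_left)
qed

text \<open>The total connection form is a combination of the three given forms with coefficients
  that depend only on the number of indices. The index \<open>o'\<close> stands for
  \<open>dp\<close> when one form of the web is not of the shape \<open>dq - x dp\<close>.\<close>

theorem flat_on_chart:
  assumes cl: "closed_on (\<lambda>z. smul (\<Sum>i\<in>I. r i z) (dif p z)) N"
    "closed_on (\<lambda>z. smul (\<Sum>i\<in>I. g i z * S (I - {i}) i z) (dif p z)) N"
    "closed_on (\<lambda>z. \<Sum>i\<in>I. smul (g i z * (((S (I - {i}) i z)\<^sup>2 - (\<Sum>j\<in>I - {i}. (1 / (x i z - x j z))\<^sup>2)) / 2)) (W i z)) N"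
    and d: "{..<d} = I \<or> (o' \<notin> I \<and> {..<d} = insert o' I)"
    and \<rho>: "\<And>i. i < d \<Longrightarrow> holomorphic2_on (\<rho> i) N" "\<And>i z. i < d \<Longrightarrow> z \<in> N \<Longrightarrow> \<rho> i z \<noteq> 0"
    and w: "\<And>i z. i \<in> I \<Longrightarrow> z \<in> N \<Longrightarrow> w i z = smul (\<rho> i z) (W i z)"
      "\<And>z. z \<in> N \<Longrightarrow> o' \<in> {..<d} - I \<Longrightarrow> w o' z = smul (\<rho> o' z) (dif p z)"
  shows "has_curvature N d w (\<lambda>_. 0)"
proof -
  define T where "T = {J. J \<subseteq> {..<d} \<and> card J = 3}"
  define T1 where "T1 = {J. J \<subseteq> I \<and> card J = 3}"
  define T2 where "T2 = (if {..<d} = I then {} else {K. K \<subseteq> I \<and> card K = 2})"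
  have Id: "I \<subseteq> {..<d}" using d by auto
  have fin: "finite T1" "finite T2" using fin_I by (auto simp: T1_def T2_def)
  have oo: "o' \<notin> I" "o' \<in> {..<d}" "{..<d} = insert o' I" if "T2 \<noteq> {}" using that d by (auto simp: T2_def)
  have T_eq: "T = T1 \<union> insert o' ` T2"
  proof (cases "{..<d} = I")
    case True
    then show ?thesis by (auto simp: T_def T1_def T2_def)
  next
    case False
    then have o: "o' \<notin> I" "{..<d} = insert o' I" using d by auto
    have "J \<in> T \<longleftrightarrow> J \<in> T1 \<union> insert o' ` T2" for J
    proof (cases "o' \<in> J")
      case True
      have "J \<in> T \<longleftrightarrow> J - {o'} \<in> T2"
        using True o False fin_I by (auto simp: T_def T2_def card_Diff_singleton card_gt_0_iff intro: card_ge_0_finite)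
      also have "\<dots> \<longleftrightarrow> J \<in> insert o' ` T2"
      proof
        assume "J - {o'} \<in> T2" then show "J \<in> insert o' ` T2" using True by (auto simp: insert_absorb image_iff intro!: bexI[of _ "J - {o'}"])
      next
        assume "J \<in> insert o' ` T2"
        then obtain K where K: "J = insert o' K" "K \<in> T2" by auto
        then have "o' \<notin> K" using o by (auto simp: T2_def split: if_splits)
        then show "J - {o'} \<in> T2" using K by simp
      qed
      finally show ?thesis using True o by (auto simp: T1_def)
    next
      case False
      then show ?thesis using o by (auto simp: T_def T1_def)
    qed
    then show ?thesis by blast
  qed
  have T2D: "K \<subseteq> I" "card K = 2" "o' \<notin> I" "o' \<notin> K" "o' \<in> {..<d}" if "K \<in> T2" for K
  proof -
    show 1: "K \<subseteq> I" "card K = 2" using that by (auto simp: T2_def split: if_splits)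
    have "T2 \<noteq> {}" using that by blast
    then show "o' \<notin> I" "o' \<notin> K" "o' \<in> {..<d}" using oo(1,2) 1 by auto
  qed
  have disj: "T1 \<inter> insert o' ` T2 = {}"
  proof -
    have "insert o' K \<notin> T1" if "K \<in> T2" for K using T2D(3)[OF that] by (simp add: T1_def)
    then show ?thesis by blast
  qed
  have inj: "inj_on (insert o') T2"
    by (rule inj_onI) (use T2D(4) insert_ident in metis)
  define e where "e J = (if J \<subseteq> I then eta J else eta_sum (J - {o'}))" for J
  have e2: "e (insert o' K) = eta_sum K" if "K \<in> T2" for K
    using T2D[OF that] by (simp add: e_def)
  have e1: "e J = eta J" if "J \<in> T1" for J
    using that by (simp add: e_def T1_def)
  have hol_e: "holomorphic_form_on (e J) N" if "J \<in> T" for J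
    using that unfolding T_eq
  proof
    assume J: "J \<in> T1"
    show ?thesis unfolding e1[OF J] by (rule hol_eta) (use J in \<open>simp add: T1_def\<close>)
  next
    assume "J \<in> insert o' ` T2"
    then obtain K where K: "J = insert o' K" "K \<in> T2" by blast
    show ?thesis unfolding K(1) e2[OF K(2)] by (rule hol_eta_sum[OF T2D(1)[OF K(2)]])
  qed
  have c3: "has_curvature3 N J w (ext_deriv (e J))" if "J \<in> T" for J
    using that unfolding T_eq
  proof
    assume J: "J \<in> T1"
    then have J': "card J = 3" "J \<subseteq> I" by (simp_all add: T1_def)
    show ?thesis
      unfolding e1[OF J]
    proof (rule curvature3_finite[OF J', of \<rho> w])
      fix i assume "i \<in> J"
      then have i: "i \<in> I" "i < d" using J'(2) Id by auto
      show "holomorphic2_on (\<rho> i) N" by (rule \<rho>(1)[OF i(2)])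
      fix z assume "z \<in> N"
      then show "\<rho> i z \<noteq> 0" "w i z = smul (\<rho> i z) (W i z)" using \<rho>(2) w(1) i by auto
    qed
  next
    assume "J \<in> insert o' ` T2"
    then obtain K where K: "J = insert o' K" "K \<in> T2" by blast
    note K' = T2D(2,1)[OF K(2)] and o = T2D(3,5)[OF K(2)]
    show ?thesis
      unfolding K(1) e2[OF K(2)]
    proof (rule curvature3_infinite[OF K' o(1), of \<rho> w])
      fix i assume "i \<in> insert o' K"
      then have i: "i < d" using o(2) K'(2) Id by auto
      show "holomorphic2_on (\<rho> i) N" by (rule \<rho>(1)[OF i])
      fix z assume "z \<in> N"
      then show "\<rho> i z \<noteq> 0" using \<rho>(2) i by auto
    next
      fix i z assume "i \<in> K" "z \<in> N"
      then show "w i z = smul (\<rho> i z) (W i z)" using K'(2) w(1) by blast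
    next
      fix z assume "z \<in> N"
      then show "w o' z = smul (\<rho> o' z) (dif p z)" using w(2) o by simp
    qed
  qed
  let ?R = "\<lambda>z. smul (\<Sum>i\<in>I. r i z) (dif p z)"
  let ?G = "\<lambda>z. smul (\<Sum>i\<in>I. g i z * S (I - {i}) i z) (dif p z)"
  let ?H = "\<lambda>z. \<Sum>i\<in>I. smul (g i z * (((S (I - {i}) i z)\<^sup>2 - (\<Sum>j\<in>I - {i}. (1 / (x i z - x j z))\<^sup>2)) / 2)) (W i z)"
  \<comment> \<open>An index lies in \<open>card I - 1 choose 2\<close> triples of \<open>I\<close>
    and a pair of indices in \<open>card I - 2\<close> of them; the triples containing
    \<open>o'\<close> add \<open>card I - 1\<close> and 1.\<close>
  define c1 c2 where "c1 = (of_nat (card I - 1 choose 2) + (if T2 = {} then 0 else of_nat (card I - 1)) :: complex)"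
    and "c2 = (of_nat (card I - 2) + (if T2 = {} then 0 else 1) :: complex)"
  have tot: "smul c1 (?R z) - smul c2 (?G z) - ?H z = (\<Sum>J\<in>T. e J z)" for z
  proof -
    have "(\<Sum>J\<in>T. e J z) = (\<Sum>J\<in>T1. eta J z) + (\<Sum>K\<in>T2. eta_sum K z)"
      unfolding T_eq sum.union_disjoint[OF fin(1) finite_imageI[OF fin(2)] disj] sum.reindex[OF inj]
      by (simp add: e1 e2)
    also have "(\<Sum>K\<in>T2. eta_sum K z) = smul (if T2 = {} then 0 else of_nat (card I - 1) * (\<Sum>i\<in>I. r i z) - (\<Sum>i\<in>I. g i z * S (I - {i}) i z)) (dif p z)"
      using sum_eta_sum[of z] by (auto simp: T2_def)
    finally have "(\<Sum>J\<in>T. e J z) = smul (of_nat (card I - 1 choose 2) * (\<Sum>i\<in>I. r i z) -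
        of_nat (card I - 2) * (\<Sum>i\<in>I. g i z * S (I - {i}) i z)) (dif p z) - ?H z +
        smul (if T2 = {} then 0 else of_nat (card I - 1) * (\<Sum>i\<in>I. r i z) - (\<Sum>i\<in>I. g i z * S (I - {i}) i z)) (dif p z)"
      unfolding T1_def sum_eta .
    moreover have "smul (C + (if t then 0 else n)) (smul R v) - smul (D + (if t then 0 else 1)) (smul G v) - H =
        smul (C * R - D * G) v - H + smul (if t then 0 else n * R - G) v" for t and n C D R G :: complex and v H
      by (cases t) (simp_all add: prod_eq_iff algebra_simps)
    ultimately show ?thesis
      unfolding c1_def c2_def by simp
  qed
  have "closed_on (\<lambda>z. smul c1 (?R z) - smul c2 (?G z) - ?H z) N"
    by (intro closed_on_diff closed_on_cmult cl)
  then have "closed_on (\<lambda>z. \<Sum>J\<in>T. e J z) N"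
    unfolding tot .
  then have "\<forall>z\<in>N. (\<Sum>J\<in>T. ext_deriv (e J) z) = 0"
    unfolding closed_on_def using ext_deriv_sum[of T e N] hol_e by auto
  then show ?thesis
    unfolding has_curvature_def T_def[symmetric]
    using c3 by (intro exI[of _ "\<lambda>J. ext_deriv (e J)"]) (auto simp: T_def)
qed

end

section \<open>Polynomial identities on a line\<close>

lemma pderiv_prod_roots:
  fixes x c :: complex
  assumes "finite A" "\<And>j. j \<in> A \<Longrightarrow> x \<noteq> \<rho> j"
  defines "R \<equiv> smult c (\<Prod>j\<in>A. [:- \<rho> j, 1:])"
  shows "poly (pderiv R) x = poly R x * (\<Sum>j\<in>A. 1 / (x - \<rho> j))"
    and "poly (pderiv (pderiv R)) x = poly R x * ((\<Sum>j\<in>A. 1 / (x - \<rho> j))\<^sup>2 - (\<Sum>j\<in>A. (1 / (x - \<rho> j))\<^sup>2))"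
proof -
  define P where "P A = smult c (\<Prod>j\<in>A. [:- \<rho> j, 1:])" for A
  have "poly (pderiv (P A)) x = poly (P A) x * (\<Sum>j\<in>A. 1 / (x - \<rho> j)) \<and>
    poly (pderiv (pderiv (P A))) x = poly (P A) x * ((\<Sum>j\<in>A. 1 / (x - \<rho> j))\<^sup>2 - (\<Sum>j\<in>A. (1 / (x - \<rho> j))\<^sup>2))"
    using assms(1,2)
  proof (induction A rule: finite_induct)
    case empty
    then show ?case by (simp add: P_def pderiv_smult)
  next
    case (insert j A)
    have P: "P (insert j A) = [:- \<rho> j, 1:] * P A"
      using insert by (simp add: P_def mult_ac)
    have d: "pderiv [:- \<rho> j, 1:] = 1" by (simp add: pderiv_pCons)
    have ne: "x - \<rho> j \<noteq> 0" using insert by auto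
    define s where "s = (\<Sum>j\<in>A. 1 / (x - \<rho> j))"
    define s2 where "s2 = (\<Sum>j\<in>A. (1 / (x - \<rho> j))\<^sup>2)"
    have IH: "poly (pderiv (P A)) x = poly (P A) x * s" "poly (pderiv (pderiv (P A))) x = poly (P A) x * (s\<^sup>2 - s2)"
      using insert by (auto simp: s_def s2_def)
    have 1: "(\<Sum>j\<in>insert j A. 1 / (x - \<rho> j)) = 1 / (x - \<rho> j) + s"
      "(\<Sum>j\<in>insert j A. (1 / (x - \<rho> j))\<^sup>2) = (1 / (x - \<rho> j))\<^sup>2 + s2"
      using insert by (simp_all add: s_def s2_def)
    have u: "(x - \<rho> j) * (1 / (x - \<rho> j)) = 1" using ne by simp
    have "poly (pderiv (P (insert j A))) x = (x - \<rho> j) * (poly (P A) x * s) + poly (P A) x"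
      unfolding P pderiv_mult d by (simp add: IH algebra_simps)
    also have "\<dots> = (x - \<rho> j) * poly (P A) x * (1 / (x - \<rho> j) + s)"
      using u by algebra
    finally have 2: "poly (pderiv (P (insert j A))) x = poly (P (insert j A)) x * (1 / (x - \<rho> j) + s)"
      unfolding P by (simp add: left_diff_distrib)
    have "poly (pderiv (pderiv (P (insert j A)))) x = (x - \<rho> j) * (poly (P A) x * (s\<^sup>2 - s2)) + 2 * (poly (P A) x * s)"
      unfolding P pderiv_mult d pderiv_add by (simp add: IH pderiv_mult d algebra_simps)
    also have "\<dots> = (x - \<rho> j) * poly (P A) x * ((1 / (x - \<rho> j) + s)\<^sup>2 - ((1 / (x - \<rho> j))\<^sup>2 + s2))"
      using u by algebra
    finally have 3: "poly (pderiv (pderiv (P (insert j A)))) x = poly (P (insert j A)) x *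
        ((1 / (x - \<rho> j) + s)\<^sup>2 - ((1 / (x - \<rho> j))\<^sup>2 + s2))"
      unfolding P by (simp add: left_diff_distrib)
    show ?case unfolding 1 using 2 3 by simp
  qed
  then show "poly (pderiv R) x = poly R x * (\<Sum>j\<in>A. 1 / (x - \<rho> j))"
    and "poly (pderiv (pderiv R)) x = poly R x * ((\<Sum>j\<in>A. 1 / (x - \<rho> j))\<^sup>2 - (\<Sum>j\<in>A. (1 / (x - \<rho> j))\<^sup>2))"
    by (simp_all add: P_def R_def)
qed

lemma poly_eq_0_if_many_roots:
  fixes P :: "complex poly"
  assumes "finite A" "inj_on \<rho> A" "\<And>j. j \<in> A \<Longrightarrow> poly P (\<rho> j) = 0" "\<And>n. card A \<le> n \<Longrightarrow> coeff P n = 0"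
  shows "P = 0"
proof (rule ccontr)
  assume P: "P \<noteq> 0"
  have "card A = card (\<rho> ` A)" using assms(2) by (simp add: card_image)
  also have "\<dots> \<le> card {x. poly P x = 0}"
    by (rule card_mono[OF poly_roots_finite[OF P]]) (use assms(3) in auto)
  also have "\<dots> \<le> degree P" by (rule card_poly_roots_bound[OF P])
  finally show False using assms(4)[of "degree P"] P by simp
qed

lemma coeff_prod_linear:
  "finite A \<Longrightarrow> degree (\<Prod>j\<in>A. [:- \<rho> j, 1:]) = card A" 
  "finite A \<Longrightarrow> coeff (\<Prod>j\<in>A. [:- \<rho> j, 1:]) (card A) = 1" for \<rho> :: "'i \<Rightarrow> complex"
proof -
  show 1: "degree (\<Prod>j\<in>A. [:- \<rho> j, 1:]) = card A" if "finite A"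
    using that by (subst degree_prod_eq_sum_degree) auto
  have "lead_coeff (\<Prod>j\<in>A. [:- \<rho> j, 1:]) = 1" by (simp add: lead_coeff_prod)
  then show "coeff (\<Prod>j\<in>A. [:- \<rho> j, 1:]) (card A) = 1" if "finite A"
    using 1[OF that] by simp
qed

lemma poly_eq_smult_prod_roots:
  fixes P :: "complex poly"
  assumes "finite A" "inj_on \<rho> A" "\<And>j. j \<in> A \<Longrightarrow> poly P (\<rho> j) = 0" "degree P \<le> card A"
  shows "P = smult (coeff P (card A)) (\<Prod>j\<in>A. [:- \<rho> j, 1:])"
proof -
  have "P - smult (coeff P (card A)) (\<Prod>j\<in>A. [:- \<rho> j, 1:]) = 0"
  proof (rule poly_eq_0_if_many_roots[OF assms(1,2)])
    fix j assume j: "j \<in> A"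
    then have "(\<Prod>i\<in>A. poly [:- \<rho> i, 1:] (\<rho> j)) = 0"
      using assms(1) by (intro prod_zero bexI[of _ j]) auto
    then show "poly (P - smult (coeff P (card A)) (\<Prod>j\<in>A. [:- \<rho> j, 1:])) (\<rho> j) = 0"
      using assms(3)[OF j] by (simp add: poly_prod)
  next
    fix n assume n: "card A \<le> n"
    show "coeff (P - smult (coeff P (card A)) (\<Prod>j\<in>A. [:- \<rho> j, 1:])) n = 0"
    proof (cases "n = card A")
      case True then show ?thesis by (simp add: coeff_prod_linear assms(1))
    next
      case False
      then show ?thesis using n assms(4) by (simp add: coeff_eq_0 coeff_prod_linear(1) assms(1))
    qed
  qed
  then show ?thesis by simp
qed

lemma coeff_mult_top:
  fixes P Q :: "'a::comm_semiring_0 poly"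
  assumes "degree P \<le> k" "degree Q \<le> l"
  shows "coeff (P * Q) (k + l) = coeff P k * coeff Q l"
proof -
  have "coeff (P * Q) (k + l) = (\<Sum>i\<le>k + l. coeff P i * coeff Q (k + l - i))" by (rule coeff_mult)
  also have "\<dots> = (\<Sum>i\<in>{k}. coeff P i * coeff Q (k + l - i))"
  proof (rule sum.mono_neutral_right)
    show "\<forall>i\<in>{..k + l} - {k}. coeff P i * coeff Q (k + l - i) = 0"
    proof
      fix i assume "i \<in> {..k + l} - {k}"
      then have "degree P < i \<or> degree Q < k + l - i" using assms by auto
      then show "coeff P i * coeff Q (k + l - i) = 0" by (auto simp: coeff_eq_0)
    qed
  qed auto
  finally show ?thesis by simp
qed

lemma coeff_shift_pderiv:
  "0 < m \<Longrightarrow> coeff (pCons 0 (pderiv P)) (m - 1) = of_nat (m - 1) * coeff P (m - 1)" for P :: "complex poly"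
  by (cases "m - 1") (auto simp: coeff_pCons coeff_pderiv)

section \<open>Lagrange interpolation at the roots of a polynomial with simple roots\<close>

locale simple_roots =
  fixes T :: "complex poly" and I :: "'i set" and t :: "'i \<Rightarrow> complex" and \<tau> :: complex and m :: nat
  assumes fin_I: "finite I" and card_I: "card I = m" and inj_t: "inj_on t I" and m_pos: "0 < m"
    and T_eq: "T = smult \<tau> (\<Prod>i\<in>I. [:- t i, 1:])" and \<tau>: "\<tau> \<noteq> 0"
begin

definition cofac :: "'i \<Rightarrow> complex poly" where "cofac i = smult \<tau> (\<Prod>j\<in>I - {i}. [:- t j, 1:])"

lemma T_cofac: "i \<in> I \<Longrightarrow> T = [:- t i, 1:] * cofac i"
  by (simp add: T_eq cofac_def prod.remove[OF fin_I] mult_ac)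

lemma T_root: "i \<in> I \<Longrightarrow> poly T (t i) = 0"
  by (simp add: T_cofac)

lemma t_ne: "i \<in> I \<Longrightarrow> j \<in> I - {i} \<Longrightarrow> t i \<noteq> t j"
  using inj_t by (auto dest: inj_onD)

lemma degree_T: "degree T = m" and coeff_T: "coeff T m = \<tau>"
  using \<tau> coeff_prod_linear[OF fin_I, of t] by (auto simp: T_eq card_I)

lemma T'_root: "i \<in> I \<Longrightarrow> poly (pderiv T) (t i) = poly (cofac i) (t i)"
  using arg_cong[OF T_cofac[of i], of pderiv] unfolding pderiv_mult by (simp add: pderiv_pCons)

lemma T'_ne: "i \<in> I \<Longrightarrow> poly (pderiv T) (t i) \<noteq> 0"
  using \<tau> t_ne fin_I by (auto simp: T'_root cofac_def poly_prod)

lemma T2_root: "i \<in> I \<Longrightarrow> poly (pderiv (pderiv T)) (t i) = 2 * poly (pderiv T) (t i) * (\<Sum>j\<in>I - {i}. 1 / (t i - t j))"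
proof -
  assume i: "i \<in> I"
  have d: "pderiv [:- t i, 1:] = 1" by (simp add: pderiv_pCons)
  have "poly (pderiv (pderiv T)) (t i) = 2 * poly (pderiv (cofac i)) (t i)"
    unfolding T_cofac[OF i] pderiv_mult d pderiv_add by (simp add: pderiv_mult d)
  also have "poly (pderiv (cofac i)) (t i) = poly (cofac i) (t i) * (\<Sum>j\<in>I - {i}. 1 / (t i - t j))"
    unfolding cofac_def by (rule pderiv_prod_roots(1)) (use fin_I t_ne[OF i] in auto)
  finally show ?thesis by (simp add: T'_root[OF i])
qed

text \<open>At the root only the terms in which X - \<open>t i\<close> is differentiated exactly
  once survive, leaving three times the second derivative of the cofactor. The bracket is the one
  occurring in \<open>sum_eta\<close>, so it can be read off from
  \<open>T''' / (3 T')\<close>.\<close>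

lemma T3_root: "i \<in> I \<Longrightarrow> poly (pderiv (pderiv (pderiv T))) (t i) = 3 * poly (pderiv T) (t i) *
    ((\<Sum>j\<in>I - {i}. 1 / (t i - t j))\<^sup>2 - (\<Sum>j\<in>I - {i}. (1 / (t i - t j))\<^sup>2))"
proof -
  assume i: "i \<in> I"
  have d: "pderiv [:- t i, 1:] = 1" by (simp add: pderiv_pCons)
  have "poly (pderiv (pderiv (pderiv T))) (t i) = 3 * poly (pderiv (pderiv (cofac i))) (t i)"
    unfolding T_cofac[OF i] pderiv_mult d pderiv_add by (simp add: pderiv_mult pderiv_add d)
  also have "poly (pderiv (pderiv (cofac i))) (t i) = poly (cofac i) (t i) *
      ((\<Sum>j\<in>I - {i}. 1 / (t i - t j))\<^sup>2 - (\<Sum>j\<in>I - {i}. (1 / (t i - t j))\<^sup>2))"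
    unfolding cofac_def by (rule pderiv_prod_roots(2)) (use fin_I t_ne[OF i] in auto)
  finally show ?thesis by (simp add: T'_root[OF i])
qed

lemma interpolation:
  assumes "\<And>n. m \<le> n \<Longrightarrow> coeff P n = 0"
  shows "P = (\<Sum>i\<in>I. smult (poly P (t i) / poly (pderiv T) (t i)) (cofac i))"
proof -
  have "P - (\<Sum>i\<in>I. smult (poly P (t i) / poly (pderiv T) (t i)) (cofac i)) = 0"
  proof (rule poly_eq_0_if_many_roots[OF fin_I inj_t])
    fix j assume j: "j \<in> I"
    have "poly (cofac i) (t j) = 0" if "i \<in> I - {j}" for i
    proof -
      have "(\<Prod>k\<in>I - {i}. poly [:- t k, 1:] (t j)) = 0"
        using that j fin_I by (intro prod_zero bexI[of _ j]) auto
      then show ?thesis by (simp add: cofac_def poly_prod)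
    qed
    then have "(\<Sum>i\<in>I. poly P (t i) / poly (pderiv T) (t i) * poly (cofac i) (t j)) = poly P (t j)"
      using T'_ne[OF j] by (simp add: sum.remove[OF fin_I j] T'_root[OF j])
    then show "poly (P - (\<Sum>i\<in>I. smult (poly P (t i) / poly (pderiv T) (t i)) (cofac i))) (t j) = 0"
      by (simp add: poly_sum)
  next
    fix n assume n: "card I \<le> n"
    have "coeff (cofac i) n = 0" if "i \<in> I" for i
    proof (rule coeff_eq_0)
      have "card (I - {i}) < card I" by (rule card_Diff1_less[OF fin_I that])
      then show "degree (cofac i) < n"
        using n coeff_prod_linear(1)[of "I - {i}" t] fin_I \<tau> by (simp add: cofac_def)
    qed
    then show "coeff (P - (\<Sum>i\<in>I. smult (poly P (t i) / poly (pderiv T) (t i)) (cofac i))) n = 0"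
      using assms n by (simp add: coeff_sum card_I)
  qed
  then show ?thesis by simp
qed

lemma T_dvd:
  assumes "\<And>i. i \<in> I \<Longrightarrow> poly P (t i) = 0"
  shows "T dvd P"
proof -
  have "P mod T = 0"
  proof (rule poly_eq_0_if_many_roots[OF fin_I inj_t])
    fix i assume i: "i \<in> I"
    have "poly (P mod T) (t i) = poly P (t i) - poly (P div T * T) (t i)"
      by (metis minus_div_mult_eq_mod poly_diff)
    then show "poly (P mod T) (t i) = 0" using assms[OF i] T_root[OF i] by simp
  next
    fix n assume n: "card I \<le> n"
    show "coeff (P mod T) n = 0"
    proof (cases "P mod T = 0")
      case False
      have "T \<noteq> 0" using degree_T m_pos by auto
      then have "degree (P mod T) < m" using degree_mod_less[of T P] False degree_T by simp
      then show ?thesis using n card_I by (intro coeff_eq_0) simp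
    qed simp
  qed
  then show ?thesis by (simp add: mod_eq_0_iff_dvd)
qed

text \<open>The residue theorem for \<open>P / T\<close>, obtained as the leading coefficient of the
  interpolation formula.\<close>

lemma sum_residues:
  assumes "\<And>n. m \<le> n \<Longrightarrow> coeff P n = 0"
  shows "(\<Sum>i\<in>I. poly P (t i) / poly (pderiv T) (t i)) = coeff P (m - 1) / \<tau>"
proof -
  have "coeff (cofac i) (m - 1) = \<tau>" if "i \<in> I" for i
  proof -
    have "card (I - {i}) = m - 1" using that card_I by simp
    then show ?thesis using coeff_prod_linear(2)[of "I - {i}" t] fin_I by (simp add: cofac_def)
  qed
  then have "coeff P (m - 1) = (\<Sum>i\<in>I. poly P (t i) / poly (pderiv T) (t i) * \<tau>)"
    by (subst interpolation[OF assms]) (simp_all add: coeff_sum cong: sum.cong)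
  then have "coeff P (m - 1) = (\<Sum>i\<in>I. poly P (t i) / poly (pderiv T) (t i)) * \<tau>"
    by (simp only: sum_distrib_right)
  then show ?thesis using \<tau> by simp
qed

text \<open>The interpolation formula evaluated at \<open>c\<close>, divided by
  \<open>T c\<close>.\<close>

lemma sum_residues_pole:
  assumes "\<And>n. m \<le> n \<Longrightarrow> coeff P n = 0" "poly T c \<noteq> 0"
  shows "(\<Sum>i\<in>I. poly P (t i) / ((t i - c) * poly (pderiv T) (t i))) = - poly P c / poly T c"
proof -
  have "poly P (t i) / ((t i - c) * poly (pderiv T) (t i)) =
      - (poly P (t i) / poly (pderiv T) (t i) * poly (cofac i) c) / poly T c" if "i \<in> I" for i
  proof -
    have e: "poly T c = (c - t i) * poly (cofac i) c" using arg_cong[OF T_cofac[OF that], of "\<lambda>P. poly P c"] by (simp add: left_diff_distrib)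
    then have "c - t i \<noteq> 0" "t i - c \<noteq> 0" "poly (cofac i) c \<noteq> 0" using assms(2) by auto
    then show ?thesis using T'_ne[OF that] unfolding e by (simp add: divide_simps) (simp add: algebra_simps)
  qed
  then have "(\<Sum>i\<in>I. poly P (t i) / ((t i - c) * poly (pderiv T) (t i))) =
      - (\<Sum>i\<in>I. poly P (t i) / poly (pderiv T) (t i) * poly (cofac i) c) / poly T c"
    by (simp add: sum_negf[symmetric] sum_divide_distrib cong: sum.cong)
  also have "(\<Sum>i\<in>I. poly P (t i) / poly (pderiv T) (t i) * poly (cofac i) c) = poly P c"
    using arg_cong[OF interpolation[OF assms(1)], of "\<lambda>P. poly P c"] by (simp add: poly_sum)
  finally show ?thesis .
qed

end

text \<open>The data of the vector field \<open>(a, b)\<close> on one line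
  \<open>y = p x - q\<close>, with \<open>T = p a - b\<close>, whose roots are the tangencies.
  \<open>Tq\<close> and \<open>aq\<close> are the derivatives of \<open>T\<close> and
  \<open>a\<close> in \<open>q\<close>. For the invariant line \<open>y = al x + be\<close>,
  \<open>\<pi>\<close> is \<open>p - al\<close>, \<open>lam\<close> is the abscissa of the
  intersection, and \<open>C\<close> is the restriction of the cofactor: \<open>b - al a\<close>
  equals the cofactor times \<open>y - al x - be\<close>. The assumption \<open>cofactor\<close> is
  this equation on the line, and \<open>transversal\<close> is its derivative across the line at the
  intersection.\<close>

locale tangency_line = simple_roots T I t \<tau> m
  for T :: "complex poly" and I :: "'i set" and t \<tau> m +
  fixes a Tq aq :: "complex poly" and J :: "'j set" and lam \<pi> :: "'j \<Rightarrow> complex" and C :: "'j \<Rightarrow> complex poly"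
  assumes deg_a: "degree a \<le> m" and deg_Tq: "degree Tq \<le> m - 1" and deg_aq: "degree aq \<le> m - 1"
    and fin_J: "finite J" and card_J: "card J = 3 * m - 1" and inj_lam: "inj_on lam J"
    and \<pi>_ne: "j \<in> J \<Longrightarrow> \<pi> j \<noteq> 0"
    and cofactor: "j \<in> J \<Longrightarrow> a - smult (1 / \<pi> j) T = [:- lam j, 1:] * C j"
    and transversal: "j \<in> J \<Longrightarrow> \<pi> j * poly aq (lam j) = poly Tq (lam j) - poly (C j) (lam j)"
    and a_lam: "j \<in> J \<Longrightarrow> poly a (lam j) \<noteq> 0"
    and not_concurrent: "\<exists>j\<in>J. \<exists>k\<in>J. \<pi> j \<noteq> \<pi> k"
begin

text \<open>With \<open>T = p a - b\<close>, differentiation along the line and in \<open>q\<close>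
  shows that \<open>D\<close> is the divergence of the vector field \<open>(a, b)\<close> and
  \<open>Jac\<close> below its Jacobian determinant. \<open>CC\<close> is the sum of the cofactors
  of all affine invariant lines.\<close>

definition D :: "complex poly" where "D = Tq + pderiv a"
definition CC :: "complex poly" where "CC = (\<Sum>j\<in>J. C j)"
definition M :: "complex poly" where "M = CC - D"
definition Jac :: "complex poly" where "Jac = pderiv a * Tq - aq * pderiv T"

text \<open>The extactic polynomial of the foliation, restricted to the line: it vanishes exactly on the
  invariant lines, and at a point of tangency it equals \<open>- a\<^sup>2 T'\<close>.\<close>

definition EE :: "complex poly" where
  "EE = - (a * a * pderiv T) + T * (a * (pderiv a - Tq) + T * aq)"

lemma T_lam: "j \<in> J \<Longrightarrow> poly T (lam j) = \<pi> j * poly a (lam j)"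
  using arg_cong[OF cofactor[of j], of "\<lambda>P. poly P (lam j)"] \<pi>_ne[of j] by (simp add: field_simps)

lemma T_lam_ne: "j \<in> J \<Longrightarrow> poly T (lam j) \<noteq> 0"
  using T_lam \<pi>_ne a_lam by simp

lemma C_lam: "j \<in> J \<Longrightarrow> poly (C j) (lam j) = poly (pderiv a) (lam j) - poly (pderiv T) (lam j) / \<pi> j"
  using arg_cong[OF cofactor[of j], of "\<lambda>P. poly (pderiv P) (lam j)"]
  by (simp add: pderiv_mult pderiv_diff pderiv_smult pderiv_pCons)

text \<open>At the intersection \<open>T = \<pi> a\<close>; the derivatives of
  \<open>cofactor\<close> along and across the line give two expressions for the cofactor, and
  eliminating it gives the vanishing.\<close>

lemma EE_lam: "j \<in> J \<Longrightarrow> poly EE (lam j) = 0"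
proof -
  assume j: "j \<in> J"
  define A A1 T1 c tq q where defs: "A = poly a (lam j)" "A1 = poly (pderiv a) (lam j)" "T1 = poly (pderiv T) (lam j)"
    "c = poly (C j) (lam j)" "tq = poly Tq (lam j)" "q = poly aq (lam j)"
  have 1: "poly T (lam j) = \<pi> j * A" using T_lam[OF j] by (simp add: defs)
  have 2: "\<pi> j * c = \<pi> j * A1 - T1" using C_lam[OF j] \<pi>_ne[OF j] by (simp add: defs field_simps)
  have 3: "\<pi> j * q = tq - c" using transversal[OF j] by (simp add: defs)
  have "- (A * A * T1) + \<pi> j * A * (A * (A1 - tq) + \<pi> j * A * q) = 0"
    using 2 3 by algebra
  then show ?thesis by (simp add: EE_def 1 defs)
qed

lemma deg_T': "degree (pderiv T) \<le> m - 1" and deg_a': "degree (pderiv a) \<le> m - 1"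
  using degree_T deg_a by (simp_all add: degree_pderiv)

text \<open>The bound 3m - 1 is exactly the number of known roots \<open>lam j\<close>, so no factor
  of \<open>EE\<close> remains unknown.\<close>

lemma degree_EE: "degree EE \<le> card J"
proof -
  have mult: "degree (P * Q) \<le> k + l" if "degree P \<le> k" "degree Q \<le> l" for P Q :: "complex poly" and k l
    using degree_mult_le[of P Q] that by linarith
  have 1: "degree (a * a * pderiv T) \<le> (m + m) + (m - 1)"
    by (intro mult deg_a deg_T')
  have "degree (a * (pderiv a - Tq)) \<le> m + (m - 1)"
    by (intro mult degree_diff_le deg_a deg_a' deg_Tq)
  moreover have "degree (T * aq) \<le> m + (m - 1)"
    by (intro mult deg_aq) (simp add: degree_T)
  ultimately have "degree (a * (pderiv a - Tq) + T * aq) \<le> m + (m - 1)"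
    by (rule degree_add_le)
  then have 2: "degree (T * (a * (pderiv a - Tq) + T * aq)) \<le> m + (m + (m - 1))"
    by (intro mult) (simp add: degree_T)
  have "degree EE \<le> m + (m + (m - 1))"
    unfolding EE_def by (rule degree_add_le[OF _ 2]) (use 1 in \<open>simp add: add.assoc\<close>)
  then show ?thesis using m_pos by (simp add: card_J)
qed

lemma EE_prod: "EE = smult (coeff EE (card J)) (\<Prod>j\<in>J. [:- lam j, 1:])"
  by (rule poly_eq_smult_prod_roots[OF fin_J inj_lam EE_lam degree_EE])

lemma EE_root: "i \<in> I \<Longrightarrow> poly EE (t i) = - ((poly a (t i))\<^sup>2 * poly (pderiv T) (t i))"
  by (simp add: EE_def T_root power2_eq_square)

text \<open>If \<open>EE\<close> vanished, \<open>a\<close> would vanish at all roots of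
  \<open>T\<close> and be a constant multiple of \<open>T\<close>. Then all \<open>\<pi> j\<close>
  would coincide, that is, all the lines would be parallel.\<close>

lemma EE_ne_0: "EE \<noteq> 0"
proof
  assume "EE = 0"
  then have "poly a (t i) = 0" if "i \<in> I" for i
    using EE_root[OF that] T'_ne[OF that] by simp
  then have "a = smult (coeff a m) (\<Prod>i\<in>I. [:- t i, 1:])"
    using poly_eq_smult_prod_roots[OF fin_I inj_t, of a] deg_a by (simp add: card_I)
  then have a: "a = smult (coeff a m / \<tau>) T" using \<tau> by (simp add: T_eq)
  have "coeff a m / \<tau> * \<pi> j = 1" if "j \<in> J" for j
    using arg_cong[OF a, of "\<lambda>P. poly P (lam j)"] T_lam[OF that] a_lam[OF that] \<tau>
    by (simp add: divide_simps)
  then show False using not_concurrent by (metis mult_left_cancel mult_zero_left zero_neq_one)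
qed

lemma coeff_EE_ne: "coeff EE (card J) \<noteq> 0"
  using EE_prod EE_ne_0 by (metis smult_0_left)

lemma t_ne_lam: "i \<in> I \<Longrightarrow> j \<in> J \<Longrightarrow> t i \<noteq> lam j"
  using T_root[of i] T_lam_ne[of j] by auto

text \<open>A zero of \<open>a\<close> at a tangency would be a zero of \<open>EE\<close>, hence one
  of the \<open>lam j\<close>, where \<open>T\<close> does not vanish.\<close>

lemma a_ne: "i \<in> I \<Longrightarrow> poly a (t i) \<noteq> 0"
proof
  assume i: "i \<in> I" and "poly a (t i) = 0"
  then have "poly EE (t i) = 0" by (simp add: EE_root)
  then have "(\<Prod>j\<in>J. t i - lam j) = 0"
    using coeff_EE_ne by (subst (asm) EE_prod) (simp add: poly_prod)
  then show False using t_ne_lam[OF i] fin_J by auto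
qed

lemma C_root: "i \<in> I \<Longrightarrow> j \<in> J \<Longrightarrow> poly (C j) (t i) = poly a (t i) / (t i - lam j)"
  using arg_cong[OF cofactor[of j], of "\<lambda>P. poly P (t i)"] T_root[of i] t_ne_lam[of i j]
  by (simp add: field_simps)

text \<open>Logarithmic differentiation of the product formula; at a tangency
  \<open>1 / (t i - lam j)\<close> is \<open>C j / a\<close> by \<open>C_root\<close>.\<close>

lemma EE'_root: "i \<in> I \<Longrightarrow> poly (pderiv EE) (t i) * poly a (t i) = poly EE (t i) * poly CC (t i)"
  and EE''_root: "i \<in> I \<Longrightarrow> poly (pderiv (pderiv EE)) (t i) * (poly a (t i))\<^sup>2 =
     poly EE (t i) * ((poly CC (t i))\<^sup>2 - (\<Sum>j\<in>J. (poly (C j) (t i))\<^sup>2))"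
proof -
  assume i: "i \<in> I"
  let ?A = "poly a (t i)"
  have s: "?A * (\<Sum>j\<in>J. 1 / (t i - lam j)) = poly CC (t i)"
    using C_root[OF i] by (simp add: CC_def poly_sum sum_distrib_left cong: sum.cong)
  have s2: "?A\<^sup>2 * (\<Sum>j\<in>J. (1 / (t i - lam j))\<^sup>2) = (\<Sum>j\<in>J. (poly (C j) (t i))\<^sup>2)"
    using C_root[OF i] by (simp add: sum_distrib_left power_divide cong: sum.cong)
  have 1: "poly (pderiv EE) (t i) = poly EE (t i) * (\<Sum>j\<in>J. 1 / (t i - lam j))"
    by (subst (1 2) EE_prod) (rule pderiv_prod_roots(1)[OF fin_J t_ne_lam[OF i]])
  have 2: "poly (pderiv (pderiv EE)) (t i) = poly EE (t i) *
      ((\<Sum>j\<in>J. 1 / (t i - lam j))\<^sup>2 - (\<Sum>j\<in>J. (1 / (t i - lam j))\<^sup>2))"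
    by (subst (1 2) EE_prod) (rule pderiv_prod_roots(2)[OF fin_J t_ne_lam[OF i]])
  show "poly (pderiv EE) (t i) * ?A = poly EE (t i) * poly CC (t i)"
    unfolding 1 s[symmetric] by simp
  show "poly (pderiv (pderiv EE)) (t i) * ?A\<^sup>2 =
     poly EE (t i) * ((poly CC (t i))\<^sup>2 - (\<Sum>j\<in>J. (poly (C j) (t i))\<^sup>2))"
    unfolding 2 s[symmetric] s2[symmetric] by (simp add: power_mult_distrib algebra_simps)
qed

text \<open>The first derivative of \<open>EE\<close> computed from its definition is compared with
  the one from its factorization into invariant lines.\<close>

lemma a_T'': "i \<in> I \<Longrightarrow> poly a (t i) * poly (pderiv (pderiv T)) (t i) = poly M (t i) * poly (pderiv T) (t i)"
proof -
  assume i: "i \<in> I"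
  define A A1 T1 T2 tq q c where defs: "A = poly a (t i)" "A1 = poly (pderiv a) (t i)" "T1 = poly (pderiv T) (t i)"
    "T2 = poly (pderiv (pderiv T)) (t i)" "tq = poly Tq (t i)" "q = poly aq (t i)" "c = poly CC (t i)"
  have "poly (pderiv EE) (t i) = - (2 * A * A1 * T1 + A * A * T2) + T1 * (A * (A1 - tq))"
    unfolding EE_def pderiv_mult pderiv_add pderiv_minus pderiv_diff by (simp add: T_root[OF i] defs algebra_simps)
  then have "(- (2 * A * A1 * T1 + A * A * T2) + T1 * (A * (A1 - tq))) * A = - (A\<^sup>2 * T1) * c"
    using EE'_root[OF i] EE_root[OF i] by (simp add: defs)
  moreover have "A \<noteq> 0" using a_ne[OF i] by (simp add: defs)
  ultimately have "A * T2 = (c - (tq + A1)) * T1" by algebra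
  then show ?thesis by (simp add: M_def D_def defs)
qed

text \<open>The relation \<open>a T'' = M T'\<close> holds only at the roots of \<open>T\<close>.
  Dividing the difference by \<open>T\<close> makes it a polynomial identity, which can be
  differentiated to reach \<open>T'''\<close>.\<close>

definition HH :: "complex poly" where "HH = (a * pderiv (pderiv T) - M * pderiv T) div T"

lemma HH: "a * pderiv (pderiv T) - M * pderiv T = T * HH"
proof -
  have "T dvd a * pderiv (pderiv T) - M * pderiv T"
    by (rule T_dvd) (simp add: a_T'')
  then show ?thesis by (simp add: HH_def)
qed

text \<open>Two sources for \<open>T'''\<close> are combined: the derivative of the identity
  \<open>HH\<close> and the second derivative of \<open>EE\<close>. The result is grouped into
  products whose traces are separately closed.\<close>

lemma cubic_identity:
  assumes i: "i \<in> I"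
  shows "(poly a (t i))\<^sup>2 * poly (pderiv (pderiv (pderiv T))) (t i) = poly (pderiv T) (t i) *
    ((poly CC (t i))\<^sup>2 - 3 * poly CC (t i) * poly D (t i) + 2 * (\<Sum>j\<in>J. (poly (C j) (t i))\<^sup>2) + 4 * poly Jac (t i)
      - poly M (t i) * poly Tq (t i)
      + poly a (t i) * poly (smult 4 (pderiv Tq) + smult 3 (pderiv M) + smult 3 HH) (t i))"
proof -
  define A A1 A2 T1 T2 T3 tq tq1 q q1 c c2 mm m1 h where defs: "A = poly a (t i)" "A1 = poly (pderiv a) (t i)"
    "A2 = poly (pderiv (pderiv a)) (t i)" "T1 = poly (pderiv T) (t i)"
    "T2 = poly (pderiv (pderiv T)) (t i)" "T3 = poly (pderiv (pderiv (pderiv T))) (t i)"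
    "tq = poly Tq (t i)" "tq1 = poly (pderiv Tq) (t i)" "q = poly aq (t i)" "q1 = poly (pderiv aq) (t i)"
    "c = poly CC (t i)" "c2 = (\<Sum>j\<in>J. (poly (C j) (t i))\<^sup>2)"
    "mm = poly M (t i)" "m1 = poly (pderiv M) (t i)" "h = poly HH (t i)"
  have T0: "poly T (t i) = 0" by (rule T_root[OF i])
  have ne: "A \<noteq> 0" "T1 \<noteq> 0" using a_ne[OF i] T'_ne[OF i] by (simp_all add: defs)
  have mm: "mm = c - (tq + A1)" by (simp add: M_def D_def defs)
  have e1: "A * T2 = mm * T1" using a_T''[OF i] by (simp add: defs)
  have e2: "A * T3 + A1 * T2 = m1 * T1 + mm * T2 + T1 * h"
    using arg_cong[OF HH, of "\<lambda>P. poly (pderiv P) (t i)"] T0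
    by (simp add: pderiv_mult pderiv_diff defs algebra_simps)
  have "poly (pderiv (pderiv EE)) (t i) = - (2 * (A1 * A1 + A * A2) * T1 + 4 * A * A1 * T2 + A * A * T3)
      + T2 * (A * (A1 - tq)) + 2 * T1 * (A1 * (A1 - tq) + A * (A2 - tq1) + T1 * q)"
    unfolding EE_def pderiv_mult pderiv_add pderiv_minus pderiv_diff
    by (simp add: pderiv_mult pderiv_add pderiv_minus pderiv_diff T0 defs algebra_simps)
  then have "(- (2 * (A1 * A1 + A * A2) * T1 + 4 * A * A1 * T2 + A * A * T3)
      + T2 * (A * (A1 - tq)) + 2 * T1 * (A1 * (A1 - tq) + A * (A2 - tq1) + T1 * q)) * A\<^sup>2 = - (A\<^sup>2 * T1) * (c\<^sup>2 - c2)"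
    using EE''_root[OF i] EE_root[OF i] by (simp add: defs)
  then have e3: "- (2 * (A1 * A1 + A * A2) * T1 + 4 * A * A1 * T2 + A * A * T3)
      + T2 * (A * (A1 - tq)) + 2 * T1 * (A1 * (A1 - tq) + A * (A2 - tq1) + T1 * q) = - T1 * (c\<^sup>2 - c2)"
    using ne(1) by algebra
  have e4: "A * A * T3 = T1 * (A * (m1 + h) + (mm - A1) * mm)"
    using e1 e2 by algebra
  have "T1 * (- (2 * (A1 * A1 + A * A2) + 4 * A1 * mm + (A * (m1 + h) + (mm - A1) * mm))
      + mm * (A1 - tq) + 2 * (A1 * (A1 - tq) + A * (A2 - tq1) + T1 * q)) = T1 * - (c\<^sup>2 - c2)"
    using e3 e4 e1 by algebra
  then have e5: "- (2 * (A1 * A1 + A * A2) + 4 * A1 * mm + (A * (m1 + h) + (mm - A1) * mm))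
      + mm * (A1 - tq) + 2 * (A1 * (A1 - tq) + A * (A2 - tq1) + T1 * q) = - (c\<^sup>2 - c2)"
    using ne(2) by simp
  \<comment> \<open>Call the left side X; \<open>e5\<close> gives a second expression for X. The
    claim is X = 3 X - 2 X with the first X as it stands and the second taken from
    \<open>e5\<close>. The weights 3 and -2 make the cofactor terms equal to
    \<open>(c^2 - c2) + 3 (c2 - c D)\<close>, a sum of products of distinct cofactors plus terms
    treated line by line.\<close>
  have e6: "A * (m1 + h) + (mm - A1) * mm = c\<^sup>2 - 3 * c * (tq + A1) + 2 * c2 + 4 * (A1 * tq - q * T1) - mm * tq
      + A * (4 * tq1 + 3 * m1 + 3 * h)"
    using e5 mm by algebra
  have "A\<^sup>2 * T3 = T1 * (c\<^sup>2 - 3 * c * (tq + A1) + 2 * c2 + 4 * (A1 * tq - q * T1) - mm * tq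
      + A * (4 * tq1 + 3 * m1 + 3 * h))"
    using e4 unfolding e6 by (simp add: power2_eq_square)
  then show ?thesis
    by (simp add: Jac_def D_def defs)
qed

definition psi :: "complex poly" where "psi = smult 4 (pderiv Tq) + smult 3 (pderiv M) + smult 3 HH"

section \<open>Degrees and leading coefficients\<close>

lemma C_coeff:
  assumes "j \<in> J"
  shows "degree (C j) \<le> m - 1" and "coeff (C j) (m - 1) = coeff a m - \<tau> / \<pi> j"
proof -
  have dl: "degree [:- lam j, 1:] = 1" by simp
  have "degree ([:- lam j, 1:] * C j) \<le> m"
    unfolding cofactor[OF assms, symmetric]
    by (rule degree_diff_le[OF deg_a]) (use degree_smult_le[of "1 / \<pi> j" T] degree_T in simp)
  then show d: "degree (C j) \<le> m - 1"
  proof (cases "C j = 0")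
    case False
    have "degree ([:- lam j, 1:] * C j) = 1 + degree (C j)"
      using degree_mult_eq[of "[:- lam j, 1:]" "C j"] False dl by (simp del: mult_pCons_left)
    with \<open>degree ([:- lam j, 1:] * C j) \<le> m\<close> show ?thesis by linarith
  qed simp
  have "coeff ([:- lam j, 1:] * C j) (1 + (m - 1)) = coeff (C j) (m - 1)"
    by (subst coeff_mult_top[OF _ d]) simp_all
  then show "coeff (C j) (m - 1) = coeff a m - \<tau> / \<pi> j"
    unfolding cofactor[OF assms, symmetric] using m_pos coeff_T by simp
qed

lemma CC_coeff: "degree CC \<le> m - 1" "coeff CC (m - 1) = (\<Sum>j\<in>J. coeff a m - \<tau> / \<pi> j)"
  using C_coeff by (simp_all add: CC_def coeff_sum degree_sum_le fin_J)

lemma D_coeff: "degree D \<le> m - 1" "coeff D (m - 1) = coeff Tq (m - 1) + of_nat m * coeff a m"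
proof -
  show "degree D \<le> m - 1" unfolding D_def by (rule degree_add_le[OF deg_Tq deg_a'])
  show "coeff D (m - 1) = coeff Tq (m - 1) + of_nat m * coeff a m"
    using m_pos by (simp add: D_def coeff_pderiv)
qed

lemma M_coeff: "degree M \<le> m - 1"
  "coeff M (m - 1) = (\<Sum>j\<in>J. coeff a m - \<tau> / \<pi> j) - (coeff Tq (m - 1) + of_nat m * coeff a m)"
  using CC_coeff D_coeff by (simp_all add: M_def degree_diff_le)

text \<open>\<open>pCons 0 P\<close> is X times \<open>P\<close>. Bounding its degree by m - 1 says
  that \<open>P\<close> has degree at most m - 2, and for m = 1 that \<open>P\<close> is zero, a
  case that the truncated difference m - 2 would miss.\<close>

lemma HH_coeff:
  shows "degree (pCons 0 HH) \<le> m - 1"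
    and "coeff (pCons 0 HH) (m - 1) = of_nat m * of_nat (m - 1) * coeff a m - of_nat m * coeff M (m - 1)"
proof -
  let ?xT'' = "pCons 0 (pderiv (pderiv T))" and ?xT' = "pCons 0 (pderiv T)"
  have eq: "a * ?xT'' - M * ?xT' = T * pCons 0 HH"
    using HH by (simp add: algebra_simps)
  have d1: "degree ?xT' \<le> m"
    using degree_T m_pos by (simp add: degree_pCons_eq_if degree_pderiv)
  have d2: "degree ?xT'' \<le> m - 1"
    using degree_T m_pos by (auto simp: degree_pCons_eq_if degree_pderiv pderiv_eq_0_iff)
  have "degree (a * ?xT'' - M * ?xT') \<le> m + (m - 1)"
    using degree_mult_le[of a ?xT''] degree_mult_le[of M ?xT'] deg_a d1 d2 M_coeff(1)
    by (intro degree_diff_le) linarith+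
  then have "degree (T * pCons 0 HH) \<le> m + (m - 1)" by (simp only: eq)
  moreover have "T \<noteq> 0" using degree_T m_pos by auto
  ultimately show d: "degree (pCons 0 HH) \<le> m - 1"
    using degree_T by (cases "pCons 0 HH = 0") (simp_all add: degree_mult_eq del: pCons_eq_0_iff mult_pCons_right degree_pCons_eq_if)
  have "coeff (a * ?xT'' - M * ?xT') (m + (m - 1)) = coeff a m * coeff ?xT'' (m - 1) - coeff M (m - 1) * coeff ?xT' m"
    unfolding coeff_diff coeff_mult_top[OF deg_a d2]
    using coeff_mult_top[OF M_coeff(1) d1] by (simp only: add.commute)
  also have "coeff ?xT'' (m - 1) = of_nat (m - 1) * (of_nat m * \<tau>)"
    unfolding coeff_shift_pderiv[OF m_pos] using m_pos coeff_T by (simp add: coeff_pderiv)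
  also have "coeff ?xT' m = of_nat m * \<tau>"
    using m_pos coeff_T by (cases m) (simp_all add: coeff_pderiv)
  finally have "\<tau> * coeff (pCons 0 HH) (m - 1) = \<tau> * (of_nat m * of_nat (m - 1) * coeff a m - of_nat m * coeff M (m - 1))"
    unfolding eq using coeff_mult_top[of T m "pCons 0 HH" "m - 1"] degree_T d coeff_T
    by (simp add: algebra_simps)
  then show "coeff (pCons 0 HH) (m - 1) = of_nat m * of_nat (m - 1) * coeff a m - of_nat m * coeff M (m - 1)"
    using \<tau> by simp
qed

lemma degree_shift_pderiv: "degree P \<le> m - 1 \<Longrightarrow> degree (pCons 0 (pderiv P)) \<le> m - 1" for P :: "complex poly"
  using pderiv_eq_0_iff[of P] by (auto simp: degree_pCons_eq_if degree_pderiv)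

lemma psi_coeff:
  shows "degree (pCons 0 psi) \<le> m - 1"
    and "coeff (pCons 0 psi) (m - 1) = 4 * (of_nat (m - 1) * coeff Tq (m - 1)) + 3 * (of_nat (m - 1) * coeff M (m - 1))
       + 3 * (of_nat m * of_nat (m - 1) * coeff a m - of_nat m * coeff M (m - 1))"
proof -
  have eq: "pCons 0 psi = smult 4 (pCons 0 (pderiv Tq)) + smult 3 (pCons 0 (pderiv M)) + smult 3 (pCons 0 HH)"
    by (simp add: psi_def)
  show "degree (pCons 0 psi) \<le> m - 1"
    unfolding eq
    by (intro degree_add_le order_trans[OF degree_smult_le] degree_shift_pderiv deg_Tq M_coeff HH_coeff)
  show "coeff (pCons 0 psi) (m - 1) = 4 * (of_nat (m - 1) * coeff Tq (m - 1)) + 3 * (of_nat (m - 1) * coeff M (m - 1))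
       + 3 * (of_nat m * of_nat (m - 1) * coeff a m - of_nat m * coeff M (m - 1))"
    unfolding eq coeff_add coeff_smult coeff_shift_pderiv[OF m_pos] HH_coeff(2) ..
qed

text \<open>The two sums are the coefficients needed for \<open>dq\<close> and \<open>dp\<close>
  when weights of the form \<open>P / T'\<close> are attached to the forms \<open>dq - x dp\<close>;
  the first vanishes because \<open>P\<close> lacks the coefficient m - 1.\<close>

lemma sum_shifted_residues:
  assumes "degree (pCons 0 P) \<le> m - 1"
  shows "(\<Sum>i\<in>I. poly P (t i) / poly (pderiv T) (t i)) = 0"
    and "(\<Sum>i\<in>I. t i * poly P (t i) / poly (pderiv T) (t i)) = coeff (pCons 0 P) (m - 1) / \<tau>"
proof -
  have 0: "coeff (pCons 0 P) n = 0" if "m \<le> n" for n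
    using assms that m_pos by (intro coeff_eq_0) linarith
  have 1: "coeff P n = 0" if "m - 1 \<le> n" for n
    using 0[of "Suc n"] that by simp
  have "(\<Sum>i\<in>I. poly P (t i) / poly (pderiv T) (t i)) = coeff P (m - 1) / \<tau>"
    by (rule sum_residues) (use 1 in simp)
  then show "(\<Sum>i\<in>I. poly P (t i) / poly (pderiv T) (t i)) = 0" using 1 by simp
  show "(\<Sum>i\<in>I. t i * poly P (t i) / poly (pderiv T) (t i)) = coeff (pCons 0 P) (m - 1) / \<tau>"
    using sum_residues[of "pCons 0 P"] 0 by simp
qed

text \<open>The equation of the line \<open>j\<close> read at the intersection with the line
  \<open>k\<close>, where \<open>T = \<pi> k a\<close>.\<close>

lemma C_at_lam:
  assumes "j \<in> J" "k \<in> J" "j \<noteq> k"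
  shows "poly (C j) (lam k) / poly T (lam k) = (1 / \<pi> k - 1 / \<pi> j) / (lam k - lam j)"
proof -
  have ne: "lam k - lam j \<noteq> 0" using inj_lam assms by (auto dest: inj_onD)
  have "poly a (lam k) - poly T (lam k) / \<pi> j = (lam k - lam j) * poly (C j) (lam k)"
    using arg_cong[OF cofactor[OF assms(1)], of "\<lambda>P. poly P (lam k)"] by (simp add: algebra_simps)
  then have "poly T (lam k) * (1 / \<pi> k - 1 / \<pi> j) = (lam k - lam j) * poly (C j) (lam k)"
    using T_lam[OF assms(2)] \<pi>_ne[OF assms(2)] by (simp add: algebra_simps)
  then show ?thesis
    using ne T_lam_ne[OF assms(2)] by (simp add: frac_eq_eq mult_ac)
qed

end

section \<open>The dual web in an affine chart whose line at infinity is invariant\<close>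

context web_chart
begin

lemma sum_smul_W:
  "(\<Sum>i\<in>A. smul (c i) (W i z)) = smul (\<Sum>i\<in>A. c i) (dif q z) - smul (\<Sum>i\<in>A. x i z * c i) (dif p z)"
  unfolding smul_sum_left sum_subtractf[symmetric]
  by (rule sum.cong) (simp_all add: W_def prod_eq_iff algebra_simps)

section \<open>Restriction of plane polynomials to the moving line, and functions of
  \<open>p\<close>\<close>

definition on_line :: "complex poly poly \<Rightarrow> complex \<times> complex \<Rightarrow> complex poly" where
  "on_line B z = poly B [:- q z, p z:]"

lemma on_line_pCons: "on_line (pCons c B) z = c + [:- q z, p z:] * on_line B z"
  by (simp add: on_line_def)

lemma pderiv_on_line_pCons:
  "pderiv (on_line (pCons c B) z) = pderiv c + smult (p z) (on_line B z) + [:- q z, p z:] * pderiv (on_line B z)"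
proof -
  have "pderiv [:- q z, p z:] = [:p z:]" by (simp add: pderiv_pCons)
  then show ?thesis unfolding on_line_pCons pderiv_add pderiv_mult by simp
qed

lemma pderiv_pderiv_on_line_pCons:
  "pderiv (pderiv (on_line (pCons c B) z)) = pderiv (pderiv c) + smult (2 * p z) (pderiv (on_line B z))
    + [:- q z, p z:] * pderiv (pderiv (on_line B z))"
proof -
  have "pderiv [:- q z, p z:] = [:p z:]" by (simp add: pderiv_pCons)
  moreover have "smult (2 * p z) X = smult (p z) X + smult (p z) X" for X :: "complex poly"
    by (simp add: smult_add_left[symmetric])
  ultimately show ?thesis
    unfolding pderiv_on_line_pCons pderiv_add pderiv_mult pderiv_smult by simp
qed

lemma on_line_add: "on_line (A + B) z = on_line A z + on_line B z"
  by (simp add: on_line_def)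

lemma has_diff_p: "z \<in> N \<Longrightarrow> has_diff p (dif p z) z" and has_diff_q: "z \<in> N \<Longrightarrow> has_diff q (dif q z) z"
  by (rule holomorphic2_on_has_diff[OF hol_p] holomorphic2_on_has_diff[OF hol_q]; assumption)+

lemma has_diff_line_point:
  assumes "z \<in> N" "has_diff y v z"
  shows "has_diff (\<lambda>z. p z * y z - q z) (smul (p z) v + (smul (y z) (dif p z) - dif q z)) z"
proof -
  have "has_diff (\<lambda>z. p z * y z - q z) ((smul (p z) v + smul (y z) (dif p z)) - dif q z) z"
    by (intro has_diff_diff has_diff_mult has_diff_p has_diff_q assms)
  then show ?thesis by (simp only: add_diff_eq)
qed

lemma has_diff_eqI: "has_diff f v z \<Longrightarrow> v = w \<Longrightarrow> has_diff f w z"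
  by simp

lemma has_diff_poly: "has_diff y v z \<Longrightarrow> has_diff (\<lambda>z. poly c (y z)) (smul (poly (pderiv c) (y z)) v) z"
  by (rule has_diff_chain[OF _ poly_DERIV])

text \<open>Chain rule: besides the motion of the abscissa, the point moves with the line, and
  \<open>y dp - dq\<close> is the change of its ordinate at fixed abscissa.\<close>

lemma has_diff_on_line:
  assumes z: "z \<in> N" and y: "has_diff y v z"
  shows "has_diff (\<lambda>z. poly (on_line B z) (y z))
    (smul (poly (pderiv (on_line B z)) (y z)) v
     + smul (poly (on_line (pderiv B) z) (y z)) (smul (y z) (dif p z) - dif q z)) z"
proof (induction B)
  case 0
  then show ?case by (simp add: on_line_def has_diff_const zero_prod_def[symmetric])
next
  case (pCons c B)
  have eq: "(\<lambda>z. poly (on_line (pCons c B) z) (y z)) =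
      (\<lambda>z. poly c (y z) + (p z * y z - q z) * poly (on_line B z) (y z))"
    by (simp add: on_line_pCons fun_eq_iff algebra_simps)
  have d: "poly (pderiv (on_line (pCons c B) z)) (y z) =
      poly (pderiv c) (y z) + p z * poly (on_line B z) (y z) + (p z * y z - q z) * poly (pderiv (on_line B z)) (y z)"
    by (simp add: pderiv_on_line_pCons algebra_simps)
  have d': "poly (on_line (pderiv (pCons c B)) z) (y z) =
      poly (on_line B z) (y z) + (p z * y z - q z) * poly (on_line (pderiv B) z) (y z)"
    by (simp add: pderiv_pCons on_line_add on_line_pCons algebra_simps)
  show ?case
    unfolding eq
    by (rule has_diff_eqI[OF has_diff_add[OF has_diff_poly[OF y]
          has_diff_mult[OF has_diff_line_point[OF z y] pCons.IH]]])
       (simp add: d d' prod_eq_iff algebra_simps)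
qed

lemma has_diff_pderiv_on_line:
  assumes z: "z \<in> N" and y: "has_diff y v z"
  shows "has_diff (\<lambda>z. poly (pderiv (on_line B z)) (y z))
    (smul (poly (pderiv (pderiv (on_line B z))) (y z)) v
     + smul (poly (pderiv (on_line (pderiv B) z)) (y z)) (smul (y z) (dif p z) - dif q z)
     + smul (poly (on_line (pderiv B) z) (y z)) (dif p z)) z"
proof (induction B)
  case 0
  then show ?case by (simp add: on_line_def has_diff_const zero_prod_def[symmetric])
next
  case (pCons c B)
  have d: "poly (pderiv (on_line (pCons c B) z)) (y z) =
      poly (pderiv c) (y z) + p z * poly (on_line B z) (y z) + (p z * y z - q z) * poly (pderiv (on_line B z)) (y z)" for z
    by (simp add: pderiv_on_line_pCons algebra_simps)
  have d2: "poly (pderiv (pderiv (on_line (pCons c B) z))) (y z) =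
      poly (pderiv (pderiv c)) (y z) + 2 * (p z * poly (pderiv (on_line B z)) (y z))
       + (p z * y z - q z) * poly (pderiv (pderiv (on_line B z))) (y z)"
    by (simp add: pderiv_pderiv_on_line_pCons algebra_simps)
  have d': "poly (on_line (pderiv (pCons c B)) z) (y z) =
      poly (on_line B z) (y z) + (p z * y z - q z) * poly (on_line (pderiv B) z) (y z)"
    by (simp add: pderiv_pCons on_line_add on_line_pCons algebra_simps)
  have d'2: "poly (pderiv (on_line (pderiv (pCons c B)) z)) (y z) =
      poly (pderiv (on_line B z)) (y z) + p z * poly (on_line (pderiv B) z) (y z)
      + (p z * y z - q z) * poly (pderiv (on_line (pderiv B) z)) (y z)"
    by (simp add: pderiv_pCons[of c] on_line_add pderiv_add pderiv_on_line_pCons algebra_simps)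
  show ?case
    unfolding d
    by (rule has_diff_eqI[OF has_diff_add[OF has_diff_add[OF has_diff_poly[OF y]
          has_diff_mult[OF has_diff_p[OF z] has_diff_on_line[OF z y]]]
          has_diff_mult[OF has_diff_line_point[OF z y] pCons.IH]]])
       (simp add: d d2 d' d'2 prod_eq_iff algebra_simps)
qed

text \<open>Locally a function of \<open>p\<close> alone, expressed by \<open>df\<close> being a
  multiple of \<open>dp\<close>. This is stable under the field operations and makes
  \<open>f dp\<close> closed.\<close>

definition p_fun :: "(complex \<times> complex \<Rightarrow> complex) \<Rightarrow> bool" where
  "p_fun f \<longleftrightarrow> holomorphic2_on f N \<and> (\<forall>z\<in>N. wedge (dif f z) (dif p z) = 0)"

lemma p_funI: "(\<And>z. z \<in> N \<Longrightarrow> has_diff f (w z) z \<and> wedge (w z) (dif p z) = 0) \<Longrightarrow> p_fun f"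
  unfolding p_fun_def using holomorphic2_onI[of N f w] has_diff_imp_dif by metis

lemma p_funD: "p_fun f \<Longrightarrow> z \<in> N \<Longrightarrow> has_diff f (dif f z) z \<and> wedge (dif f z) (dif p z) = 0"
  unfolding p_fun_def using holomorphic2_on_has_diff by blast

lemma p_fun_const: "p_fun (\<lambda>_. c)"
  by (rule p_funI[where w = "\<lambda>_. 0"]) (simp add: has_diff_const wedge_simps)

lemma p_fun_p: "p_fun p"
  by (rule p_funI[where w = "dif p"]) (simp add: has_diff_p wedge_simps)

lemma p_fun_add: assumes "p_fun f" "p_fun h" shows "p_fun (\<lambda>z. f z + h z)"
  by (rule p_funI[where w = "\<lambda>z. dif f z + dif h z"])
     (use p_funD[OF assms(1)] p_funD[OF assms(2)] has_diff_add in \<open>simp add: wedge_simps\<close>)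

lemma p_fun_diff: assumes "p_fun f" "p_fun h" shows "p_fun (\<lambda>z. f z - h z)"
  by (rule p_funI[where w = "\<lambda>z. dif f z - dif h z"])
     (use p_funD[OF assms(1)] p_funD[OF assms(2)] has_diff_diff in \<open>simp add: wedge_simps\<close>)

lemma p_fun_mult: assumes "p_fun f" "p_fun h" shows "p_fun (\<lambda>z. f z * h z)"
  by (rule p_funI[where w = "\<lambda>z. smul (f z) (dif h z) + smul (h z) (dif f z)"])
     (use p_funD[OF assms(1)] p_funD[OF assms(2)] has_diff_mult in \<open>simp add: wedge_simps\<close>)

lemma p_fun_divide: assumes "p_fun f" "p_fun h" "\<And>z. z \<in> N \<Longrightarrow> h z \<noteq> 0" shows "p_fun (\<lambda>z. f z / h z)"
  by (rule p_funI[where w = "\<lambda>z. smul (1 / h z) (dif f z - smul (f z / h z) (dif h z))"])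
     (use p_funD[OF assms(1)] p_funD[OF assms(2)] has_diff_divide assms(3) in \<open>simp add: wedge_simps\<close>)

lemma p_fun_sum: assumes "\<And>j. j \<in> A \<Longrightarrow> p_fun (f j)" shows "p_fun (\<lambda>z. \<Sum>j\<in>A. f j z)"
  using assms by (induction A rule: infinite_finite_induct) (simp_all add: p_fun_const p_fun_add)

lemma p_fun_comp: assumes "\<And>z. z \<in> N \<Longrightarrow> (\<phi> has_field_derivative \<phi>' (p z)) (at (p z))" shows "p_fun (\<lambda>z. \<phi> (p z))"
  by (rule p_funI[where w = "\<lambda>z. smul (\<phi>' (p z)) (dif p z)"])
     (use has_diff_chain[OF has_diff_p assms] in \<open>simp add: wedge_simps\<close>)

lemma closed_p_fun: "p_fun f \<Longrightarrow> closed_on (\<lambda>z. smul (f z) (dif p z)) N"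
  unfolding p_fun_def by (intro closed_on_smul closed_on_dif hol_p open_N) auto

lemmas p_fun_intros = p_fun_const p_fun_p p_fun_add p_fun_diff p_fun_mult p_fun_divide p_fun_sum

end

text \<open>The indices in \<open>It\<close> belong to tangencies, the other indices of
  \<open>I\<close> to components of the curve, each attached by \<open>line\<close> to an affine
  invariant line. The polynomials on the moving line are fixed by \<open>aB\<close> and
  \<open>bB\<close>, where \<open>aB dy - bB dx\<close> defines the foliation;
  \<open>\<alpha>\<close>, \<open>\<tau>\<close>, \<open>\<theta>\<close> are the leading
  coefficients of \<open>a\<close>, \<open>T\<close>, \<open>Tq\<close> as functions of
  \<open>p\<close>.\<close>

locale foliation_chart = web_chart +
  fixes aB bB :: "complex poly poly" and m :: nat and It :: "nat set" and J :: "'j set"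
    and al be :: "'j \<Rightarrow> complex" and line :: "nat \<Rightarrow> 'j"
    and \<alpha> \<tau> \<theta> \<alpha>' \<tau>' \<theta>' :: "complex \<Rightarrow> complex"
  fixes aP Tq T aq :: "complex \<times> complex \<Rightarrow> complex poly" and lam \<pi> :: "'j \<Rightarrow> complex \<times> complex \<Rightarrow> complex"
    and C :: "'j \<Rightarrow> complex \<times> complex \<Rightarrow> complex poly"
  defines "aP z \<equiv> on_line aB z"
    and "T z \<equiv> smult (p z) (on_line aB z) - on_line bB z"
    and "Tq z \<equiv> on_line (pderiv bB) z - smult (p z) (on_line (pderiv aB) z)"
    and "aq z \<equiv> - on_line (pderiv aB) z"
    and "lam j z \<equiv> (q z + be j) / (p z - al j)"
    and "\<pi> j z \<equiv> p z - al j"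
    and "C j z \<equiv> (aP z - smult (1 / \<pi> j z) (T z)) div [:- lam j z, 1:]"
  assumes It: "It \<subseteq> I" and line: "line ` (I - It) \<subseteq> J" "inj_on line (I - It)"
    and x_line: "i \<in> I - It \<Longrightarrow> z \<in> N \<Longrightarrow> x i z = lam (line i) z"
    and d\<alpha>: "(\<alpha> has_field_derivative \<alpha>' c) (at c)" and d\<tau>: "(\<tau> has_field_derivative \<tau>' c) (at c)"
    and d\<theta>: "(\<theta> has_field_derivative \<theta>' c) (at c)"
    and coeff_a: "z \<in> N \<Longrightarrow> coeff (aP z) m = \<alpha> (p z)"
    and coeff_Tq: "z \<in> N \<Longrightarrow> coeff (Tq z) (m - 1) = \<theta> (p z)"
    and tangency: "z \<in> N \<Longrightarrow> tangency_line (T z) It (\<lambda>i. x i z) (\<tau> (p z)) m (aP z) (Tq z) (aq z) J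
      (\<lambda>j. lam j z) (\<lambda>j. \<pi> j z) (\<lambda>j. C j z)"
begin

section \<open>Differentials of the slopes\<close>

lemma It_I: "i \<in> It \<Longrightarrow> i \<in> I" using It by auto

lemma fin_It: "finite It" using It fin_I finite_subset by blast

lemma hd_x: "i \<in> I \<Longrightarrow> z \<in> N \<Longrightarrow> has_diff (x i) (dif (x i) z) z"
  by (rule holomorphic2_on_has_diff[OF hol_x])

lemma W_eq: "smul (x i z) (dif p z) - dif q z = - W i z"
  by (simp add: W_def)

lemma has_diff_a:
  assumes "i \<in> It" "z \<in> N"
  shows "has_diff (\<lambda>z. poly (aP z) (x i z)) (smul (poly (pderiv (aP z)) (x i z)) (dif (x i) z) + smul (poly (aq z) (x i z)) (W i z)) z"
  unfolding aP_def
  by (rule has_diff_eqI[OF has_diff_on_line[OF assms(2) hd_x[OF It_I assms(2)]]])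
     (use assms in \<open>simp_all add: W_eq aq_def prod_eq_iff\<close>)

text \<open>At fixed abscissa \<open>T = p a - b\<close> varies through the explicit factor
  \<open>p\<close>, giving \<open>a dp\<close>, and through the motion of the line, giving
  \<open>Tq W\<close>.\<close>

lemma has_diff_T:
  assumes "i \<in> It" "z \<in> N"
  shows "has_diff (\<lambda>z. poly (T z) (x i z)) (smul (poly (pderiv (T z)) (x i z)) (dif (x i) z)
    + smul (poly (Tq z) (x i z)) (W i z) + smul (poly (aP z) (x i z)) (dif p z)) z"
proof -
  note hx = hd_x[OF It_I[OF assms(1)] assms(2)]
  have "has_diff (\<lambda>z. p z * poly (on_line aB z) (x i z) - poly (on_line bB z) (x i z))
    (smul (poly (pderiv (T z)) (x i z)) (dif (x i) z)
    + smul (poly (Tq z) (x i z)) (W i z) + smul (poly (aP z) (x i z)) (dif p z)) z"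
    by (rule has_diff_eqI[OF has_diff_diff[OF has_diff_mult[OF has_diff_p[OF assms(2)]
          has_diff_on_line[OF assms(2) hx]] has_diff_on_line[OF assms(2) hx]]])
       (simp add: W_eq T_def Tq_def aP_def pderiv_diff pderiv_smult prod_eq_iff algebra_simps)
  then show ?thesis by (simp add: T_def)
qed

lemma has_diff_T':
  assumes "i \<in> It" "z \<in> N"
  shows "has_diff (\<lambda>z. poly (pderiv (T z)) (x i z)) (smul (poly (pderiv (pderiv (T z))) (x i z)) (dif (x i) z)
    + smul (poly (pderiv (Tq z)) (x i z)) (W i z) + smul (poly (pderiv (aP z)) (x i z) - poly (Tq z) (x i z)) (dif p z)) z"
proof -
  note hx = hd_x[OF It_I[OF assms(1)] assms(2)]
  have "has_diff (\<lambda>z. p z * poly (pderiv (on_line aB z)) (x i z) - poly (pderiv (on_line bB z)) (x i z))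
    (smul (poly (pderiv (pderiv (T z))) (x i z)) (dif (x i) z)
    + smul (poly (pderiv (Tq z)) (x i z)) (W i z) + smul (poly (pderiv (aP z)) (x i z) - poly (Tq z) (x i z)) (dif p z)) z"
    by (rule has_diff_eqI[OF has_diff_diff[OF has_diff_mult[OF has_diff_p[OF assms(2)]
          has_diff_pderiv_on_line[OF assms(2) hx]] has_diff_pderiv_on_line[OF assms(2) hx]]])
       (simp add: W_eq T_def Tq_def aP_def pderiv_diff pderiv_smult prod_eq_iff algebra_simps)
  then show ?thesis by (simp add: T_def pderiv_diff pderiv_smult)
qed

lemma T_ne:
  assumes "i \<in> It" "z \<in> N"
  shows "poly (T z) (x i z) = 0" "poly (pderiv (T z)) (x i z) \<noteq> 0" "poly (aP z) (x i z) \<noteq> 0"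
proof -
  interpret tl: tangency_line "T z" It "\<lambda>i. x i z" "\<tau> (p z)" m "aP z" "Tq z" "aq z" J "\<lambda>j. lam j z" "\<lambda>j. \<pi> j z" "\<lambda>j. C j z"
    by (rule tangency[OF assms(2)])
  show "poly (T z) (x i z) = 0" "poly (pderiv (T z)) (x i z) \<noteq> 0" "poly (aP z) (x i z) \<noteq> 0"
    using tl.T_root tl.T'_ne tl.a_ne assms(1) by auto
qed

text \<open>Implicit differentiation of the equation \<open>T = 0\<close> satisfied by the
  slope.\<close>

lemma dif_x_tangency:
  assumes "i \<in> It" "z \<in> N"
  shows "dif (x i) z = smul (- poly (aP z) (x i z) / poly (pderiv (T z)) (x i z)) (dif p z)
     + smul (- poly (Tq z) (x i z) / poly (pderiv (T z)) (x i z)) (W i z)"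
proof -
  have "has_diff (\<lambda>z. poly (T z) (x i z)) 0 z"
    by (rule has_diff_transform[OF has_diff_const[of 0] open_N assms(2)]) (simp add: T_ne(1)[OF assms(1)])
  then have "smul (poly (pderiv (T z)) (x i z)) (dif (x i) z)
    + smul (poly (Tq z) (x i z)) (W i z) + smul (poly (aP z) (x i z)) (dif p z) = 0"
    using has_diff_imp_dif[OF has_diff_T[OF assms]] has_diff_imp_dif by metis
  then show ?thesis
    using T_ne(2)[OF assms] by (simp add: prod_eq_iff field_simps eq_neg_iff_add_eq_0)
qed

lemma g_r_tangency:
  assumes "i \<in> It" "z \<in> N"
  shows "g i z = - poly (aP z) (x i z) / poly (pderiv (T z)) (x i z)"
    and "r i z = - poly (Tq z) (x i z) / poly (pderiv (T z)) (x i z)"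
  by (rule g_r_eqI[OF assms(2) dif_x_tangency[OF assms]])+

lemma \<pi>_ne: "j \<in> J \<Longrightarrow> z \<in> N \<Longrightarrow> \<pi> j z \<noteq> 0"
  using tangency_line.\<pi>_ne[OF tangency] by blast

lemma has_diff_lam:
  assumes "j \<in> J" "z \<in> N"
  shows "has_diff (lam j) (smul (1 / \<pi> j z) (dif q z - smul (lam j z) (dif p z))) z"
proof -
  have "p z - al j \<noteq> 0" using \<pi>_ne[OF assms] by (simp add: \<pi>_def)
  then show ?thesis
    unfolding lam_def[abs_def]
    by (intro has_diff_eqI[OF has_diff_divide[OF has_diff_add[OF has_diff_q[OF assms(2)] has_diff_const]
          has_diff_diff[OF has_diff_p[OF assms(2)] has_diff_const]]])
       (simp_all add: \<pi>_def)
qed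

text \<open>The dual of a line is a radial foliation: its leaves are straight, so the slope is
  constant along each leaf.\<close>

lemma g_r_line:
  assumes "i \<in> I - It" "z \<in> N"
  shows "g i z = 0" and "r i z = 1 / \<pi> (line i) z"
proof -
  have j: "line i \<in> J" using line assms by auto
  have "has_diff (x i) (smul (1 / \<pi> (line i) z) (dif q z - smul (lam (line i) z) (dif p z))) z"
    by (rule has_diff_transform[OF has_diff_lam[OF j assms(2)] open_N assms(2)]) (simp add: x_line[OF assms(1)])
  then have "dif (x i) z = smul 0 (dif p z) + smul (1 / \<pi> (line i) z) (W i z)"
    using has_diff_imp_dif x_line[OF assms] by (simp add: W_def)
  from g_r_eqI[OF assms(2) this] show "g i z = 0" "r i z = 1 / \<pi> (line i) z" .
qed

lemma sum_split_I: "(\<Sum>i\<in>I. f i) = (\<Sum>i\<in>It. f i) + (\<Sum>i\<in>I - It. f i)" for f :: "nat \<Rightarrow> 'b::comm_monoid_add"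
  using sum.subset_diff[OF It fin_I, of f] by (simp add: add.commute)

lemma p_fun_\<alpha>: "p_fun (\<lambda>z. \<alpha> (p z))" and p_fun_\<tau>: "p_fun (\<lambda>z. \<tau> (p z))" and p_fun_\<theta>: "p_fun (\<lambda>z. \<theta> (p z))"
  by (rule p_fun_comp, rule d\<alpha> d\<tau> d\<theta>)+

lemma p_fun_\<pi>: "p_fun (\<pi> j)"
  unfolding \<pi>_def[abs_def] by (intro p_fun_intros)

lemma \<tau>_ne: "z \<in> N \<Longrightarrow> \<tau> (p z) \<noteq> 0"
  using simple_roots.\<tau> tangency tangency_line.axioms(1) by blast

section \<open>Traces over the points of tangency\<close>

definition D where "D z = Tq z + pderiv (aP z)"
definition CC where "CC z = (\<Sum>j\<in>J. C j z)"
definition M where "M z = CC z - D z"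
definition Jac where "Jac z = pderiv (aP z) * Tq z - aq z * pderiv (T z)"
definition psi where "psi z = smult 4 (pderiv (Tq z)) + smult 3 (pderiv (M z))
  + smult 3 ((aP z * pderiv (pderiv (T z)) - M z * pderiv (T z)) div T z)"

text \<open>At a tangency \<open>p = b / a\<close>, hence \<open>W = (b dx - a dy) / a\<close> in
  terms of the point of tangency, and the extactic polynomial is \<open>- a^2 T'\<close>. So
  \<open>\<sigma> i\<close> is the form \<open>(a dy - b dx) / E\<close> at the i-th
  tangency.\<close>

definition \<sigma> where "\<sigma> i z = smul (1 / (poly (aP z) (x i z) * poly (pderiv (T z)) (x i z))) (W i z)"

text \<open>\<open>Tr f\<close> is the trace of the 1-form \<open>f \<cdot> (a dy - b dx) / E\<close>, with \<open>E\<close> the extactic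
  polynomial, under the Gauss map.\<close>

definition Tr :: "(nat \<Rightarrow> complex \<times> complex \<Rightarrow> complex) \<Rightarrow> form1" where
  "Tr f z = (\<Sum>i\<in>It. smul (f i z) (\<sigma> i z))"

lemma Tr_add: "Tr (\<lambda>i z. f i z + h i z) z = Tr f z + Tr h z"
  and Tr_cmult: "Tr (\<lambda>i z. c * f i z) z = smul c (Tr f z)"
  by (simp_all add: Tr_def prod_eq_iff fst_sum snd_sum sum.distrib sum_distrib_left algebra_simps)

lemma Tr_sum: "Tr (\<lambda>i z. \<Sum>j\<in>A. f j i z) z = (\<Sum>j\<in>A. Tr (f j) z)"
  by (induction A rule: infinite_finite_induct) (simp_all add: Tr_add, simp_all add: Tr_def)

text \<open>A sum with weights \<open>P / T'\<close> is a leading coefficient over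
  \<open>\<tau> (p z)\<close>. For the forms \<open>W i\<close> the coefficient of \<open>dq\<close>
  is such a sum of degree too low by one, hence zero, and only a multiple of \<open>dp\<close>
  remains.\<close>

lemma
  assumes z: "z \<in> N"
  shows sum_residues_dp: "degree P \<le> m - 1 \<Longrightarrow>
      (\<Sum>i\<in>It. smul (poly P (x i z) / poly (pderiv (T z)) (x i z)) (dif p z)) = smul (coeff P (m - 1) / \<tau> (p z)) (dif p z)"
    and sum_residues_W: "degree (pCons 0 P) \<le> m - 1 \<Longrightarrow>
      (\<Sum>i\<in>It. smul (poly P (x i z) / poly (pderiv (T z)) (x i z)) (W i z)) = smul (- coeff (pCons 0 P) (m - 1) / \<tau> (p z)) (dif p z)"
proof -
  interpret tl: tangency_line "T z" It "\<lambda>i. x i z" "\<tau> (p z)" m "aP z" "Tq z" "aq z" J "\<lambda>j. lam j z" "\<lambda>j. \<pi> j z" "\<lambda>j. C j z"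
    by (rule tangency[OF z])
  show "(\<Sum>i\<in>It. smul (poly P (x i z) / poly (pderiv (T z)) (x i z)) (dif p z)) = smul (coeff P (m - 1) / \<tau> (p z)) (dif p z)"
    if "degree P \<le> m - 1"
  proof -
    have "coeff P n = 0" if "m \<le> n" for n
      using that \<open>degree P \<le> m - 1\<close> tl.m_pos by (intro coeff_eq_0) linarith
    then show ?thesis by (simp only: smul_sum_left[symmetric] tl.sum_residues)
  qed
  show "(\<Sum>i\<in>It. smul (poly P (x i z) / poly (pderiv (T z)) (x i z)) (W i z)) = smul (- coeff (pCons 0 P) (m - 1) / \<tau> (p z)) (dif p z)"
    if "degree (pCons 0 P) \<le> m - 1"
  proof -
    have "(\<Sum>i\<in>It. smul (poly P (x i z) / poly (pderiv (T z)) (x i z)) (W i z)) =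
       smul (\<Sum>i\<in>It. poly P (x i z) / poly (pderiv (T z)) (x i z)) (dif q z) -
       smul (\<Sum>i\<in>It. x i z * poly P (x i z) / poly (pderiv (T z)) (x i z)) (dif p z)"
      unfolding sum_smul_W by simp
    then show ?thesis
      unfolding tl.sum_shifted_residues[OF that] by (simp add: prod_eq_iff)
  qed
qed

text \<open>A factor \<open>a\<close> cancels the one in the denominator of \<open>\<sigma>\<close>,
  which turns the trace into a plain residue sum.\<close>

lemma Tr_a:
  assumes "z \<in> N" "degree (pCons 0 P) \<le> m - 1"
  shows "(\<Sum>i\<in>It. smul (poly (aP z) (x i z) * poly P (x i z)) (\<sigma> i z)) = smul (- coeff (pCons 0 P) (m - 1) / \<tau> (p z)) (dif p z)"
  unfolding sum_residues_W[OF assms, symmetric]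
  by (rule sum.cong) (use T_ne(3)[OF _ assms(1)] in \<open>simp_all add: \<sigma>_def smul_def\<close>)

definition trace_closed where "trace_closed f \<longleftrightarrow> closed_on (Tr f) N"

lemma trace_closed_add: "trace_closed f \<Longrightarrow> trace_closed h \<Longrightarrow> trace_closed (\<lambda>i z. f i z + h i z)"
  unfolding trace_closed_def Tr_add[abs_def] by (rule closed_on_add)

lemma trace_closed_cmult: "trace_closed f \<Longrightarrow> trace_closed (\<lambda>i z. c * f i z)"
  unfolding trace_closed_def Tr_cmult[abs_def] by (rule closed_on_cmult)

lemma trace_closed_sum: "(\<And>j. j \<in> A \<Longrightarrow> trace_closed (f j)) \<Longrightarrow> trace_closed (\<lambda>i z. \<Sum>j\<in>A. f j i z)"
  unfolding trace_closed_def Tr_sum[abs_def] by (rule closed_on_sum)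

lemma trace_closedI:
  assumes "closed_on w N" "p_fun h" "\<And>z. z \<in> N \<Longrightarrow> Tr f z = w z + smul (h z) (dif p z)"
  shows "trace_closed f"
  unfolding trace_closed_def
  by (rule closed_on_cong[OF open_N _ closed_on_add[OF assms(1) closed_p_fun[OF assms(2)]]])
     (simp add: assms(3))

lemma p_fun_coeff_C: "p_fun (\<lambda>z. \<alpha> (p z) - \<tau> (p z) / \<pi> j z)" if "j \<in> J"
  using \<pi>_ne[OF that] by (intro p_fun_diff p_fun_divide p_fun_\<alpha> p_fun_\<tau> p_fun_\<pi>)

lemma coeff_C:
  assumes "j \<in> J" "z \<in> N"
  shows "degree (C j z) \<le> m - 1" "coeff (C j z) (m - 1) = \<alpha> (p z) - \<tau> (p z) / \<pi> j z"
proof -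
  interpret tl: tangency_line "T z" It "\<lambda>i. x i z" "\<tau> (p z)" m "aP z" "Tq z" "aq z" J "\<lambda>j. lam j z" "\<lambda>j. \<pi> j z" "\<lambda>j. C j z"
    by (rule tangency[OF assms(2)])
  show "degree (C j z) \<le> m - 1" "coeff (C j z) (m - 1) = \<alpha> (p z) - \<tau> (p z) / \<pi> j z"
    using tl.C_coeff[OF assms(1)] coeff_a[OF assms(2)] by simp_all
qed

lemma hol_lam: "j \<in> J \<Longrightarrow> holomorphic2_on (lam j) N"
  by (rule holomorphic2_onI[OF has_diff_lam])

text \<open>Up to a function of \<open>p\<close> times \<open>dp\<close>, the trace is the sum over
  the tangencies of the logarithmic differentials of \<open>x i - lam j\<close>. The difference is
  made of residue sums for \<open>C j\<close> and its derivative.\<close>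

lemma trace_closed_log_line:
  assumes j: "j \<in> J"
  shows "trace_closed (\<lambda>i z. (poly (C j z) (x i z))\<^sup>2 - poly (C j z) (x i z) * poly (D z) (x i z))"
proof (rule trace_closedI)
  let ?w = "\<lambda>z. \<Sum>i\<in>It. smul (1 / (x i z - lam j z)) (dif (\<lambda>z. x i z - lam j z) z)"
  let ?h = "\<lambda>z. of_nat m * ((\<alpha> (p z) - \<tau> (p z) / \<pi> j z) / \<tau> (p z)) + of_nat m * (1 / \<pi> j z)"
  have ne: "x i z - lam j z \<noteq> 0" if "i \<in> It" "z \<in> N" for i z
    using tangency_line.t_ne_lam[OF tangency[OF that(2)] that(1) j] by simp
  show "closed_on ?w N"
    by (intro closed_on_sum closed_on_dlog holomorphic2_diff hol_x It_I hol_lam[OF j] open_N ne)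
  show "p_fun ?h"
    using \<pi>_ne[OF j] \<tau>_ne by (intro p_fun_intros p_fun_coeff_C[OF j] p_fun_\<tau> p_fun_\<pi>) auto
  fix z assume z: "z \<in> N"
  interpret tl: tangency_line "T z" It "\<lambda>i. x i z" "\<tau> (p z)" m "aP z" "Tq z" "aq z" J "\<lambda>j. lam j z" "\<lambda>j. \<pi> j z" "\<lambda>j. C j z"
    by (rule tangency[OF z])
  have each: "smul ((poly (C j z) (x i z))\<^sup>2 - poly (C j z) (x i z) * poly (D z) (x i z)) (\<sigma> i z) =
      smul (1 / (x i z - lam j z)) (dif (\<lambda>z. x i z - lam j z) z)
      - smul (poly (pderiv (C j z)) (x i z) / poly (pderiv (T z)) (x i z)) (W i z)
      + smul (poly (C j z) (x i z) / poly (pderiv (T z)) (x i z)) (dif p z) + smul (1 / \<pi> j z) (dif p z)"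
    if i: "i \<in> It" for i
  proof -
    have dif: "dif (\<lambda>z. x i z - lam j z) z = dif (x i) z - smul (1 / \<pi> j z) (dif q z - smul (lam j z) (dif p z))"
      by (rule has_diff_imp_dif[OF has_diff_diff[OF hd_x[OF It_I[OF i] z] has_diff_lam[OF j z]]])
    define A T1 c c1 tq a1 u where defs: "A = poly (aP z) (x i z)" "T1 = poly (pderiv (T z)) (x i z)" "c = poly (C j z) (x i z)"
      "c1 = poly (pderiv (C j z)) (x i z)" "tq = poly (Tq z) (x i z)" "a1 = poly (pderiv (aP z)) (x i z)" "u = x i z - lam j z"
    have nz: "A \<noteq> 0" "T1 \<noteq> 0" "\<pi> j z \<noteq> 0" "u \<noteq> 0"
      using T_ne[OF i z] \<pi>_ne[OF j z] ne[OF i z] by (simp_all add: defs)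
    have 1: "u * c = A" using tl.C_root[OF i j] nz by (simp add: defs)
    have 2: "a1 - T1 / \<pi> j z = c + u * c1"
      using arg_cong[OF tl.cofactor[OF j], of "\<lambda>P. poly (pderiv P) (x i z)"]
      by (simp add: pderiv_mult pderiv_diff pderiv_smult pderiv_pCons defs algebra_simps)
    have q: "dif q z = W i z + smul (x i z) (dif p z)" by (simp add: W_def)
    have D: "poly (D z) (x i z) = tq + a1" by (simp add: D_def defs)
    \<comment> \<open>The \<open>W\<close>-component: \<open>cofactor\<close>, differentiated along
      the line at the tangency, replaces \<open>T' / \<pi>\<close>.\<close>
    have w: "(c\<^sup>2 - c * (tq + a1)) * (1 / (A * T1)) = 1 / u * (- tq / T1 - 1 / \<pi> j z) - c1 / T1"
    proof -
      have "T1 * (1 / \<pi> j z) = a1 - c - u * c1" using 2 by (simp add: eq_diff_eq diff_eq_eq add_ac)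
      then have "(c\<^sup>2 - c * (tq + a1)) = A * T1 * (1 / u * (- tq / T1 - 1 / \<pi> j z) - c1 / T1)"
      proof -
        have "A * T1 * (1 / u * (- tq / T1 - 1 / \<pi> j z) - c1 / T1) = c * (- tq - T1 * (1 / \<pi> j z)) - u * c * c1"
          using nz unfolding 1[symmetric] by (simp add: field_simps)
        also have "\<dots> = c\<^sup>2 - c * (tq + a1)"
          using \<open>T1 * (1 / \<pi> j z) = a1 - c - u * c1\<close> by algebra
        finally show ?thesis by simp
      qed
      then show ?thesis using nz by simp
    qed
    \<comment> \<open>The \<open>dp\<close>-component. The left side of \<open>each\<close> has
      none, so a vanishing combination is added to complete the logarithmic differential.\<close>
    have d: "0 = 1 / u * (- A / T1 - 1 / \<pi> j z * u) + c / T1 + 1 / \<pi> j z"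
      using nz unfolding 1[symmetric] by (simp add: field_simps)
    have "smul (c\<^sup>2 - c * (tq + a1)) (\<sigma> i z) = smul ((c\<^sup>2 - c * (tq + a1)) * (1 / (A * T1))) (W i z)"
      by (simp add: \<sigma>_def defs prod_eq_iff)
    also have "\<dots> = smul (1 / u * (- tq / T1 - 1 / \<pi> j z) - c1 / T1) (W i z) +
       smul (1 / u * (- A / T1 - 1 / \<pi> j z * u) + c / T1 + 1 / \<pi> j z) (dif p z)"
      unfolding w d[symmetric] by simp
    also have "\<dots> = smul (1 / u) (smul (- A / T1) (dif p z) + smul (- tq / T1) (W i z)
        - smul (1 / \<pi> j z) (W i z + smul (x i z) (dif p z) - smul (lam j z) (dif p z)))
      - smul (c1 / T1) (W i z) + smul (c / T1) (dif p z) + smul (1 / \<pi> j z) (dif p z)"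
      by (simp add: prod_eq_iff defs algebra_simps)
    finally show ?thesis
      unfolding D dif dif_x_tangency[OF i z] q by (simp add: defs)
  qed
  have shift: "degree (pCons 0 (pderiv (C j z))) \<le> m - 1"
    by (rule tl.degree_shift_pderiv[OF coeff_C(1)[OF j z]])
  have top: "coeff (pCons 0 (pderiv (C j z))) (m - 1) = of_nat (m - 1) * (\<alpha> (p z) - \<tau> (p z) / \<pi> j z)"
    unfolding coeff_shift_pderiv[OF tl.m_pos] coeff_C(2)[OF j z] ..
  have card: "(\<Sum>i\<in>It. smul (1 / \<pi> j z) (dif p z)) = smul (of_nat m * (1 / \<pi> j z)) (dif p z)"
    using tl.card_I by (simp add: prod_eq_iff fst_sum snd_sum)
  have mm: "of_nat m = (of_nat (m - 1) + 1 :: complex)" using tl.m_pos by simp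
  have tr: "Tr (\<lambda>i z. (poly (C j z) (x i z))\<^sup>2 - poly (C j z) (x i z) * poly (D z) (x i z)) z =
    ?w z - smul (- (of_nat (m - 1) * (\<alpha> (p z) - \<tau> (p z) / \<pi> j z)) / \<tau> (p z)) (dif p z)
    + smul ((\<alpha> (p z) - \<tau> (p z) / \<pi> j z) / \<tau> (p z)) (dif p z) + smul (of_nat m * (1 / \<pi> j z)) (dif p z)"
    unfolding Tr_def using each
    by (simp only: sum.distrib sum_subtractf sum_residues_W[OF z shift] sum_residues_dp[OF z coeff_C(1)[OF j z]]
        coeff_C(2)[OF j z] top card cong: sum.cong)
  show "Tr (\<lambda>i z. (poly (C j z) (x i z))\<^sup>2 - poly (C j z) (x i z) * poly (D z) (x i z)) z = ?w z + smul (?h z) (dif p z)"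
  proof -
    have "w - smul (- (n * K) / t) v + smul (K / t) v + smul ((n + 1) * u) v = w + smul ((n + 1) * (K / t) + (n + 1) * u) v"
      for w v and n K t u :: complex
      by (simp add: prod_eq_iff algebra_simps add_divide_distrib)
    then show ?thesis unfolding tr mm by blast
  qed
qed

lemma dif_x_\<sigma>:
  assumes "i \<in> It" "z \<in> N"
  shows "dif (x i) z = smul (- (1 / poly (pderiv (T z)) (x i z)) * poly (aP z) (x i z)) (dif p z)
     + smul (- poly (aP z) (x i z) * poly (Tq z) (x i z)) (\<sigma> i z)"
  using T_ne[OF assms] unfolding dif_x_tangency[OF assms] by (simp add: \<sigma>_def prod_eq_iff)

lemma W_\<sigma>:
  assumes "i \<in> It" "z \<in> N"
  shows "W i z = smul (poly (aP z) (x i z) * poly (pderiv (T z)) (x i z)) (\<sigma> i z)"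
  using T_ne[OF assms] by (simp add: \<sigma>_def prod_eq_iff)

lemma deg_a': "z \<in> N \<Longrightarrow> degree (pderiv (aP z)) \<le> m - 1" and m_pos: "z \<in> N \<Longrightarrow> 0 < m"
  using tangency_line.deg_a'[OF tangency] simple_roots.m_pos[OF tangency_line.axioms(1)[OF tangency]] by auto

lemma coeff_a': "z \<in> N \<Longrightarrow> coeff (pderiv (aP z)) (m - 1) = of_nat m * \<alpha> (p z)"
  using m_pos coeff_a[of z] by (simp add: coeff_pderiv)

lemma deg_Tq: "z \<in> N \<Longrightarrow> degree (Tq z) \<le> m - 1"
  using tangency_line.deg_Tq[OF tangency] by auto

text \<open>At a tangency \<open>Jac\<close> times \<open>\<sigma>\<close> is the negative
  logarithmic differential of \<open>a\<close> minus \<open>(a' / T') dp\<close>; the last term is a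
  residue sum.\<close>

lemma trace_closed_Jac: "trace_closed (\<lambda>i z. poly (Jac z) (x i z))"
proof (rule trace_closedI)
  let ?w = "\<lambda>z. smul (-1) (\<Sum>i\<in>It. smul (1 / poly (aP z) (x i z)) (dif (\<lambda>z. poly (aP z) (x i z)) z))"
  let ?h = "\<lambda>z. - 1 * (of_nat m * \<alpha> (p z) / \<tau> (p z))"
  show "closed_on ?w N"
    by (intro closed_on_cmult closed_on_sum closed_on_dlog open_N holomorphic2_onI[OF has_diff_a] T_ne(3))
  show "p_fun ?h" using \<tau>_ne by (intro p_fun_intros p_fun_\<alpha> p_fun_\<tau>)
  fix z assume z: "z \<in> N"
  have each: "smul (poly (Jac z) (x i z)) (\<sigma> i z) =
     smul (-1) (smul (1 / poly (aP z) (x i z)) (dif (\<lambda>z. poly (aP z) (x i z)) z))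
     + smul (-1) (smul (poly (pderiv (aP z)) (x i z) / poly (pderiv (T z)) (x i z)) (dif p z))" if i: "i \<in> It" for i
    unfolding has_diff_imp_dif[OF has_diff_a[OF i z]] dif_x_\<sigma>[OF i z] W_\<sigma>[OF i z]
    using T_ne(2,3)[OF i z] by (simp add: prod_eq_iff Jac_def field_simps)
  have "Tr (\<lambda>i z. poly (Jac z) (x i z)) z = ?w z + smul (-1) (smul (of_nat m * \<alpha> (p z) / \<tau> (p z)) (dif p z))"
    unfolding Tr_def smul_sum_right sum_residues_dp[OF z deg_a'[OF z], unfolded coeff_a'[OF z], symmetric]
      sum.distrib[symmetric]
    by (rule sum.cong) (simp_all add: each)
  then show "Tr (\<lambda>i z. poly (Jac z) (x i z)) z = ?w z + smul (?h z) (dif p z)"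
    by (simp add: smul_def)
qed

lemma coeff_M:
  assumes "z \<in> N"
  shows "degree (M z) \<le> m - 1"
    "coeff (M z) (m - 1) = (\<Sum>j\<in>J. \<alpha> (p z) - \<tau> (p z) / \<pi> j z) - (\<theta> (p z) + of_nat m * \<alpha> (p z))"
proof -
  interpret tl: tangency_line "T z" It "\<lambda>i. x i z" "\<tau> (p z)" m "aP z" "Tq z" "aq z" J "\<lambda>j. lam j z" "\<lambda>j. \<pi> j z" "\<lambda>j. C j z"
    by (rule tangency[OF assms])
  have "M z = tl.M" by (simp add: M_def tl.M_def CC_def tl.CC_def D_def tl.D_def)
  then show "degree (M z) \<le> m - 1"
    "coeff (M z) (m - 1) = (\<Sum>j\<in>J. \<alpha> (p z) - \<tau> (p z) / \<pi> j z) - (\<theta> (p z) + of_nat m * \<alpha> (p z))"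
    using tl.M_coeff coeff_a[OF assms] coeff_Tq[OF assms] by simp_all
qed

lemma p_fun_coeff_M: "p_fun (\<lambda>z. (\<Sum>j\<in>J. \<alpha> (p z) - \<tau> (p z) / \<pi> j z) - (\<theta> (p z) + of_nat m * \<alpha> (p z)))"
  by (intro p_fun_intros p_fun_coeff_C p_fun_\<alpha> p_fun_\<theta>)

lemma a_T'':
  assumes "i \<in> It" "z \<in> N"
  shows "poly (aP z) (x i z) * poly (pderiv (pderiv (T z))) (x i z) = poly (M z) (x i z) * poly (pderiv (T z)) (x i z)"
proof -
  interpret tl: tangency_line "T z" It "\<lambda>i. x i z" "\<tau> (p z)" m "aP z" "Tq z" "aq z" J "\<lambda>j. lam j z" "\<lambda>j. \<pi> j z" "\<lambda>j. C j z"
    by (rule tangency[OF assms(2)])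
  show ?thesis
    using tl.a_T''[OF assms(1)] by (simp add: M_def tl.M_def CC_def tl.CC_def D_def tl.D_def)
qed

text \<open>Here the function is \<open>T'\<close>: by \<open>a_T''\<close> the factor
  \<open>M\<close> is \<open>a T'' / T'\<close>, which is how \<open>T''\<close> enters its
  logarithmic differential.\<close>

lemma trace_closed_M_Tq: "trace_closed (\<lambda>i z. poly (M z) (x i z) * poly (Tq z) (x i z))"
proof (rule trace_closedI)
  let ?w = "\<lambda>z. smul (-1) (\<Sum>i\<in>It. smul (1 / poly (pderiv (T z)) (x i z)) (dif (\<lambda>z. poly (pderiv (T z)) (x i z)) z))"
  let ?cM = "\<lambda>z. (\<Sum>j\<in>J. \<alpha> (p z) - \<tau> (p z) / \<pi> j z) - (\<theta> (p z) + of_nat m * \<alpha> (p z))"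
  let ?h = "\<lambda>z. ((of_nat m * \<alpha> (p z) - \<theta> (p z) - ?cM z) - of_nat (m - 1) * \<theta> (p z)) / \<tau> (p z)"
  show "closed_on ?w N"
    by (intro closed_on_cmult closed_on_sum closed_on_dlog open_N holomorphic2_onI[OF has_diff_T'] T_ne(2))
  show "p_fun ?h" using \<tau>_ne by (intro p_fun_intros p_fun_\<alpha> p_fun_\<tau> p_fun_\<theta> p_fun_coeff_C)
  fix z assume z: "z \<in> N"
  let ?P = "pderiv (aP z) - Tq z - M z"
  have degP: "degree ?P \<le> m - 1"
    by (intro degree_diff_le deg_a'[OF z] deg_Tq[OF z] coeff_M(1)[OF z])
  have coeffP: "coeff ?P (m - 1) = of_nat m * \<alpha> (p z) - \<theta> (p z) - ?cM z"
    by (simp only: coeff_diff coeff_a'[OF z] coeff_Tq[OF z] coeff_M(2)[OF z])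
  have shift: "degree (pCons 0 (pderiv (Tq z))) \<le> m - 1"
    by (rule tangency_line.degree_shift_pderiv[OF tangency[OF z] deg_Tq[OF z]])
  have top: "coeff (pCons 0 (pderiv (Tq z))) (m - 1) = of_nat (m - 1) * \<theta> (p z)"
    unfolding coeff_shift_pderiv[OF m_pos[OF z]] coeff_Tq[OF z] ..
  have each: "smul (poly (M z) (x i z) * poly (Tq z) (x i z)) (\<sigma> i z) =
     smul (-1) (smul (1 / poly (pderiv (T z)) (x i z)) (dif (\<lambda>z. poly (pderiv (T z)) (x i z)) z))
     + smul (poly (pderiv (Tq z)) (x i z) / poly (pderiv (T z)) (x i z)) (W i z)
     + smul (poly ?P (x i z) / poly (pderiv (T z)) (x i z)) (dif p z)" if i: "i \<in> It" for i
  proof -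
    define T1 T2 A where "T1 = poly (pderiv (T z)) (x i z)" "T2 = poly (pderiv (pderiv (T z))) (x i z)" "A = poly (aP z) (x i z)"
    have ne: "T1 \<noteq> 0" "A \<noteq> 0" using T_ne[OF i z] by (simp_all add: T1_T2_A_def)
    have M: "poly (M z) (x i z) = A * T2 / T1" using a_T''[OF i z] ne by (simp add: T1_T2_A_def field_simps)
    show ?thesis
      unfolding has_diff_imp_dif[OF has_diff_T'[OF i z]] dif_x_\<sigma>[OF i z] W_\<sigma>[OF i z] poly_diff M
        T1_T2_A_def[symmetric]
      using ne by (simp add: prod_eq_iff field_simps)
  qed
  have "Tr (\<lambda>i z. poly (M z) (x i z) * poly (Tq z) (x i z)) z = ?w z
     + smul (- (of_nat (m - 1) * \<theta> (p z)) / \<tau> (p z)) (dif p z)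
     + smul ((of_nat m * \<alpha> (p z) - \<theta> (p z) - ?cM z) / \<tau> (p z)) (dif p z)"
    unfolding Tr_def smul_sum_right sum_residues_dp[OF z degP, unfolded coeffP, symmetric]
      sum_residues_W[OF z shift, unfolded top, symmetric] sum.distrib[symmetric]
    by (rule sum.cong) (simp_all add: each)
  moreover have "w + smul (- b / t) v + smul (a / t) v = w + smul ((a - b) / t) v" for w v and a b t :: complex
    by (simp add: prod_eq_iff algebra_simps diff_divide_distrib)
  ultimately show "Tr (\<lambda>i z. poly (M z) (x i z) * poly (Tq z) (x i z)) z = ?w z + smul (?h z) (dif p z)"
    by simp
qed

text \<open>With the factor \<open>a\<close> present the trace is already a function of
  \<open>p\<close> times \<open>dp\<close>, so no logarithmic differential is involved.\<close>

lemma trace_closed_psi: "trace_closed (\<lambda>i z. poly (aP z) (x i z) * poly (psi z) (x i z))"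
proof (rule trace_closedI)
  let ?cM = "\<lambda>z. (\<Sum>j\<in>J. \<alpha> (p z) - \<tau> (p z) / \<pi> j z) - (\<theta> (p z) + of_nat m * \<alpha> (p z))"
  let ?c = "\<lambda>z. 4 * (of_nat (m - 1) * \<theta> (p z)) + 3 * (of_nat (m - 1) * ?cM z)
       + 3 * (of_nat m * of_nat (m - 1) * \<alpha> (p z) - of_nat m * ?cM z)"
  let ?h = "\<lambda>z. -1 * (?c z / \<tau> (p z))"
  show "closed_on (\<lambda>_. 0) N"
    using closed_on_cmult[OF closed_on_dif[OF hol_p open_N], of 0] by simp
  show "p_fun ?h" using \<tau>_ne by (intro p_fun_intros p_fun_\<alpha> p_fun_\<tau> p_fun_\<theta> p_fun_coeff_C)
  fix z assume z: "z \<in> N"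
  interpret tl: tangency_line "T z" It "\<lambda>i. x i z" "\<tau> (p z)" m "aP z" "Tq z" "aq z" J "\<lambda>j. lam j z" "\<lambda>j. \<pi> j z" "\<lambda>j. C j z"
    by (rule tangency[OF z])
  have M: "M z = tl.M" by (simp add: M_def tl.M_def CC_def tl.CC_def D_def tl.D_def)
  have psi: "psi z = tl.psi" by (simp add: psi_def tl.psi_def tl.HH_def M)
  have deg: "degree (pCons 0 (psi z)) \<le> m - 1" and co: "coeff (pCons 0 (psi z)) (m - 1) = ?c z"
    using tl.psi_coeff coeff_a[OF z] coeff_Tq[OF z] coeff_M(2)[OF z] unfolding psi M by simp_all
  show "Tr (\<lambda>i z. poly (aP z) (x i z) * poly (psi z) (x i z)) z = 0 + smul (?h z) (dif p z)"
    unfolding Tr_def Tr_a[OF z deg] co by simp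
qed

text \<open>One cofactor is written as \<open>a / (x i - lam k)\<close>, so the trace is a residue
  sum with a pole at \<open>lam k\<close>. It evaluates to minus the logarithmic differential of
  \<open>lam k - lam j\<close>, up to a function of \<open>p\<close> times
  \<open>dp\<close>.\<close>

lemma trace_closed_pair:
  assumes j: "j \<in> J" and k: "k \<in> J" and jk: "j \<noteq> k"
  shows "trace_closed (\<lambda>i z. poly (C j z) (x i z) * poly (C k z) (x i z))"
proof (rule trace_closedI)
  let ?w = "\<lambda>z. smul (-1) (smul (1 / (lam k z - lam j z)) (dif (\<lambda>z. lam k z - lam j z) z))"
  let ?h = "\<lambda>z. -1 * ((\<alpha> (p z) - \<tau> (p z) / \<pi> j z) / \<tau> (p z)) - 1 / \<pi> j z"
  have ne: "lam k z - lam j z \<noteq> 0" if "z \<in> N" for z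
    using tangency_line.inj_lam[OF tangency[OF that]] j k jk by (auto dest: inj_onD)
  show "closed_on ?w N"
    by (intro closed_on_cmult closed_on_dlog holomorphic2_diff hol_lam[OF j] hol_lam[OF k] open_N ne)
  show "p_fun ?h" using \<pi>_ne[OF j] \<tau>_ne by (intro p_fun_intros p_fun_coeff_C[OF j] p_fun_\<tau> p_fun_\<pi>)
  fix z assume z: "z \<in> N"
  interpret tl: tangency_line "T z" It "\<lambda>i. x i z" "\<tau> (p z)" m "aP z" "Tq z" "aq z" J "\<lambda>j. lam j z" "\<lambda>j. \<pi> j z" "\<lambda>j. C j z"
    by (rule tangency[OF z])
  let ?V = "dif q z - smul (lam k z) (dif p z)"
  have each: "smul (poly (C j z) (x i z) * poly (C k z) (x i z)) (\<sigma> i z) =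
     smul (poly (C j z) (x i z) / ((x i z - lam k z) * poly (pderiv (T z)) (x i z))) ?V
     - smul (poly (C j z) (x i z) / poly (pderiv (T z)) (x i z)) (dif p z)" if i: "i \<in> It" for i
  proof -
    have W: "W i z = ?V - smul (x i z - lam k z) (dif p z)"
      by (simp add: W_def prod_eq_iff algebra_simps)
    have u: "x i z - lam k z \<noteq> 0" using tl.t_ne_lam[OF i k] by simp
    show ?thesis
      unfolding \<sigma>_def W tl.C_root[OF i k] using T_ne(2,3)[OF i z] u by (simp add: prod_eq_iff field_simps)
  qed
  have deg: "coeff (C j z) n = 0" if "m \<le> n" for n
    using that coeff_C(1)[OF j z] tl.m_pos by (intro coeff_eq_0) linarith
  have pole: "(\<Sum>i\<in>It. smul (poly (C j z) (x i z) / ((x i z - lam k z) * poly (pderiv (T z)) (x i z))) ?V) =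
      smul (- poly (C j z) (lam k z) / poly (T z) (lam k z)) ?V"
    by (simp only: smul_sum_left[symmetric] tl.sum_residues_pole[OF deg tl.T_lam_ne[OF k]])
  have "Tr (\<lambda>i z. poly (C j z) (x i z) * poly (C k z) (x i z)) z =
     smul (- poly (C j z) (lam k z) / poly (T z) (lam k z)) ?V
     - smul ((\<alpha> (p z) - \<tau> (p z) / \<pi> j z) / \<tau> (p z)) (dif p z)"
    unfolding Tr_def sum_residues_dp[OF z coeff_C(1)[OF j z], unfolded coeff_C(2)[OF j z], symmetric]
      pole[symmetric] sum_subtractf[symmetric]
    by (rule sum.cong) (simp_all add: each)
  also have "- poly (C j z) (lam k z) / poly (T z) (lam k z) = - ((1 / \<pi> k z - 1 / \<pi> j z) / (lam k z - lam j z))"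
    using tl.C_at_lam[OF j k jk] by simp
  finally have Tr: "Tr (\<lambda>i z. poly (C j z) (x i z) * poly (C k z) (x i z)) z =
     smul (- ((1 / \<pi> k z - 1 / \<pi> j z) / (lam k z - lam j z))) ?V
     - smul ((\<alpha> (p z) - \<tau> (p z) / \<pi> j z) / \<tau> (p z)) (dif p z)" .
  have dif: "dif (\<lambda>z. lam k z - lam j z) z = smul (1 / \<pi> k z) ?V - smul (1 / \<pi> j z) (?V + smul (lam k z - lam j z) (dif p z))"
    by (subst has_diff_imp_dif[OF has_diff_diff[OF has_diff_lam[OF k z] has_diff_lam[OF j z]]])
       (simp add: prod_eq_iff algebra_simps)
  show "Tr (\<lambda>i z. poly (C j z) (x i z) * poly (C k z) (x i z)) z = ?w z + smul (?h z) (dif p z)"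
    unfolding Tr dif using ne[OF z] \<pi>_ne[OF j z] \<pi>_ne[OF k z] \<tau>_ne[OF z]
    by (simp add: prod_eq_iff field_simps)
qed

section \<open>Symmetric functions of all slopes at a tangency\<close>

lemma sum_other_slopes:
  fixes f :: "complex \<Rightarrow> complex"
  assumes i: "i \<in> It"
  shows "(\<Sum>j\<in>I - {i}. f (x j z)) = (\<Sum>j\<in>It - {i}. f (x j z)) + (\<Sum>l\<in>I - It. f (x l z))"
proof -
  have "I - {i} = (It - {i}) \<union> (I - It)" "(It - {i}) \<inter> (I - It) = {}" using i It by auto
  then show ?thesis using fin_It fin_I by (simp add: sum.union_disjoint)
qed

text \<open>Tangencies contribute \<open>T'' / (2 T')\<close>, which is \<open>M / (2 a)\<close> by
  \<open>a_T''\<close>; each component of the curve contributes \<open>C / a\<close>.\<close>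

lemma S_tangency:
  assumes "i \<in> It" "z \<in> N"
  shows "poly (aP z) (x i z) * S (I - {i}) i z =
    poly (M z) (x i z) / 2 + (\<Sum>l\<in>I - It. poly (C (line l) z) (x i z))"
proof -
  interpret tl: tangency_line "T z" It "\<lambda>i. x i z" "\<tau> (p z)" m "aP z" "Tq z" "aq z" J "\<lambda>j. lam j z" "\<lambda>j. \<pi> j z" "\<lambda>j. C j z"
    by (rule tangency[OF assms(2)])
  have "poly (aP z) (x i z) * (2 * poly (pderiv (T z)) (x i z) * (\<Sum>j\<in>It - {i}. 1 / (x i z - x j z))) =
      poly (M z) (x i z) * poly (pderiv (T z)) (x i z)"
    using tl.T2_root[OF assms(1)] a_T''[OF assms] by simp
  then have 1: "poly (aP z) (x i z) * (\<Sum>j\<in>It - {i}. 1 / (x i z - x j z)) = poly (M z) (x i z) / 2"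
    using T_ne(2)[OF assms] by (simp add: mult_ac)
  have 2: "poly (aP z) (x i z) * (\<Sum>l\<in>I - It. 1 / (x i z - x l z)) = (\<Sum>l\<in>I - It. poly (C (line l) z) (x i z))"
    unfolding sum_distrib_left
    by (rule sum.cong) (use tl.C_root[OF assms(1)] x_line[OF _ assms(2)] line in auto)
  show ?thesis
    unfolding S_def sum_other_slopes[OF assms(1), of "\<lambda>y. 1 / (x i z - y)"] distrib_left 1 2 ..
qed

text \<open>The terms without curve components come from \<open>cubic_identity\<close>. The
  components add \<open>3 mm \<gamma> + 3 (\<gamma>^2 - \<gamma>2)\<close> with
  \<open>mm = cc - dd\<close>. Adding and subtracting \<open>\<gamma>2\<close> splits this again
  into products of distinct cofactors and terms \<open>C^2 - C D\<close>, the two kinds with closed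
  trace.\<close>

lemma quadratic_tangency:
  assumes "i \<in> It" "z \<in> N"
  shows "6 * (poly (aP z) (x i z))\<^sup>2 * (((S (I - {i}) i z)\<^sup>2 - (\<Sum>j\<in>I - {i}. (1 / (x i z - x j z))\<^sup>2)) / 2) =
    (\<Sum>j\<in>J. \<Sum>k\<in>J - {j}. poly (C j z) (x i z) * poly (C k z) (x i z))
    + 3 * (\<Sum>j\<in>J. (poly (C j z) (x i z))\<^sup>2 - poly (C j z) (x i z) * poly (D z) (x i z))
    + 4 * poly (Jac z) (x i z) + (-1) * (poly (M z) (x i z) * poly (Tq z) (x i z)) + poly (aP z) (x i z) * poly (psi z) (x i z)
    + 3 * (\<Sum>l\<in>I - It. \<Sum>j\<in>J - {line l}. poly (C (line l) z) (x i z) * poly (C j z) (x i z))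
    + 3 * (\<Sum>l\<in>I - It. (poly (C (line l) z) (x i z))\<^sup>2 - poly (C (line l) z) (x i z) * poly (D z) (x i z))
    + 3 * (\<Sum>l\<in>I - It. \<Sum>l'\<in>I - It - {l}. poly (C (line l) z) (x i z) * poly (C (line l') z) (x i z))"
proof -
  interpret tl: tangency_line "T z" It "\<lambda>i. x i z" "\<tau> (p z)" m "aP z" "Tq z" "aq z" J "\<lambda>j. lam j z" "\<lambda>j. \<pi> j z" "\<lambda>j. C j z"
    by (rule tangency[OF assms(2)])
  define A where "A = poly (aP z) (x i z)"
  define c where "c j = poly (C j z) (x i z)" for j
  define s1 where "s1 = (\<Sum>j\<in>It - {i}. 1 / (x i z - x j z))"
  define s2 where "s2 = (\<Sum>j\<in>It - {i}. (1 / (x i z - x j z))\<^sup>2)"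
  define s where "s = S (I - {i}) i z"
  define \<gamma> where "\<gamma> = (\<Sum>l\<in>I - It. c (line l))"
  define \<gamma>2 where "\<gamma>2 = (\<Sum>l\<in>I - It. (c (line l))\<^sup>2)"
  define cc where "cc = (\<Sum>j\<in>J. c j)"
  define cc2 where "cc2 = (\<Sum>j\<in>J. (c j)\<^sup>2)"
  define mm dd where "mm = poly (M z) (x i z)" and "dd = poly (D z) (x i z)"
  have finL: "finite (I - It)" using fin_I by simp
  have Ms: "M z = tl.M" "D z = tl.D" "Jac z = tl.Jac"
    by (simp_all add: M_def tl.M_def CC_def tl.CC_def D_def tl.D_def Jac_def tl.Jac_def)
  have psi: "psi z = tl.psi" by (simp add: psi_def tl.psi_def tl.HH_def Ms)
  have cc: "poly tl.CC (x i z) = cc" by (simp add: tl.CC_def cc_def c_def poly_sum)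
  have mm: "mm = cc - dd" by (simp add: mm_def dd_def Ms tl.M_def cc)
  have T1: "poly (pderiv (T z)) (x i z) \<noteq> 0" by (rule T_ne(2)[OF assms])
  have "A\<^sup>2 * (3 * poly (pderiv (T z)) (x i z) * (s1\<^sup>2 - s2)) = poly (pderiv (T z)) (x i z) *
      (cc\<^sup>2 - 3 * cc * dd + 2 * cc2 + 4 * poly (Jac z) (x i z) - mm * poly (Tq z) (x i z) + A * poly (psi z) (x i z))"
    using tl.cubic_identity[OF assms(1)] tl.T3_root[OF assms(1)]
    by (simp add: A_def s1_def s2_def cc cc2_def c_def mm_def dd_def Ms psi tl.psi_def)
  then have "poly (pderiv (T z)) (x i z) * (3 * (A\<^sup>2 * (s1\<^sup>2 - s2))) = poly (pderiv (T z)) (x i z) *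
      (cc\<^sup>2 - 3 * cc * dd + 2 * cc2 + 4 * poly (Jac z) (x i z) - mm * poly (Tq z) (x i z) + A * poly (psi z) (x i z))"
    by (simp only: mult_ac)
  then have 1: "3 * (A\<^sup>2 * (s1\<^sup>2 - s2)) = cc\<^sup>2 - 3 * cc * dd + 2 * cc2 + 4 * poly (Jac z) (x i z) - mm * poly (Tq z) (x i z)
      + A * poly (psi z) (x i z)"
    unfolding mult_cancel_left using T1 by blast
  have a: "A * s = mm / 2 + \<gamma>"
    using S_tangency[OF assms] by (simp add: A_def s_def mm_def \<gamma>_def c_def)
  have a1: "A * s1 = mm / 2"
  proof -
    have "A * (2 * poly (pderiv (T z)) (x i z) * s1) = mm * poly (pderiv (T z)) (x i z)"
      using tl.T2_root[OF assms(1)] a_T''[OF assms] by (simp add: A_def s1_def mm_def)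
    then show ?thesis using T1 by (simp add: mult_ac)
  qed
  have sq: "A\<^sup>2 * (\<Sum>j\<in>I - {i}. (1 / (x i z - x j z))\<^sup>2) = A\<^sup>2 * s2 + \<gamma>2"
  proof -
    have "A\<^sup>2 * (\<Sum>l\<in>I - It. (1 / (x i z - x l z))\<^sup>2) = \<gamma>2"
      unfolding sum_distrib_left \<gamma>2_def
    proof (rule sum.cong)
      fix l assume l: "l \<in> I - It"
      then have "c (line l) = A / (x i z - x l z)"
        using tl.C_root[OF assms(1), of "line l"] x_line[OF l assms(2)] line by (auto simp: c_def A_def)
      then show "A\<^sup>2 * (1 / (x i z - x l z))\<^sup>2 = (c (line l))\<^sup>2" by (simp add: power_divide)
    qed simp
    then show ?thesis
      unfolding sum_other_slopes[OF assms(1), of "\<lambda>y. (1 / (x i z - y))\<^sup>2"] by (simp only: s2_def distrib_left)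
  qed
  have off: "(\<Sum>j\<in>B. \<Sum>k\<in>B - {j}. h j * h k) = (\<Sum>j\<in>B. h j)\<^sup>2 - (\<Sum>j\<in>B. (h j)\<^sup>2)" if "finite B" for h :: "'x \<Rightarrow> complex" and B
  proof -
    have "(\<Sum>j\<in>B. \<Sum>k\<in>B - {j}. h j * h k) = (\<Sum>j\<in>B. h j * (\<Sum>k\<in>B. h k) - (h j)\<^sup>2)"
      using that by (intro sum.cong refl) (simp add: sum.remove[of B] sum_distrib_left power2_eq_square algebra_simps)
    then show ?thesis by (simp add: sum_subtractf sum_distrib_right power2_eq_square)
  qed
  have e1: "(\<Sum>j\<in>J. \<Sum>k\<in>J - {j}. c j * c k) = cc\<^sup>2 - cc2"
    unfolding cc_def cc2_def by (rule off[OF tl.fin_J])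
  have e2: "(\<Sum>l\<in>I - It. \<Sum>l'\<in>I - It - {l}. c (line l) * c (line l')) = \<gamma>\<^sup>2 - \<gamma>2"
    unfolding \<gamma>_def \<gamma>2_def by (rule off[OF finL])
  have e3: "(\<Sum>l\<in>I - It. \<Sum>j\<in>J - {line l}. c (line l) * c j) = \<gamma> * cc - \<gamma>2"
  proof -
    have "(\<Sum>l\<in>I - It. \<Sum>j\<in>J - {line l}. c (line l) * c j) = (\<Sum>l\<in>I - It. c (line l) * cc - (c (line l))\<^sup>2)"
    proof (rule sum.cong)
      fix l assume "l \<in> I - It"
      then have "line l \<in> J" using line by auto
      then show "(\<Sum>j\<in>J - {line l}. c (line l) * c j) = c (line l) * cc - (c (line l))\<^sup>2"
        unfolding cc_def using tl.fin_J
        by (simp add: sum.remove[of J "line l"] sum_distrib_left power2_eq_square algebra_simps)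
    qed simp
    then show ?thesis by (simp add: sum_subtractf sum_distrib_right \<gamma>_def \<gamma>2_def)
  qed
  have e4: "(\<Sum>j\<in>J. (c j)\<^sup>2 - c j * dd) = cc2 - cc * dd" "(\<Sum>l\<in>I - It. (c (line l))\<^sup>2 - c (line l) * dd) = \<gamma>2 - \<gamma> * dd"
    by (simp_all add: sum_subtractf sum_distrib_right cc2_def cc_def \<gamma>_def \<gamma>2_def)
  have six: "6 * A\<^sup>2 * ((s\<^sup>2 - Z) / 2) = 3 * ((A * s)\<^sup>2 - A\<^sup>2 * Z)" for Z
    by (simp add: power_mult_distrib right_diff_distrib diff_divide_distrib mult_ac)
  have "6 * A\<^sup>2 * ((s\<^sup>2 - (\<Sum>j\<in>I - {i}. (1 / (x i z - x j z))\<^sup>2)) / 2) = 3 * ((mm / 2 + \<gamma>)\<^sup>2 - (A\<^sup>2 * s2 + \<gamma>2))"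
    unfolding six a sq ..
  also have "\<dots> = 3 * (A\<^sup>2 * (s1\<^sup>2 - s2)) + 3 * (mm * \<gamma>) + 3 * (\<gamma>\<^sup>2 - \<gamma>2)"
  proof -
    have "A\<^sup>2 * (s1\<^sup>2 - s2) = (mm / 2)\<^sup>2 - A\<^sup>2 * s2"
      unfolding a1[symmetric] by (simp add: power_mult_distrib algebra_simps)
    then show ?thesis by (simp add: power2_eq_square algebra_simps)
  qed
  finally show ?thesis
    unfolding A_def[symmetric] s_def[symmetric] c_def[symmetric] mm_def[symmetric] dd_def[symmetric] e1 e2 e3 e4 1
    unfolding mm by (simp add: algebra_simps power2_eq_square)
qed

text \<open>The first two forms of \<open>flat_on_chart\<close> are residue sums, hence functions of
  \<open>p\<close> times \<open>dp\<close>. The third is a constant multiple of the trace of the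
  right side of \<open>quadratic_tangency\<close>, since \<open>g i = 0\<close> outside
  \<open>It\<close>.\<close>

theorem chart_flat:
  assumes d: "{..<d} = I \<or> (o' \<notin> I \<and> {..<d} = insert o' I)"
    and \<rho>: "\<And>i. i < d \<Longrightarrow> holomorphic2_on (\<rho> i) N" "\<And>i z. i < d \<Longrightarrow> z \<in> N \<Longrightarrow> \<rho> i z \<noteq> 0"
    and w: "\<And>i z. i \<in> I \<Longrightarrow> z \<in> N \<Longrightarrow> w i z = smul (\<rho> i z) (W i z)"
      "\<And>z. z \<in> N \<Longrightarrow> o' \<in> {..<d} - I \<Longrightarrow> w o' z = smul (\<rho> o' z) (dif p z)"
  shows "has_curvature N d w (\<lambda>_. 0)"
proof (rule flat_on_chart[OF _ _ _ d \<rho> w])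
  have lineJ: "line l \<in> J" if "l \<in> I - It" for l using that line by auto
  let ?h1 = "\<lambda>z. - 1 * (\<theta> (p z) / \<tau> (p z)) + (\<Sum>i\<in>I - It. 1 / \<pi> (line i) z)"
  have h1: "p_fun ?h1"
    using \<tau>_ne \<pi>_ne[OF lineJ] by (intro p_fun_intros p_fun_\<theta> p_fun_\<tau> p_fun_\<pi>) auto
  have "smul (?h1 z) (dif p z) = smul (\<Sum>i\<in>I. r i z) (dif p z)" if z: "z \<in> N" for z
  proof -
    have "(\<Sum>i\<in>It. smul (poly (Tq z) (x i z) / poly (pderiv (T z)) (x i z)) (dif p z)) = smul (\<theta> (p z) / \<tau> (p z)) (dif p z)"
      unfolding sum_residues_dp[OF z deg_Tq[OF z]] coeff_Tq[OF z] ..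
    then have "smul (\<Sum>i\<in>It. r i z) (dif p z) = smul (- 1 * (\<theta> (p z) / \<tau> (p z))) (dif p z)"
      using g_r_tangency(2)[OF _ z] by (simp add: smul_sum_left[symmetric] sum_negf prod_eq_iff)
    moreover have "(\<Sum>i\<in>I - It. r i z) = (\<Sum>i\<in>I - It. 1 / \<pi> (line i) z)"
      using g_r_line(2)[OF _ z] by simp
    ultimately show ?thesis
      unfolding sum_split_I by (simp add: prod_eq_iff algebra_simps)
  qed
  then show "closed_on (\<lambda>z. smul (\<Sum>i\<in>I. r i z) (dif p z)) N"
    by (rule closed_on_cong[OF open_N _ closed_p_fun[OF h1]])
  let ?cM = "\<lambda>z. (\<Sum>j\<in>J. \<alpha> (p z) - \<tau> (p z) / \<pi> j z) - (\<theta> (p z) + of_nat m * \<alpha> (p z))"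
  let ?h2 = "\<lambda>z. - 1 * (((1 / 2) * ?cM z + (\<Sum>l\<in>I - It. \<alpha> (p z) - \<tau> (p z) / \<pi> (line l) z)) / \<tau> (p z))"
  have h2: "p_fun ?h2"
    using \<tau>_ne by (intro p_fun_intros p_fun_coeff_M p_fun_coeff_C p_fun_\<tau> p_fun_\<alpha> p_fun_\<theta> lineJ) auto
  have "smul (?h2 z) (dif p z) = smul (\<Sum>i\<in>I. g i z * S (I - {i}) i z) (dif p z)" if z: "z \<in> N" for z
  proof -
    let ?P = "smult (1 / 2) (M z) + (\<Sum>l\<in>I - It. C (line l) z)"
    have deg: "degree ?P \<le> m - 1"
      using coeff_M(1)[OF z] coeff_C(1)[OF lineJ z] fin_I
      by (intro degree_add_le order_trans[OF degree_smult_le] degree_sum_le) auto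
    have co: "coeff ?P (m - 1) = (1 / 2) * ?cM z + (\<Sum>l\<in>I - It. \<alpha> (p z) - \<tau> (p z) / \<pi> (line l) z)"
      using coeff_C(2)[OF lineJ z] by (simp add: coeff_M(2)[OF z, simplified] coeff_sum)
    have each: "g i z * S (I - {i}) i z = - (poly ?P (x i z) / poly (pderiv (T z)) (x i z))" if i: "i \<in> It" for i
      using S_tangency[OF i z] unfolding g_r_tangency(1)[OF i z] by (simp add: poly_sum)
    have "smul (\<Sum>i\<in>It. g i z * S (I - {i}) i z) (dif p z) =
        smul (-1) (\<Sum>i\<in>It. smul (poly ?P (x i z) / poly (pderiv (T z)) (x i z)) (dif p z))"
      unfolding smul_sum_left smul_sum_right by (rule sum.cong) (simp_all add: each prod_eq_iff)
    also have "\<dots> = smul (?h2 z) (dif p z)"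
      unfolding sum_residues_dp[OF z deg] co by (simp only: smul_simps prod_eq_iff mult.assoc)
    finally show ?thesis
      unfolding sum_split_I using g_r_line(1)[OF _ z] by simp
  qed
  then show "closed_on (\<lambda>z. smul (\<Sum>i\<in>I. g i z * S (I - {i}) i z) (dif p z)) N"
    by (rule closed_on_cong[OF open_N _ closed_p_fun[OF h2]])
  let ?c = "\<lambda>j i z. poly (C j z) (x i z)"
  let ?F = "\<lambda>i z. (\<Sum>j\<in>J. \<Sum>k\<in>J - {j}. ?c j i z * ?c k i z)
    + 3 * (\<Sum>j\<in>J. (?c j i z)\<^sup>2 - ?c j i z * poly (D z) (x i z))
    + 4 * poly (Jac z) (x i z) + (-1) * (poly (M z) (x i z) * poly (Tq z) (x i z)) + poly (aP z) (x i z) * poly (psi z) (x i z)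
    + 3 * (\<Sum>l\<in>I - It. \<Sum>j\<in>J - {line l}. ?c (line l) i z * ?c j i z)
    + 3 * (\<Sum>l\<in>I - It. (?c (line l) i z)\<^sup>2 - ?c (line l) i z * poly (D z) (x i z))
    + 3 * (\<Sum>l\<in>I - It. \<Sum>l'\<in>I - It - {l}. ?c (line l) i z * ?c (line l') i z)"
  have "trace_closed ?F"
  proof (intro trace_closed_add trace_closed_cmult trace_closed_sum trace_closed_Jac trace_closed_M_Tq trace_closed_psi)
    fix j k assume "j \<in> J" "k \<in> J - {j}"
    then show "trace_closed (\<lambda>i z. ?c j i z * ?c k i z)" by (intro trace_closed_pair) auto
  next
    fix j assume "j \<in> J"
    then show "trace_closed (\<lambda>i z. (?c j i z)\<^sup>2 - ?c j i z * poly (D z) (x i z))" by (rule trace_closed_log_line)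
  next
    fix l j assume "l \<in> I - It" "j \<in> J - {line l}"
    then show "trace_closed (\<lambda>i z. ?c (line l) i z * ?c j i z)" using lineJ by (intro trace_closed_pair) auto
  next
    fix l assume "l \<in> I - It"
    then show "trace_closed (\<lambda>i z. (?c (line l) i z)\<^sup>2 - ?c (line l) i z * poly (D z) (x i z))"
      by (intro trace_closed_log_line lineJ)
  next
    fix l l' assume "l \<in> I - It" "l' \<in> I - It - {l}"
    then show "trace_closed (\<lambda>i z. ?c (line l) i z * ?c (line l') i z)"
      using lineJ line(2) by (intro trace_closed_pair) (auto dest: inj_onD)
  qed
  then have F: "closed_on (\<lambda>z. smul (- (1 / 6)) (Tr ?F z)) N"
    unfolding trace_closed_def by (rule closed_on_cmult)
  have "smul (- (1 / 6)) (Tr ?F z) =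
    (\<Sum>i\<in>I. smul (g i z * (((S (I - {i}) i z)\<^sup>2 - (\<Sum>j\<in>I - {i}. (1 / (x i z - x j z))\<^sup>2)) / 2)) (W i z))"
    if z: "z \<in> N" for z
  proof -
    \<comment> \<open>As \<open>g i = - a / T'\<close>, the symmetric function times
      \<open>g i W i\<close> is minus \<open>a^2\<close> times it times \<open>\<sigma> i\<close>,
      and \<open>quadratic_tangency\<close> computes six times \<open>a^2\<close> times it.\<close>
    have each: "smul (- (1 / 6)) (smul (?F i z) (\<sigma> i z)) =
        smul (g i z * (((S (I - {i}) i z)\<^sup>2 - (\<Sum>j\<in>I - {i}. (1 / (x i z - x j z))\<^sup>2)) / 2)) (W i z)" if i: "i \<in> It" for i
      unfolding quadratic_tangency[OF i z, symmetric] g_r_tangency(1)[OF i z] \<sigma>_def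
      using T_ne(2,3)[OF i z] by (simp add: prod_eq_iff power2_eq_square field_simps)
    show ?thesis
      unfolding sum_split_I Tr_def smul_sum_right using g_r_line(1)[OF _ z] each by simp
  qed
  then show "closed_on (\<lambda>z. \<Sum>i\<in>I. smul (g i z * (((S (I - {i}) i z)\<^sup>2 -
      (\<Sum>j\<in>I - {i}. (1 / (x i z - x j z))\<^sup>2)) / 2)) (W i z)) N"
    by (rule closed_on_cong[OF open_N _ F])
qed

end

section \<open>Homogeneous polynomials in three variables\<close>

type_synonym vec = "complex \<times> complex \<times> complex"

lemma eval3_simps [simp]:
  "eval3 0 v = 0" "eval3 1 v = 1" "eval3 (H + K) v = eval3 H v + eval3 K v" "eval3 (H - K) v = eval3 H v - eval3 K v"
  "eval3 (- H) v = - eval3 H v" "eval3 (H * K) v = eval3 H v * eval3 K v" "eval3 (H ^ n) v = eval3 H v ^ n"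
  by (simp_all add: eval3_def split: prod.split)

lemma eval3_prod [simp]: "eval3 (\<Prod>i\<in>A. H i) v = (\<Prod>i\<in>A. eval3 (H i) v)"
  by (induction A rule: infinite_finite_induct) simp_all

lemma eval3_const [simp]: "eval3 [:[:[:c:]:]:] v = c"
  and eval3_vars [simp]: "eval3 varX v = fst v" "eval3 varY v = fst (snd v)" "eval3 varZ v = snd (snd v)"
  by (simp_all add: eval3_def split: prod.split)

lemma poly_eq_0_if_const_roots:
  fixes P :: "complex poly poly"
  assumes "\<And>c. poly P [:c:] = 0"
  shows "P = 0"
proof (rule ccontr)
  assume "P \<noteq> 0"
  then have "finite {c. poly P c = 0}" by (rule poly_roots_finite)
  then have "finite (range (\<lambda>c::complex. [:c:]))" by (rule finite_subset[rotated]) (use assms in auto)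
  then have "finite (UNIV :: complex set)" by (rule finite_imageD) (simp add: inj_def)
  then show False by (simp add: infinite_UNIV_char_0)
qed

lemma eval3_eq_0: "(\<And>v. eval3 H v = 0) \<Longrightarrow> H = 0"
proof -
  assume H: "\<And>v. eval3 H v = 0"
  have "poly (poly H [:[:z:]:]) [:y:] = 0" for y z
    using H[of "(_, y, z)"] by (intro iffD1[OF poly_all_0_iff_0]) (simp add: eval3_def)
  then have 1: "poly H [:[:z:]:] = 0" for z by (rule poly_eq_0_if_const_roots)
  show "H = 0"
  proof (rule ccontr)
    assume "H \<noteq> 0"
    then have "finite {c. poly H c = 0}" by (rule poly_roots_finite)
    then have "finite (range (\<lambda>c::complex. [:[:c:]:]))" by (rule finite_subset[rotated]) (use 1 in auto)
    then have "finite (UNIV :: complex set)" by (rule finite_imageD) (simp add: inj_def)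
    then show False by (simp add: infinite_UNIV_char_0)
  qed
qed

lemma eval3_inject: "(\<And>v. eval3 H v = eval3 K v) \<Longrightarrow> H = K"
  using eval3_eq_0[of "H - K"] by simp

lemma homogeneous_0: "homogeneous n 0"
  by (simp add: homogeneous_def)

lemma homogeneous_add: "homogeneous n H \<Longrightarrow> homogeneous n K \<Longrightarrow> homogeneous n (H + K)"
  by (auto simp: homogeneous_def) (metis add.right_neutral)

lemma homogeneous_mult: "homogeneous n H \<Longrightarrow> homogeneous k K \<Longrightarrow> homogeneous (n + k) (H * K)"
  unfolding homogeneous_def
proof (intro allI impI)
  fix i j l
  assume H: "\<forall>i j k. coeff (coeff (coeff H k) j) i \<noteq> 0 \<longrightarrow> i + j + k = n"
    and K: "\<forall>i j ka. coeff (coeff (coeff K ka) j) i \<noteq> 0 \<longrightarrow> i + j + ka = k"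
    and "coeff (coeff (coeff (H * K) l) j) i \<noteq> 0"
  then have "(\<Sum>a\<le>l. \<Sum>b\<le>j. \<Sum>c\<le>i. coeff (coeff (coeff H a) b) c * coeff (coeff (coeff K (l - a)) (j - b)) (i - c)) \<noteq> 0"
    by (simp add: coeff_mult coeff_sum)
  then obtain a where a: "a \<le> l" "(\<Sum>b\<le>j. \<Sum>c\<le>i. coeff (coeff (coeff H a) b) c * coeff (coeff (coeff K (l - a)) (j - b)) (i - c)) \<noteq> 0"
    by (metis (mono_tags, lifting) atMost_iff sum.neutral)
  then obtain b where b: "b \<le> j" "(\<Sum>c\<le>i. coeff (coeff (coeff H a) b) c * coeff (coeff (coeff K (l - a)) (j - b)) (i - c)) \<noteq> 0"
    by (metis (mono_tags, lifting) atMost_iff sum.neutral)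
  then obtain c where c: "c \<le> i" "coeff (coeff (coeff H a) b) c * coeff (coeff (coeff K (l - a)) (j - b)) (i - c) \<noteq> 0"
    by (metis (mono_tags, lifting) atMost_iff sum.neutral)
  then have "coeff (coeff (coeff H a) b) c \<noteq> 0" "coeff (coeff (coeff K (l - a)) (j - b)) (i - c) \<noteq> 0" by auto
  then have "c + b + a = n" "(i - c) + (j - b) + (l - a) = k" using H K by blast+
  then show "i + j + l = n + k" using a b c by linarith
qed

lemma homogeneous_const: "homogeneous 0 [:[:[:c:]:]:]"
  by (auto simp: homogeneous_def coeff_pCons split: nat.splits)

lemma homogeneous_vars: "homogeneous 1 varX" "homogeneous 1 varY" "homogeneous 1 varZ"
  by (auto simp: homogeneous_def coeff_pCons split: nat.splits)

lemma homogeneous_cmult: "homogeneous n H \<Longrightarrow> homogeneous n ([:[:[:c:]:]:] * H)"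
  using homogeneous_mult[OF homogeneous_const] by fastforce

lemma homogeneous_power: "homogeneous n H \<Longrightarrow> homogeneous (n * k) (H ^ k)"
  by (induction k) (use homogeneous_const[of 1] in \<open>auto simp: one_pCons intro: homogeneous_mult\<close>)

lemma poly_altdef_le: "degree P \<le> n \<Longrightarrow> poly P x = (\<Sum>i\<le>n. coeff P i * x ^ i)"
  for P :: "'a::comm_semiring_1 poly"
  unfolding poly_altdef by (rule sum.mono_neutral_left) (auto simp: coeff_eq_0)

lemma homogeneous_degrees:
  assumes "homogeneous n H"
  shows "degree H \<le> n" "degree (coeff H k) \<le> n" "degree (coeff (coeff H k) j) \<le> n"
proof -
  have *: "coeff (coeff (coeff H k) j) i = 0" if "n < i \<or> n < j \<or> n < k" for i j k
    using assms that unfolding homogeneous_def by (metis add_leD1 add_leD2 le_eq_less_or_eq less_le_not_le)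
  show "degree (coeff (coeff H k) j) \<le> n" for j k using * by (intro degree_le) auto
  have **: "coeff (coeff H k) j = 0" if "n < j \<or> n < k" for j k
    using * that by (intro poly_eqI) auto
  show "degree (coeff H k) \<le> n" for k using ** by (intro degree_le) auto
  have "coeff H k = 0" if "n < k" for k
    using ** that by (intro poly_eqI) auto
  then show "degree H \<le> n" by (intro degree_le) auto
qed

lemma eval3_expand:
  assumes "homogeneous n H"
  shows "eval3 H (x, y, z) = (\<Sum>k\<le>n. \<Sum>j\<le>n. \<Sum>i\<le>n. coeff (coeff (coeff H k) j) i * x ^ i * y ^ j * z ^ k)"
proof -
  have "poly H [:[:z:]:] = (\<Sum>k\<le>n. coeff H k * [:[:z:]:] ^ k)"
    by (rule poly_altdef_le[OF homogeneous_degrees(1)[OF assms]])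
  moreover have "poly (coeff H k) [:y:] = (\<Sum>j\<le>n. coeff (coeff H k) j * [:y:] ^ j)" for k
    by (rule poly_altdef_le[OF homogeneous_degrees(2)[OF assms]])
  moreover have "poly (coeff (coeff H k) j) x = (\<Sum>i\<le>n. coeff (coeff (coeff H k) j) i * x ^ i)" for k j
    by (rule poly_altdef_le[OF homogeneous_degrees(3)[OF assms]])
  ultimately show ?thesis
    by (simp add: eval3_def poly_sum sum_distrib_right sum_distrib_left mult_ac)
qed

lemma eval3_scale:
  assumes "homogeneous n H"
  shows "eval3 H (c * x, c * y, c * z) = c ^ n * eval3 H (x, y, z)"
  unfolding eval3_expand[OF assms] sum_distrib_left
proof (intro sum.cong refl)
  fix i j k
  show "coeff (coeff (coeff H k) j) i * (c * x) ^ i * (c * y) ^ j * (c * z) ^ k =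
      c ^ n * (coeff (coeff (coeff H k) j) i * x ^ i * y ^ j * z ^ k)"
  proof (cases "coeff (coeff (coeff H k) j) i = 0")
    case False
    then have "n = i + j + k" using assms by (auto simp: homogeneous_def)
    then show ?thesis by (simp add: power_mult_distrib power_add mult_ac)
  qed simp
qed

text \<open>Homogeneous polynomials seen as functions: linear changes of coordinates and
  factorizations can then be handled pointwise, and \<open>eval3_inject\<close> leads back to
  polynomials.\<close>

definition hom_fun :: "nat \<Rightarrow> (vec \<Rightarrow> complex) \<Rightarrow> bool" where
  "hom_fun n f \<longleftrightarrow> (\<exists>H. homogeneous n H \<and> f = eval3 H)"

lemma hom_fun_eval3: "homogeneous n H \<Longrightarrow> hom_fun n (eval3 H)"
  by (auto simp: hom_fun_def)

lemma hom_fun_add: "hom_fun n f \<Longrightarrow> hom_fun n g \<Longrightarrow> hom_fun n (\<lambda>v. f v + g v)"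
  unfolding hom_fun_def by (metis (no_types, lifting) eval3_simps(3) homogeneous_add ext)

lemma hom_fun_mult: "hom_fun n f \<Longrightarrow> hom_fun k g \<Longrightarrow> hom_fun (n + k) (\<lambda>v. f v * g v)"
  unfolding hom_fun_def by (metis (no_types, lifting) eval3_simps(6) homogeneous_mult ext)

lemma hom_fun_cmult: "hom_fun n f \<Longrightarrow> hom_fun n (\<lambda>v. c * f v)"
  using hom_fun_mult[of 0 "\<lambda>_. c" n f] hom_fun_eval3[OF homogeneous_const[of c]] by (simp add: eval3_const[abs_def])

lemma hom_fun_0: "hom_fun n (\<lambda>_. 0)"
  using hom_fun_eval3[OF homogeneous_0] by (simp add: eval3_simps(1)[abs_def])

lemma hom_fun_sum: "(\<And>i. i \<in> A \<Longrightarrow> hom_fun n (f i)) \<Longrightarrow> hom_fun n (\<lambda>v. \<Sum>i\<in>A. f i v)"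
  by (induction A rule: infinite_finite_induct) (auto simp: hom_fun_0 intro: hom_fun_add)

lemma hom_fun_power: "hom_fun n f \<Longrightarrow> hom_fun (n * k) (\<lambda>v. f v ^ k)"
  unfolding hom_fun_def by (metis (no_types, lifting) eval3_simps(7) homogeneous_power ext)

lemma hom_fun_subst:
  assumes f: "hom_fun n f" and g: "hom_fun 1 g1" "hom_fun 1 g2" "hom_fun 1 g3"
  shows "hom_fun n (\<lambda>v. f (g1 v, g2 v, g3 v))"
proof -
  obtain H where H: "homogeneous n H" "f = eval3 H" using f by (auto simp: hom_fun_def)
  show ?thesis
    unfolding H(2) eval3_expand[OF H(1)]
  proof (intro hom_fun_sum)
    fix i j k
    show "hom_fun n (\<lambda>v. coeff (coeff (coeff H k) j) i * g1 v ^ i * g2 v ^ j * g3 v ^ k)"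
    proof (cases "coeff (coeff (coeff H k) j) i = 0")
      case False
      then have "n = 1 * i + 1 * j + 1 * k" using H(1) by (auto simp: homogeneous_def)
      then show ?thesis
        by (simp only:) (intro hom_fun_mult hom_fun_cmult hom_fun_power g)
    qed (simp add: hom_fun_0)
  qed
qed

section \<open>Vectors and covectors of the three-dimensional space\<close>

definition dot :: "vec \<Rightarrow> vec \<Rightarrow> complex" where
  "dot u v = fst u * fst v + fst (snd u) * fst (snd v) + snd (snd u) * snd (snd v)"

definition cross :: "vec \<Rightarrow> vec \<Rightarrow> vec" where
  "cross u v = (fst (snd u) * snd (snd v) - snd (snd u) * fst (snd v),
                snd (snd u) * fst v - fst u * snd (snd v), fst u * fst (snd v) - fst (snd u) * fst v)"

definition vscale :: "complex \<Rightarrow> vec \<Rightarrow> vec" where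
  "vscale c v = (c * fst v, c * fst (snd v), c * snd (snd v))"

text \<open>\<open>dot\<close> is bilinear, so a nonzero vector may be orthogonal to itself. Its
  product with the conjugate is the squared norm, so \<open>vcnj l\<close> is a vector off the plane
  \<open>dot l v = 0\<close>.\<close>

definition vcnj :: "vec \<Rightarrow> vec" where
  "vcnj v = (cnj (fst v), cnj (fst (snd v)), cnj (snd (snd v)))"

lemma hom_fun_linear: "hom_fun 1 (\<lambda>v. a * fst v + b * fst (snd v) + c * snd (snd v))"
proof -
  have "hom_fun 1 fst" "hom_fun 1 (\<lambda>v. fst (snd v))" "hom_fun 1 (\<lambda>v. snd (snd v))"
    using homogeneous_vars[THEN hom_fun_eval3] by (simp_all add: eval3_vars[abs_def])
  then show ?thesis by (intro hom_fun_add hom_fun_cmult)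
qed

lemma hom_fun_dot: "hom_fun 1 (dot l)"
  using hom_fun_linear by (simp add: dot_def[abs_def])

lemma hom_fun_scale: "hom_fun n f \<Longrightarrow> f (vscale c v) = c ^ n * f v"
  unfolding hom_fun_def vscale_def by (metis eval3_scale prod.collapse)

lemma hom_fun_at_0: "hom_fun n f \<Longrightarrow> 0 < n \<Longrightarrow> f (0, 0, 0) = 0"
  using hom_fun_scale[of n f 0 "(0, 0, 0)"] by (simp add: vscale_def power_0_left)

lemma homogeneous_1_explicit:
  assumes "homogeneous 1 L"
  obtains a b c where "L = [:[:[:0, a:], [:b:]:], [:[:c:]:]:]"
proof
  let ?K = "[:[:[:0, coeff (coeff (coeff L 0) 0) 1:], [:coeff (coeff (coeff L 0) 1) 0:]:], [:[:coeff (coeff (coeff L 1) 0) 0:]:]:]"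
  show "L = ?K"
  proof (intro poly_eqI)
    fix k j i
    show "coeff (coeff (coeff L k) j) i = coeff (coeff (coeff ?K k) j) i"
    proof (cases "i + j + k = 1")
      case True
      then consider "i = 1" "j = 0" "k = 0" | "i = 0" "j = 1" "k = 0" | "i = 0" "j = 0" "k = 1" by linarith
      then show ?thesis by cases simp_all
    next
      case False
      then have "coeff (coeff (coeff L k) j) i = 0" using assms by (auto simp: homogeneous_def)
      moreover have "coeff (coeff (coeff ?K k) j) i = 0"
        using False by (auto simp: coeff_pCons split: nat.splits)
      ultimately show ?thesis by simp
    qed
  qed
qed

lemma homogeneous_1_dot:
  assumes "homogeneous 1 L"
  obtains l where "eval3 L = dot l" "eval3 (dX L) = (\<lambda>_. fst l)" "eval3 (dY L) = (\<lambda>_. fst (snd l))" "eval3 (dZ L) = (\<lambda>_. snd (snd l))"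
proof -
  obtain a b c where L: "L = [:[:[:0, a:], [:b:]:], [:[:c:]:]:]" by (rule homogeneous_1_explicit[OF assms])
  show thesis
    by (rule that[of "(a, b, c)"])
       (simp_all add: L fun_eq_iff eval3_def dX_def dY_def dZ_def dot_def map_poly_pCons pderiv_pCons mult_ac split: prod.split)
qed

lemma hom_fun_vanish_z:
  assumes "hom_fun n f" "0 < n" "\<And>x y. f (x, y, 0) = 0"
  obtains f1 where "hom_fun (n - 1) f1" "\<And>v. f v = snd (snd v) * f1 v"
proof -
  obtain H where H: "homogeneous n H" "f = eval3 H" using assms(1) by (auto simp: hom_fun_def)
  obtain c K where HK: "H = pCons c K" by (cases H)
  have "poly (poly c [:y:]) x = 0" for x y
    using assms(3)[of x y] by (simp add: H(2) eval3_def HK)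
  then have "poly c [:y:] = 0" for y by (intro iffD1[OF poly_all_0_iff_0]) simp
  then have "c = 0" by (rule poly_eq_0_if_const_roots)
  then have eq: "eval3 H v = snd (snd v) * eval3 K v" for v
    by (simp add: HK eval3_def split: prod.split)
  have "homogeneous (n - 1) K"
    unfolding homogeneous_def
  proof (intro allI impI)
    fix i j k assume "coeff (coeff (coeff K k) j) i \<noteq> 0"
    then have "coeff (coeff (coeff H (Suc k)) j) i \<noteq> 0" by (simp add: HK)
    then show "i + j + k = n - 1" using H(1) by (fastforce simp: homogeneous_def)
  qed
  then show ?thesis using that[of "eval3 K"] eq H(2) hom_fun_eval3 by auto
qed

subsection \<open>Linear coordinates\<close>

lemma dot_simps:
  "dot u (v + w) = dot u v + dot u w" "dot u (vscale c v) = c * dot u v" "dot (u + w) v = dot u v + dot w v"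
  "dot (vscale c u) v = c * dot u v" "dot u (v - w) = dot u v - dot u w"
  by (simp_all add: dot_def vscale_def algebra_simps)

lemma dot_commute: "dot u v = dot v u"
  by (simp add: dot_def mult_ac)

lemma vscale_simps [simp]: "fst (vscale c v) = c * fst v" "fst (snd (vscale c v)) = c * fst (snd v)"
  "snd (snd (vscale c v)) = c * snd (snd v)" "vscale 1 v = v"
  by (simp_all add: vscale_def)

lemma vec_eqI: "fst u = fst v \<Longrightarrow> fst (snd u) = fst (snd v) \<Longrightarrow> snd (snd u) = snd (snd v) \<Longrightarrow> u = v" for u v :: vec
  by (simp add: prod_eq_iff)

lemma cross_orth: "dot u (cross u v) = 0" "dot v (cross u v) = 0"
  by (simp_all add: dot_def cross_def algebra_simps)

lemma triple_cycle: "dot u (cross v w) = dot v (cross w u)" "dot (cross u v) w = dot u (cross v w)"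
  by (simp_all add: dot_def cross_def algebra_simps)

lemma triple_swap: "dot u (cross v w) = - dot v (cross u w)" "dot u (cross v w) = - dot w (cross v u)" "cross u v = - cross v u"
  by (simp_all add: dot_def cross_def algebra_simps)

lemma dot_vcnj_ne_0: "v \<noteq> 0 \<Longrightarrow> dot v (vcnj v) \<noteq> 0"
proof -
  assume v: "v \<noteq> 0"
  have "dot v (vcnj v) = of_real ((cmod (fst v))\<^sup>2 + (cmod (fst (snd v)))\<^sup>2 + (cmod (snd (snd v)))\<^sup>2)"
    by (simp only: dot_def vcnj_def fst_conv snd_conv of_real_add complex_norm_square)
  moreover have "(cmod (fst v))\<^sup>2 + (cmod (fst (snd v)))\<^sup>2 + (cmod (snd (snd v)))\<^sup>2 \<noteq> 0"
    using v by (simp add: prod_eq_iff add_nonneg_eq_0_iff)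
  ultimately show ?thesis by (simp only: of_real_eq_0_iff not_False_eq_True)
qed

lemma cross_eq_0_imp_proportional:
  assumes "u \<noteq> 0" "cross u v = 0"
  shows "\<exists>c. v = vscale c u"
proof
  have 0: "fst (snd u) * snd (snd v) = snd (snd u) * fst (snd v)" "snd (snd u) * fst v = fst u * snd (snd v)"
    "fst u * fst (snd v) = fst (snd u) * fst v"
    using assms(2) by (simp_all add: cross_def zero_prod_def)
  have n: "dot u (vcnj u) \<noteq> 0" by (rule dot_vcnj_ne_0[OF assms(1)])
  have e: "v = vscale (1 / dot u (vcnj u)) (vscale (dot u (vcnj u)) v)"
    using n by (simp add: vscale_def)
  have "vscale (dot u (vcnj u)) v = vscale (dot v (vcnj u)) u"
    using 0 by (intro vec_eqI; simp add: dot_def vcnj_def) (algebra+)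
  then show "v = vscale (dot v (vcnj u) / dot u (vcnj u)) u"
    using e by (simp add: vscale_def)
qed

lemma cross_vscale: "cross (vscale c u) v = vscale c (cross u v)"
  by (intro vec_eqI; simp add: cross_def vscale_def algebra_simps)

lemma vscale_vscale: "vscale a (vscale b v) = vscale (a * b) v"
  by (simp add: vscale_def mult_ac)

lemma vscale_0 [simp]: "vscale 0 v = 0"
  by (simp add: vscale_def zero_prod_def)

lemma kernel_eq_cross:
  assumes "l \<noteq> 0" "dot l s = 0"
  shows "\<exists>u. s = cross u l"
proof
  have n: "dot l (vcnj l) \<noteq> 0" by (rule dot_vcnj_ne_0[OF assms(1)])
  have "cross (cross (vcnj l) s) l = vscale (dot l (vcnj l)) s - vscale (dot l s) (vcnj l)"
    by (intro vec_eqI; simp add: cross_def dot_def vscale_def algebra_simps)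
  then have "cross (vscale (1 / dot l (vcnj l)) (cross (vcnj l) s)) l = vscale (1 / dot l (vcnj l)) (vscale (dot l (vcnj l)) s)"
    using assms(2) by (simp add: cross_vscale)
  then show "s = cross (vscale (1 / dot l (vcnj l)) (cross (vcnj l) s)) l"
    using n by (simp add: vscale_vscale)
qed

lemma exists_generic_vector:
  assumes "finite S" "0 \<notin> S"
  shows "\<exists>h. \<forall>s\<in>S. dot s h \<noteq> 0"
proof -
  \<comment> \<open>The vector is sought on the moment curve \<open>(1, t, t * t)\<close>; each
    covector excludes only the finitely many roots of a nonzero polynomial.\<close>
  let ?P = "\<lambda>s. [:fst s, fst (snd s), snd (snd s):]"
  have "finite (\<Union>s\<in>S. {t. poly (?P s) t = 0})"
  proof (intro finite_UN_I poly_roots_finite)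
    show "?P s \<noteq> 0" if "s \<in> S" for s
    proof -
      have "s \<noteq> 0" using assms(2) that by metis
      then show ?thesis by (auto simp: prod_eq_iff)
    qed
  qed (rule assms(1))
  then obtain t where "t \<notin> (\<Union>s\<in>S. {t. poly (?P s) t = 0})"
    using ex_new_if_finite[OF infinite_UNIV_char_0] by blast
  then have "\<forall>s\<in>S. dot s (1, t, t * t) \<noteq> 0"
    by (auto simp: dot_def algebra_simps)
  then show ?thesis by blast
qed

locale frame =
  fixes f1 f2 f3 :: vec
  assumes det_ne: "dot f1 (cross f2 f3) \<noteq> 0"
begin

definition lin :: "vec \<Rightarrow> vec" where
  "lin c = vscale (fst c) f1 + (vscale (fst (snd c)) f2 + vscale (snd (snd c)) f3)"

definition coord :: "vec \<Rightarrow> vec" where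
  "coord v = vscale (1 / dot f1 (cross f2 f3)) (dot (cross f2 f3) v, dot (cross f3 f1) v, dot (cross f1 f2) v)"

lemma lin_coord: "lin (coord v) = v"
proof -
  let ?d = "dot f1 (cross f2 f3)"
  have "vscale (dot (cross f2 f3) v) f1 + (vscale (dot (cross f3 f1) v) f2 + vscale (dot (cross f1 f2) v) f3) = vscale ?d v"
    by (intro vec_eqI; simp add: cross_def dot_def algebra_simps)
  moreover have "lin (coord v) = vscale (1 / ?d) (vscale (dot (cross f2 f3) v) f1 + (vscale (dot (cross f3 f1) v) f2 + vscale (dot (cross f1 f2) v) f3))"
    by (intro vec_eqI; simp add: lin_def coord_def algebra_simps add_divide_distrib)
  ultimately show ?thesis using det_ne by (simp add: vscale_def)
qed

lemma hom_fun_coord: "hom_fun n f \<Longrightarrow> hom_fun n (\<lambda>v. f (coord v))"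
  unfolding coord_def vscale_def fst_conv snd_conv
  by (erule hom_fun_subst) (intro hom_fun_cmult hom_fun_dot)+

lemma hom_fun_lin: "hom_fun n f \<Longrightarrow> hom_fun n (\<lambda>c. f (lin c))"
proof -
  assume f: "hom_fun n f"
  have "lin c = (fst f1 * fst c + fst f2 * fst (snd c) + fst f3 * snd (snd c),
      fst (snd f1) * fst c + fst (snd f2) * fst (snd c) + fst (snd f3) * snd (snd c),
      snd (snd f1) * fst c + snd (snd f2) * fst (snd c) + snd (snd f3) * snd (snd c))" for c
    by (intro vec_eqI; simp add: lin_def)
  then show ?thesis
    by (simp only:) (rule hom_fun_subst[OF f hom_fun_linear hom_fun_linear hom_fun_linear])
qed

end

text \<open>The first two vectors span the kernel of \<open>l\<close>, with the freedom to prescribe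
  the second one through \<open>h\<close>, and the third is normalised to \<open>dot l = 1\<close>.
  The determinant reduces to the squared norm of \<open>n\<close> by the double cross
  product.\<close>

lemma frame_of_covector:
  assumes "l \<noteq> 0" "cross l h \<noteq> 0"
  defines "n \<equiv> cross l h"
  shows "frame (cross (vcnj n) l) n (vscale (1 / dot l (vcnj l)) (vcnj l))"
    and "dot l (cross (vcnj n) l) = 0" "dot l n = 0" "dot l (vscale (1 / dot l (vcnj l)) (vcnj l)) = 1"
proof -
  show o: "dot l (cross (vcnj n) l) = 0" "dot l n = 0" by (simp_all add: n_def cross_orth)
  show one: "dot l (vscale (1 / dot l (vcnj l)) (vcnj l)) = 1"
    using dot_vcnj_ne_0[OF assms(1)] by (simp add: dot_simps)
  have "cross (cross (vcnj n) l) n = vscale (dot n (vcnj n)) l - vscale (dot l n) (vcnj n)"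
    by (intro vec_eqI; simp add: cross_def dot_def algebra_simps)
  then have "cross (cross (vcnj n) l) n = vscale (dot n (vcnj n)) l"
    using o(2) by (simp add: vscale_def zero_prod_def[symmetric])
  then have "dot (cross (vcnj n) l) (cross n (vscale (1 / dot l (vcnj l)) (vcnj l))) = dot n (vcnj n)"
    using one by (simp add: triple_cycle(2)[symmetric] dot_simps(4))
  then show "frame (cross (vcnj n) l) n (vscale (1 / dot l (vcnj l)) (vcnj l))"
    using dot_vcnj_ne_0[of n] assms(2) by (simp add: frame_def n_def)
qed

lemma exists_cross_ne_0:
  assumes "l \<noteq> 0"
  shows "\<exists>h. cross l h \<noteq> 0"
proof -
  have "cross l (1, 0, 0) \<noteq> 0 \<or> cross l (0, 1, 0) \<noteq> 0"
    using assms by (auto simp: cross_def prod_eq_iff)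
  then show ?thesis by blast
qed

text \<open>In a frame adapted to \<open>l\<close> this covector is the third coordinate, and the
  claim becomes divisibility by a variable.\<close>

lemma linear_factor:
  assumes f: "hom_fun n f" "0 < n" and l: "l \<noteq> 0" and v: "\<And>v. dot l v = 0 \<Longrightarrow> f v = 0"
  shows "\<exists>g. hom_fun (n - 1) g \<and> (\<forall>v. f v = dot l v * g v)"
proof -
  obtain h where h: "cross l h \<noteq> 0" using exists_cross_ne_0[OF l] by blast
  define n' where "n' = cross l h"
  define f1 f2 f3 where "f1 = cross (vcnj n') l" and "f2 = n'" and "f3 = vscale (1 / dot l (vcnj l)) (vcnj l)"
  interpret frame f1 f2 f3
    unfolding f1_def f2_def f3_def n'_def by (rule frame_of_covector(1)[OF l h])
  have lf: "dot l f1 = 0" "dot l f2 = 0" "dot l f3 = 1"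
    unfolding f1_def f2_def f3_def n'_def by (rule frame_of_covector(2-4)[OF l h])+
  have l_lin: "dot l (lin c) = snd (snd c)" for c
    by (simp add: lin_def dot_simps lf)
  obtain F where F: "hom_fun (n - 1) F" "\<And>c. f (lin c) = snd (snd c) * F c"
    using hom_fun_vanish_z[OF hom_fun_lin[OF f(1)] f(2)] v l_lin by (metis snd_conv)
  show ?thesis
  proof (intro exI conjI allI)
    show "hom_fun (n - 1) (\<lambda>v. F (coord v))" by (rule hom_fun_coord[OF F(1)])
    fix v
    show "f v = dot l v * F (coord v)"
      using F(2)[of "coord v"] l_lin[of "coord v"] by (simp add: lin_coord)
  qed
qed

subsection \<open>Foliations and invariant lines\<close>

locale plane_foliation =
  fixes P Q R :: ternary and m :: nat
  assumes fol: "foliation m P Q R" and m_pos: "0 < m"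
begin

definition om :: "vec \<Rightarrow> vec \<Rightarrow> complex" where
  "om v = dot (eval3 P v, eval3 Q v, eval3 R v)"

definition inv_line :: "vec \<Rightarrow> bool" where
  "inv_line l \<longleftrightarrow> l \<noteq> 0 \<and> (\<forall>v h. dot l v = 0 \<longrightarrow> dot l h = 0 \<longrightarrow> om v h = 0)"

lemma hom_fun_om: "hom_fun (m + 1) (\<lambda>v. om v h)"
proof -
  have "hom_fun (m + 1) (\<lambda>v. fst h * eval3 P v + fst (snd h) * eval3 Q v + snd (snd h) * eval3 R v)"
    using fol by (intro hom_fun_add hom_fun_cmult hom_fun_eval3) (simp_all add: foliation_def)
  then show ?thesis by (simp add: om_def dot_def mult.commute)
qed

lemma om_self: "om v v = 0"
proof -
  have "varX * P + varY * Q + varZ * R = 0" using fol by (simp add: foliation_def)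
  from arg_cong[OF this, of "\<lambda>H. eval3 H v"] show ?thesis by (simp only: eval3_simps eval3_vars om_def dot_def fst_conv snd_conv mult.commute)
qed

lemma om_linear: "om v (a + b) = om v a + om v b" "om v (vscale c a) = c * om v a"
  by (simp_all add: om_def dot_simps)

lemma om_scale: "om (vscale c v) h = c ^ (m + 1) * om v h"
  by (rule hom_fun_scale[OF hom_fun_om])

lemma no_common_factor:
  assumes h: "hom_fun k h" "0 < k" and "\<And>v. eval3 P v = h v * p v" "\<And>v. eval3 Q v = h v * q v" "\<And>v. eval3 R v = h v * r v"
    and "hom_fun a p" "hom_fun a q" "hom_fun a r"
  shows False
proof -
  obtain H where H: "homogeneous k H" "h = eval3 H" using h by (auto simp: hom_fun_def)
  have dvd: "H dvd K" if K: "\<And>v. eval3 K v = h v * s v" and s: "hom_fun a s" for K s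
  proof -
    obtain S where "s = eval3 S" using s by (auto simp: hom_fun_def)
    then have "K = H * S" using K H(2) by (intro eval3_inject) simp
    then show ?thesis by simp
  qed
  have "H dvd P" "H dvd Q" "H dvd R" using assms(3-) by (auto intro: dvd)
  then have "is_unit H" using fol by (simp add: foliation_def)
  then obtain K where "H * K = 1" by (metis dvdE)
  then have "eval3 H (0, 0, 0) * eval3 K (0, 0, 0) = 1" by (metis eval3_simps(2,6))
  then show False using hom_fun_at_0[OF h] H(2) by simp
qed

text \<open>Otherwise \<open>linear_factor\<close> would split \<open>l\<close> off all three
  coefficients, against the absence of a common factor.\<close>

lemma om_ne_0_on_line:
  assumes l: "l \<noteq> 0"
  shows "\<exists>v h. dot l v = 0 \<and> om v h \<noteq> 0"
proof (rule ccontr)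
  assume "\<not> ?thesis"
  then have 0: "om v h = 0" if "dot l v = 0" for v h using that by blast
  have van: "eval3 P v = 0" "eval3 Q v = 0" "eval3 R v = 0" if "dot l v = 0" for v
    using 0[OF that, of "(1, 0, 0)"] 0[OF that, of "(0, 1, 0)"] 0[OF that, of "(0, 0, 1)"] by (simp_all add: om_def dot_def)
  have homs: "hom_fun (m + 1) (eval3 P)" "hom_fun (m + 1) (eval3 Q)" "hom_fun (m + 1) (eval3 R)"
    using fol unfolding foliation_def by (blast intro: hom_fun_eval3)+
  have pos: "0 < m + 1" by simp
  obtain p where p: "hom_fun (m + 1 - 1) p" "\<And>v. eval3 P v = dot l v * p v"
    using linear_factor[OF homs(1) pos l van(1)] by blast
  obtain q where q: "hom_fun (m + 1 - 1) q" "\<And>v. eval3 Q v = dot l v * q v"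
    using linear_factor[OF homs(2) pos l van(2)] by blast
  obtain r where r: "hom_fun (m + 1 - 1) r" "\<And>v. eval3 R v = dot l v * r v"
    using linear_factor[OF homs(3) pos l van(3)] by blast
  show False
    by (rule no_common_factor[OF hom_fun_dot zero_less_one p(2) q(2) r(2) p(1) q(1) r(1)])
qed

text \<open>On an invariant line the covector \<open>om v\<close> annihilates the kernel of
  \<open>l\<close>, so it is a multiple of \<open>l\<close>, measured by its value on
  \<open>vcnj l\<close>.\<close>

lemma om_parallel:
  assumes "inv_line l" "dot l v = 0"
  shows "om v h = dot l h / dot l (vcnj l) * om v (vcnj l)"
proof -
  have l: "dot l (vcnj l) \<noteq> 0" using assms dot_vcnj_ne_0 by (auto simp: inv_line_def)
  have "dot l (h - vscale (dot l h / dot l (vcnj l)) (vcnj l)) = 0"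
    using l by (simp add: dot_simps)
  then have "om v (h - vscale (dot l h / dot l (vcnj l)) (vcnj l)) = 0"
    using assms unfolding inv_line_def by blast
  then show ?thesis by (simp add: om_def dot_simps)
qed

lemma om_vcnj_ne_0:
  assumes "inv_line l"
  shows "\<exists>v. dot l v = 0 \<and> om v (vcnj l) \<noteq> 0"
proof -
  have "l \<noteq> 0" using assms by (simp add: inv_line_def)
  from om_ne_0_on_line[OF this] obtain v h where v: "dot l v = 0" "om v h \<noteq> 0" by blast
  from v(2) have "om v (vcnj l) \<noteq> 0" unfolding om_parallel[OF assms v(1), of h] by (rule contrapos_nn) simp
  with v(1) show ?thesis by blast
qed

text \<open>All leaves would be lines through \<open>s\<close>. With \<open>s\<close> along the
  third frame vector, contraction with the radial field leaves \<open>x A + y B = 0\<close>, so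
  \<open>A = y H\<close> and \<open>B = - x H\<close>. The factor \<open>H\<close> of positive
  degree m then divides all coefficients.\<close>

lemma not_radial:
  assumes s: "s \<noteq> 0" and 0: "\<And>v. om v s = 0"
  shows False
proof -
  have cs: "vcnj s \<noteq> 0" using s by (auto simp: vcnj_def prod_eq_iff)
  obtain h where h: "cross (vcnj s) h \<noteq> 0" using exists_cross_ne_0[OF cs] by blast
  define n' where "n' = cross (vcnj s) h"
  \<comment> \<open>The frame belongs to the covector \<open>vcnj s\<close>, so that its third
    vector is a multiple of \<open>s\<close>.\<close>
  define f1 f2 f3 where "f1 = cross (vcnj n') (vcnj s)" and "f2 = n'" and "f3 = vscale (1 / dot (vcnj s) (vcnj (vcnj s))) (vcnj (vcnj s))"
  interpret frame f1 f2 f3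
    unfolding f1_def f2_def f3_def n'_def by (rule frame_of_covector(1)[OF cs h])
  have "vcnj (vcnj s) = s" by (simp add: vcnj_def)
  then have 3: "om v f3 = 0" for v by (simp add: f3_def om_linear 0)
  obtain A where A: "homogeneous (m + 1) A" "\<And>c. eval3 A c = om (lin c) f1"
    using hom_fun_lin[OF hom_fun_om[of f1]] unfolding hom_fun_def by metis
  obtain B where B: "\<And>c. eval3 B c = om (lin c) f2"
    using hom_fun_lin[OF hom_fun_om[of f2]] unfolding hom_fun_def by metis
  have rel: "fst c * eval3 A c + fst (snd c) * eval3 B c = 0" for c
    using om_self[of "lin c"] unfolding A B by (subst (asm) (2) lin_def) (simp add: om_linear 3)
  have A0: "eval3 A (x, 0, z) = 0" for x z
  proof -
    have "x * poly (poly (poly A [:[:z:]:]) [:0:]) x = 0" for x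
      using rel[of "(x, 0, z)"] by (simp add: eval3_def)
    then have "[:0, 1:] * poly (poly A [:[:z:]:]) [:0:] = 0"
      by (intro iffD1[OF poly_all_0_iff_0]) simp
    then have "poly (poly A [:[:z:]:]) [:0:] = 0"
      by (metis mult_eq_0_iff one_neq_zero pCons_eq_0_iff)
    then show ?thesis by (simp add: eval3_def)
  qed
  have "\<exists>H. hom_fun (m + 1 - 1) H \<and> (\<forall>v. eval3 A v = dot (0, 1, 0) v * H v)"
  proof (rule linear_factor[OF hom_fun_eval3[OF A(1)]])
    show "eval3 A v = 0" if "dot (0, 1, 0) v = 0" for v
      using A0[of "fst v" "snd (snd v)"] that by (cases v) (auto simp: dot_def)
  qed (auto simp: prod_eq_iff)
  then obtain H where H: "hom_fun (m + 1 - 1) H" "\<And>v. eval3 A v = dot (0, 1, 0) v * H v"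
    by blast
  obtain HH where HH: "H = eval3 HH" using H(1) by (auto simp: hom_fun_def)
  have "varY * (varX * HH + B) = 0"
  proof (rule eval3_eq_0)
    fix v show "eval3 (varY * (varX * HH + B)) v = 0"
      using rel[of v] H(2)[of v] unfolding eval3_simps eval3_vars by (simp add: HH dot_def algebra_simps)
  qed
  then have "varX * HH + B = 0" by (metis mult_eq_0_iff one_neq_zero pCons_eq_0_iff)
  then have Bv: "eval3 B v = - fst v * H v" for v
    using arg_cong[of _ _ "\<lambda>K. eval3 K v"] HH by (metis add_eq_0_iff eval3_simps(1,3,6) eval3_vars(1) mult_minus_left)
  define p where "p e v = fst (snd (coord v)) * fst (coord e) - fst (coord v) * fst (snd (coord e))" for e v
  have om: "om v e = H (coord v) * p e v" for v e
  proof -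
    have "om v e = om (lin (coord v)) (lin (coord e))" by (simp add: lin_coord)
    also have "\<dots> = fst (coord e) * eval3 A (coord v) + fst (snd (coord e)) * eval3 B (coord v)"
      unfolding A B by (subst (2) lin_def) (simp add: om_linear 3)
    also have "\<dots> = H (coord v) * p e v"
      unfolding Bv H(2) by (simp add: p_def dot_def algebra_simps)
    finally show ?thesis .
  qed
  have hp: "hom_fun 1 (p e)" for e
  proof -
    have "hom_fun 1 (\<lambda>v. (- fst (snd (coord e))) * fst v + fst (coord e) * fst (snd v) + 0 * snd (snd v))"
      by (rule hom_fun_linear)
    from hom_fun_coord[OF this] show ?thesis by (simp add: p_def[abs_def] algebra_simps)
  qed
  have "eval3 P v = H (coord v) * p (1, 0, 0) v" "eval3 Q v = H (coord v) * p (0, 1, 0) v"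
     "eval3 R v = H (coord v) * p (0, 0, 1) v" for v
    using om[of v "(1, 0, 0)"] om[of v "(0, 1, 0)"] om[of v "(0, 0, 1)"] by (simp_all add: om_def dot_def)
  from no_common_factor[OF hom_fun_coord[OF H(1)] _ this hp hp hp] show False
    using m_pos by simp
qed

end

section \<open>Restriction of homogeneous polynomials to affine lines\<close>

lemma poly_poly_1: "poly (poly (poly H 1) Y) x = eval3 H (x, poly Y x, 1)"
proof -
  have "poly (poly B Y) x = poly (poly B [:poly Y x:]) x" for B :: "complex poly poly"
    by (induction B) simp_all
  then show ?thesis by (simp add: eval3_def one_pCons)
qed

lemma homogeneous_restrict:
  assumes H: "homogeneous n H"
  shows "degree (poly (poly H 1) [:e, s:]) \<le> n" "coeff (poly (poly H 1) [:e, s:]) n = eval3 H (1, s, 0)"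
proof -
  have deg: "degree (coeff (coeff H k) j * [:e, s:] ^ j) \<le> n \<and>
      coeff (coeff (coeff H k) j * [:e, s:] ^ j) n = (\<Sum>i\<le>n. coeff (coeff (coeff H k) j) i * 1 ^ i * s ^ j * 0 ^ k)" for j k
  proof (cases "coeff (coeff H k) j = 0")
    case False
    then obtain i where i: "coeff (coeff (coeff H k) j) i \<noteq> 0" by (auto simp: poly_eq_iff)
    then have n: "n = i + j + k" using H by (auto simp: homogeneous_def)
    have m: "coeff (coeff H k) j = monom (coeff (coeff (coeff H k) j) i) i"
    proof (intro poly_eqI)
      fix i' show "coeff (coeff (coeff H k) j) i' = coeff (monom (coeff (coeff (coeff H k) j) i) i) i'"
        using H n unfolding homogeneous_def by (cases "i' = i") (simp, metis add_right_cancel coeff_monom)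
    qed
    have dp: "degree ([:e, s:] ^ j) \<le> j"
      using degree_power_le[of "[:e, s:]" j] by (rule order_trans) simp
    have ct: "coeff ([:e, s:] ^ j) j = s ^ j"
    proof (induction j)
      case (Suc j)
      have "degree ([:e, s:] ^ j) \<le> j"
        using degree_power_le[of "[:e, s:]" j] by (rule order_trans) simp
      then show ?case using Suc by (simp add: coeff_eq_0)
    qed simp
    have "degree (coeff (coeff H k) j) \<le> i" by (subst m) (rule degree_monom_le)
    then have 1: "degree (coeff (coeff H k) j * [:e, s:] ^ j) \<le> i + j"
      using dp by (metis (no_types, lifting) add_mono degree_mult_le order_trans)
    have "coeff (coeff (coeff H k) j * [:e, s:] ^ j) n =
        (if k = 0 then coeff (coeff (coeff H k) j) i * s ^ j else 0)"
    proof (cases "k = 0")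
      case True
      then show ?thesis by (subst m) (simp add: n coeff_monom_mult ct)
    next
      case False
      then show ?thesis using 1 by (simp add: coeff_eq_0 n)
    qed
    also have "\<dots> = (\<Sum>i'\<le>n. if i' = i then coeff (coeff (coeff H k) j) i * s ^ j * 0 ^ k else 0)"
      using n by (simp add: power_0_left)
    also have "\<dots> = (\<Sum>i\<le>n. coeff (coeff (coeff H k) j) i * 1 ^ i * s ^ j * 0 ^ k)"
    proof (rule sum.cong[OF refl])
      fix i' show "(if i' = i then coeff (coeff (coeff H k) j) i * s ^ j * 0 ^ k else 0) =
          coeff (coeff (coeff H k) j) i' * 1 ^ i' * s ^ j * 0 ^ k"
        by (subst (2) m) simp
    qed
    finally show ?thesis using 1 n by simp
  qed simp
  have eq: "poly (poly H 1) [:e, s:] = (\<Sum>k\<le>n. \<Sum>j\<le>n. coeff (coeff H k) j * [:e, s:] ^ j)"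
    by (simp add: poly_altdef_le[OF homogeneous_degrees(1)[OF H]] poly_sum
        poly_altdef_le[OF homogeneous_degrees(2)[OF H]])
  show "degree (poly (poly H 1) [:e, s:]) \<le> n"
    unfolding eq using deg by (intro degree_sum_le) auto
  show "coeff (poly (poly H 1) [:e, s:]) n = eval3 H (1, s, 0)"
    unfolding eq eval3_expand[OF H] coeff_sum using deg by simp
qed

lemma pderiv_poly_1: "pderiv (poly H 1) = poly (dY H) 1"
  unfolding dY_def by (induction H) (simp_all add: map_poly_pCons pderiv_add)

lemma homogeneous_dY: "homogeneous n H \<Longrightarrow> homogeneous (n - 1) (dY H)"
  unfolding homogeneous_def dY_def
proof (intro allI impI)
  fix i j k
  assume H: "\<forall>i j k. coeff (coeff (coeff H k) j) i \<noteq> 0 \<longrightarrow> i + j + k = n"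
    and "coeff (coeff (coeff (map_poly pderiv H) k) j) i \<noteq> 0"
  then have "coeff (coeff (coeff H k) (Suc j)) i \<noteq> 0"
    by (simp add: coeff_map_poly coeff_pderiv of_nat_poly del: of_nat_Suc)
  then have "i + Suc j + k = n" using H by blast
  then show "i + j + k = n - 1" by simp
qed

lemma continuous_on_eval3:
  assumes "homogeneous n H" "continuous_on U f" "continuous_on U g" "continuous_on U h"
  shows "continuous_on U (\<lambda>z. eval3 H (f z, g z, h z))"
  unfolding eval3_expand[OF assms(1)] by (intro continuous_intros assms(2-4))

lemma eval3_1_poly:
  assumes "homogeneous n H"
  shows "\<exists>C. \<forall>y. eval3 H (1, y, 0) = poly C y"
proof
  show "\<forall>y. eval3 H (1, y, 0) = poly (\<Sum>k\<le>n. \<Sum>j\<le>n. \<Sum>i\<le>n. smult (coeff (coeff (coeff H k) j) i * 0 ^ k) ([:0, 1:] ^ j)) y"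
    unfolding eval3_expand[OF assms] by (simp add: poly_sum mult_ac)
qed

text \<open>Unique factorization: each of the distinct linear factors goes to exactly one of
  \<open>A\<close> and \<open>B\<close>.\<close>

lemma factor_eq_prod_roots:
  fixes A B :: "complex poly"
  assumes "finite I" "inj_on x I" "c \<noteq> 0" "A * B = smult c (\<Prod>i\<in>I. [:- x i, 1:])"
  shows "A = smult (lead_coeff A) (\<Prod>i\<in>{i\<in>I. poly A (x i) = 0}. [:- x i, 1:])"
  using assms
proof (induction I arbitrary: A B rule: finite_induct)
  case empty
  then have AB: "A * B = [:c:]" by simp
  then have "A \<noteq> 0" "B \<noteq> 0" using \<open>c \<noteq> 0\<close> by auto
  then have "degree A = 0" using degree_mult_eq[of A B] AB by simp
  then show ?case by (auto elim: degree_eq_zeroE)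
next
  case (insert j I)
  have inj: "inj_on x I" and xj: "i \<in> I \<Longrightarrow> x i \<noteq> x j" for i
    using insert.prems(1) insert.hyps(2) by (auto simp: inj_on_def)
  have AB: "A * B = [:- x j, 1:] * smult c (\<Prod>i\<in>I. [:- x i, 1:])"
    using insert.prems(3) insert.hyps by (simp add: mult_ac)
  have ne: "poly (smult c (\<Prod>i\<in>I. [:- x i, 1:])) (x j) \<noteq> 0"
    using xj insert.prems(2) insert.hyps(1) by (force simp: poly_prod)
  have "poly A (x j) * poly B (x j) = 0" using arg_cong[OF AB, of "\<lambda>p. poly p (x j)"] by simp
  then consider "poly A (x j) = 0" | "poly A (x j) \<noteq> 0" "poly B (x j) = 0" by auto
  then show ?case
  proof cases
    case 1
    then obtain A' where A': "A = [:- x j, 1:] * A'" by (metis poly_eq_0_iff_dvd dvdE)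
    then have "[:- x j, 1:] * (A' * B) = [:- x j, 1:] * smult c (\<Prod>i\<in>I. [:- x i, 1:])"
      using AB by (simp only: mult.assoc)
    then have *: "A' * B = smult c (\<Prod>i\<in>I. [:- x i, 1:])" by (subst (asm) mult_cancel_left) auto
    have IH: "A' = smult (lead_coeff A') (\<Prod>i\<in>{i\<in>I. poly A' (x i) = 0}. [:- x i, 1:])"
      by (rule insert.IH[OF inj \<open>c \<noteq> 0\<close> *])
    have S: "{i\<in>insert j I. poly A (x i) = 0} = insert j {i\<in>I. poly A' (x i) = 0}"
      using xj by (auto simp: A')
    have lc: "lead_coeff A = lead_coeff A'" unfolding A' lead_coeff_mult by simp
    have "(\<Prod>i\<in>{i\<in>insert j I. poly A (x i) = 0}. [:- x i, 1:]) =
        [:- x j, 1:] * (\<Prod>i\<in>{i\<in>I. poly A' (x i) = 0}. [:- x i, 1:])"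
      unfolding S using insert.hyps by (subst prod.insert) auto
    then have "smult (lead_coeff A) (\<Prod>i\<in>{i\<in>insert j I. poly A (x i) = 0}. [:- x i, 1:]) =
        [:- x j, 1:] * smult (lead_coeff A') (\<Prod>i\<in>{i\<in>I. poly A' (x i) = 0}. [:- x i, 1:])"
      by (simp only: lc mult_smult_right)
    also have "\<dots> = A" by (simp only: IH[symmetric] A')
    finally show ?thesis ..
  next
    case 2
    then obtain B' where B': "B = [:- x j, 1:] * B'" by (metis poly_eq_0_iff_dvd dvdE)
    then have "[:- x j, 1:] * (A * B') = [:- x j, 1:] * smult c (\<Prod>i\<in>I. [:- x i, 1:])"
      using AB by (simp only: mult.left_commute)
    then have *: "A * B' = smult c (\<Prod>i\<in>I. [:- x i, 1:])" by (subst (asm) mult_cancel_left) auto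
    have "{i\<in>insert j I. poly A (x i) = 0} = {i\<in>I. poly A (x i) = 0}" using 2 by auto
    then show ?thesis using insert.IH[OF inj \<open>c \<noteq> 0\<close> *] by simp
  qed
qed

subsection \<open>Affine charts with an invariant line at infinity\<close>

text \<open>Affine coordinates along \<open>f1\<close> and \<open>f2\<close> with the invariant line
  \<open>l0\<close> at infinity. The vertical direction \<open>f2\<close> lies on none of the lines
  in \<open>J\<close>, so each has an equation \<open>y = al x + be\<close>.\<close>

locale convex_chart = plane_foliation P Q R m + frame f1 f2 f3
  for P Q R m f1 f2 f3 +
  fixes l0 :: vec and J :: "vec set"
  assumes inv0: "inv_line l0" and f12: "dot l0 f1 = 0" "dot l0 f2 = 0" and f3: "dot l0 f3 = 1"
    and fin_J: "finite J" and card_J: "card J = 3 * m - 1" and inv_J: "l \<in> J \<Longrightarrow> inv_line l"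
    and f2_J: "l \<in> J \<Longrightarrow> dot l f2 \<noteq> 0" and cross_J: "l \<in> J \<Longrightarrow> k \<in> J \<Longrightarrow> l \<noteq> k \<Longrightarrow> cross l k \<noteq> 0"
begin

text \<open>Because \<open>l0\<close> is invariant, the form evaluated on a direction of
  \<open>l0\<close> vanishes along \<open>l0\<close> and is divisible by the third coordinate. The
  quotients for \<open>f1\<close> and \<open>f2\<close> have degree m; up to a sign they are the
  components of the affine vector field.\<close>

definition slope :: "vec \<Rightarrow> ternary" where
  "slope f = (SOME H. homogeneous m H \<and> (\<forall>c. om (lin c) f = snd (snd c) * eval3 H c))"

lemma slope:
  assumes "dot l0 f = 0"
  shows "homogeneous m (slope f)" "om (lin c) f = snd (snd c) * eval3 (slope f) c"
proof -
  have 0: "om (lin (x, y, 0)) f = 0" for x y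
  proof -
    have "dot l0 (lin (x, y, 0)) = 0" by (simp add: lin_def dot_simps f12)
    then show ?thesis using inv0 assms unfolding inv_line_def by blast
  qed
  have pos: "0 < m + 1" by simp
  obtain g where g: "hom_fun (m + 1 - 1) g" "\<And>c. om (lin c) f = snd (snd c) * g c"
    using hom_fun_vanish_z[OF hom_fun_lin[OF hom_fun_om] pos 0] by blast
  obtain H where "homogeneous m H" "g = eval3 H" using g(1) by (auto simp: hom_fun_def)
  then have "\<exists>H. homogeneous m H \<and> (\<forall>c. om (lin c) f = snd (snd c) * eval3 H c)" using g(2) by blast
  from someI_ex[OF this] show "homogeneous m (slope f)" "om (lin c) f = snd (snd c) * eval3 (slope f) c"
    unfolding slope_def[symmetric] by blast+
qed

lemmas slope1 = slope[OF f12(1)] and slope2 = slope[OF f12(2)]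

definition al :: "vec \<Rightarrow> complex" where "al l = - dot l f1 / dot l f2"
definition be :: "vec \<Rightarrow> complex" where "be l = - dot l f3 / dot l f2"
definition aB :: "complex poly poly" where "aB = poly (slope f2) 1"
definition bB :: "complex poly poly" where "bB = - poly (slope f1) 1"
text \<open>Values at the point at infinity \<open>(1, c, 0)\<close> of a line of slope
  \<open>c\<close>: these are the top coefficients of \<open>a\<close>, \<open>T\<close> and
  \<open>Tq\<close> on any line of that slope.\<close>

definition \<alpha> :: "complex \<Rightarrow> complex" where "\<alpha> c = eval3 (slope f2) (1, c, 0)"
definition \<tau> :: "complex \<Rightarrow> complex" where "\<tau> c = c * \<alpha> c + eval3 (slope f1) (1, c, 0)"
definition \<theta> :: "complex \<Rightarrow> complex" where
  "\<theta> c = - eval3 (dY (slope f1)) (1, c, 0) - c * eval3 (dY (slope f2)) (1, c, 0)"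

lemma coeff_derivs:
  obtains \<alpha>' \<tau>' \<theta>' where "\<And>c. (\<alpha> has_field_derivative \<alpha>' c) (at c)"
    "\<And>c. (\<tau> has_field_derivative \<tau>' c) (at c)" "\<And>c. (\<theta> has_field_derivative \<theta>' c) (at c)"
proof -
  obtain A where A: "\<And>y. eval3 (slope f1) (1, y, 0) = poly A y" using eval3_1_poly[OF slope1(1)] by blast
  obtain B where B: "\<And>y. eval3 (slope f2) (1, y, 0) = poly B y" using eval3_1_poly[OF slope2(1)] by blast
  obtain A' where A': "\<And>y. eval3 (dY (slope f1)) (1, y, 0) = poly A' y"
    using eval3_1_poly[OF homogeneous_dY[OF slope1(1)]] by blast
  obtain B' where B': "\<And>y. eval3 (dY (slope f2)) (1, y, 0) = poly B' y"
    using eval3_1_poly[OF homogeneous_dY[OF slope2(1)]] by blast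
  have eq: "\<alpha> = poly B" "\<tau> = poly ([:0, 1:] * B + A)" "\<theta> = poly (- A' - [:0, 1:] * B')"
    by (simp_all add: fun_eq_iff \<alpha>_def \<tau>_def \<theta>_def A B A' B')
  show thesis by (rule that; subst eq) (rule poly_DERIV)+
qed

lemma m_less_card: "m < card J"
  using card_J m_pos by linarith

text \<open>The vector field applied to \<open>y - al x\<close>; it vanishes on every invariant line
  with this slope.\<close>

definition GB :: "vec \<Rightarrow> complex poly poly" where "GB l = bB - smult [:al l:] aB"

lemma dir: "l \<in> J \<Longrightarrow> dot l (f1 + vscale (al l) f2) = 0"
  using f2_J by (simp add: dot_simps al_def)

lemma GB_eq: "poly (poly (GB l) Y) x = - om (lin (x, poly Y x, 1)) (f1 + vscale (al l) f2)"
proof -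
  have "poly (poly bB Y) x = - om (lin (x, poly Y x, 1)) f1"
    unfolding bB_def poly_minus poly_poly_1 by (simp add: slope1)
  moreover have "poly (poly aB Y) x = om (lin (x, poly Y x, 1)) f2"
    unfolding aB_def poly_poly_1 by (simp add: slope2)
  ultimately show ?thesis by (simp add: GB_def om_linear)
qed

lemma GB_line: 
  assumes l: "l \<in> J" and al: "al l = al k"
  shows "poly (GB k) [:be l, al l:] = 0"
proof (intro iffD1[OF poly_all_0_iff_0] allI)
  fix x
  have "dot l (lin (x, be l + x * al l, 1)) = 0"
    using f2_J[OF l] by (simp add: lin_def dot_simps al_def be_def field_simps)
  then have "om (lin (x, be l + x * al l, 1)) (f1 + vscale (al l) f2) = 0"
    using inv_J[OF l] dir[OF l] unfolding inv_line_def by blast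
  then show "poly (poly (GB k) [:be l, al l:]) x = 0" by (simp add: GB_eq al)
qed

lemma degree_GB: "degree (GB k) \<le> m"
  unfolding GB_def aB_def bB_def
proof (intro degree_diff_le)
  have d: "degree (poly H 1) \<le> m" if H: "homogeneous m H" for H
    unfolding poly_altdef_le[OF homogeneous_degrees(1)[OF H]]
    by (intro degree_sum_le) (auto simp: homogeneous_degrees(2)[OF H])
  show "degree (- poly (slope f1) 1) \<le> m" using d[OF slope1(1)] by simp
  show "degree (smult [:al k:] (poly (slope f2) 1)) \<le> m" using d[OF slope2(1)] degree_smult_le le_trans by blast
qed

lemma be_inj:
  assumes "l \<in> J" "k \<in> J" "al l = al k" "be l = be k"
  shows "l = k"
proof (rule ccontr)
  assume "l \<noteq> k"
  let ?s = "vscale (dot k f2) l - vscale (dot l f2) k"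
  have "dot ?s f2 = 0" "dot ?s f1 = 0" "dot ?s f3 = 0"
    using assms(3,4) f2_J[OF assms(1)] f2_J[OF assms(2)]
    by (simp_all add: al_def be_def field_simps) (simp_all add: dot_def algebra_simps)
  then have s: "dot ?s (lin c) = 0" for c by (simp add: lin_def dot_simps(1,2))
  have "dot ?s v = 0" for v using s[of "coord v"] by (simp only: lin_coord)
  then have "?s = 0" using dot_vcnj_ne_0[of ?s] by (simp only:) blast
  then have eq: "vscale (dot k f2) l = vscale (dot l f2) k" by (simp only: right_minus_eq)
  have "vscale (dot k f2) (cross l k) = cross (vscale (dot l f2) k) k"
    by (simp only: cross_vscale[symmetric] eq)
  also have "\<dots> = 0" by (simp add: cross_def zero_prod_def)
  finally have "vscale (dot k f2) (cross l k) = 0" .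
  then show False using cross_J[OF assms(1,2) \<open>l \<noteq> k\<close>] f2_J[OF assms(2)]
    by (auto simp: vscale_def prod_eq_iff)
qed

text \<open>If all slopes agreed, \<open>GB k\<close> would have degree at most m in y but 3m - 1 >
  m linear roots, hence vanish. Then the foliation would consist of parallel lines, which
  \<open>not_radial\<close> excludes.\<close>

lemma not_all_parallel: "\<exists>j\<in>J. \<exists>k\<in>J. al j \<noteq> al k"
proof (rule ccontr)
  assume "\<not> ?thesis"
  then have par: "al j = al k" if "j \<in> J" "k \<in> J" for j k using that by blast
  obtain k where k: "k \<in> J" using m_less_card by (metis card.empty ex_in_conv not_less0)
  have "GB k = 0"
  proof (rule ccontr)
    assume "GB k \<noteq> 0"
    have inj: "inj_on (\<lambda>l. [:be l, al l:]) J" using be_inj by (auto simp: inj_on_def)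
    have "card J = card ((\<lambda>l. [:be l, al l:]) ` J)" using inj by (simp add: card_image)
    also have "\<dots> \<le> card {Y. poly (GB k) Y = 0}"
      by (rule card_mono[OF poly_roots_finite[OF \<open>GB k \<noteq> 0\<close>]]) (use GB_line par k in blast)
    also have "\<dots> \<le> m"
      using card_poly_roots_bound[OF \<open>GB k \<noteq> 0\<close>] degree_GB[of k] by linarith
    finally show False using m_less_card by simp
  qed
  define s where "s = f1 + vscale (al k) f2"
  have "dot s (cross f2 f3) = dot f1 (cross f2 f3)"
    by (simp add: s_def dot_simps cross_orth)
  then have "s \<noteq> 0" using det_ne by (auto simp: dot_def)
  moreover have "om v s = 0" for v
  proof -
    have aff: "om (lin (x, y, 1)) s = 0" for x y
      using GB_eq[of k "[:y:]" x] \<open>GB k = 0\<close> by (simp add: s_def)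
    obtain x y z where c: "coord v = (x, y, z)" by (cases "coord v")
    have "om (lin (x, y, z)) s = 0"
    proof (cases "z = 0")
      case True
      then show ?thesis by (simp add: s_def om_linear slope1(2) slope2(2))
    next
      case False
      then have "lin (x, y, z) = vscale z (lin (x / z, y / z, 1))"
        by (simp add: lin_def vscale_def distrib_left)
      then show ?thesis by (simp add: om_scale aff)
    qed
    then show ?thesis using lin_coord[of v] c by simp
  qed
  ultimately show False by (rule not_radial)
qed

end

context plane_foliation
begin

text \<open>The line \<open>u\<close> avoids the intersections of the lines of \<open>\<Lambda>\<close> and meets each of them in a point,
  necessarily a multiple of \<open>cross u l\<close>, at which the foliation is regular.\<close>

definition generic :: "vec set \<Rightarrow> vec \<Rightarrow> bool" where
  "generic \<Lambda> u \<longleftrightarrow> (\<forall>l\<in>\<Lambda>. \<forall>k\<in>\<Lambda>. l \<noteq> k \<longrightarrow> dot u (cross l k) \<noteq> 0) \<and> (\<forall>l\<in>\<Lambda>. om (cross u l) (vcnj l) \<noteq> 0)"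

text \<open>The vectors \<open>v\<close> and \<open>cross u l\<close> both represent the
  intersection of the two lines, so they are proportional, and genericity makes the foliation
  regular there.\<close>

lemma om_ne_0_generic:
  assumes l: "inv_line l" and u: "om (cross u l) (vcnj l) \<noteq> 0"
    and v: "dot l v = 0" "dot u v = 0" "v \<noteq> 0" and h: "dot l h \<noteq> 0"
  shows "om v h \<noteq> 0"
proof -
  have "cross (cross u l) v = vscale (dot u v) l - vscale (dot l v) u"
    by (intro vec_eqI; simp add: cross_def dot_def vscale_def algebra_simps)
  then have "cross v (cross u l) = 0"
    using v(1,2) triple_swap(3)[of v "cross u l"] by (simp add: vscale_def zero_prod_def)
  then obtain c where "cross u l = vscale c v"
    using cross_eq_0_imp_proportional[OF v(3)] by blast
  then have "om v (vcnj l) \<noteq> 0" using u by (auto simp: om_scale)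
  moreover have "dot l (vcnj l) \<noteq> 0" using l dot_vcnj_ne_0 by (simp add: inv_line_def)
  ultimately show ?thesis unfolding om_parallel[OF l v(1), of h] using h by simp
qed

end

locale generic_line = convex_chart +
  fixes u :: vec
  assumes u_f2: "dot u f2 \<noteq> 0" and gen: "generic (insert l0 J) u"
begin

section \<open>The tangency data on a generic line \<open>u\<close>, in the form
  \<open>y = pp x - qq\<close>\<close>

definition pp :: complex where "pp = - dot u f1 / dot u f2"
definition qq :: complex where "qq = dot u f3 / dot u f2"
definition aL :: "complex poly" where "aL = poly aB [:- qq, pp:]"
definition TL :: "complex poly" where "TL = smult pp aL - poly bB [:- qq, pp:]"
definition TqL :: "complex poly" where
  "TqL = poly (pderiv bB) [:- qq, pp:] - smult pp (poly (pderiv aB) [:- qq, pp:])"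
definition aqL :: "complex poly" where "aqL = - poly (pderiv aB) [:- qq, pp:]"
definition lamL :: "vec \<Rightarrow> complex" where "lamL l = (qq + be l) / (pp - al l)"
definition pt :: "complex \<Rightarrow> vec" where "pt x = lin (x, pp * x - qq, 1)"
definition dr :: vec where "dr = f1 + vscale pp f2"

lemma u_dr: "dot u dr = 0" using u_f2 by (simp add: dr_def dot_simps pp_def)

lemma pt_eq: "pt x = (f3 - vscale qq f2) + vscale x dr"
  by (intro vec_eqI; simp add: pt_def dr_def lin_def algebra_simps)

lemma u_pt: "dot u (pt x) = 0"
proof -
  have "dot u (f3 - vscale qq f2) = 0" using u_f2 by (simp add: dot_simps qq_def)
  then show ?thesis by (simp add: pt_eq dot_simps(1,2) u_dr)
qed

lemma l0_pt: "dot l0 (pt x) = 1"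
  by (simp add: pt_def lin_def dot_simps f12 f3)

lemma pt_ne_0: "pt x \<noteq> 0"
  using l0_pt[of x] by (auto simp: dot_def)

lemma l0_notin_J: "l0 \<notin> J"
  using f2_J[of l0] f12 by auto

lemma pp_al: "l \<in> J \<Longrightarrow> pp - al l \<noteq> 0"
proof
  assume l: "l \<in> J" and 0: "pp - al l = 0"
  have "dot u dr = 0" by (rule u_dr)
  moreover have "dot l dr = 0" using dir[OF l] 0 by (simp add: dr_def)
  moreover have "dot l0 dr = 0" by (simp add: dr_def dot_simps f12)
  ultimately have z: "dot u dr = 0" "dot l dr = 0" "dot l0 dr = 0" .
  \<comment> \<open>Cramer's rule: a vector annihilated by the three independent covectors
    \<open>u\<close>, \<open>l\<close>, \<open>l0\<close> is zero.\<close>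
  have "vscale (dot u (cross l l0)) dr = vscale (dot u dr) (cross l l0) + (vscale (dot l dr) (cross l0 u) + vscale (dot l0 dr) (cross u l))"
    by (intro vec_eqI; simp add: cross_def dot_def vscale_def algebra_simps)
  then have "vscale (dot u (cross l l0)) dr = 0" unfolding z by (simp add: vscale_def zero_prod_def)
  moreover have "dot u (cross l l0) \<noteq> 0" using gen l l0_notin_J by (auto simp: generic_def)
  ultimately have "dr = 0" by (auto simp: vscale_def prod_eq_iff)
  moreover have "dot dr (cross f2 f3) = dot f1 (cross f2 f3)"
    by (simp add: dr_def dot_simps cross_orth)
  ultimately show False using det_ne by (simp add: dot_def)
qed

lemma dr_ne_0: "dr \<noteq> 0"
proof
  assume "dr = 0"
  moreover have "dot dr (cross f2 f3) = dot f1 (cross f2 f3)"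
    by (simp add: dr_def dot_simps cross_orth)
  ultimately show False using det_ne by (simp add: dot_def)
qed

lemma dot_pt:
  assumes l: "l \<in> J"
  shows "dot l (pt x) = dot l f2 * (pp - al l) * (x - lamL l)"
proof -
  have "(pp - al l) * (x - lamL l) = (pp - al l) * x - (qq + be l)"
    using pp_al[OF l] by (simp add: lamL_def right_diff_distrib)
  moreover have "dot l f1 = - al l * dot l f2" "dot l f3 = - be l * dot l f2"
    using f2_J[OF l] by (simp_all add: al_def be_def)
  ultimately show ?thesis
    by (simp only: mult.assoc) (simp add: pt_def lin_def dot_simps algebra_simps)
qed

lemma poly_aL: "poly aL x = om (pt x) f2"
  unfolding aL_def aB_def poly_poly_1 by (simp add: pt_def slope2 algebra_simps)

lemma poly_TL: "poly TL x = om (pt x) dr"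
  unfolding TL_def aL_def aB_def bB_def poly_minus poly_diff poly_smult poly_poly_1
  by (simp add: pt_def dr_def om_linear slope1 slope2 algebra_simps)

lemma a_lamL: "l \<in> J \<Longrightarrow> poly aL (lamL l) \<noteq> 0"
  unfolding poly_aL
  by (rule om_ne_0_generic[of l u]) (use gen inv_J f2_J u_pt pt_ne_0 dot_pt in \<open>auto simp: generic_def\<close>)

lemma inj_lamL: "inj_on lamL J"
proof (rule inj_onI, rule ccontr)
  fix l k assume lk: "l \<in> J" "k \<in> J" "lamL l = lamL k" "l \<noteq> k"
  let ?v = "pt (lamL l)"
  have z: "dot u ?v = 0" "dot l ?v = 0" "dot k ?v = 0"
    using dot_pt[OF lk(1), of "lamL l"] dot_pt[OF lk(2), of "lamL l"] by (simp_all add: u_pt lk(3))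
  have "vscale (dot u (cross l k)) ?v = vscale (dot u ?v) (cross l k) + (vscale (dot l ?v) (cross k u) + vscale (dot k ?v) (cross u l))"
    by (intro vec_eqI; simp add: cross_def dot_def vscale_def algebra_simps)
  then have "vscale (dot u (cross l k)) ?v = 0" unfolding z by (simp add: vscale_def zero_prod_def)
  moreover have "dot u (cross l k) \<noteq> 0" using gen lk by (auto simp: generic_def)
  ultimately show False using pt_ne_0[of "lamL l"] by (auto simp: vscale_def prod_eq_iff)
qed

lemma degree_aL: "degree aL \<le> m" and coeff_aL: "coeff aL m = \<alpha> pp"
  unfolding aL_def aB_def \<alpha>_def using homogeneous_restrict[OF slope2(1)] by auto

lemma degree_TL: "degree TL \<le> m" and coeff_TL: "coeff TL m = \<tau> pp"
proof -
  show "degree TL \<le> m"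
    unfolding TL_def bB_def poly_minus
    by (intro degree_diff_le order_trans[OF degree_smult_le] degree_aL)
       (simp add: homogeneous_restrict[OF slope1(1)])
  show "coeff TL m = \<tau> pp"
    unfolding TL_def bB_def poly_minus coeff_diff coeff_smult coeff_minus coeff_aL
    by (simp add: homogeneous_restrict[OF slope1(1)] \<tau>_def)
qed

lemma aqL_eq: "aqL = - poly (poly (dY (slope f2)) 1) [:- qq, pp:]"
  by (simp add: aqL_def aB_def pderiv_poly_1)

lemma TqL_eq: "TqL = - poly (poly (dY (slope f1)) 1) [:- qq, pp:] - smult pp (poly (poly (dY (slope f2)) 1) [:- qq, pp:])"
  by (simp add: TqL_def aB_def bB_def pderiv_poly_1 pderiv_minus)

lemma degree_aqL: "degree aqL \<le> m - 1"
  unfolding aqL_eq degree_minus by (rule homogeneous_restrict(1)[OF homogeneous_dY[OF slope2(1)]])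

lemma degree_TqL: "degree TqL \<le> m - 1" and coeff_TqL: "coeff TqL (m - 1) = \<theta> pp"
proof -
  note 1 = homogeneous_restrict[OF homogeneous_dY[OF slope1(1)]] and 2 = homogeneous_restrict[OF homogeneous_dY[OF slope2(1)]]
  show "degree TqL \<le> m - 1"
    unfolding TqL_eq by (intro degree_diff_le order_trans[OF degree_smult_le] 2) (simp only: degree_minus 1)
  show "coeff TqL (m - 1) = \<theta> pp"
    unfolding TqL_eq coeff_diff coeff_minus coeff_smult 1 2 \<theta>_def ..
qed

text \<open>Contraction with the radial field, divided by the third coordinate and read at infinity,
  identifies \<open>\<tau> pp\<close> with \<open>- om dr f3\<close>. This is nonzero because the
  line meets \<open>l0\<close> at a regular point. Hence no tangency escapes to infinity.\<close>

lemma \<tau>_ne_0: "\<tau> pp \<noteq> 0"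
proof -
  let ?v = "lin (1, pp, 0)"
  have v: "?v = dr" by (intro vec_eqI; simp add: lin_def dr_def)
  obtain H where H: "homogeneous (m + 1) H" "\<And>c. om (lin c) f3 = eval3 H c"
    using hom_fun_lin[OF hom_fun_om[of f3]] unfolding hom_fun_def fun_eq_iff by blast
  have "varZ * (varX * slope f1 + varY * slope f2 + H) = 0"
  proof (rule eval3_eq_0)
    fix c
    have "om (lin c) (lin c) = fst c * om (lin c) f1 + fst (snd c) * om (lin c) f2 + snd (snd c) * om (lin c) f3"
      by (subst (2) lin_def) (simp add: om_linear)
    then have "snd (snd c) * (fst c * eval3 (slope f1) c + fst (snd c) * eval3 (slope f2) c + eval3 H c) = 0"
      unfolding om_self slope1(2) slope2(2) H(2) by (simp add: algebra_simps)
    then show "eval3 (varZ * (varX * slope f1 + varY * slope f2 + H)) c = 0"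
      unfolding eval3_simps eval3_vars by simp
  qed
  then have "varX * slope f1 + varY * slope f2 + H = 0" by (simp only: mult_eq_0_iff) simp
  from arg_cong[OF this, of "\<lambda>K. eval3 K (1, pp, 0)"]
  have "eval3 (slope f1) (1, pp, 0) + pp * eval3 (slope f2) (1, pp, 0) + om ?v f3 = 0"
    unfolding eval3_simps eval3_vars H(2) by simp
  then have "\<tau> pp = - om dr f3"
    unfolding \<tau>_def \<alpha>_def v by (simp add: eq_neg_iff_add_eq_0 algebra_simps)
  moreover have "om dr f3 \<noteq> 0"
    by (rule om_ne_0_generic[of l0 u]) (use inv0 gen u_dr dr_ne_0 f3 in \<open>auto simp: generic_def dr_def dot_simps f12\<close>)
  ultimately show ?thesis by simp
qed

lemma cofactorL:
  assumes l: "l \<in> J"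
  shows "aL - smult (1 / (pp - al l)) TL = [:- lamL l, 1:] * ((aL - smult (1 / (pp - al l)) TL) div [:- lamL l, 1:])"
    and "(pp - al l) * poly aqL (lamL l) =
      poly TqL (lamL l) - poly ((aL - smult (1 / (pp - al l)) TL) div [:- lamL l, 1:]) (lamL l)"
proof -
  let ?\<pi> = "pp - al l"
  note \<pi> = pp_al[OF l]
  \<comment> \<open>\<open>S\<close> is the cofactor of the line in the whole plane; its restriction
    to the line \<open>u\<close> is the quotient in the claim. Both claims come from this equation
    and its derivative in y.\<close>
  obtain S where S: "GB l = [:- [:be l, al l:], 1:] * S"
    using GB_line[OF l refl] by (metis poly_eq_0_iff_dvd dvdE)
  let ?Y = "[:- qq, pp:]"
  have lin: "?Y - [:be l, al l:] = smult ?\<pi> [:- lamL l, 1:]"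
    using \<pi> by (simp add: lamL_def)
  have g: "poly [:- c, 1:] Y = Y - c" for c Y :: "complex poly" by simp
  have "poly (GB l) ?Y = (?Y - [:be l, al l:]) * poly S ?Y" unfolding S poly_mult g ..
  moreover have "poly (GB l) ?Y = smult pp aL - TL - smult (al l) aL"
    by (simp add: GB_def TL_def aL_def)
  moreover have "smult pp aL - TL - smult (al l) aL = smult ?\<pi> (aL - smult (1 / ?\<pi>) TL)"
    using \<pi> by (simp add: smult_diff_right smult_diff_left)
  ultimately have "smult ?\<pi> (aL - smult (1 / ?\<pi>) TL) = smult ?\<pi> ([:- lamL l, 1:] * poly S ?Y)"
    unfolding lin by (simp only: mult_smult_left)
  then have eq: "aL - smult (1 / ?\<pi>) TL = [:- lamL l, 1:] * poly S ?Y"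
    by (rule smult_cancel[OF \<pi>])
  have C: "(aL - smult (1 / ?\<pi>) TL) div [:- lamL l, 1:] = poly S ?Y"
    unfolding eq by (rule nonzero_mult_div_cancel_left) simp
  show "aL - smult (1 / ?\<pi>) TL = [:- lamL l, 1:] * ((aL - smult (1 / ?\<pi>) TL) div [:- lamL l, 1:])"
    unfolding C by (rule eq)
  have d: "pderiv [:- [:be l, al l:], 1:] = 1" by (simp add: pderiv_pCons)
  have "poly (pderiv (GB l)) ?Y = (?Y - [:be l, al l:]) * poly (pderiv S) ?Y + poly S ?Y"
    unfolding S pderiv_mult d poly_add poly_mult g by simp
  then have 1: "poly (poly (pderiv (GB l)) ?Y) (lamL l) = poly (poly S ?Y) (lamL l)"
    unfolding lin by simp
  have "pderiv (GB l) = pderiv bB - smult [:al l:] (pderiv aB)"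
    by (simp add: GB_def pderiv_diff pderiv_smult)
  then have 2: "poly (pderiv (GB l)) ?Y = TqL - smult ?\<pi> aqL"
    by (simp add: TqL_def aqL_def smult_diff_left)
  have "a - b = c \<Longrightarrow> b = a - c" for a b c :: complex by auto
  moreover have "poly TqL (lamL l) - ?\<pi> * poly aqL (lamL l) = poly (poly S ?Y) (lamL l)"
    using 1 unfolding 2 by simp
  ultimately show "?\<pi> * poly aqL (lamL l) = poly TqL (lamL l) - poly ((aL - smult (1 / ?\<pi>) TL) div [:- lamL l, 1:]) (lamL l)"
    unfolding C by blast
qed

theorem tangency_lineI:
  assumes "simple_roots TL It t (\<tau> pp) m"
  shows "tangency_line TL It t (\<tau> pp) m aL TqL aqL J lamL (\<lambda>l. pp - al l)
    (\<lambda>l. (aL - smult (1 / (pp - al l)) TL) div [:- lamL l, 1:])"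
proof -
  interpret simple_roots TL It t "\<tau> pp" m by (rule assms)
  show ?thesis
  proof
    show "degree aL \<le> m" "degree TqL \<le> m - 1" "degree aqL \<le> m - 1" "finite J" "card J = 3 * m - 1" "inj_on lamL J"
      by (fact degree_aL degree_TqL degree_aqL fin_J card_J inj_lamL)+
    show "\<exists>j\<in>J. \<exists>k\<in>J. pp - al j \<noteq> pp - al k" using not_all_parallel by simp
  qed (fact pp_al cofactorL a_lamL)+
qed

end

subsection \<open>Genericity is an open dense condition\<close>

definition dual :: "complex \<times> complex \<Rightarrow> vec" where "dual z = (fst z, -1, - snd z)"

lemma dual_dense:
  assumes f: "hom_fun n f" "f w \<noteq> 0" and U: "open U" "z \<in> U"
  shows "\<exists>z'\<in>U. f (dual z') \<noteq> 0"
proof (rule ccontr)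
  assume "\<not> ?thesis"
  then have 0: "f (dual z') = 0" if "z' \<in> U" for z' using that by blast
  obtain H where H: "homogeneous n H" "f = eval3 H" using f(1) by (auto simp: hom_fun_def)
  have all: "eval3 H (p, -1, - q) = 0" for p q
  proof -
    let ?g = "\<lambda>t::complex. (fst z + t * (p - fst z), snd z + t * (q - snd z))"
    define C where "C = (\<Sum>k\<le>n. \<Sum>j\<le>n. \<Sum>i\<le>n. smult (coeff (coeff (coeff H k) j) i * (-1) ^ j)
        ([:fst z, p - fst z:] ^ i * [:- snd z, - (q - snd z):] ^ k))"
    have C: "poly C t = f (dual (?g t))" for t
      unfolding H(2) dual_def eval3_expand[OF H(1)] C_def fst_conv snd_conv
      by (simp add: poly_sum poly_power algebra_simps)
    have "open (?g -` U)"
      by (rule open_vimage[OF U(1)]) (intro continuous_intros)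
    moreover have "0 \<in> ?g -` U" using U(2) by simp
    ultimately obtain e where e: "e > 0" "ball 0 e \<subseteq> ?g -` U" by (meson open_contains_ball)
    have "C = 0"
    proof (rule ccontr)
      assume "C \<noteq> 0"
      then have "finite {t. poly C t = 0}" by (rule poly_roots_finite)
      moreover have "ball 0 e \<subseteq> {t. poly C t = 0}" using e(2) 0 C by auto
      ultimately have "finite (ball (0::complex) e)" by (rule rev_finite_subset)
      then show False using e(1) finite_imp_not_open[of "ball (0::complex) e"] by simp
    qed
    then show ?thesis using C[of 1] by (simp add: H(2) dual_def)
  qed
  \<comment> \<open>\<open>dual\<close> reaches only covectors with nonzero second coordinate, up to
    scaling; multiplication by \<open>varY\<close> takes care of the others.\<close>
  have "varY * H = 0"
  proof (rule eval3_eq_0)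
    fix v :: vec
    obtain x y zz where v: "v = (x, y, zz)" by (cases v)
    show "eval3 (varY * H) v = 0"
    proof (cases "y = 0")
      case False
      then have "v = vscale (- y) (- x / y, -1, - (zz / y))" by (simp add: v vscale_def)
      then have "eval3 H v = 0"
        by (simp only: hom_fun_scale[OF f(1)[unfolded H(2)]] all mult_zero_right)
      then show ?thesis by (simp only: eval3_simps mult_zero_right)
    qed (simp only: eval3_simps eval3_vars v fst_conv snd_conv mult_zero_left)
  qed
  then have "H = 0" by (simp only: mult_eq_0_iff) simp
  then show False using f(2) H(2) by simp
qed

lemma continuous_on_hom_fun_dual:
  assumes "hom_fun n f"
  shows "continuous_on U (\<lambda>z. f (dual z))"
proof -
  obtain H where H: "homogeneous n H" "f = eval3 H" using assms by (auto simp: hom_fun_def)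
  show ?thesis unfolding H(2) dual_def
    by (intro continuous_on_eval3[OF H(1)] continuous_intros)
qed

lemma dual_dense_finite:
  assumes "finite F" "\<And>f. f \<in> F \<Longrightarrow> (\<exists>n. hom_fun n f) \<and> (\<exists>w. f w \<noteq> 0)" "open U" "z \<in> U"
  shows "\<exists>z'\<in>U. \<forall>f\<in>F. f (dual z') \<noteq> 0"
  using assms
proof (induction F arbitrary: U z rule: finite_induct)
  case (insert f F)
  then obtain n w where f: "hom_fun n f" "f w \<noteq> 0" by blast
  let ?V = "U \<inter> (\<lambda>z. f (dual z)) -` (- {0})"
  have "open ?V"
    by (rule continuous_open_preimage[OF continuous_on_hom_fun_dual[OF f(1)] insert.prems(2)]) auto
  moreover obtain z' where "z' \<in> ?V" using dual_dense[OF f insert.prems(2,3)] by auto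
  ultimately have "\<exists>z'\<in>?V. \<forall>f\<in>F. f (dual z') \<noteq> 0"
    using insert.prems(1) by (intro insert.IH) auto
  then show ?case by auto
qed auto

context plane_foliation
begin

lemma hom_fun_om_cross: "hom_fun (m + 1) (\<lambda>u. om (cross u l) h)"
proof -
  define g1 where "g1 u = 0 * fst u + snd (snd l) * fst (snd u) + (- fst (snd l)) * snd (snd u)" for u :: vec
  define g2 where "g2 u = (- snd (snd l)) * fst u + 0 * fst (snd u) + fst l * snd (snd u)" for u :: vec
  define g3 where "g3 u = fst (snd l) * fst u + (- fst l) * fst (snd u) + 0 * snd (snd u)" for u :: vec
  have g: "hom_fun 1 g1" "hom_fun 1 g2" "hom_fun 1 g3"
    unfolding g1_def[abs_def] g2_def[abs_def] g3_def[abs_def] by (rule hom_fun_linear)+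
  have "cross u l = (g1 u, g2 u, g3 u)" for u
    by (simp add: cross_def g1_def g2_def g3_def)
  then show ?thesis
    using hom_fun_subst[of "m + 1" "\<lambda>v. om v h" g1 g2 g3, OF hom_fun_om[of h] g] by (simp only:)
qed

text \<open>Each of the finitely many conditions is the nonvanishing of a homogeneous function of
  the line. None is identically zero: intersections of distinct lines are nonzero vectors, and no
  invariant line is entirely singular.\<close>

lemma generic_dense:
  assumes \<Lambda>: "finite \<Lambda>" "\<And>l. l \<in> \<Lambda> \<Longrightarrow> inv_line l" "\<And>l k. l \<in> \<Lambda> \<Longrightarrow> k \<in> \<Lambda> \<Longrightarrow> l \<noteq> k \<Longrightarrow> cross l k \<noteq> 0"
    and U: "open U" "z \<in> U"
  shows "\<exists>z'\<in>U. generic \<Lambda> (dual z')"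
proof -
  define F1 where "F1 = (\<lambda>x. dot (cross (fst x) (snd x))) ` {x \<in> \<Lambda> \<times> \<Lambda>. fst x \<noteq> snd x}"
  define F2 where "F2 = (\<lambda>l u. om (cross u l) (vcnj l)) ` \<Lambda>"
  let ?F = "F1 \<union> F2"
  have fin: "finite ?F"
    unfolding F1_def F2_def by (intro finite_UnI finite_imageI \<Lambda>(1) finite_Collect_conjI disjI1) (simp add: \<Lambda>(1))
  have "\<exists>z'\<in>U. \<forall>f\<in>?F. f (dual z') \<noteq> 0"
  proof (rule dual_dense_finite[OF fin _ U])
    fix f assume "f \<in> ?F"
    then consider l k where "l \<in> \<Lambda>" "k \<in> \<Lambda>" "l \<noteq> k" "f = dot (cross l k)"
      | l where "l \<in> \<Lambda>" "f = (\<lambda>u. om (cross u l) (vcnj l))" unfolding F1_def F2_def by auto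
    then show "(\<exists>n. hom_fun n f) \<and> (\<exists>w. f w \<noteq> 0)"
    proof cases
      case 1
      then have "f (vcnj (cross l k)) \<noteq> 0" using dot_vcnj_ne_0 \<Lambda>(3) by simp
      then show ?thesis using hom_fun_dot 1(4) by blast
    next
      case 2
      obtain v where v: "dot l v = 0" "om v (vcnj l) \<noteq> 0" using om_vcnj_ne_0 \<Lambda>(2) 2(1) by blast
      have "l \<noteq> 0" using \<Lambda>(2)[OF 2(1)] by (simp add: inv_line_def)
      then obtain u where "v = cross u l" using kernel_eq_cross v(1) by blast
      then have "f u \<noteq> 0" using v(2) 2(2) by simp
      moreover have "hom_fun (m + 1) f" unfolding 2(2) by (rule hom_fun_om_cross)
      ultimately show ?thesis by blast
    qed
  qed
  then obtain z' where z': "z' \<in> U" "\<And>f. f \<in> ?F \<Longrightarrow> f (dual z') \<noteq> 0" by blast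
  have "generic \<Lambda> (dual z')"
    unfolding generic_def
  proof (intro conjI ballI impI)
    fix l k assume "l \<in> \<Lambda>" "k \<in> \<Lambda>" "l \<noteq> k"
    then have "dot (cross l k) \<in> ?F" unfolding F1_def by (intro UnI1 image_eqI[of _ _ "(l, k)"]) auto
    from z'(2)[OF this] show "dot (dual z') (cross l k) \<noteq> 0" by (simp add: dot_commute)
  next
    fix l assume "l \<in> \<Lambda>"
    then have "(\<lambda>u. om (cross u l) (vcnj l)) \<in> ?F" unfolding F2_def using imageI[of l \<Lambda> "\<lambda>l u. om (cross u l) (vcnj l)"] by blast
    from z'(2)[OF this] show "om (cross (dual z') l) (vcnj l) \<noteq> 0" .
  qed
  then show ?thesis using z'(1) by blast
qed

subsection \<open>Invariant lines as covectors\<close>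

lemma invariant_line_covector:
  assumes L: "invariant_line P Q R L"
  shows "\<exists>l. eval3 L = dot l \<and> inv_line l"
proof -
  have "homogeneous 1 L" using L by (simp add: invariant_line_def)
  then obtain l where l: "eval3 L = dot l" "eval3 (dX L) = (\<lambda>_. fst l)" "eval3 (dY L) = (\<lambda>_. fst (snd l))"
    "eval3 (dZ L) = (\<lambda>_. snd (snd l))" by (rule homogeneous_1_dot)
  have "l \<noteq> 0"
  proof
    assume "l = 0"
    then have "L = 0" by (intro eval3_eq_0) (simp add: l(1) dot_def)
    then show False using L by (simp add: invariant_line_def)
  qed
  moreover have "om v h = 0" if v: "dot l v = 0" and h: "dot l h = 0" for v h
  proof -
    have 0: "eval3 K v = 0" if "L dvd K" for K
      using that v l(1) by (auto simp: dvd_def)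
    have "cross l (eval3 P v, eval3 Q v, eval3 R v) = 0"
      using 0[of "P * dY L - Q * dX L"] 0[of "P * dZ L - R * dX L"] 0[of "Q * dZ L - R * dY L"] L
      by (simp add: invariant_line_def invariant_curve_def l cross_def zero_prod_def mult_ac)
    then obtain c where "(eval3 P v, eval3 Q v, eval3 R v) = vscale c l"
      using cross_eq_0_imp_proportional[OF \<open>l \<noteq> 0\<close>] by blast
    then show ?thesis using h by (simp add: om_def dot_simps)
  qed
  ultimately have "inv_line l" by (simp add: inv_line_def)
  then show ?thesis using l(1) by blast
qed

lemma same_kernel_imp_proportional:
  assumes "l \<noteq> 0" "{v. dot l v = 0} = {v. dot k v = 0}"
  shows "\<exists>c. k = vscale c l"
proof -
  have "dot (cross k l) h = 0" for h
  proof -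
    have "cross l h \<in> {v. dot l v = 0}" by (simp add: cross_orth)
    then have "dot k (cross l h) = 0" unfolding assms(2) by simp
    then show ?thesis by (simp add: triple_cycle)
  qed
  then have "cross k l = 0" using dot_vcnj_ne_0 by blast
  then have "cross l k = 0" by (subst triple_swap(3)) simp
  then show ?thesis by (rule cross_eq_0_imp_proportional[OF assms(1)])
qed

lemma invariant_lines:
  assumes card: "card (invariant_line_loci P Q R) = 3 * m"
  obtains \<Lambda> where "finite \<Lambda>" "card \<Lambda> = 3 * m" "\<And>l. l \<in> \<Lambda> \<Longrightarrow> inv_line l"
    "\<And>l k. l \<in> \<Lambda> \<Longrightarrow> k \<in> \<Lambda> \<Longrightarrow> l \<noteq> k \<Longrightarrow> cross l k \<noteq> 0"
    "\<And>L. invariant_line P Q R L \<Longrightarrow> \<exists>l\<in>\<Lambda>. \<exists>c. c \<noteq> 0 \<and> eval3 L = dot (vscale c l)"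
proof -
  let ?X = "invariant_line_loci P Q R"
  have "\<exists>l. inv_line l \<and> {v. dot l v = 0} = X" if X: "X \<in> ?X" for X
  proof -
    obtain L where L: "invariant_line P Q R L" "X = {v. eval3 L v = 0}"
      using X by (auto simp: invariant_line_loci_def)
    obtain l where "eval3 L = dot l" "inv_line l" using invariant_line_covector[OF L(1)] by blast
    then show ?thesis using L(2) by (intro exI[of _ l]) simp
  qed
  then have "\<exists>f. \<forall>X\<in>?X. inv_line (f X) \<and> {v. dot (f X) v = 0} = X" by (intro bchoice) blast
  then obtain f where f: "\<And>X. X \<in> ?X \<Longrightarrow> inv_line (f X)" "\<And>X. X \<in> ?X \<Longrightarrow> {v. dot (f X) v = 0} = X"
    by blast
  have inj: "inj_on f ?X" by (rule inj_on_inverseI[of _ "\<lambda>l. {v. dot l v = 0}"]) (rule f(2))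
  show thesis
  proof (rule that[of "f ` ?X"])
    have "0 < card ?X" using card m_pos by simp
    then show "finite (f ` ?X)" by (intro finite_imageI card_ge_0_finite)
    show "card (f ` ?X) = 3 * m" using inj card by (simp add: card_image)
    show "inv_line l" if "l \<in> f ` ?X" for l using that f(1) by blast
    show "cross l k \<noteq> 0" if lk: "l \<in> f ` ?X" "k \<in> f ` ?X" "l \<noteq> k" for l k
    proof
      assume 0: "cross l k = 0"
      obtain X Y where X: "X \<in> ?X" "l = f X" and Y: "Y \<in> ?X" "k = f Y" using lk by blast
      have ne: "l \<noteq> 0" "k \<noteq> 0" using f(1)[OF X(1)] f(1)[OF Y(1)] X(2) Y(2) by (simp_all add: inv_line_def)
      obtain c where c: "k = vscale c l" using cross_eq_0_imp_proportional[OF ne(1) 0] by blast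
      then have "c \<noteq> 0" using ne(2) by auto
      then have "{v. dot k v = 0} = {v. dot l v = 0}" by (simp add: c dot_simps)
      then have "X = Y" using f(2)[OF X(1)] f(2)[OF Y(1)] X(2) Y(2) by simp
      then show False using lk(3) X(2) Y(2) by simp
    qed
    show "\<exists>l\<in>f ` ?X. \<exists>c. c \<noteq> 0 \<and> eval3 L = dot (vscale c l)" if L: "invariant_line P Q R L" for L
    proof -
      obtain k where k: "eval3 L = dot k" "inv_line k" using invariant_line_covector[OF L] by blast
      have X: "{v. eval3 L v = 0} \<in> ?X" using L by (auto simp: invariant_line_loci_def)
      let ?l = "f {v. eval3 L v = 0}"
      have "?l \<noteq> 0" using f(1)[OF X] by (simp add: inv_line_def)
      moreover have "{v. dot ?l v = 0} = {v. dot k v = 0}" using f(2)[OF X] k(1) by simp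
      ultimately obtain c where c: "k = vscale c ?l" using same_kernel_imp_proportional by blast
      moreover have "c \<noteq> 0" using c k(2) by (auto simp: inv_line_def)
      ultimately show ?thesis using X k(1) by blast
    qed
  qed
qed

subsection \<open>The Legendre transform\<close>

lemma poly_Leg: "poly (Leg G P Q (p, q)) x = eval3 G (x, p * x - q, 1) * om (x, p * x - q, 1) (1, p, 0)"
  by (simp add: Leg_def poly_poly_1 om_def dot_def algebra_simps)

text \<open>\<open>P\<close> and \<open>Q\<close> have degree m + 1, but the coefficient of this
  degree is \<open>om\<close> at \<open>(1, p, 0)\<close> contracted with the same vector, which is
  zero.\<close>

lemma degree_Leg:
  assumes G: "homogeneous k G"
  shows "degree (Leg G P Q (p, q)) \<le> k + m"
proof -
  have hom: "homogeneous (m + 1) P" "homogeneous (m + 1) Q" using fol by (simp_all add: foliation_def)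
  let ?B = "poly (poly P 1) [:- q, p:] + [:p:] * poly (poly Q 1) [:- q, p:]"
  have "degree ?B \<le> m"
  proof (rule degree_le, intro allI impI)
    fix i assume "m < i"
    then consider "i = m + 1" | "m + 1 < i" by linarith
    then show "coeff ?B i = 0"
    proof cases
      case 1
      have "coeff ?B (m + 1) = om (1, p, 0) (1, p, 0)"
        by (simp only: coeff_add) (simp add: homogeneous_restrict[OF hom(1), simplified] homogeneous_restrict[OF hom(2), simplified] om_def dot_def)
      then show ?thesis using 1 om_self by simp
    next
      case 2
      then show ?thesis
        using homogeneous_restrict(1)[OF hom(1), of "- q" p] homogeneous_restrict(1)[OF hom(2), of "- q" p]
        by (simp add: coeff_eq_0)
    qed
  qed
  then show ?thesis
    using homogeneous_restrict(1)[OF G, of "- q" p] degree_mult_le[of "poly (poly G 1) [:- q, p:]" ?B]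
    by (simp only: Leg_def case_prod_conv)
qed

lemma implicit_form_eq:
  assumes "degree (F z) \<le> d" "fst v \<noteq> 0"
  shows "implicit_form d F z v = fst v ^ d * poly (F z) (snd v / fst v)"
  unfolding implicit_form_def poly_altdef_le[OF assms(1)] sum_distrib_left
proof (rule sum.cong[OF refl])
  fix i assume "i \<in> {..d}"
  then have "fst v ^ d = fst v ^ i * fst v ^ (d - i)" by (simp add: power_add[symmetric])
  then show "coeff (F z) i * snd v ^ i * fst v ^ (d - i) = fst v ^ d * (coeff (F z) i * (snd v / fst v) ^ i)"
    using assms(2) by (simp add: power_divide)
qed

text \<open>Homogenising in the point removes the affine chart: the direction
  \<open>(dp, dq) = (w, x)\<close> of the dual plane corresponds to the point
  \<open>(x, y, w)\<close> of the line. The extra factor \<open>w\<close> balances the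
  degree.\<close>

lemma implicit_form_Leg:
  assumes G: "homogeneous k G" and v: "dot (dual z) v = 0" "snd (snd v) \<noteq> 0"
  shows "snd (snd v) * implicit_form (k + m) (Leg G P Q) z (snd (snd v), fst v) = eval3 G v * om v (1, fst z, 0)"
proof -
  obtain p q where z: "z = (p, q)" by (cases z)
  obtain x y w where v': "v = (x, y, w)" by (cases v)
  have w: "w \<noteq> 0" and e: "p * x - y = q * w" using v by (auto simp: dual_def dot_def z v')
  have y: "y = p * x - q * w" unfolding e[symmetric] by simp
  let ?v = "(x / w, p * (x / w) - q, 1)"
  have vv: "v = vscale w ?v" using w by (simp add: v' vscale_def y algebra_simps)
  have "w * implicit_form (k + m) (Leg G P Q) z (w, x) = w * (w ^ (k + m) * (eval3 G ?v * om ?v (1, p, 0)))"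
    using implicit_form_eq[of "Leg G P Q" z "k + m" "(w, x)"] degree_Leg[OF G, of p q] w
    by (simp add: z poly_Leg)
  also have "\<dots> = eval3 G v * om v (1, p, 0)"
    unfolding vv om_scale hom_fun_scale[OF hom_fun_eval3[OF G]] by (simp add: power_add)
  finally show ?thesis by (simp add: v' z)
qed

end

subsection \<open>The dual web at a generic point\<close>

text \<open>The direction \<open>(dp, dq)\<close> at the dual point in which the line turns about
  its point \<open>v\<close>; its slope \<open>dq / dp\<close> is the abscissa of
  \<open>v\<close>.\<close>

definition plane :: "vec \<Rightarrow> complex \<times> complex" where "plane v = (snd (snd v), fst v)"

lemma dual_orth: "dot (dual z) v = 0 \<Longrightarrow> fst (snd v) = fst z * fst v - snd z * snd (snd v)"
  by (simp add: dual_def dot_def algebra_simps add_eq_0_iff)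

lemma plane_ne_0: "dot (dual z) v = 0 \<Longrightarrow> v \<noteq> 0 \<Longrightarrow> plane v \<noteq> 0"
  using dual_orth[of z v] by (auto simp: plane_def prod_eq_iff)

lemma form_apply_plane_add: "form_apply a (plane (v + vscale c w)) = form_apply a (plane v) + c * form_apply a (plane w)"
  by (simp add: form_apply_def plane_def algebra_simps)

lemma wedge_eq_0_if_common_kernel:
  assumes "form_apply a v = 0" "form_apply b v = 0" "v \<noteq> 0"
  shows "wedge a b = 0"
proof -
  have "wedge a b * fst v = snd b * form_apply a v - snd a * form_apply b v"
    "wedge a b * snd v = fst a * form_apply b v - fst b * form_apply a v"
    by (simp_all add: wedge_def form_apply_def algebra_simps)
  then show ?thesis using assms by (auto simp: prod_eq_iff)
qed

text \<open>One generic point of the dual plane with an arbitrary factorization of the web into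
  covectors \<open>\<omega> i\<close>. The original chart and the adapted one are compared here:
  \<open>\<l>\<close> names the component lines of the curve among \<open>l0\<close> and
  \<open>J\<close>.\<close>

locale leg_point = generic_line P Q R m f1 f2 f3 l0 J "dual z"
  for P Q R m f1 f2 f3 l0 J z +
  fixes k d :: nat and G :: ternary and r :: complex and S :: "'s set" and \<l> :: "'s \<Rightarrow> vec"
    and \<omega> :: "nat \<Rightarrow> complex \<times> complex"
  assumes G: "homogeneous k G" and d: "d = k + m" and r: "r \<noteq> 0" and fin_S: "finite S" and card_S: "card S = k"
    and \<l>: "L \<in> S \<Longrightarrow> \<l> L \<in> insert l0 J" and eval_G: "eval3 G y = r * (\<Prod>L\<in>S. dot (\<l> L) y)"
    and \<omega>_ne: "i < d \<Longrightarrow> \<omega> i \<noteq> 0" and transv: "i < d \<Longrightarrow> j < d \<Longrightarrow> i \<noteq> j \<Longrightarrow> wedge (\<omega> i) (\<omega> j) \<noteq> 0"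
    and factors: "implicit_form d (Leg G P Q) z v = (\<Prod>i<d. form_apply (\<omega> i) v)"
begin

text \<open>On the direction belonging to the point \<open>pt x\<close> the form
  \<open>\<omega> i\<close> takes the value \<open>ee i + x * kk i\<close>. So \<open>xx i\<close>
  is its slope in the adapted chart, and \<open>kk i = 0\<close> means that the form is a multiple
  of the new \<open>dp\<close>.\<close>

definition kk :: "nat \<Rightarrow> complex" where "kk i = form_apply (\<omega> i) (plane dr)"
definition ee :: "nat \<Rightarrow> complex" where "ee i = form_apply (\<omega> i) (plane (pt 0))"
definition \<Delta> :: complex where "\<Delta> = fst dr * snd (snd (pt 0)) - snd (snd dr) * fst (pt 0)"

lemma pt_affine: "pt x = pt 0 + vscale x dr"
  by (simp add: pt_eq)

lemma form_apply_pt: "form_apply (\<omega> i) (plane (pt x)) = ee i + x * kk i"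
  unfolding ee_def kk_def by (subst pt_affine) (rule form_apply_plane_add)

lemma plane_pt_ne_0: "plane (pt x) \<noteq> 0" and plane_dr_ne_0: "plane dr \<noteq> 0"
  by (rule plane_ne_0[of z] u_pt u_dr pt_ne_0 dr_ne_0)+

lemma \<Delta>_ne_0: "\<Delta> \<noteq> 0"
proof
  assume 0: "\<Delta> = 0"
  have "\<exists>c. plane (pt 0) = (c * fst (plane dr), c * snd (plane dr))"
  proof (cases "fst dr = 0")
    case False
    then show ?thesis using 0 by (intro exI[of _ "fst (pt 0) / fst dr"]) (simp add: plane_def \<Delta>_def field_simps)
  next
    case True
    then have "snd (snd dr) \<noteq> 0" using plane_dr_ne_0 by (simp add: plane_def zero_prod_def)
    then show ?thesis using 0 True
      by (intro exI[of _ "snd (snd (pt 0)) / snd (snd dr)"]) (simp add: plane_def \<Delta>_def)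
  qed
  then obtain c where "plane (pt 0) = (c * fst (plane dr), c * snd (plane dr))" by blast
  then have "plane (pt (- c)) = 0"
    by (subst pt_affine) (simp add: plane_def zero_prod_def)
  then show False using plane_pt_ne_0 by blast
qed

lemma factorization_on_line:
  "smult r (\<Prod>L\<in>S. [:dot (\<l> L) (pt 0), dot (\<l> L) dr:]) * TL = smult \<Delta> (\<Prod>i<d. [:ee i, kk i:])" (is "?L = ?R")
proof -
  have L: "poly ?L x = eval3 G (pt x) * om (pt x) dr" for x
  proof -
    have "dot (\<l> L) (pt x) = dot (\<l> L) (pt 0) + x * dot (\<l> L) dr" for L
      by (subst pt_affine) (simp add: dot_simps)
    then show ?thesis by (simp add: poly_prod poly_TL eval_G)
  qed
  have R: "poly ?R x = \<Delta> * (\<Prod>i<d. form_apply (\<omega> i) (plane (pt x)))" for x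
    by (simp add: poly_prod form_apply_pt)
  \<comment> \<open>The original third coordinate along the line. The comparison through
    \<open>implicit_form_Leg\<close> needs it to be nonzero; as a nonzero polynomial it can be
    cancelled afterwards.\<close>
  let ?X3 = "[:snd (snd (pt 0)), snd (snd dr):]"
  have X3: "poly ?X3 x = snd (snd (pt x))" for x by (subst pt_affine) simp
  have "poly (?X3 * (?L - ?R)) x = 0" for x
  proof (cases "snd (snd (pt x)) = 0")
    case False
    let ?a = "om (pt x) (1, fst z, 0)" and ?b = "om (pt x) (0, - snd z, 1)"
    have dec: "v = vscale (fst v) (1, fst z, 0) + vscale (snd (snd v)) (0, - snd z, 1)" if "dot (dual z) v = 0" for v
      using dual_orth[OF that] by (intro vec_eqI; simp)
    have "om (pt x) (pt x) = fst (pt x) * ?a + snd (snd (pt x)) * ?b"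
      by (subst (2) dec[OF u_pt]) (simp only: om_linear)
    then have b: "snd (snd (pt x)) * ?b = - fst (pt x) * ?a" by (simp add: om_self add_eq_0_iff)
    have "om (pt x) dr = fst dr * ?a + snd (snd dr) * ?b"
      by (subst (1) dec[OF u_dr]) (simp only: om_linear)
    then have "snd (snd (pt x)) * om (pt x) dr = snd (snd (pt x)) * fst dr * ?a + snd (snd dr) * (snd (snd (pt x)) * ?b)"
      by (simp add: algebra_simps)
    also have "\<dots> = (fst dr * snd (snd (pt x)) - snd (snd dr) * fst (pt x)) * ?a"
      unfolding b by (simp add: algebra_simps)
    also have "fst dr * snd (snd (pt x)) - snd (snd dr) * fst (pt x) = \<Delta>"
      unfolding \<Delta>_def by (subst (1 2) pt_affine) (simp add: algebra_simps)
    finally have 1: "snd (snd (pt x)) * om (pt x) dr = \<Delta> * ?a" .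
    have 2: "snd (snd (pt x)) * (\<Prod>i<d. form_apply (\<omega> i) (plane (pt x))) = eval3 G (pt x) * ?a"
      using implicit_form_Leg[OF G u_pt False] factors[of "plane (pt x)"] by (simp add: d plane_def)
    have "poly (?X3 * (?L - ?R)) x = snd (snd (pt x)) * (eval3 G (pt x) * om (pt x) dr) - 
        snd (snd (pt x)) * (\<Delta> * (\<Prod>i<d. form_apply (\<omega> i) (plane (pt x))))"
      by (simp only: poly_mult[of ?X3] poly_diff X3 L R right_diff_distrib)
    also have "\<dots> = eval3 G (pt x) * (snd (snd (pt x)) * om (pt x) dr) - 
        \<Delta> * (snd (snd (pt x)) * (\<Prod>i<d. form_apply (\<omega> i) (plane (pt x))))"
      by (simp only: mult.left_commute)
    also have "\<dots> = 0" unfolding 1 2 by simp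
    finally show ?thesis .
  qed (simp only: poly_mult X3 mult_zero_left)
  then have "?X3 * (?L - ?R) = 0" by (intro iffD1[OF poly_all_0_iff_0]) blast
  moreover have "?X3 \<noteq> 0" using \<Delta>_ne_0 by (auto simp: \<Delta>_def)
  ultimately show ?thesis by (simp only: mult_eq_0_iff) simp
qed

lemma TL_lam_ne_0: "l \<in> J \<Longrightarrow> poly TL (lamL l) \<noteq> 0"
  using arg_cong[OF cofactorL(1)[of l], of "\<lambda>p. poly p (lamL l)"] a_lamL[of l] by auto

lemma line_factor:
  "\<l> L = l0 \<Longrightarrow> [:dot (\<l> L) (pt 0), dot (\<l> L) dr:] = 1"
  "\<l> L \<in> J \<Longrightarrow> [:dot (\<l> L) (pt 0), dot (\<l> L) dr:] = smult (dot (\<l> L) f2 * (pp - al (\<l> L))) [:- lamL (\<l> L), 1:]"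
proof -
  show "\<l> L = l0 \<Longrightarrow> [:dot (\<l> L) (pt 0), dot (\<l> L) dr:] = 1"
    by (simp add: l0_pt dr_def dot_simps f12 one_pCons)
next
  assume J: "\<l> L \<in> J"
  have "dot (\<l> L) (pt 1) = dot (\<l> L) (pt 0) + dot (\<l> L) dr"
    by (subst pt_affine) (simp add: dot_simps)
  then show "[:dot (\<l> L) (pt 0), dot (\<l> L) dr:] = smult (dot (\<l> L) f2 * (pp - al (\<l> L))) [:- lamL (\<l> L), 1:]"
    using dot_pt[OF J, of 0] dot_pt[OF J, of 1] by (simp add: algebra_simps)
qed

lemma TL_ne_0: "TL \<noteq> 0" and degree_TL_eq: "degree TL = m"
proof -
  show "TL \<noteq> 0" using coeff_TL \<tau>_ne_0 by auto
  show "degree TL = m" using degree_TL coeff_TL \<tau>_ne_0 le_degree[of TL m] by simp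
qed

text \<open>Degrees in \<open>factorization_on_line\<close>: a component equal to \<open>l0\<close>
  contributes a constant on the left, a vertical form a constant on the right.\<close>

lemma card_vertical: "card {i. i < d \<and> kk i = 0} = card {L \<in> S. \<l> L = l0}"
proof -
  let ?c = "\<lambda>L. [:dot (\<l> L) (pt 0), dot (\<l> L) dr:]"
  have c: "?c L \<noteq> 0" "degree (?c L) = (if \<l> L = l0 then 0 else 1)" if L: "L \<in> S" for L
  proof -
    consider "\<l> L = l0" | "\<l> L \<in> J" using \<l>[OF L] by blast
    then have "?c L \<noteq> 0 \<and> degree (?c L) = (if \<l> L = l0 then 0 else 1)"
    proof cases
      case 1
      then show ?thesis using line_factor(1)[OF 1] by simp
    next
      case 2
      have "dot (\<l> L) f2 * (pp - al (\<l> L)) \<noteq> 0" using f2_J[OF 2] pp_al[OF 2] by simp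
      then show ?thesis using 2 l0_notin_J unfolding line_factor(2)[OF 2] by auto
    qed
    then show "?c L \<noteq> 0" "degree (?c L) = (if \<l> L = l0 then 0 else 1)" by blast+
  qed
  have prod_ne: "(\<Prod>L\<in>S. ?c L) \<noteq> 0" using c(1) fin_S by (simp only: prod_zero_iff) blast
  have "degree (\<Prod>L\<in>S. ?c L) = (\<Sum>L\<in>S. degree (?c L))"
    by (rule degree_prod_eq_sum_degree) (use c(1) in blast)
  also have "\<dots> = (\<Sum>L\<in>S. if \<l> L = l0 then 0 else 1)" by (rule sum.cong) (use c(2) in auto)
  also have "\<dots> = card (S - {L \<in> S. \<l> L = l0})"
    using fin_S by (simp add: sum.If_cases card_eq_sum[symmetric]) (rule arg_cong[of _ _ card], auto)
  also have "\<dots> = k - card {L \<in> S. \<l> L = l0}"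
    using fin_S by (subst card_Diff_subset) (auto simp: card_S)
  finally have dl: "degree (\<Prod>L\<in>S. ?c L) = k - card {L \<in> S. \<l> L = l0}" .
  have le: "card {L \<in> S. \<l> L = l0} \<le> k" unfolding card_S[symmetric] by (rule card_mono) (use fin_S in auto)
  have dL: "degree (smult r (\<Prod>L\<in>S. ?c L) * TL) = k - card {L \<in> S. \<l> L = l0} + m"
    using prod_ne r TL_ne_0 dl by (simp add: degree_mult_eq degree_TL_eq)
  have Lne: "smult r (\<Prod>L\<in>S. ?c L) * TL \<noteq> 0"
    using prod_ne r TL_ne_0 by (simp only: mult_eq_0_iff smult_eq_0_iff) blast
  then have "(\<Prod>i<d. [:ee i, kk i:]) \<noteq> 0" unfolding factorization_on_line by auto
  then have f: "[:ee i, kk i:] \<noteq> 0" if "i < d" for i using that by (simp only: prod_zero_iff[OF finite_lessThan]) auto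
  have "degree (\<Prod>i<d. [:ee i, kk i:]) = (\<Sum>i<d. degree [:ee i, kk i:])"
    by (rule degree_prod_eq_sum_degree) (use f in auto)
  also have "\<dots> = (\<Sum>i<d. if kk i = 0 then 0 else 1)" by (rule sum.cong) auto
  also have "\<dots> = card ({..<d} - {i. i < d \<and> kk i = 0})"
    by (simp add: sum.If_cases card_eq_sum[symmetric]) (rule arg_cong[of _ _ card], auto)
  also have "\<dots> = d - card {i. i < d \<and> kk i = 0}"
    by (subst card_Diff_subset) auto
  finally have "degree (smult \<Delta> (\<Prod>i<d. [:ee i, kk i:])) = d - card {i. i < d \<and> kk i = 0}"
    using \<Delta>_ne_0 by simp
  then have "d - card {i. i < d \<and> kk i = 0} = k - card {L \<in> S. \<l> L = l0} + m" using dL unfolding factorization_on_line by simp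
  moreover have "card {i. i < d \<and> kk i = 0} \<le> card {..<d}" by (rule card_mono) auto
  ultimately show ?thesis using le unfolding d by simp
qed

lemma vertical_unique: "i < d \<Longrightarrow> j < d \<Longrightarrow> kk i = 0 \<Longrightarrow> kk j = 0 \<Longrightarrow> i = j"
  using transv[of i j] wedge_eq_0_if_common_kernel[OF _ _ plane_dr_ne_0, of "\<omega> i" "\<omega> j"] unfolding kk_def by blast

lemma ee_ne_0: "i < d \<Longrightarrow> kk i = 0 \<Longrightarrow> ee i \<noteq> 0"
proof
  assume i: "i < d" and 0: "kk i = 0" "ee i = 0"
  have "fst (\<omega> i) * \<Delta> = fst dr * ee i - fst (pt 0) * kk i" "snd (\<omega> i) * \<Delta> = snd (snd (pt 0)) * kk i - snd (snd dr) * ee i"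
    by (simp_all add: kk_def ee_def \<Delta>_def form_apply_def plane_def algebra_simps)
  then have "\<omega> i = 0" using 0 \<Delta>_ne_0 by (simp add: prod_eq_iff)
  then show False using \<omega>_ne[OF i] by simp
qed

lemma \<omega>_eq: "fst (\<omega> i) = (fst dr * ee i - fst (pt 0) * kk i) / \<Delta>" "snd (\<omega> i) = (snd (snd (pt 0)) * kk i - snd (snd dr) * ee i) / \<Delta>"
proof -
  have "fst (\<omega> i) * \<Delta> = fst dr * ee i - fst (pt 0) * kk i" "snd (\<omega> i) * \<Delta> = snd (snd (pt 0)) * kk i - snd (snd dr) * ee i"
    by (simp_all add: kk_def ee_def \<Delta>_def form_apply_def plane_def algebra_simps)
  then show "fst (\<omega> i) = (fst dr * ee i - fst (pt 0) * kk i) / \<Delta>" "snd (\<omega> i) = (snd (snd (pt 0)) * kk i - snd (snd dr) * ee i) / \<Delta>"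
    using \<Delta>_ne_0 by (simp_all add: eq_divide_eq)
qed

definition xx :: "nat \<Rightarrow> complex" where "xx i = - ee i / kk i"

lemma form_apply_xx: "kk i \<noteq> 0 \<Longrightarrow> form_apply (\<omega> i) (plane (pt (xx i))) = 0"
  by (simp add: form_apply_pt xx_def)

lemma inj_xx: "inj_on xx {i. i < d \<and> kk i \<noteq> 0}"
proof (rule inj_onI, rule ccontr)
  fix i j assume ij: "i \<in> {i. i < d \<and> kk i \<noteq> 0}" "j \<in> {i. i < d \<and> kk i \<noteq> 0}" "xx i = xx j" "i \<noteq> j"
  then have "wedge (\<omega> i) (\<omega> j) = 0"
    by (intro wedge_eq_0_if_common_kernel[OF _ _ plane_pt_ne_0[of "xx i"]]) (use form_apply_xx[of i] form_apply_xx[of j] in auto)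
  then show False using transv ij by blast
qed

lemma root_cases:
  assumes i: "i < d" "kk i \<noteq> 0"
  shows "poly TL (xx i) = 0 \<or> (\<exists>l\<in>J. xx i = lamL l)"
proof -
  have 0: "(\<Prod>j<d. poly [:ee j, kk j:] (xx i)) = 0"
    using i by (intro prod_zero bexI[of _ i]) (auto simp: xx_def)
  have "r * (\<Prod>L\<in>S. poly [:dot (\<l> L) (pt 0), dot (\<l> L) dr:] (xx i)) * poly TL (xx i) = \<Delta> * 0"
    using arg_cong[OF factorization_on_line, of "\<lambda>p. poly p (xx i)"] unfolding poly_mult poly_smult poly_prod 0 .
  then have "(\<Prod>L\<in>S. poly [:dot (\<l> L) (pt 0), dot (\<l> L) dr:] (xx i)) * poly TL (xx i) = 0"
    using r by (simp only: mult_zero_right mult_eq_0_iff) blast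
  then consider "poly TL (xx i) = 0" | "(\<Prod>L\<in>S. poly [:dot (\<l> L) (pt 0), dot (\<l> L) dr:] (xx i)) = 0"
    by (simp only: mult_eq_0_iff) blast
  then show ?thesis
  proof cases
    case 2
    then obtain L where L: "L \<in> S" "poly [:dot (\<l> L) (pt 0), dot (\<l> L) dr:] (xx i) = 0"
      using prod_zero_iff[OF fin_S, of "\<lambda>L. poly [:dot (\<l> L) (pt 0), dot (\<l> L) dr:] (xx i)"] by blast
    have J: "\<l> L \<in> J"
    proof (rule ccontr)
      assume "\<l> L \<notin> J"
      then have "\<l> L = l0" using \<l>[OF L(1)] by blast
      from line_factor(1)[OF this] L(2) show False by simp
    qed
    have "dot (\<l> L) f2 * (pp - al (\<l> L)) \<noteq> 0" using f2_J[OF J] pp_al[OF J] by simp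
    then have "xx i = lamL (\<l> L)" using L(2) unfolding line_factor(2)[OF J] by simp
    then show ?thesis using J by blast
  qed simp
qed

text \<open>\<open>TL\<close> divides a product of distinct linear factors, so it is the product of
  those that vanish with it. In particular, exactly m of the forms of the web are tangencies and the
  roots are simple.\<close>

lemma TL_factorization:
  "TL = smult (\<tau> pp) (\<Prod>i\<in>{i\<in>{i. i < d \<and> kk i \<noteq> 0}. poly TL (xx i) = 0}. [:- xx i, 1:])"
proof -
  let ?I = "{i. i < d \<and> kk i \<noteq> 0}" and ?Z = "{i. i < d \<and> kk i = 0}"
  have "{..<d} = ?I \<union> ?Z" by auto
  then have "(\<Prod>i<d. [:ee i, kk i:]) = (\<Prod>i\<in>?I. [:ee i, kk i:]) * (\<Prod>i\<in>?Z. [:ee i, kk i:])"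
    by (simp only:) (rule prod.union_disjoint, auto)
  also have "(\<Prod>i\<in>?I. [:ee i, kk i:]) = (\<Prod>i\<in>?I. smult (kk i) [:- xx i, 1:])"
    by (rule prod.cong) (auto simp: xx_def)
  also have "\<dots> = smult (\<Prod>i\<in>?I. kk i) (\<Prod>i\<in>?I. [:- xx i, 1:])" by (rule prod_smult)
  also have "(\<Prod>i\<in>?Z. [:ee i, kk i:]) = [:\<Prod>i\<in>?Z. ee i:]"
  proof -
    have "(\<Prod>i\<in>?Z. [:ee i, kk i:]) = (\<Prod>i\<in>?Z. smult (ee i) 1)" by (rule prod.cong) (auto simp: one_pCons)
    also have "\<dots> = [:\<Prod>i\<in>?Z. ee i:]" unfolding prod_smult by simp
    finally show ?thesis .
  qed
  finally have prod: "(\<Prod>i<d. [:ee i, kk i:]) = smult ((\<Prod>i\<in>?I. kk i) * (\<Prod>i\<in>?Z. ee i)) (\<Prod>i\<in>?I. [:- xx i, 1:])"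
    by (simp add: mult_ac)
  have c: "\<Delta> * ((\<Prod>i\<in>?I. kk i) * (\<Prod>i\<in>?Z. ee i)) \<noteq> 0"
    using \<Delta>_ne_0 ee_ne_0 by auto
  have "TL * smult r (\<Prod>L\<in>S. [:dot (\<l> L) (pt 0), dot (\<l> L) dr:]) =
      smult (\<Delta> * ((\<Prod>i\<in>?I. kk i) * (\<Prod>i\<in>?Z. ee i))) (\<Prod>i\<in>?I. [:- xx i, 1:])"
    using factorization_on_line unfolding prod by (simp only: mult.commute[of TL] smult_smult)
  from factor_eq_prod_roots[OF _ inj_xx c this]
  show ?thesis using coeff_TL degree_TL_eq by simp
qed

lemma simple_rootsI:
  "simple_roots TL {i\<in>{i. i < d \<and> kk i \<noteq> 0}. poly TL (xx i) = 0} xx (\<tau> pp) m"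
proof
  let ?I = "{i\<in>{i. i < d \<and> kk i \<noteq> 0}. poly TL (xx i) = 0}"
  show "finite ?I" by simp
  have "degree TL = (\<Sum>i\<in>?I. degree [:- xx i, 1:])"
    by (subst TL_factorization) (simp add: \<tau>_ne_0 degree_prod_eq_sum_degree)
  then show "card ?I = m" unfolding degree_TL_eq by simp
  show "inj_on xx ?I" by (rule inj_on_subset[OF inj_xx]) auto
qed (rule m_pos TL_factorization \<tau>_ne_0)+

end

lemma open_all_ne_0:
  assumes "open V" "finite A" "\<And>a. a \<in> A \<Longrightarrow> continuous_on V (f a)"
  shows "open {z \<in> V. \<forall>a\<in>A. f a z \<noteq> (0::complex)}"
proof -
  have "open {z \<in> V. f a z \<noteq> 0}" if "a \<in> A" for a
  proof -
    have "open (V \<inter> f a -` (- {0}))"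
      by (rule continuous_open_preimage[OF assms(3)[OF that] assms(1)]) auto
    then show ?thesis by (simp add: Int_def)
  qed
  then have "open (V \<inter> (\<Inter>a\<in>A. {z \<in> V. f a z \<noteq> 0}))"
    using assms(1,2) by (intro open_Int open_INT) auto
  moreover have "V \<inter> (\<Inter>a\<in>A. {z \<in> V. f a z \<noteq> 0}) = {z \<in> V. \<forall>a\<in>A. f a z \<noteq> 0}" by auto
  ultimately show ?thesis by simp
qed

lemma ball_off_diagonal:
  "(\<forall>a\<in>{a \<in> A \<times> A. fst a \<noteq> snd a}. \<phi> (fst a) (snd a)) \<longleftrightarrow> (\<forall>l\<in>A. \<forall>k\<in>A. l \<noteq> k \<longrightarrow> \<phi> l k)"
  by auto

lemma has_diff_dual: "has_diff (\<lambda>z. dot (dual z) f) (fst f, - snd (snd f)) z"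
  unfolding has_diff_iff dot_def dual_def by (auto intro!: derivative_eq_intros)

locale leg_web = convex_chart P Q R m f1 f2 f3 l0 J
  for P Q R m f1 f2 f3 l0 J +
  fixes k d :: nat and G :: ternary and r :: complex and S :: "'s set" and \<l> :: "'s \<Rightarrow> vec"
    and U :: "(complex \<times> complex) set" and w :: "nat \<Rightarrow> form1"
  assumes G: "homogeneous k G" and d: "d = k + m" and r: "r \<noteq> 0" and fin_S: "finite S" and card_S: "card S = k"
    and \<l>: "L \<in> S \<Longrightarrow> \<l> L \<in> insert l0 J" and eval_G: "eval3 G y = r * (\<Prod>L\<in>S. dot (\<l> L) y)"
    and reg: "regular_decomposition d (Leg G P Q) U w"
begin

section \<open>The web in the adapted chart near a generic point\<close>

definition N1 :: "(complex \<times> complex) set" where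
  "N1 = {z \<in> U. dot (dual z) f2 \<noteq> 0 \<and> generic (insert l0 J) (dual z)}"

lemma open_N1: "open N1"
proof -
  let ?\<Lambda> = "insert l0 J"
  let ?V = "{z \<in> U. \<forall>a\<in>{()}. dot f2 (dual z) \<noteq> 0}"
  let ?V' = "{z \<in> ?V. \<forall>a\<in>{a \<in> ?\<Lambda> \<times> ?\<Lambda>. fst a \<noteq> snd a}. dot (cross (fst a) (snd a)) (dual z) \<noteq> 0}"
  have cd: "continuous_on V (\<lambda>z. dot l (dual z))" for V l
    by (rule continuous_on_hom_fun_dual[OF hom_fun_dot])
  have co: "continuous_on V (\<lambda>z. om (cross (dual z) l) h)" for V l h
    using continuous_on_hom_fun_dual[OF hom_fun_om_cross[of l h]] .
  have "open U" using reg by (simp add: regular_decomposition_def)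
  then have "open ?V" by (rule open_all_ne_0) (simp_all add: cd)
  then have "open ?V'"
  proof (rule open_all_ne_0)
    show "finite {a \<in> ?\<Lambda> \<times> ?\<Lambda>. fst a \<noteq> snd a}" using fin_J by (intro finite_Collect_conjI disjI1) simp
  qed (rule cd)
  then have "open {z \<in> ?V'. \<forall>l\<in>?\<Lambda>. om (cross (dual z) l) (vcnj l) \<noteq> 0}"
    by (rule open_all_ne_0) (use fin_J co in auto)
  also have "{z \<in> ?V'. \<forall>l\<in>?\<Lambda>. om (cross (dual z) l) (vcnj l) \<noteq> 0} = N1"
    unfolding N1_def generic_def dot_commute[of "dual _"] ball_off_diagonal[where \<phi> = "\<lambda>l k. dot (cross l k) (dual _) \<noteq> 0"]
    by (simp only: mem_Collect_eq ball_simps conj_assoc simp_thms)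
  finally show ?thesis .
qed

definition p :: "complex \<times> complex \<Rightarrow> complex" where "p z = - dot (dual z) f1 / dot (dual z) f2"
definition q :: "complex \<times> complex \<Rightarrow> complex" where "q z = dot (dual z) f3 / dot (dual z) f2"
definition DD :: "complex \<times> complex \<Rightarrow> vec" where "DD z = f1 + vscale (p z) f2"
definition EE :: "complex \<times> complex \<Rightarrow> vec" where "EE z = f3 - vscale (q z) f2"
definition kf :: "nat \<Rightarrow> complex \<times> complex \<Rightarrow> complex" where "kf i z = form_apply (w i z) (plane (DD z))"
definition ef :: "nat \<Rightarrow> complex \<times> complex \<Rightarrow> complex" where "ef i z = form_apply (w i z) (plane (EE z))"
definition x :: "nat \<Rightarrow> complex \<times> complex \<Rightarrow> complex" where "x i z = - ef i z / kf i z"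
definition Tf :: "complex \<times> complex \<Rightarrow> complex poly" where
  "Tf z = smult (p z) (poly aB [:- q z, p z:]) - poly bB [:- q z, p z:]"
definition lam :: "vec \<Rightarrow> complex \<times> complex \<Rightarrow> complex" where "lam l z = (q z + be l) / (p z - al l)"
definition \<Delta> :: "complex \<times> complex \<Rightarrow> complex" where
  "\<Delta> z = fst (DD z) * snd (snd (EE z)) - snd (snd (DD z)) * fst (EE z)"

lemma leg_point_at: "z \<in> N1 \<Longrightarrow> leg_point P Q R m f1 f2 f3 l0 J z k d G r S \<l> (\<lambda>i. w i z)"
  using reg by unfold_locales
    (auto simp: N1_def regular_decomposition_def G d[symmetric] r fin_S card_S eval_G dest: \<l>)

text \<open>The conclusions obtained at one dual point, restated with functions of \<open>z\<close>
  so that they can be used while \<open>z\<close> varies.\<close>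

lemma at_point:
  assumes z: "z \<in> N1"
  shows pp_al: "\<And>l. l \<in> J \<Longrightarrow> p z - al l \<noteq> 0"
    and simple_roots_at: "simple_roots (Tf z) {i \<in> {i. i < d \<and> kf i z \<noteq> 0}. poly (Tf z) (x i z) = 0} (\<lambda>i. x i z) (\<tau> (p z)) m"
    and tangency_at: "\<And>It t. simple_roots (Tf z) It t (\<tau> (p z)) m \<Longrightarrow>
      tangency_line (Tf z) It t (\<tau> (p z)) m (poly aB [:- q z, p z:])
        (poly (pderiv bB) [:- q z, p z:] - smult (p z) (poly (pderiv aB) [:- q z, p z:]))
        (- poly (pderiv aB) [:- q z, p z:]) J (\<lambda>l. lam l z) (\<lambda>l. p z - al l)
        (\<lambda>l. (poly aB [:- q z, p z:] - smult (1 / (p z - al l)) (Tf z)) div [:- lam l z, 1:])"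
    and coeff_a_at: "coeff (poly aB [:- q z, p z:]) m = \<alpha> (p z)"
    and coeff_Tq_at: "coeff (poly (pderiv bB) [:- q z, p z:] - smult (p z) (poly (pderiv aB) [:- q z, p z:])) (m - 1) = \<theta> (p z)"
    and root_cases_at: "\<And>i. i < d \<Longrightarrow> kf i z \<noteq> 0 \<Longrightarrow> poly (Tf z) (x i z) = 0 \<or> (\<exists>l\<in>J. x i z = lam l z)"
    and card_vertical_at: "card {i. i < d \<and> kf i z = 0} = card {L \<in> S. \<l> L = l0}"
    and vertical_unique_at: "\<And>i j. i < d \<Longrightarrow> j < d \<Longrightarrow> kf i z = 0 \<Longrightarrow> kf j z = 0 \<Longrightarrow> i = j"
    and ef_ne_0: "\<And>i. i < d \<Longrightarrow> kf i z = 0 \<Longrightarrow> ef i z \<noteq> 0"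
    and w_eq: "\<And>i. fst (w i z) = (fst (DD z) * ef i z - fst (EE z) * kf i z) / \<Delta> z"
      "\<And>i. snd (w i z) = (snd (snd (EE z)) * kf i z - snd (snd (DD z)) * ef i z) / \<Delta> z"
    and \<Delta>_ne_0: "\<Delta> z \<noteq> 0"
    and inj_x_at: "inj_on (\<lambda>i. x i z) {i. i < d \<and> kf i z \<noteq> 0}"
    and T_lam_at: "\<And>l. l \<in> J \<Longrightarrow> poly (Tf z) (lam l z) \<noteq> 0"
    and inj_lam_at: "inj_on (\<lambda>l. lam l z) J"
proof -
  interpret lp: leg_point P Q R m f1 f2 f3 l0 J z k d G r S \<l> "\<lambda>i. w i z" by (rule leg_point_at[OF z])
  have 1: "lp.pp = p z" "lp.qq = q z" by (simp_all add: lp.pp_def lp.qq_def p_def q_def)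
  have 2: "lp.dr = DD z" "lp.pt 0 = EE z" by (simp_all add: lp.dr_def DD_def lp.pt_eq EE_def 1)
  have 3: "lp.kk = (\<lambda>i. kf i z)" "lp.ee = (\<lambda>i. ef i z)" by (simp_all add: fun_eq_iff lp.kk_def lp.ee_def kf_def ef_def 2)
  have 4: "lp.xx = (\<lambda>i. x i z)" "lp.lamL = (\<lambda>l. lam l z)" by (simp_all add: fun_eq_iff lp.xx_def lp.lamL_def x_def lam_def 1 3)
  have 5: "lp.aL = poly aB [:- q z, p z:]" "lp.TqL = poly (pderiv bB) [:- q z, p z:] - smult (p z) (poly (pderiv aB) [:- q z, p z:])"
    "lp.aqL = - poly (pderiv aB) [:- q z, p z:]" by (simp_all add: lp.aL_def lp.TqL_def lp.aqL_def 1)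
  have 6: "lp.TL = Tf z" by (simp add: lp.TL_def Tf_def 5 1)
  have 7: "lp.\<Delta> = \<Delta> z" by (simp add: lp.\<Delta>_def \<Delta>_def 2)
  note ids = 1 2 3 4 5 6 7
  show "\<And>l. l \<in> J \<Longrightarrow> p z - al l \<noteq> 0" using lp.pp_al unfolding ids .
  show "simple_roots (Tf z) {i \<in> {i. i < d \<and> kf i z \<noteq> 0}. poly (Tf z) (x i z) = 0} (\<lambda>i. x i z) (\<tau> (p z)) m"
    using lp.simple_rootsI unfolding ids .
  show "\<And>It t. simple_roots (Tf z) It t (\<tau> (p z)) m \<Longrightarrow>
      tangency_line (Tf z) It t (\<tau> (p z)) m (poly aB [:- q z, p z:])
        (poly (pderiv bB) [:- q z, p z:] - smult (p z) (poly (pderiv aB) [:- q z, p z:]))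
        (- poly (pderiv aB) [:- q z, p z:]) J (\<lambda>l. lam l z) (\<lambda>l. p z - al l)
        (\<lambda>l. (poly aB [:- q z, p z:] - smult (1 / (p z - al l)) (Tf z)) div [:- lam l z, 1:])"
    using lp.tangency_lineI unfolding ids .
  show "coeff (poly aB [:- q z, p z:]) m = \<alpha> (p z)" using lp.coeff_aL unfolding ids .
  show "coeff (poly (pderiv bB) [:- q z, p z:] - smult (p z) (poly (pderiv aB) [:- q z, p z:])) (m - 1) = \<theta> (p z)"
    using lp.coeff_TqL unfolding ids .
  show "\<And>i. i < d \<Longrightarrow> kf i z \<noteq> 0 \<Longrightarrow> poly (Tf z) (x i z) = 0 \<or> (\<exists>l\<in>J. x i z = lam l z)"
    using lp.root_cases unfolding ids .
  show "card {i. i < d \<and> kf i z = 0} = card {L \<in> S. \<l> L = l0}" using lp.card_vertical unfolding ids .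
  show "\<And>i j. i < d \<Longrightarrow> j < d \<Longrightarrow> kf i z = 0 \<Longrightarrow> kf j z = 0 \<Longrightarrow> i = j"
    using lp.vertical_unique unfolding ids .
  show "\<And>i. i < d \<Longrightarrow> kf i z = 0 \<Longrightarrow> ef i z \<noteq> 0" using lp.ee_ne_0 unfolding ids .
  show "\<And>i. fst (w i z) = (fst (DD z) * ef i z - fst (EE z) * kf i z) / \<Delta> z"
    "\<And>i. snd (w i z) = (snd (snd (EE z)) * kf i z - snd (snd (DD z)) * ef i z) / \<Delta> z"
    using lp.\<omega>_eq unfolding ids by blast+
  show "\<Delta> z \<noteq> 0" using lp.\<Delta>_ne_0 unfolding ids .
  show "inj_on (\<lambda>i. x i z) {i. i < d \<and> kf i z \<noteq> 0}" using lp.inj_xx unfolding ids .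
  show "\<And>l. l \<in> J \<Longrightarrow> poly (Tf z) (lam l z) \<noteq> 0" using lp.TL_lam_ne_0 unfolding ids .
  show "inj_on (\<lambda>l. lam l z) J" using lp.inj_lamL unfolding ids .
qed

lemma f2_ne: "z \<in> N1 \<Longrightarrow> dot (dual z) f2 \<noteq> 0" by (simp add: N1_def)

lemma has_diff_pq:
  assumes z: "z \<in> N1"
  shows "has_diff p (smul (- 1 / dot (dual z) f2) (fst (DD z), - snd (snd (DD z)))) z"
    and "has_diff q (smul (1 / dot (dual z) f2) (fst (EE z), - snd (snd (EE z)))) z"
proof -
  have "has_diff p (smul (1 / dot (dual z) f2) (- (fst f1, - snd (snd f1)) - smul (p z) (fst f2, - snd (snd f2)))) z"
    unfolding p_def[abs_def] by (rule has_diff_divide[OF has_diff_minus[OF has_diff_dual] has_diff_dual f2_ne[OF z]])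
  then show "has_diff p (smul (- 1 / dot (dual z) f2) (fst (DD z), - snd (snd (DD z)))) z"
    by (rule back_subst[of "\<lambda>v. has_diff p v z"]) (simp add: DD_def prod_eq_iff smul_def algebra_simps)
  have "has_diff q (smul (1 / dot (dual z) f2) ((fst f3, - snd (snd f3)) - smul (q z) (fst f2, - snd (snd f2)))) z"
    unfolding q_def[abs_def] by (rule has_diff_divide[OF has_diff_dual has_diff_dual f2_ne[OF z]])
  then show "has_diff q (smul (1 / dot (dual z) f2) (fst (EE z), - snd (snd (EE z)))) z"
    by (rule back_subst[of "\<lambda>v. has_diff q v z"]) (simp add: EE_def prod_eq_iff smul_def algebra_simps)
qed

lemma dif_pq:
  assumes z: "z \<in> N1"
  shows "dif p z = smul (- 1 / dot (dual z) f2) (fst (DD z), - snd (snd (DD z)))"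
    and "dif q z = smul (1 / dot (dual z) f2) (fst (EE z), - snd (snd (EE z)))"
  by (rule has_diff_imp_dif has_diff_pq z)+

lemma hol_pq: "holomorphic2_on p N1" "holomorphic2_on q N1"
  by (rule holomorphic2_onI, erule has_diff_pq)+

lemma hol_dual: "holomorphic2_on (\<lambda>z. dot (dual z) f) N1"
  by (rule holomorphic2_onI, rule has_diff_dual)

lemma hol_DE:
  "holomorphic2_on (\<lambda>z. fst (DD z)) N1" "holomorphic2_on (\<lambda>z. snd (snd (DD z))) N1"
  "holomorphic2_on (\<lambda>z. fst (EE z)) N1" "holomorphic2_on (\<lambda>z. snd (snd (EE z))) N1"
  unfolding DD_def EE_def fst_add snd_add fst_diff snd_diff vscale_simps
  by (intro holomorphic2_add holomorphic2_diff holomorphic2_mult holomorphic2_const hol_pq)+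

lemma hol_\<Delta>: "holomorphic2_on \<Delta> N1"
  unfolding \<Delta>_def[abs_def] by (intro holomorphic2_diff holomorphic2_mult hol_DE)

lemma hol_w: "i < d \<Longrightarrow> holomorphic2_on (\<lambda>z. fst (w i z)) N1" "i < d \<Longrightarrow> holomorphic2_on (\<lambda>z. snd (w i z)) N1"
proof -
  assume "i < d"
  then have "holomorphic_form_on (w i) U" using reg by (simp add: regular_decomposition_def)
  moreover have "N1 \<subseteq> U" by (auto simp: N1_def)
  ultimately show "holomorphic2_on (\<lambda>z. fst (w i z)) N1" "holomorphic2_on (\<lambda>z. snd (w i z)) N1"
    unfolding holomorphic_form_on_def by (blast intro: holomorphic2_on_subset)+
qed

lemma hol_kf: "i < d \<Longrightarrow> holomorphic2_on (kf i) N1" and hol_ef: "i < d \<Longrightarrow> holomorphic2_on (ef i) N1"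
  unfolding kf_def[abs_def] ef_def[abs_def] form_apply_def plane_def fst_conv snd_conv
  by (intro holomorphic2_add holomorphic2_mult hol_DE hol_w; assumption)+

lemma frame_pq: "z \<in> N1 \<Longrightarrow> wedge (dif p z) (dif q z) \<noteq> 0"
proof -
  assume z: "z \<in> N1"
  have "wedge (dif p z) (dif q z) = \<Delta> z / (dot (dual z) f2)\<^sup>2"
    by (simp add: dif_pq[OF z] wedge_def smul_def \<Delta>_def power2_eq_square algebra_simps diff_divide_distrib)
  then show ?thesis using \<Delta>_ne_0[OF z] f2_ne[OF z] by simp
qed

text \<open>Being vertical, a tangency or a given line is a discrete property of each index. On a
  small neighbourhood all these types are constant, which gives the fixed index sets and the map
  \<open>line\<close> required by \<open>foliation_chart\<close>.\<close>

theorem flat_near: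
  assumes z0: "z0 \<in> N1"
  shows "\<exists>N. open N \<and> z0 \<in> N \<and> N \<subseteq> U \<and> has_curvature N d w (\<lambda>_. 0)"
proof -
  define I where "I = {i. i < d \<and> kf i z0 \<noteq> 0}"
  define Z where "Z = {i. i < d \<and> kf i z0 = 0}"
  define N2 where "N2 = {z \<in> N1. \<forall>i\<in>I. kf i z \<noteq> 0}"
  have fin_I: "finite I" and I_d: "i \<in> I \<Longrightarrow> i < d" for i by (simp_all add: I_def)
  have N21: "N2 \<subseteq> N1" by (auto simp: N2_def)
  have open_N2: "open N2"
    unfolding N2_def by (rule open_all_ne_0[OF open_N1 fin_I holomorphic2_on_continuous[OF hol_kf[OF I_d]]])
  \<comment> \<open>Nearby, vertical forms can only become non-vertical, but their number is the
    number of components equal to \<open>l0\<close> and does not depend on the point.\<close>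
  have vert: "{i. i < d \<and> kf i z \<noteq> 0} = I" if z: "z \<in> N2" for z
  proof -
    have z1: "z \<in> N1" using z N21 by blast
    have "{i. i < d \<and> kf i z = 0} \<subseteq> Z" using z by (auto simp: N2_def I_def Z_def)
    moreover have "card {i. i < d \<and> kf i z = 0} = card Z"
      unfolding Z_def card_vertical_at[OF z1] card_vertical_at[OF z0] ..
    ultimately have "{i. i < d \<and> kf i z = 0} = Z" by (intro card_subset_eq) (simp_all add: Z_def)
    then show ?thesis unfolding I_def Z_def by blast
  qed
  have hol_x: "holomorphic2_on (x i) N2" if i: "i \<in> I" for i
    unfolding x_def[abs_def]
    by (intro holomorphic2_divide holomorphic2_minus holomorphic2_on_subset[OF hol_ef[OF I_d[OF i]] N21]
        holomorphic2_on_subset[OF hol_kf[OF I_d[OF i]] N21]) (use i in \<open>auto simp: N2_def\<close>)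
  note cont = holomorphic2_on_continuous[OF holomorphic2_on_subset[OF hol_pq(1) N21]]
    holomorphic2_on_continuous[OF holomorphic2_on_subset[OF hol_pq(2) N21]]
    holomorphic2_on_continuous[OF hol_x]
  have cont_T: "continuous_on N2 (\<lambda>z. poly (Tf z) (x i z))" if i: "i \<in> I" for i
    unfolding Tf_def aB_def bB_def poly_minus poly_diff poly_smult poly_poly_1 poly_pCons poly_0
    by (intro continuous_on_diff continuous_on_minus continuous_on_mult continuous_on_add continuous_on_const
        continuous_on_eval3[OF slope1(1)] continuous_on_eval3[OF slope2(1)] cont i)
  have cont_lam: "continuous_on N2 (lam l)" if l: "l \<in> J" for l
    unfolding lam_def[abs_def]
    by (intro continuous_on_divide continuous_on_diff continuous_on_add continuous_on_const cont)
       (use pp_al[OF _ l] N21 in auto)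
  define It where "It = {i \<in> I. poly (Tf z0) (x i z0) = 0}"
  \<comment> \<open>Pairs of a slope and a line that are separated at \<open>z0\<close>; they are
    kept separated on \<open>N\<close>, so an index can meet a line there only if it already does at
    \<open>z0\<close>.\<close>
  define X where "X = {y \<in> I \<times> J. x (fst y) z0 \<noteq> lam (snd y) z0}"
  define N where "N = {z \<in> {z \<in> N2. \<forall>i\<in>I - It. poly (Tf z) (x i z) \<noteq> 0}.
    \<forall>y\<in>X. x (fst y) z - lam (snd y) z \<noteq> 0}"
  have N2: "N \<subseteq> N2" by (auto simp: N_def)
  then have N1: "z \<in> N \<Longrightarrow> z \<in> N1" for z using N21 by blast
  have open_T: "open {z \<in> N2. \<forall>i\<in>I - It. poly (Tf z) (x i z) \<noteq> 0}"
    by (rule open_all_ne_0[OF open_N2]) (use fin_I cont_T in auto)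
  have open_N: "open N"
    unfolding N_def
  proof (rule open_all_ne_0[OF open_T])
    show "finite X" unfolding X_def using fin_I fin_J by (intro finite_Collect_conjI disjI1) simp
    fix y assume y: "y \<in> X"
    then have "fst y \<in> I" "snd y \<in> J" by (auto simp: X_def)
    then have "continuous_on N2 (\<lambda>z. x (fst y) z - lam (snd y) z)"
      by (intro continuous_on_diff cont cont_lam)
    then show "continuous_on {z \<in> N2. \<forall>i\<in>I - It. poly (Tf z) (x i z) \<noteq> 0} (\<lambda>z. x (fst y) z - lam (snd y) z)"
      by (rule continuous_on_subset) blast
  qed
  have sep: "x i z0 = lam l z0" if "z \<in> N" "i \<in> I" "l \<in> J" "x i z = lam l z" for z i l
  proof (rule ccontr)
    assume "x i z0 \<noteq> lam l z0"
    then have "(i, l) \<in> X" using that(2,3) by (simp add: X_def)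
    then have "x i z - lam l z \<noteq> 0" using that(1) unfolding N_def by force
    then show False using that(4) by simp
  qed
  have T_ne: "poly (Tf z) (x i z) \<noteq> 0" if "z \<in> N" "i \<in> I - It" for z i
    using that unfolding N_def by blast
  have kf_N: "kf i z \<noteq> 0" if "z \<in> N" "i \<in> I" for z i using that N2 unfolding N2_def by blast
  have "z0 \<in> N" using z0 by (auto simp: N_def N2_def I_def It_def X_def)
  \<comment> \<open>A tangency that stopped being one would have to meet an invariant line, and by
    \<open>sep\<close> it would do so at \<open>z0\<close>, where \<open>T\<close> is nonzero on
    that line.\<close>
  have It_eq: "{i \<in> {i. i < d \<and> kf i z \<noteq> 0}. poly (Tf z) (x i z) = 0} = It" if z: "z \<in> N" for z
  proof -
    have "poly (Tf z) (x i z) = 0" if i: "i \<in> It" for i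
    proof (rule ccontr)
      assume ne: "poly (Tf z) (x i z) \<noteq> 0"
      have iI: "i \<in> I" using i by (simp add: It_def)
      obtain l where l: "l \<in> J" "x i z = lam l z"
        using root_cases_at[OF N1[OF z] I_d[OF iI] kf_N[OF z iI]] ne by blast
      from sep[OF z iI l] T_lam_at[OF z0 l(1)] i show False by (simp add: It_def)
    qed
    moreover have "{i. i < d \<and> kf i z \<noteq> 0} = I" using vert z N2 by blast
    ultimately show ?thesis using T_ne[OF z] by (auto simp: It_def)
  qed
  have "\<forall>i\<in>I - It. \<exists>l. l \<in> J \<and> x i z0 = lam l z0"
    using root_cases_at[OF z0] unfolding I_def It_def by blast
  from bchoice[OF this] obtain line where line: "\<And>i. i \<in> I - It \<Longrightarrow> line i \<in> J \<and> x i z0 = lam (line i) z0"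
    by blast
  have x_line: "x i z = lam (line i) z" if i: "i \<in> I - It" and z: "z \<in> N" for i z
  proof -
    have iI: "i \<in> I" using i by simp
    obtain l where l: "l \<in> J" "x i z = lam l z"
      using root_cases_at[OF N1[OF z] I_d[OF iI] kf_N[OF z iI]] T_ne[OF z i] by blast
    have "lam l z0 = lam (line i) z0" using sep[OF z iI l] line[OF i] by simp
    then have "l = line i" using inj_onD[OF inj_lam_at[OF z0]] l(1) line[OF i] by blast
    then show ?thesis using l(2) by simp
  qed
  interpret web_chart N p q I x
  proof
    show "open N" by (rule open_N)
    show "holomorphic2_on p N" "holomorphic2_on q N"
      using hol_pq N1 by (blast intro: holomorphic2_on_subset)+
    show "wedge (dif p z) (dif q z) \<noteq> 0" if "z \<in> N" for z by (rule frame_pq[OF N1[OF that]])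
    show "finite I" by (rule fin_I)
    show "holomorphic2_on (x i) N" if "i \<in> I" for i by (rule holomorphic2_on_subset[OF hol_x[OF that] N2])
    show "x i z \<noteq> x j z" if "i \<in> I" "j \<in> I" "i \<noteq> j" "z \<in> N" for i j z
      using inj_onD[OF inj_x_at[OF N1[OF that(4)]], of i j] that I_d kf_N by blast
  qed
  obtain \<alpha>' \<tau>' \<theta>' where derivs: "\<And>c. (\<alpha> has_field_derivative \<alpha>' c) (at c)"
    "\<And>c. (\<tau> has_field_derivative \<tau>' c) (at c)" "\<And>c. (\<theta> has_field_derivative \<theta>' c) (at c)"
  proof (rule coeff_derivs)
    fix \<alpha>' \<tau>' \<theta>'
    assume "\<And>c. (\<alpha> has_field_derivative \<alpha>' c) (at c)"
      "\<And>c. (\<tau> has_field_derivative \<tau>' c) (at c)" "\<And>c. (\<theta> has_field_derivative \<theta>' c) (at c)"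
    then show thesis by (rule that)
  qed
  have chart: "foliation_chart N p q I x aB bB m It J al be line \<alpha> \<tau> \<theta> \<alpha>' \<tau>' \<theta>'"
  proof (rule foliation_chart.intro[OF web_chart_axioms], rule foliation_chart_axioms.intro, unfold on_line_def lam_def[symmetric] Tf_def[symmetric])
    show "It \<subseteq> I" by (auto simp: It_def)
    show "line ` (I - It) \<subseteq> J" using line by blast
    show "inj_on line (I - It)"
    proof (rule inj_onI)
      fix i j assume ij: "i \<in> I - It" "j \<in> I - It" "line i = line j"
      then have "x i z0 = x j z0" using line by metis
      then show "i = j" using inj_onD[OF inj_x_at[OF z0], of i j] ij(1,2) unfolding I_def by blast
    qed
    fix z assume z: "z \<in> N"
    show "tangency_line (Tf z) It (\<lambda>i. x i z) (\<tau> (p z)) m (poly aB [:- q z, p z:])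
        (poly (pderiv bB) [:- q z, p z:] - smult (p z) (poly (pderiv aB) [:- q z, p z:]))
        (- poly (pderiv aB) [:- q z, p z:]) J (\<lambda>l. lam l z) (\<lambda>l. p z - al l)
        (\<lambda>l. (poly aB [:- q z, p z:] - smult (1 / (p z - al l)) (Tf z)) div [:- lam l z, 1:])"
      by (rule tangency_at[OF N1[OF z] simple_roots_at[OF N1[OF z], unfolded It_eq[OF z]]])
  qed (fact x_line derivs coeff_a_at[OF N1] coeff_Tq_at[OF N1])+
  obtain o' where o': "{..<d} = I \<or> (o' \<notin> I \<and> {..<d} = insert o' I)"
  proof (cases "Z = {}")
    case True
    then show thesis by (intro that) (auto simp: I_def Z_def)
  next
    case False
    then obtain o' where o': "o' \<in> Z" by blast
    then have "Z = {o'}" using vertical_unique_at[OF z0] unfolding Z_def by blast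
    moreover have "{..<d} = I \<union> Z" "I \<inter> Z = {}" by (auto simp: I_def Z_def)
    ultimately show thesis by (intro that[of o']) auto
  qed
  have kf_0: "kf i z = 0" if "z \<in> N" "i < d" "i \<notin> I" for i z
    using vert[of z] that N2 by blast
  \<comment> \<open>Obtained by solving \<open>w_eq\<close> against the differentials of
    \<open>p\<close> and \<open>q\<close> in \<open>dif_pq\<close>; vertical forms have
    \<open>kf = 0\<close> and are multiples of \<open>dp\<close> through \<open>ef\<close>.\<close>
  define \<rho> where "\<rho> i z = (if i \<in> I then - kf i z else - ef i z) * dot (dual z) f2 / \<Delta> z" for i z
  have "has_curvature N d w (\<lambda>_. 0)"
  proof (rule foliation_chart.chart_flat[OF chart o', where \<rho> = \<rho>])
    show "holomorphic2_on (\<rho> i) N" if i: "i < d" for i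
    proof -
      have "holomorphic2_on (\<lambda>z. - ef i z * dot (dual z) f2 / \<Delta> z) N1" "holomorphic2_on (\<lambda>z. - kf i z * dot (dual z) f2 / \<Delta> z) N1"
        by (intro holomorphic2_divide holomorphic2_mult holomorphic2_minus hol_ef hol_kf hol_dual hol_\<Delta> i; rule \<Delta>_ne_0; assumption)+
      then have "holomorphic2_on (\<rho> i) N1" unfolding \<rho>_def[abs_def] by (cases "i \<in> I") simp_all
      then show ?thesis by (rule holomorphic2_on_subset) (use N1 in blast)
    qed
    show "\<rho> i z \<noteq> 0" if "i < d" "z \<in> N" for i z
      using kf_0[OF that(2,1)] kf_N[OF that(2), of i] ef_ne_0[OF N1[OF that(2)] that(1)] \<Delta>_ne_0[OF N1[OF that(2)]] f2_ne[OF N1[OF that(2)]]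
      by (auto simp: \<rho>_def)
    show "w i z = smul (\<rho> i z) (W i z)" if "i \<in> I" "z \<in> N" for i z
    proof -
      note z1 = N1[OF that(2)]
      have xk: "kf i z * x i z = - ef i z" using kf_N[OF that(2,1)] by (simp add: x_def)
      let ?u = "dot (dual z) f2"
      have "W i z = smul (1 / ?u) (fst (EE z) + x i z * fst (DD z), - (snd (snd (EE z)) + x i z * snd (snd (DD z))))"
        unfolding W_def dif_pq[OF z1] by (simp add: smul_def prod_eq_iff algebra_simps add_divide_distrib)
      then have W: "smul (\<rho> i z) (W i z) = smul (1 / \<Delta> z) (- (kf i z * fst (EE z) + (kf i z * x i z) * fst (DD z)),
          kf i z * snd (snd (EE z)) + (kf i z * x i z) * snd (snd (DD z)))"
        using that(1) f2_ne[OF z1] by (simp add: \<rho>_def smul_def algebra_simps)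
      show ?thesis
        unfolding W[unfolded xk] by (rule prod_eqI) (simp_all add: smul_def w_eq[OF z1] algebra_simps diff_divide_distrib)
    qed
    show "w o' z = smul (\<rho> o' z) (dif p z)" if z: "z \<in> N" and o: "o' \<in> {..<d} - I" for z
    proof -
      note z1 = N1[OF z]
      have k: "kf o' z = 0" using kf_0[OF z] o by simp
      have W: "smul (\<rho> o' z) (dif p z) = smul (1 / \<Delta> z) (ef o' z * fst (DD z), - (ef o' z * snd (snd (DD z))))"
        using o f2_ne[OF z1] unfolding dif_pq[OF z1] by (simp add: \<rho>_def smul_def)
      show ?thesis unfolding W by (rule prod_eqI) (simp_all add: smul_def w_eq[OF z1] k mult.commute)
    qed
  qed
  moreover have "N \<subseteq> U" using N1 by (auto simp: N1_def)
  ultimately show ?thesis using open_N \<open>z0 \<in> N\<close> by blast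
qed

end

subsection \<open>Flatness\<close>

lemma homogeneous_unique: "homogeneous n H \<Longrightarrow> homogeneous k H \<Longrightarrow> H \<noteq> 0 \<Longrightarrow> n = k"
  unfolding homogeneous_def poly_eq_iff coeff_0 by (metis coeff_0)

lemma homogeneous_prod: "(\<And>L. L \<in> S \<Longrightarrow> homogeneous 1 L) \<Longrightarrow> homogeneous (card S) (\<Prod>L\<in>S. L)"
proof (induction S rule: infinite_finite_induct)
  case (insert L S)
  then have "homogeneous (1 + card S) (L * (\<Prod>L\<in>S. L))" by (intro homogeneous_mult) auto
  then show ?case using insert by simp
qed (use homogeneous_const[of 1] in \<open>simp_all add: one_pCons\<close>)

context plane_foliation
begin

text \<open>Any of the invariant lines can serve as line at infinity; the vertical direction is a
  general point of it.\<close>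

lemma exists_chart:
  assumes \<Lambda>: "finite \<Lambda>" "card \<Lambda> = 3 * m" "\<And>l. l \<in> \<Lambda> \<Longrightarrow> inv_line l"
    "\<And>l k. l \<in> \<Lambda> \<Longrightarrow> k \<in> \<Lambda> \<Longrightarrow> l \<noteq> k \<Longrightarrow> cross l k \<noteq> 0" and u: "generic \<Lambda> u"
  obtains f1 f2 f3 l0 J where "convex_chart P Q R m f1 f2 f3 l0 J" "insert l0 J = \<Lambda>" "dot u f2 \<noteq> 0"
proof -
  have "\<Lambda> \<noteq> {}" using \<Lambda>(2) m_pos by auto
  then obtain l0 where l0: "l0 \<in> \<Lambda>" by blast
  then have l0_ne: "l0 \<noteq> 0" using \<Lambda>(3) by (simp add: inv_line_def)
  define J where "J = \<Lambda> - {l0}"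
  have "om (cross u l0) (vcnj l0) \<noteq> 0" using u l0 by (simp add: generic_def)
  then have ul: "cross u l0 \<noteq> 0" using om_scale[of 0 0 "vcnj l0"] by auto
  \<comment> \<open>With \<open>f2 = cross l0 h\<close> the conditions that \<open>f2\<close> avoid
    \<open>u\<close> and the lines of \<open>J\<close> become
    \<open>dot (cross u l0) h \<noteq> 0\<close> and
    \<open>dot (cross l l0) h \<noteq> 0\<close>.\<close>
  have "\<exists>h. \<forall>s\<in>insert (cross u l0) ((\<lambda>l. cross l l0) ` J). dot s h \<noteq> 0"
  proof (rule exists_generic_vector)
    have "cross l l0 \<noteq> 0" if "l \<in> J" for l using that l0 \<Lambda>(4) by (simp add: J_def)
    then show "0 \<notin> insert (cross u l0) ((\<lambda>l. cross l l0) ` J)" using ul by (metis imageE insertE)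
  qed (simp add: J_def \<Lambda>(1))
  then obtain h where h: "dot (cross u l0) h \<noteq> 0" "\<And>l. l \<in> J \<Longrightarrow> dot (cross l l0) h \<noteq> 0" by blast
  define f1 f2 f3 where "f1 = cross (vcnj (cross l0 h)) l0" and "f2 = cross l0 h"
    and "f3 = vscale (1 / dot l0 (vcnj l0)) (vcnj l0)"
  have dot_f2: "dot v f2 = dot (cross v l0) h" for v by (simp add: f2_def triple_cycle(2))
  have "cross l0 h \<noteq> 0" using h(1) dot_f2[of u] by (auto simp: f2_def dot_def)
  note fr = frame_of_covector[OF l0_ne this, folded f1_def f2_def f3_def]
  have "convex_chart P Q R m f1 f2 f3 l0 J"
  proof (rule convex_chart.intro[OF plane_foliation_axioms fr(1)], unfold_locales)
    show "inv_line l0" using \<Lambda>(3) l0 by blast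
    show "finite J" "card J = 3 * m - 1" using \<Lambda>(1,2) l0 by (simp_all add: J_def)
    show "inv_line l" if "l \<in> J" for l using that \<Lambda>(3) by (simp add: J_def)
    show "dot l f2 \<noteq> 0" if "l \<in> J" for l using h(2)[OF that] by (simp add: dot_f2)
    show "cross l k \<noteq> 0" if "l \<in> J" "k \<in> J" "l \<noteq> k" for l k using that \<Lambda>(4) by (simp add: J_def)
  qed (rule fr)+
  moreover have "insert l0 J = \<Lambda>" using l0 by (auto simp: J_def)
  moreover have "dot u f2 \<noteq> 0" using h(1) by (simp add: dot_f2)
  ultimately show thesis by (rule that)
qed

end

text \<open>On all of \<open>U\<close> the curvature exists and is continuous, and by uniqueness it
  agrees with the local one near the dense set of points satisfying \<open>\<phi>\<close>, where it
  is zero.\<close>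

lemma has_curvature_0_if_dense:
  assumes reg: "regular_decomposition d F U w"
    and near: "\<And>z. z \<in> U \<Longrightarrow> \<phi> z \<Longrightarrow> \<exists>N. open N \<and> z \<in> N \<and> N \<subseteq> U \<and> has_curvature N d w (\<lambda>_. 0)"
    and dense: "\<And>V z. open V \<Longrightarrow> z \<in> V \<Longrightarrow> \<exists>z'\<in>V. \<phi> z'"
  shows "has_curvature U d w (\<lambda>_. 0)"
proof -
  let ?JJ = "{J. J \<subseteq> {..<d} \<and> card J = 3}"
  have U: "open U" using reg by (simp add: regular_decomposition_def)
  have w: "holomorphic_form_on (w i) U" if "J \<in> ?JJ" "i \<in> J" for i J
    using reg that unfolding regular_decomposition_def by blast
  have tr: "wedge (w i z) (w j z) \<noteq> 0" if "J \<in> ?JJ" "i \<in> J" "j \<in> J" "i \<noteq> j" "z \<in> U" for i j z J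
    using reg that unfolding regular_decomposition_def by blast
  have "\<exists>\<kappa>. has_curvature3 U J w \<kappa> \<and> continuous_on U \<kappa>" if J: "J \<in> ?JJ" for J
    by (rule has_curvature3_ex[OF U _ w[OF J] tr[OF J]]) (use J in auto)
  then have "\<forall>J\<in>?JJ. \<exists>\<kappa>. has_curvature3 U J w \<kappa> \<and> continuous_on U \<kappa>" by blast
  from bchoice[OF this] obtain K where K: "\<And>J. J \<in> ?JJ \<Longrightarrow> has_curvature3 U J w (K J)"
    "\<And>J. J \<in> ?JJ \<Longrightarrow> continuous_on U (K J)" by blast
  let ?h = "\<lambda>z. \<Sum>J\<in>?JJ. K J z"
  have 0: "?h z = 0" if z: "z \<in> U" "\<phi> z" for z
  proof -
    obtain N where N: "open N" "z \<in> N" "N \<subseteq> U" "has_curvature N d w (\<lambda>_. 0)" using near[OF z] by blast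
    then obtain K' where K': "\<And>J. J \<in> ?JJ \<Longrightarrow> has_curvature3 N J w (K' J)" "\<And>z. z \<in> N \<Longrightarrow> 0 = (\<Sum>J\<in>?JJ. K' J z)"
      unfolding has_curvature_def by blast
    have "K J z = K' J z" if J: "J \<in> ?JJ" for J
      by (rule has_curvature3_unique[OF N(1,3) _ w[OF J] tr[OF J] K(1)[OF J] K'(1)[OF J] N(2)]) (use J in auto)
    then show ?thesis using K'(2)[OF N(2)] by simp
  qed
  have "?h z = 0" if z: "z \<in> U" for z
  proof (rule ccontr)
    assume ne: "?h z \<noteq> 0"
    have "continuous_on U ?h" by (rule continuous_on_sum) (rule K(2))
    then have "open (U \<inter> ?h -` (- {0}))" by (rule continuous_open_preimage[OF _ U]) auto
    from dense[OF this, of z] obtain z' where "z' \<in> U" "?h z' \<noteq> 0" "\<phi> z'" using z ne by blast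
    then show False using 0 by blast
  qed
  then show ?thesis unfolding has_curvature_def using K(1) by (intro exI[of _ K]) simp
qed

theorem mainTheorem1:
  fixes k d :: nat and G P Q R :: ternary
  assumes "reduced_convex_prefoliation k d G P Q R"
    and "union_of_invariant_lines P Q R G"
  shows "flat_web d (Leg G P Q)"
proof -
  define m where "m = d - k"
  have k: "k \<le> d" "homogeneous k G" and fol: "foliation m P Q R" "0 < m"
    and card: "card (invariant_line_loci P Q R) = 3 * m"
    using assms(1) by (auto simp: reduced_convex_prefoliation_def prefoliation_def reduced_convex_def m_def)
  have d: "d = k + m" using k(1) by (simp add: m_def)
  interpret plane_foliation P Q R m by (rule plane_foliation.intro[OF fol])
  obtain \<Lambda> where \<Lambda>: "finite \<Lambda>" "card \<Lambda> = 3 * m" "\<And>l. l \<in> \<Lambda> \<Longrightarrow> inv_line l"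
    "\<And>l k. l \<in> \<Lambda> \<Longrightarrow> k \<in> \<Lambda> \<Longrightarrow> l \<noteq> k \<Longrightarrow> cross l k \<noteq> 0"
    "\<And>L. invariant_line P Q R L \<Longrightarrow> \<exists>l\<in>\<Lambda>. \<exists>c. c \<noteq> 0 \<and> eval3 L = dot (vscale c l)"
  proof (rule invariant_lines[OF card])
    fix \<Lambda>
    assume "finite \<Lambda>" "card \<Lambda> = 3 * m" "\<And>l. l \<in> \<Lambda> \<Longrightarrow> inv_line l"
      "\<And>l k. l \<in> \<Lambda> \<Longrightarrow> k \<in> \<Lambda> \<Longrightarrow> l \<noteq> k \<Longrightarrow> cross l k \<noteq> 0"
      "\<And>L. invariant_line P Q R L \<Longrightarrow> \<exists>l\<in>\<Lambda>. \<exists>c. c \<noteq> 0 \<and> eval3 L = dot (vscale c l)"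
    then show thesis by (rule that)
  qed
  obtain S r where S: "finite S" "\<And>L. L \<in> S \<Longrightarrow> invariant_line P Q R L" "r \<noteq> 0" "G = [:[:[:r:]:]:] * \<Prod>S"
    using assms(2) unfolding union_of_invariant_lines_def by blast
  have "\<forall>L\<in>S. \<exists>l c. l \<in> \<Lambda> \<and> c \<noteq> 0 \<and> eval3 L = dot (vscale c l)" using \<Lambda>(5) S(2) by blast
  from bchoice[OF this] obtain l where "\<forall>L\<in>S. \<exists>c. l L \<in> \<Lambda> \<and> c \<noteq> 0 \<and> eval3 L = dot (vscale c (l L))" by blast
  from bchoice[OF this] obtain c where l: "\<And>L. L \<in> S \<Longrightarrow> l L \<in> \<Lambda>" "\<And>L. L \<in> S \<Longrightarrow> c L \<noteq> 0"
    "\<And>L. L \<in> S \<Longrightarrow> eval3 L = dot (vscale (c L) (l L))" by blast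
  have eval_G: "eval3 G y = (r * (\<Prod>L\<in>S. c L)) * (\<Prod>L\<in>S. dot (l L) y)" for y
  proof -
    have "eval3 G y = r * (\<Prod>L\<in>S. eval3 L y)" by (simp only: S(4) eval3_simps eval3_const eval3_prod)
    also have "(\<Prod>L\<in>S. eval3 L y) = (\<Prod>L\<in>S. c L * dot (l L) y)"
      by (rule prod.cong) (simp_all add: l(3) dot_simps)
    finally show ?thesis by (simp add: prod.distrib mult.assoc)
  qed
  have "\<Prod>S \<noteq> 0" using S(1,2) by (auto simp: invariant_line_def)
  then have "G \<noteq> 0" using S(3,4) by simp
  moreover have "homogeneous (card S) G"
    unfolding S(4) by (intro homogeneous_cmult homogeneous_prod) (use S(2) in \<open>simp add: invariant_line_def\<close>)
  \<comment> \<open>The number of linear factors must be the prescribed degree of the curve, because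
    a nonzero polynomial is homogeneous of only one degree.\<close>
  ultimately have card_S: "card S = k" using homogeneous_unique[OF _ k(2)] by blast
  show ?thesis
    unfolding flat_web_def
  proof (intro allI impI)
    fix U w assume reg: "regular_decomposition d (Leg G P Q) U w"
    show "has_curvature U d w (\<lambda>_. 0)"
    proof (rule has_curvature_0_if_dense[OF reg, where \<phi> = "\<lambda>z. generic \<Lambda> (dual z)"])
      fix z assume z: "z \<in> U" "generic \<Lambda> (dual z)"
      \<comment> \<open>The chart depends on the dual point: its vertical direction must not lie on
        the line dual to \<open>z\<close>.\<close>
      obtain f1 f2 f3 l0 J where ch: "convex_chart P Q R m f1 f2 f3 l0 J" "insert l0 J = \<Lambda>" "dot (dual z) f2 \<noteq> 0"
        by (rule exists_chart[OF \<Lambda>(1-4) z(2)])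
      interpret convex_chart P Q R m f1 f2 f3 l0 J by (rule ch(1))
      interpret leg_web P Q R m f1 f2 f3 l0 J k d G "r * (\<Prod>L\<in>S. c L)" S l U w
        by unfold_locales (use k(2) d S(1,3) l(1,2) card_S eval_G reg ch(2) in auto)
      have "z \<in> N1" using z ch(2,3) by (simp add: N1_def)
      then show "\<exists>N. open N \<and> z \<in> N \<and> N \<subseteq> U \<and> has_curvature N d w (\<lambda>_. 0)" by (rule flat_near)
    next
      fix V z assume V: "open V" "(z :: complex \<times> complex) \<in> V"
      show "\<exists>z'\<in>V. generic \<Lambda> (dual z')" by (rule generic_dense[OF \<Lambda>(1,3,4) V])
    qed
  qed
qed

end
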